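(* Let $p\in(1,\infty)$ and assume that $V\in C^2(\mathbb R^n;\mathbb R)$ satisfies $\partial^\alpha V\in L^\infty(\mathbb R^n)$ for all multiindices $\alpha$ with $|\alpha|=2$. Then the operator $\mathcal P$, regarded as an unbounded operator on $L^p(\mathbb R^{2n})$ with domain $C_c^\infty(\mathbb R^{2n})$, is closable. Moreover, setting $$D(\mathcal P_{\min}) := \big\{ f\in L^p(\mathbb R^{2n}) \,\big|\, \exists (f_k)_k \in C_c^\infty(\mathbb R^{2n})^{\mathbb N},\ \exists g\in L^p(\mathbb R^{2n}),\ f_k\to f \text{ and } \mathcal P f_k\to g \text{ in } L^p(\mathbb R^{2n})\big\},$$ $$D(\mathcal P_{\max}) := \big\{ f\in L^p(\mathbb R^{2n}) \,\big|\, \mathcal P f\in L^p(\mathbb R^{2n})\big\},$$ (where in the second definition $\mathcal Pf$ is taken in the sense of distributions), the domain of the closure $\overline{\mathcal P}$ satisfies $$D(\overline{\mathcal P}) = D(\mathcal P_{\min}) = D(\mathcal P_{\max}).$$ Finally, the operator $\overline{\mathcal P}$ defined on this domain by $\overline{\mathcal P}f=\mathcal P f$ in the sense of distributions generates a strongly continuous semigroup $(e^{-\frac tm\overline{\mathcal P}})_{t\ge0}$ on $L^p(\mathbb R^{2n})$.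
   Context: Let $n\ge1$ be an integer and let $m,\beta,\gamma>0$ be constants. Points of $\mathbb R^{2n}=\mathbb R^n_x\times\mathbb R^n_v$ are written $(x,v)$; functions are complex-valued. The Fokker--Planck operator is the differential operator $\mathcal P := \mathcal T+\mathcal H$ with $$\mathcal T := m\, v\cdot\partial_x-\nabla V(x)\cdot\partial_v,\qquad \mathcal H:=\frac{\gamma}{\beta}\Big(-\Delta_v+\frac{m^2\beta^2}{4}|v|^2-\frac{m\beta n}{2}\Big).$$ For $f\in L^p(\mathbb R^{2n})$, $\mathcal Pf$ is a well-defined distribution, the term $\nabla V\cdot\partial_v f$ being defined by $\langle \nabla V\cdot\partial_v f,\varphi\rangle=-\int_{\mathbb R^{2n}} f(x,v)\,\nabla V(x)\cdot\partial_v\varphi(x,v)\,dx\,dv$ for $\varphi\in C_c^\infty(\mathbb R^{2n})$. Convention: "$A$ generates the semigroup $(e^{-tA})_{t\ge0}$" means that $-A$ is its infinitesimal generator. *)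

theory Defs
  imports "HOL-Analysis.Analysis"
begin

section \<open>Functions of class \<open>C\<^sup>k\<close> and test functions\<close>

definition dir_deriv ::
  "'a::euclidean_space \<Rightarrow> ('a \<Rightarrow> 'b::real_normed_vector) \<Rightarrow> 'a \<Rightarrow> 'b" where
  "dir_deriv e f z = frechet_derivative f (at z) e"

primrec Ck :: "nat \<Rightarrow> ('a::euclidean_space \<Rightarrow> 'b::real_normed_vector) \<Rightarrow> bool" where
  "Ck 0 f \<longleftrightarrow> continuous_on UNIV f"
| "Ck (Suc k) f \<longleftrightarrow> (\<forall>z. f differentiable (at z)) \<and> (\<forall>e\<in>Basis. Ck k (dir_deriv e f))"

definition Cc_inf :: "('a::euclidean_space \<Rightarrow> complex) set" where
  "Cc_inf = {\<phi>. (\<forall>k. Ck k \<phi>) \<and> compact (closure {z. \<phi> z \<noteq> 0})}"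


section \<open>Lebesgue spaces\<close>

text \<open>
  Elements of \<open>L\<^sup>p\<close> are represented by Borel functions (every class of Lebesgue measurable
  functions has a Borel representative), so that equality in \<open>L\<^sup>p\<close> is equality almost everywhere
  and \<open>Lp_norm\<close> is only a seminorm on these representatives. Unbounded operators on \<open>L\<^sup>p\<close> are
  represented by their graphs, as sets of pairs of representatives.
\<close>

definition Lp :: "real \<Rightarrow> ('a::euclidean_space \<Rightarrow> complex) set" where
  "Lp p = {f \<in> borel_measurable lborel. integrable lborel (\<lambda>z. norm (f z) powr p)}"

definition Lp_norm :: "real \<Rightarrow> ('a::euclidean_space \<Rightarrow> complex) \<Rightarrow> real" where
  "Lp_norm p f = (\<integral>z. norm (f z) powr p \<partial>lborel) powr (1 / p)"

definition Linfty :: "('a::euclidean_space \<Rightarrow> real) set" where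
  "Linfty = {f \<in> borel_measurable lborel. \<exists>C. AE z in lborel. \<bar>f z\<bar> \<le> C}"

definition ae_eq :: "('a::euclidean_space \<Rightarrow> complex) \<Rightarrow> ('a \<Rightarrow> complex) \<Rightarrow> bool" where
  "ae_eq f g \<longleftrightarrow> (AE z in lborel. f z = g z)"

type_synonym 'a op_graph = "(('a \<Rightarrow> complex) \<times> ('a \<Rightarrow> complex)) set"

definition graph_closure :: "real \<Rightarrow> 'a::euclidean_space op_graph \<Rightarrow> 'a op_graph" where
  "graph_closure p G = {(f, g). f \<in> Lp p \<and> g \<in> Lp p \<and>
     (\<forall>\<epsilon>>0. \<exists>(u, w)\<in>G. Lp_norm p (\<lambda>z. u z - f z) < \<epsilon> \<and> Lp_norm p (\<lambda>z. w z - g z) < \<epsilon>)}"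

text \<open>Closability: the closure of the graph is again the graph of an operator.\<close>

definition closable :: "real \<Rightarrow> 'a::euclidean_space op_graph \<Rightarrow> bool" where
  "closable p G \<longleftrightarrow> G \<subseteq> Lp p \<times> Lp p \<and>
     (\<forall>f f' g g'. (f, g) \<in> graph_closure p G \<and> (f', g') \<in> graph_closure p G \<and> ae_eq f f'
        \<longrightarrow> ae_eq g g')"

definition op_scale :: "real \<Rightarrow> 'a::euclidean_space op_graph \<Rightarrow> 'a op_graph" where
  "op_scale c A = (\<lambda>(f, g). (f, \<lambda>z. c *\<^sub>R g z)) ` A"


section \<open>Strongly continuous semigroups\<close>

text \<open>
  The bounds and linearity below make each \<open>T t\<close> compatible with equality almost everywhere.
\<close>

definition bounded_operator ::
  "real \<Rightarrow> (('a::euclidean_space \<Rightarrow> complex) \<Rightarrow> ('a \<Rightarrow> complex)) \<Rightarrow> bool" where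
  "bounded_operator p S \<longleftrightarrow>
     (\<forall>f\<in>Lp p. S f \<in> Lp p) \<and>
     (\<forall>f\<in>Lp p. \<forall>g\<in>Lp p. ae_eq (S (\<lambda>z. f z + g z)) (\<lambda>z. S f z + S g z)) \<and>
     (\<forall>f\<in>Lp p. \<forall>c. ae_eq (S (\<lambda>z. c * f z)) (\<lambda>z. c * S f z)) \<and>
     (\<exists>C. \<forall>f\<in>Lp p. Lp_norm p (S f) \<le> C * Lp_norm p f)"

definition C0_semigroup ::
  "real \<Rightarrow> (real \<Rightarrow> ('a::euclidean_space \<Rightarrow> complex) \<Rightarrow> ('a \<Rightarrow> complex)) \<Rightarrow> bool" where
  "C0_semigroup p T \<longleftrightarrow>
     (\<forall>t\<ge>0. bounded_operator p (T t)) \<and>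
     (\<forall>f\<in>Lp p. ae_eq (T 0 f) f) \<and>
     (\<forall>s\<ge>0. \<forall>t\<ge>0. \<forall>f\<in>Lp p. ae_eq (T (s + t) f) (T s (T t f))) \<and>
     (\<forall>f\<in>Lp p. ((\<lambda>t. Lp_norm p (\<lambda>z. T t f z - f z)) \<longlongrightarrow> 0) (at_right 0))"

definition infinitesimal_generator ::
  "real \<Rightarrow> (real \<Rightarrow> ('a::euclidean_space \<Rightarrow> complex) \<Rightarrow> ('a \<Rightarrow> complex)) \<Rightarrow> 'a op_graph" where
  "infinitesimal_generator p T = {(f, g). f \<in> Lp p \<and> g \<in> Lp p \<and>
     ((\<lambda>t. Lp_norm p (\<lambda>z. (1 / t) *\<^sub>R (T t f z - f z) - g z)) \<longlongrightarrow> 0) (at_right 0)}"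

text \<open>\<open>generates p A T\<close>: \<open>A\<close> generates the semigroup \<open>T t = e\<^bsup>-tA\<^esup>\<close>; note the sign.\<close>

definition generates ::
  "real \<Rightarrow> 'a::euclidean_space op_graph \<Rightarrow>
   (real \<Rightarrow> ('a \<Rightarrow> complex) \<Rightarrow> ('a \<Rightarrow> complex)) \<Rightarrow> bool" where
  "generates p A T \<longleftrightarrow> C0_semigroup p T \<and> infinitesimal_generator p T = op_scale (-1) A"


section \<open>The Fokker--Planck operator on test functions\<close>

type_synonym 'n phase = "(real^'n) \<times> (real^'n)"

definition dir_x :: "'n::finite \<Rightarrow> 'n phase" where "dir_x i = (axis i 1, 0)"
definition dir_v :: "'n::finite \<Rightarrow> 'n phase" where "dir_v i = (0, axis i 1)"

definition T_op :: "(real^'n::finite \<Rightarrow> real) \<Rightarrow> real \<Rightarrow> ('n phase \<Rightarrow> complex) \<Rightarrow> 'n phase \<Rightarrow> complex" where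
  "T_op V m \<phi> = (\<lambda>(x, v). m *\<^sub>R (\<Sum>i\<in>UNIV. (v $ i) *\<^sub>R dir_deriv (dir_x i) \<phi> (x, v))
      - (\<Sum>i\<in>UNIV. dir_deriv (axis i 1) V x *\<^sub>R dir_deriv (dir_v i) \<phi> (x, v)))"

definition H_op :: "real \<Rightarrow> real \<Rightarrow> real \<Rightarrow> ('n::finite phase \<Rightarrow> complex) \<Rightarrow> 'n phase \<Rightarrow> complex" where
  "H_op m \<beta> \<gamma> \<phi> = (\<lambda>(x, v). (\<gamma> / \<beta>) *\<^sub>R
      (- (\<Sum>i\<in>UNIV. dir_deriv (dir_v i) (dir_deriv (dir_v i) \<phi>) (x, v))
       + (m\<^sup>2 * \<beta>\<^sup>2 / 4 * (norm v)\<^sup>2 - m * \<beta> * real CARD('n) / 2) *\<^sub>R \<phi> (x, v)))"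

definition P_op ::
  "(real^'n::finite \<Rightarrow> real) \<Rightarrow> real \<Rightarrow> real \<Rightarrow> real \<Rightarrow> ('n phase \<Rightarrow> complex) \<Rightarrow> 'n phase \<Rightarrow> complex" where
  "P_op V m \<beta> \<gamma> \<phi> = (\<lambda>z. T_op V m \<phi> z + H_op m \<beta> \<gamma> \<phi> z)"

definition P_graph ::
  "(real^'n::finite \<Rightarrow> real) \<Rightarrow> real \<Rightarrow> real \<Rightarrow> real \<Rightarrow> 'n phase op_graph" where
  "P_graph V m \<beta> \<gamma> = {(\<phi>, P_op V m \<beta> \<gamma> \<phi>) |\<phi>. \<phi> \<in> Cc_inf}"


section \<open>The Fokker--Planck operator in the sense of distributions\<close>

text \<open>
  A distribution is given by its values on test functions; the pairing is bilinear.
\<close>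

type_synonym 'a distr = "('a \<Rightarrow> complex) \<Rightarrow> complex"

definition distr_of_fun :: "('a::euclidean_space \<Rightarrow> complex) \<Rightarrow> 'a distr" where
  "distr_of_fun f \<phi> = (\<integral>z. f z * \<phi> z \<partial>lborel)"

definition distr_deriv :: "'a::euclidean_space \<Rightarrow> 'a distr \<Rightarrow> 'a distr" where
  "distr_deriv e u \<phi> = - u (dir_deriv e \<phi>)"

definition distr_mult :: "('a::euclidean_space \<Rightarrow> real) \<Rightarrow> 'a distr \<Rightarrow> 'a distr" where
  "distr_mult a u \<phi> = u (\<lambda>z. a z *\<^sub>R \<phi> z)"

definition distr_eq :: "'a::euclidean_space distr \<Rightarrow> 'a distr \<Rightarrow> bool" where
  "distr_eq u w \<longleftrightarrow> (\<forall>\<phi>\<in>Cc_inf. u \<phi> = w \<phi>)"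

text \<open>
  The coefficient \<open>\<nabla>V\<close> is only \<open>C\<^sup>1\<close>, so \<open>\<nabla>V \<cdot> \<partial>\<^sub>v f\<close> is not an instance of \<open>distr_mult\<close> with a
  smooth factor. As \<open>\<nabla>V\<close> does not depend on \<open>v\<close>, it is put on the test function side.
\<close>

definition gradV_dv :: "(real^'n::finite \<Rightarrow> real) \<Rightarrow> ('n phase \<Rightarrow> complex) \<Rightarrow> 'n phase distr" where
  "gradV_dv V f \<phi> = - (\<integral>z. f z *
      (\<Sum>i\<in>UNIV. dir_deriv (axis i 1) V (fst z) *\<^sub>R dir_deriv (dir_v i) \<phi> z) \<partial>lborel)"

definition T_distr :: "(real^'n::finite \<Rightarrow> real) \<Rightarrow> real \<Rightarrow> ('n phase \<Rightarrow> complex) \<Rightarrow> 'n phase distr" where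
  "T_distr V m f \<phi> =
     m *\<^sub>R (\<Sum>i\<in>UNIV. distr_mult (\<lambda>z. snd z $ i) (distr_deriv (dir_x i) (distr_of_fun f)) \<phi>)
     - gradV_dv V f \<phi>"

definition H_distr :: "real \<Rightarrow> real \<Rightarrow> real \<Rightarrow> ('n::finite phase \<Rightarrow> complex) \<Rightarrow> 'n phase distr" where
  "H_distr m \<beta> \<gamma> f \<phi> = (\<gamma> / \<beta>) *\<^sub>R
     (- (\<Sum>i\<in>UNIV. distr_deriv (dir_v i) (distr_deriv (dir_v i) (distr_of_fun f)) \<phi>)
      + distr_mult (\<lambda>z. m\<^sup>2 * \<beta>\<^sup>2 / 4 * (norm (snd z))\<^sup>2 - m * \<beta> * real CARD('n) / 2)
          (distr_of_fun f) \<phi>)"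

definition P_distr ::
  "(real^'n::finite \<Rightarrow> real) \<Rightarrow> real \<Rightarrow> real \<Rightarrow> real \<Rightarrow> ('n phase \<Rightarrow> complex) \<Rightarrow> 'n phase distr" where
  "P_distr V m \<beta> \<gamma> f \<phi> = T_distr V m f \<phi> + H_distr m \<beta> \<gamma> f \<phi>"


section \<open>Minimal and maximal domains\<close>

definition D_min ::
  "real \<Rightarrow> (real^'n::finite \<Rightarrow> real) \<Rightarrow> real \<Rightarrow> real \<Rightarrow> real \<Rightarrow> ('n phase \<Rightarrow> complex) set" where
  "D_min p V m \<beta> \<gamma> = {f \<in> Lp p. \<exists>F. (\<forall>k::nat. F k \<in> Cc_inf) \<and> (\<exists>g\<in>Lp p.
     (\<lambda>k. Lp_norm p (\<lambda>z. F k z - f z)) \<longlonglongrightarrow> 0 \<and>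
     (\<lambda>k. Lp_norm p (\<lambda>z. P_op V m \<beta> \<gamma> (F k) z - g z)) \<longlonglongrightarrow> 0)}"

definition D_max ::
  "real \<Rightarrow> (real^'n::finite \<Rightarrow> real) \<Rightarrow> real \<Rightarrow> real \<Rightarrow> real \<Rightarrow> ('n phase \<Rightarrow> complex) set" where
  "D_max p V m \<beta> \<gamma> =
     {f \<in> Lp p. \<exists>g\<in>Lp p. distr_eq (P_distr V m \<beta> \<gamma> f) (distr_of_fun g)}"

definition P_distr_graph ::
  "real \<Rightarrow> (real^'n::finite \<Rightarrow> real) \<Rightarrow> real \<Rightarrow> real \<Rightarrow> real \<Rightarrow>
   ('n phase \<Rightarrow> complex) set \<Rightarrow> 'n phase op_graph" where
  "P_distr_graph p V m \<beta> \<gamma> D =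
     {(f, g). f \<in> D \<and> g \<in> Lp p \<and> distr_eq (P_distr V m \<beta> \<gamma> f) (distr_of_fun g)}"

end

theory Submission
  imports Defs "HOL-Library.Function_Algebras"
begin

text \<open>
  Everything rests on the uniqueness of weak solutions: if \<open>f \<in> L\<^sup>p\<close> and \<open>\<lambda>f + Pf = 0\<close> in the sense of
  distributions with \<open>\<lambda>\<close> large, then \<open>f = 0\<close>. Since the drift \<open>B = (mv, -\<nabla>V)\<close> and the potential \<open>W\<close> have
  at most linear and quadratic growth, mollifying \<open>f\<close> at scale \<open>\<epsilon>\<close> leaves a commutator that vanishes in
  \<open>L\<^sup>p\<close> on balls; multiplication by \<open>|u|\<^bsup>p-2\<^esup>u\<close> and a cutoff at scale \<open>R\<close>, on which \<open>B \<cdot> \<nabla>\<close> stays bounded,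
  then gives \<open>\<parallel>f\<parallel>\<^sub>p = 0\<close>, and gives accretivity on test functions. The hypotheses are invariant
  under \<open>B \<mapsto> -B\<close>, that is, under passing to the adjoint. Uniqueness for the adjoint in the dual
  exponent makes the range of \<open>\<lambda> + P\<close> dense, and accretivity makes the range of the closure closed, so
  \<open>\<lambda> + P\<close> is onto on the minimal domain. Uniqueness for \<open>P\<close> itself then shows that the maximal domain
  is not larger.

  The semigroup of an m-accretive operator \<open>A\<close> with resolvents \<open>J\<^sub>h = (1 + hA)\<^sup>-\<^sup>1\<close> is the limit of
  \<open>J\<^sub>h\<^bsup>\<lfloor>t/h\<rfloor>\<^esup>\<close> along \<open>h = 2\<^sup>-\<^sup>k\<close>, which exists because
  \<open>\<parallel>J\<^sub>h\<^sub>/\<^sub>2\<^sup>2f - J\<^sub>h f\<parallel> \<le> h\<^sup>2/4 \<parallel>A\<^sup>2f\<parallel>\<close>.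
\<close>

section \<open>Semigroups of m-accretive operators\<close>

text \<open>Nothing controls derivatives in \<open>x\<close>, since the diffusion acts in
  \<open>v\<close> only; the energy estimate therefore discards the diffusion by convexity and
  treats transport as an exact derivative. A drift that is merely Lipschitz suffices because each
  component of \<open>B\<close> is constant along its own axis, so that invariance of the measure
  under translation replaces a derivative of \<open>B\<close>. The commutator of mollification with
  \<open>B \<cdot> \<nabla>\<close> has a kernel of size one; its smallness comes from the
  continuity of translations in \<open>L^p\<close>. Density of the range is proved through an
  explicit annihilator: if \<open>w\<close> is the residual of a best approximation in
  \<open>L^p\<close>, then \<open>|w|^(p-2) cnj w\<close> lies in the dual space and solves the
  adjoint equation weakly. As the potential is bounded below by \<open>-d\<close> only, with
  \<open>d = \<gamma> m n / 2\<close>, the m-accretive operator is \<open>(P + d) / m\<close>, and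
  its semigroup has to be multiplied by \<open>exp (d t / m)\<close>. Since functions stand for
  their classes, norms are seminorms, and the abstract semigroup theory is developed for relations
  on a complete seminormed space, with all identities up to seminorm zero.\<close>

locale complete_seminorm =
  fixes X :: "'b::real_vector set" and N :: "'b \<Rightarrow> real"
  assumes subspace_X: "subspace X"
    and N_triangle: "\<lbrakk>x \<in> X; y \<in> X\<rbrakk> \<Longrightarrow> N (x + y) \<le> N x + N y"
    and N_scale: "x \<in> X \<Longrightarrow> N (c *\<^sub>R x) = \<bar>c\<bar> * N x"
    and complete: "\<lbrakk>\<And>n. s n \<in> X; \<And>e. e > 0 \<Longrightarrow> \<exists>M. \<forall>m\<ge>M. \<forall>n\<ge>M. N (s m - s n) < e\<rbrakk>
      \<Longrightarrow> \<exists>l\<in>X. (\<lambda>n::nat. N (s n - l)) \<longlonglongrightarrow> 0"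
begin

lemma X_add [simp]: "x \<in> X \<Longrightarrow> y \<in> X \<Longrightarrow> x + y \<in> X"
  and X_diff [simp]: "x \<in> X \<Longrightarrow> y \<in> X \<Longrightarrow> x - y \<in> X"
  and X_scale [simp]: "x \<in> X \<Longrightarrow> c *\<^sub>R x \<in> X"
  and X_zero [simp]: "0 \<in> X"
  and X_neg [simp]: "x \<in> X \<Longrightarrow> - x \<in> X"
  using subspace_X by (auto intro: subspace_add subspace_diff subspace_scale subspace_0 subspace_neg)

lemma N_zero [simp]: "N 0 = 0"
  using N_scale[of 0 0] by simp

lemma N_neg [simp]: "x \<in> X \<Longrightarrow> N (- x) = N x"
  using N_scale[of x "-1"] by simp

lemma N_nonneg [simp]: "x \<in> X \<Longrightarrow> N x \<ge> 0"
  using N_triangle[of x "-x"] by simp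

lemma N_le_0_iff [simp]: "x \<in> X \<Longrightarrow> N x \<le> 0 \<longleftrightarrow> N x = 0"
  using N_nonneg[of x] by linarith

lemma N_sym: "x \<in> X \<Longrightarrow> y \<in> X \<Longrightarrow> N (x - y) = N (y - x)"
  using N_neg[of "x - y"] by simp

lemma N_tri: "\<lbrakk>x \<in> X; y \<in> X; z \<in> X\<rbrakk> \<Longrightarrow> N (x - z) \<le> N (x - y) + N (y - z)"
  using N_triangle[of "x - y" "y - z"] by simp

lemma N_diff_le: "\<lbrakk>x \<in> X; y \<in> X\<rbrakk> \<Longrightarrow> N (x - y) \<le> N x + N y"
  using N_triangle[of x "-y"] by simp

lemma N_le_diff: "\<lbrakk>x \<in> X; y \<in> X\<rbrakk> \<Longrightarrow> N x \<le> N y + N (x - y)"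
  using N_triangle[of y "x - y"] by simp

lemma N_add_diff: "\<lbrakk>x \<in> X; y \<in> X; u \<in> X; w \<in> X\<rbrakk> \<Longrightarrow> N ((x + y) - (u + w)) \<le> N (x - u) + N (y - w)"
  using N_triangle[of "x - u" "y - w"] by (simp add: algebra_simps)

end

text \<open>\<open>A\<close> is a relation between representatives, so \<open>A_null\<close> is what
  makes membership insensitive to changes of seminorm zero (\<open>A_cong\<close>). The range
  condition is imposed for every \<open>h > 0\<close> because the approximation runs through all
  step sizes \<open>1 / 2 ^ k\<close>.\<close>

locale m_accretive = complete_seminorm X N for X :: "'b::real_vector set" and N :: "'b \<Rightarrow> real" +
  fixes A :: "('b \<times> 'b) set"
  assumes A_X: "(x, y) \<in> A \<Longrightarrow> x \<in> X \<and> y \<in> X"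
    and subspace_A: "subspace A"
    and A_null: "\<lbrakk>x \<in> X; y \<in> X; N x = 0; N y = 0\<rbrakk> \<Longrightarrow> (x, y) \<in> A"
    and accretive: "\<lbrakk>(x, y) \<in> A; h > 0\<rbrakk> \<Longrightarrow> N x \<le> N (x + h *\<^sub>R y)"
    and range: "\<lbrakk>h > 0; z \<in> X\<rbrakk> \<Longrightarrow> \<exists>x y. (x, y) \<in> A \<and> x + h *\<^sub>R y = z"
    and dense: "\<lbrakk>x \<in> X; e > 0\<rbrakk> \<Longrightarrow> \<exists>u w. (u, w) \<in> A \<and> N (u - x) < e"
begin

section \<open>Resolvents and their powers\<close>

lemma A_add: "(x, y) \<in> A \<Longrightarrow> (x', y') \<in> A \<Longrightarrow> (x + x', y + y') \<in> A"
  using subspace_add[OF subspace_A] by fastforce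

lemma A_scale: "(x, y) \<in> A \<Longrightarrow> (c *\<^sub>R x, c *\<^sub>R y) \<in> A"
  using subspace_scale[OF subspace_A] by fastforce

lemma A_diff: "(x, y) \<in> A \<Longrightarrow> (x', y') \<in> A \<Longrightarrow> (x - x', y - y') \<in> A"
  using subspace_diff[OF subspace_A] by fastforce

lemma A_cong:
  assumes "(x, y) \<in> A" "x' \<in> X" "y' \<in> X" "N (x' - x) = 0" "N (y' - y) = 0"
  shows "(x', y') \<in> A"
  using A_add[OF assms(1) A_null[of "x' - x" "y' - y"]] assms A_X by auto

text \<open>The equation determines \<open>x\<close> only up to seminorm zero, hence a choice. The
  algebraic laws of \<open>J\<close> (additivity, homogeneity, the resolvent identity
  \<open>J_sum\<close>) are therefore stated up to a null element.\<close>

definition J :: "real \<Rightarrow> 'b \<Rightarrow> 'b" where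
  "J h z = (SOME x. \<exists>y. (x, y) \<in> A \<and> x + h *\<^sub>R y = z)"

lemma J_in_A:
  assumes "h > 0" "z \<in> X"
  shows "(J h z, (1 / h) *\<^sub>R (z - J h z)) \<in> A"
proof -
  have "\<exists>y. (J h z, y) \<in> A \<and> J h z + h *\<^sub>R y = z"
    unfolding J_def by (rule someI_ex) (use range[OF assms] in blast)
  then obtain y where y: "(J h z, y) \<in> A" "J h z + h *\<^sub>R y = z" by blast
  have "z - J h z = h *\<^sub>R y" using y(2) by (metis add_diff_cancel_left')
  then show ?thesis using y(1) assms(1) by simp
qed

lemma J_X [simp]: "h > 0 \<Longrightarrow> z \<in> X \<Longrightarrow> J h z \<in> X"
  using J_in_A A_X by blast

text \<open>Accretivity applied to the difference of \<open>(x, y)\<close> and the pair given by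
  \<open>J_in_A\<close>: its first component plus \<open>h\<close> times its second collapses to the
  defect \<open>z - (x + h y)\<close>. Contraction, uniqueness and the one-step drift are all
  obtained by choosing \<open>z\<close> and \<open>(x, y)\<close>.\<close>

lemma J_near:
  assumes "(x, y) \<in> A" "h > 0" "z \<in> X"
  shows "N (J h z - x) \<le> N (z - (x + h *\<^sub>R y))"
proof -
  have "N (J h z - x) \<le> N ((J h z - x) + h *\<^sub>R ((1 / h) *\<^sub>R (z - J h z) - y))"
    by (rule accretive[OF A_diff[OF J_in_A]]) (use assms in auto)
  also have "(J h z - x) + h *\<^sub>R ((1 / h) *\<^sub>R (z - J h z) - y) = z - (x + h *\<^sub>R y)"
    using assms(2) by (simp add: scaleR_diff_right)
  finally show ?thesis .
qed

lemma J_contr: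
  assumes "h > 0" "z \<in> X" "z' \<in> X"
  shows "N (J h z - J h z') \<le> N (z - z')"
  using J_near[OF J_in_A[OF assms(1,3)] assms(1,2)] assms by simp

lemma J_le: "h > 0 \<Longrightarrow> z \<in> X \<Longrightarrow> N (J h z) \<le> N z"
  using accretive[OF J_in_A, of h z h] by simp

lemma J_eq:
  assumes "(x, y) \<in> A" "h > 0"
  shows "N (J h (x + h *\<^sub>R y) - x) = 0"
  using J_near[OF assms, of "x + h *\<^sub>R y"] A_X[OF assms(1)] assms(2) N_nonneg[of "J h (x + h *\<^sub>R y) - x"]
  by simp

lemma J_add:
  assumes "h > 0" "x \<in> X" "y \<in> X"
  shows "N (J h (x + y) - (J h x + J h y)) = 0"
  using J_eq[OF A_add[OF J_in_A[OF assms(1,2)] J_in_A[OF assms(1,3)]] assms(1)] assms(1)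
  by (simp add: scaleR_add_right)

lemma J_scale:
  assumes "h > 0" "x \<in> X"
  shows "N (J h (c *\<^sub>R x) - c *\<^sub>R J h x) = 0"
proof -
  have "c *\<^sub>R J h x + h *\<^sub>R c *\<^sub>R (1 / h) *\<^sub>R (x - J h x) = c *\<^sub>R x"
    using assms(1) by (simp add: scaleR_diff_right)
  then show ?thesis
    using J_eq[OF A_scale[OF J_in_A[OF assms(1,2)], of c] assms(1)] by simp
qed

text \<open>\<open>J h\<close> is linear up to null elements and sends \<open>x + h y\<close> back
  to \<open>x\<close>, which is the first claim. It says that \<open>J h y\<close> agrees with the
  value \<open>(1 / h) (x - J h x)\<close> of \<open>A\<close> at \<open>J h x\<close>, whence the
  second.\<close>

lemma J_commute:
  assumes "(x, y) \<in> A" "h > 0"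
  shows J_sum: "N (J h x + h *\<^sub>R J h y - x) = 0" and J_A: "(J h x, J h y) \<in> A"
proof -
  have X: "x \<in> X" "y \<in> X" using A_X assms by auto
  have "N ((J h x + h *\<^sub>R J h y) - x) \<le> N ((J h x + h *\<^sub>R J h y) - (J h x + J h (h *\<^sub>R y)))
      + N ((J h x + J h (h *\<^sub>R y)) - J h (x + h *\<^sub>R y)) + N (J h (x + h *\<^sub>R y) - x)"
    using N_tri[of "J h x + h *\<^sub>R J h y" "J h x + J h (h *\<^sub>R y)" x]
      N_tri[of "J h x + J h (h *\<^sub>R y)" "J h (x + h *\<^sub>R y)" x] X assms(2) by simp
  also have "\<dots> = 0"
    using J_add[OF assms(2) X(1), of "h *\<^sub>R y"] J_scale[OF assms(2) X(2), of h] J_eq[OF assms] X assms(2)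
      N_sym[of "J h x + J h (h *\<^sub>R y)" "J h (x + h *\<^sub>R y)"] N_sym[of "J h (h *\<^sub>R y)" "h *\<^sub>R J h y"] by simp
  finally show 1: "N (J h x + h *\<^sub>R J h y - x) = 0"
    using X assms(2) N_nonneg[of "J h x + h *\<^sub>R J h y - x"] by simp
  have "J h y - (1 / h) *\<^sub>R (x - J h x) = (1 / h) *\<^sub>R (J h x + h *\<^sub>R J h y - x)"
    using assms(2) by (simp add: algebra_simps)
  then have "N (J h y - (1 / h) *\<^sub>R (x - J h x)) = 0"
    using 1 X assms(2) by (simp add: N_scale)
  then show "(J h x, J h y) \<in> A"
    using A_cong[OF J_in_A[OF assms(2) X(1)], of "J h x" "J h y"] X assms(2) by simp
qed

abbreviation Jn :: "real \<Rightarrow> nat \<Rightarrow> 'b \<Rightarrow> 'b" where "Jn h n \<equiv> J h ^^ n"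

lemma Jn_X [simp]: "h > 0 \<Longrightarrow> z \<in> X \<Longrightarrow> Jn h n z \<in> X"
  by (induction n) auto

lemma Jn_contr:
  assumes "h > 0" "z \<in> X" "z' \<in> X"
  shows "N (Jn h n z - Jn h n z') \<le> N (z - z')"
proof (induction n)
  case (Suc n)
  show ?case using J_contr[of h "Jn h n z" "Jn h n z'"] Suc assms by simp
qed simp

lemma Jn_le: "h > 0 \<Longrightarrow> z \<in> X \<Longrightarrow> N (Jn h n z) \<le> N z"
proof (induction n)
  case (Suc n)
  show ?case using J_le[of h "Jn h n z"] Suc by simp
qed simp

lemma Jn_A: "(x, y) \<in> A \<Longrightarrow> h > 0 \<Longrightarrow> (Jn h n x, Jn h n y) \<in> A"
  by (induction n) (auto intro: J_A)

lemma Jn_add: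
  assumes "h > 0" "x \<in> X" "y \<in> X"
  shows "N (Jn h n (x + y) - (Jn h n x + Jn h n y)) = 0"
proof (induction n)
  case (Suc n)
  have "N (J h (Jn h n (x + y)) - (J h (Jn h n x) + J h (Jn h n y)))
     \<le> N (J h (Jn h n (x + y)) - J h (Jn h n x + Jn h n y))
      + N (J h (Jn h n x + Jn h n y) - (J h (Jn h n x) + J h (Jn h n y)))"
    by (rule N_tri) (use assms in auto)
  also have "\<dots> \<le> 0"
    using J_contr[of h "Jn h n (x + y)" "Jn h n x + Jn h n y"] J_add[of h "Jn h n x" "Jn h n y"] Suc assms by simp
  finally show ?case using assms N_nonneg[of "J h (Jn h n (x + y)) - (J h (Jn h n x) + J h (Jn h n y))"] by simp
qed simp

text \<open>The ambient structure is a real vector space, so multiplication by a complex scalar has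
  to enter as an operator \<open>S\<close> that preserves \<open>A\<close>; that is the instance
  used later.\<close>

lemma Jn_commute_op:
  assumes S: "\<And>x. x \<in> X \<Longrightarrow> S x \<in> X" "\<And>x y. (x, y) \<in> A \<Longrightarrow> (S x, S y) \<in> A"
    and lin: "\<And>x y c. x \<in> X \<Longrightarrow> y \<in> X \<Longrightarrow> S (x + c *\<^sub>R y) = S x + c *\<^sub>R S y"
    and h: "h > 0" "x \<in> X"
  shows "N (Jn h n (S x) - S (Jn h n x)) = 0"
proof (induction n)
  case (Suc n)
  let ?z = "Jn h n x"
  have zX: "?z \<in> X" using h by simp
  have "S (J h ?z) + h *\<^sub>R S ((1 / h) *\<^sub>R (?z - J h ?z)) = S ?z"
    using lin[of "J h ?z" "(1 / h) *\<^sub>R (?z - J h ?z)" h] h by simp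
  then have "N (J h (S ?z) - S (J h ?z)) = 0"
    using J_eq[OF S(2)[OF J_in_A[OF h(1) zX]] h(1)] by simp
  moreover have "N (J h (Jn h n (S x)) - J h (S ?z)) \<le> 0"
    using J_contr[of h "Jn h n (S x)" "S ?z"] Suc h S(1) by simp
  ultimately show ?case
    using N_tri[of "J h (Jn h n (S x))" "J h (S ?z)" "S (J h ?z)"] h S(1)
      N_nonneg[of "J h (Jn h n (S x)) - S (J h ?z)"] by simp
qed simp

lemma Jn_drift_gen:
  assumes "(x, y) \<in> A" "h > 0"
  shows "N (J h (Jn h n x) - Jn h n x) \<le> h * N y"
proof -
  have Jx: "(Jn h n x, Jn h n y) \<in> A" using Jn_A assms by blast
  have X: "x \<in> X" "y \<in> X" using A_X assms by auto
  have "N (J h (Jn h n x) - Jn h n x) \<le> h * N (Jn h n y)"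
    using J_near[OF Jx assms(2), of "Jn h n x"] X assms(2) by (simp add: N_scale)
  also have "\<dots> \<le> h * N y" using Jn_le[OF assms(2) X(2)] assms(2) by simp
  finally show ?thesis .
qed

lemma Jn_drift:
  assumes "(x, y) \<in> A" "h > 0"
  shows "N (Jn h n x - x) \<le> real n * h * N y"
proof (induction n)
  case (Suc n)
  have X: "x \<in> X" "y \<in> X" using A_X assms by auto
  show ?case
    using Suc N_tri[of "Jn h (Suc n) x" "Jn h n x" x] Jn_drift_gen[OF assms, of n] X assms(2)
    by (simp add: algebra_simps)
qed simp

text \<open>By \<open>J_sum\<close> the step from \<open>n\<close> to \<open>n + 1\<close> subtracts
  \<open>h\<close> times the iterate \<open>Jn h (Suc n) y\<close>, so the error against
  \<open>- n h y\<close> is \<open>h\<close> times a sum of \<open>n\<close> deviations of iterates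
  of \<open>y\<close> from \<open>y\<close>.\<close>

lemma Jn_first_order:
  assumes "(x, y) \<in> A" "h > 0" and B: "\<And>j. j \<le> n \<Longrightarrow> N (Jn h j y - y) \<le> B"
  shows "N (Jn h n x - x + (real n * h) *\<^sub>R y) \<le> real n * h * B"
  using B
proof (induction n)
  case (Suc n)
  have X: "x \<in> X" "y \<in> X" using A_X assms by auto
  let ?u = "Jn h n x"
  let ?w = "Jn h n y"
  have A': "(?u, ?w) \<in> A" using Jn_A assms by blast
  let ?p = "J h ?u + h *\<^sub>R J h ?w - ?u" and ?q = "?u - x + (real n * h) *\<^sub>R y" and ?r = "h *\<^sub>R (J h ?w - y)"
  have eq: "Jn h (Suc n) x - x + (real (Suc n) * h) *\<^sub>R y = (?p + ?q) - ?r"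
    by (simp add: algebra_simps)
  have "N ((?p + ?q) - ?r) \<le> N ?p + N ?q + N ?r"
    using N_diff_le[of "?p + ?q" ?r] N_triangle[of ?p ?q] X assms(2) by simp
  also have "N ?p = 0" by (rule J_sum[OF A' assms(2)])
  also have "N ?q \<le> real n * h * B" using Suc by simp
  also have "N ?r \<le> h * B" using Suc.prems[of "Suc n"] X assms(2) by (simp add: N_scale)
  finally show ?case unfolding eq by (simp add: algebra_simps)
qed simp

text \<open>With \<open>u = J h f\<close>, applying \<open>1 + (h/2) A\<close> twice to
  \<open>u\<close> gives \<open>u + h A u + (h^2/4) A^2 u\<close>, whereas
  \<open>f = u + h A u\<close>. Two half steps undo the former exactly, so by contraction the two
  results differ by the last term at most.\<close>

lemma J_halving:
  assumes fg: "(f, g) \<in> A" and gk: "(g, k) \<in> A" and h: "h > 0"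
  shows "N (J (h/2) (J (h/2) f) - J h f) \<le> h\<^sup>2 / 4 * N k"
proof -
  have X: "f \<in> X" "g \<in> X" "k \<in> X" using A_X assms by auto
  define u where "u = J h f"
  define u1 where "u1 = J h g"
  define u2 where "u2 = J h k"
  have h2: "h / 2 > 0" using h by simp
  have uX: "u \<in> X" "u1 \<in> X" "u2 \<in> X" using X h by (auto simp: u_def u1_def u2_def)
  have A1: "(u, u1) \<in> A" and A2: "(u1, u2) \<in> A"
    using J_A[OF fg h] J_A[OF gk h] by (auto simp: u_def u1_def u2_def)
  define w where "w = u + (h/2) *\<^sub>R u1"
  have wX: "w \<in> X" using uX by (simp add: w_def)
  have A3: "(w, u1 + (h/2) *\<^sub>R u2) \<in> A"
    unfolding w_def by (rule A_add[OF A1 A_scale[OF A2]])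
  have "N (J (h/2) (J (h/2) f) - u) \<le> N (J (h/2) f - w)"
    using J_near[OF A1 h2, of "J (h/2) f"] X h2 by (simp add: w_def)
  also have "\<dots> \<le> N (f - (w + (h/2) *\<^sub>R (u1 + (h/2) *\<^sub>R u2)))"
    using J_near[OF A3 h2, of f] X by simp
  also have "f - (w + (h/2) *\<^sub>R (u1 + (h/2) *\<^sub>R u2)) = - (u + h *\<^sub>R u1 - f) - (h\<^sup>2/4) *\<^sub>R u2"
    by (simp add: w_def scaleR_add_right power2_eq_square flip: scaleR_add_left)
  also have "N \<dots> \<le> N (u + h *\<^sub>R u1 - f) + h\<^sup>2/4 * N u2"
    using N_diff_le[of "- (u + h *\<^sub>R u1 - f)" "(h\<^sup>2/4) *\<^sub>R u2"] N_neg[of "u + h *\<^sub>R u1 - f"] uX X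
    by (simp add: N_scale)
  also have "N (u + h *\<^sub>R u1 - f) = 0"
    unfolding u_def u1_def by (rule J_sum[OF fg h])
  also have "N u2 \<le> N k" unfolding u2_def by (rule J_le[OF h X(3)])
  finally show ?thesis unfolding u_def by (simp add: mult_left_mono)
qed

lemma Jn_halving:
  assumes fg: "(f, g) \<in> A" and gk: "(g, k) \<in> A" and h: "h > 0"
  shows "N (Jn (h/2) (2 * n) f - Jn h n f) \<le> real n * (h\<^sup>2 / 4 * N k)"
proof (induction n)
  case (Suc n)
  have X: "f \<in> X" "g \<in> X" "k \<in> X" using A_X assms by auto
  have h2: "h / 2 > 0" using h by simp
  let ?J2 = "\<lambda>z. J (h/2) (J (h/2) z)"
  have "N (?J2 (Jn (h/2) (2 * n) f) - J h (Jn h n f))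
    \<le> N (?J2 (Jn (h/2) (2 * n) f) - ?J2 (Jn h n f)) + N (?J2 (Jn h n f) - J h (Jn h n f))"
    by (rule N_tri) (use X h in auto)
  also have "N (?J2 (Jn (h/2) (2 * n) f) - ?J2 (Jn h n f)) \<le> N (Jn (h/2) (2 * n) f - Jn h n f)"
    using J_contr[of "h/2" "J (h/2) (Jn (h/2) (2 * n) f)" "J (h/2) (Jn h n f)"]
      J_contr[of "h/2" "Jn (h/2) (2 * n) f" "Jn h n f"] X h by simp
  also have "N (?J2 (Jn h n f) - J h (Jn h n f)) \<le> h\<^sup>2 / 4 * N (Jn h n k)"
    by (rule J_halving[OF Jn_A[OF fg h] Jn_A[OF gk h] h])
  also have "\<dots> \<le> h\<^sup>2 / 4 * N k"
    using Jn_le[OF h X(3)] by (intro mult_left_mono) auto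
  finally show ?case using Suc by (simp add: algebra_simps)
qed simp

section \<open>Dyadic approximants and their convergence\<close>

definition approx :: "real \<Rightarrow> nat \<Rightarrow> 'b \<Rightarrow> 'b" where
  "approx t k = Jn (1 / 2 ^ k) (nat \<lfloor>t * 2 ^ k\<rfloor>)"

lemma approx_X [simp]: "x \<in> X \<Longrightarrow> approx t k x \<in> X"
  by (simp add: approx_def)

lemma approx_contr: "x \<in> X \<Longrightarrow> y \<in> X \<Longrightarrow> N (approx t k x - approx t k y) \<le> N (x - y)"
  unfolding approx_def by (rule Jn_contr) auto

lemma floor_double: "\<lfloor>2 * (a::real)\<rfloor> = 2 * \<lfloor>a\<rfloor> \<or> \<lfloor>2 * a\<rfloor> = 2 * \<lfloor>a\<rfloor> + 1"
  by linarith

lemma floor_sum: "\<lfloor>a + b::real\<rfloor> = \<lfloor>a\<rfloor> + \<lfloor>b\<rfloor> \<or> \<lfloor>a + b\<rfloor> = \<lfloor>a\<rfloor> + \<lfloor>b\<rfloor> + 1"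
  by linarith

lemma real_nat_floor_mult: "t \<ge> 0 \<Longrightarrow> real (nat \<lfloor>t * 2 ^ k\<rfloor>) * (1 / 2 ^ k) \<le> t"
proof -
  assume "t \<ge> 0"
  then have "real (nat \<lfloor>t * 2 ^ k\<rfloor>) \<le> t * 2 ^ k" by simp
  then show ?thesis by (simp add: field_simps)
qed

text \<open>Passing to half the step length doubles the number of steps, up to one extra half step
  created by rounding down. Halving \<open>n\<close> steps costs
  \<open>n h^2 / 4 \<le> t h / 4\<close> times \<open>N w\<close>, the extra step costs
  \<open>(h / 2) N g\<close>; both are of order \<open>h = 2^-k\<close>, hence summable.\<close>

lemma approx_step:
  assumes fg: "(f, g) \<in> A" and gk: "(g, w) \<in> A" and t: "t \<ge> 0"
  shows "N (approx t (Suc k) f - approx t k f) \<le> (t * N w + N g) * (1/2) ^ k"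
proof -
  have X: "f \<in> X" "g \<in> X" "w \<in> X" using A_X assms by auto
  define h :: real where "h = 1 / 2 ^ k"
  have h: "h > 0" "h / 2 > 0" by (auto simp: h_def)
  have h': "1 / 2 ^ Suc k = h / 2" by (simp add: h_def)
  define n where "n = nat \<lfloor>t * 2 ^ k\<rfloor>"
  define n' where "n' = nat \<lfloor>t * 2 ^ Suc k\<rfloor>"
  have nh: "real n * h \<le> t" unfolding n_def h_def by (rule real_nat_floor_mult[OF t])
  have "n' = 2 * n \<or> n' = Suc (2 * n)"
  proof -
    have "\<lfloor>t * 2 ^ k\<rfloor> \<ge> 0" using t by simp
    moreover have "t * 2 ^ Suc k = 2 * (t * 2 ^ k)" by simp
    ultimately show ?thesis using floor_double[of "t * 2 ^ k"] unfolding n_def n'_def by linarith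
  qed
  then have "N (Jn (h/2) n' f - Jn (h/2) (2 * n) f) \<le> (h / 2) * N g"
  proof
    assume "n' = Suc (2 * n)"
    then show ?thesis using Jn_drift_gen[OF fg h(2), of "2 * n"] by simp
  qed (use X h in simp)
  moreover have "N (Jn (h/2) (2 * n) f - Jn h n f) \<le> t * h / 4 * N w"
  proof -
    have "real n * (h\<^sup>2 / 4 * N w) = (real n * h) * (h / 4 * N w)" by (simp add: power2_eq_square)
    also have "\<dots> \<le> t * (h / 4 * N w)" using nh h X by (intro mult_right_mono) auto
    finally show ?thesis using Jn_halving[OF fg gk h(1), of n] by simp
  qed
  ultimately have "N (Jn (h/2) n' f - Jn h n f) \<le> (h / 2) * N g + t * h / 4 * N w"
    using N_tri[of "Jn (h/2) n' f" "Jn (h/2) (2 * n) f" "Jn h n f"] X h by simp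
  also have "\<dots> \<le> h * N g + t * h * N w"
    using X h t by (intro add_mono) (auto simp: field_simps)
  also have "\<dots> = (t * N w + N g) * (1/2) ^ k" by (simp add: h_def power_one_over add_divide_distrib algebra_simps)
  finally show ?thesis
    unfolding approx_def h' using h_def n_def n'_def by simp
qed

text \<open>\<open>J h u\<close> lies in the domain of the square of \<open>A\<close> as soon as
  \<open>u\<close> lies in that of \<open>A\<close>, because the value of \<open>A\<close> at
  \<open>J h u\<close> is \<open>J h w\<close>, again a resolvent value. It moves \<open>u\<close>
  by at most \<open>h N w\<close>.\<close>

lemma dense2:
  assumes "x \<in> X" "e > 0"
  obtains f g k where "(f, g) \<in> A" "(g, k) \<in> A" "N (f - x) < e"
proof -
  obtain u w where u: "(u, w) \<in> A" "N (u - x) < e / 2" using dense[of x "e/2"] assms by auto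
  have X: "u \<in> X" "w \<in> X" using u A_X by auto
  \<comment> \<open>Chosen so that \<open>h N w \<le> e / 2\<close>; the \<open>+ 1\<close> covers
    \<open>N w = 0\<close>.\<close>
  define h where "h = e / (2 * (N w + 1))"
  have N1: "N w + 1 > 0" using X N_nonneg[of w] by linarith
  then have h: "h > 0" using assms(2) by (simp add: h_def)
  have "N (J h u - u) \<le> h * N w" using Jn_drift[OF u(1) h, of 1] by simp
  also have "\<dots> \<le> e / 2" using N1 assms(2) by (simp add: h_def field_simps)
  finally have "N (J h u - x) < e" using N_tri[of "J h u" u x] u X h assms by simp
  then show ?thesis using that[OF J_A[OF u(1) h] J_in_A[OF h X(2)]] by blast
qed

lemma approx_convergent:
  assumes "x \<in> X" "t \<ge> 0"
  shows "\<exists>l\<in>X. (\<lambda>k. N (approx t k x - l)) \<longlonglongrightarrow> 0"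
proof (rule complete)
  show "approx t n x \<in> X" for n using assms by simp
  fix e :: real assume e: "e > 0"
  obtain f g w where f: "(f, g) \<in> A" "(g, w) \<in> A" "N (f - x) < e / 3"
    using dense2[of x "e / 3"] assms e by auto
  have X: "f \<in> X" "g \<in> X" "w \<in> X" using A_X f by auto
  define C where "C = t * N w + N g"
  have C: "C \<ge> 0" using X assms(2) by (simp add: C_def)
  \<comment> \<open>The geometric sum is kept in closed form so that the induction on
    \<open>j\<close> telescopes.\<close>
  have step: "N (approx t (m + j) f - approx t m f) \<le> 2 * C * (1/2) ^ m - 2 * C * (1/2) ^ (m + j)" for m j
  proof (induction j)
    case (Suc j)
    have "N (approx t (Suc (m + j)) f - approx t m f) \<le>
       N (approx t (Suc (m + j)) f - approx t (m + j) f) + N (approx t (m + j) f - approx t m f)"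
      using X by (intro N_tri) auto
    then show ?case
      using approx_step[OF f(1,2) assms(2), of "m + j"] Suc
      by (simp add: C_def[symmetric])
  qed (use X in simp)
  have step': "N (approx t n f - approx t m f) \<le> 2 * C * (1/2) ^ m" if "n \<ge> m" for n m
  proof -
    have "2 * C * (1/2) ^ n \<ge> 0" using C by simp
    then show ?thesis using step[of m "n - m"] that by simp
  qed
  have "(\<lambda>m. 2 * C * (1/2) ^ m) \<longlonglongrightarrow> 2 * C * 0"
    by (intro tendsto_intros LIMSEQ_power_zero) auto
  then have "\<forall>\<^sub>F m in sequentially. 2 * C * (1/2) ^ m < e / 3"
    using e by (intro order_tendstoD) auto
  then obtain M where M: "\<And>m. m \<ge> M \<Longrightarrow> 2 * C * (1/2) ^ m < e / 3"
    by (auto simp: eventually_sequentially)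
  have "N (approx t m x - approx t n x) < e" if mn: "m \<ge> M" "n \<ge> M" for m n
  proof -
    have "N (approx t m f - approx t n f) < e / 3"
    proof (cases "m \<le> n")
      case True
      then show ?thesis using step'[of m n] M[OF mn(1)] N_sym[of "approx t m f" "approx t n f"] X by simp
    next
      case False
      then show ?thesis using step'[of n m] M[OF mn(2)] X by simp
    qed
    moreover have "N (approx t m x - approx t m f) < e / 3" "N (approx t n f - approx t n x) < e / 3"
      using approx_contr[of x f t m] approx_contr[of f x t n] f(3) X assms N_sym[of f x] by auto
    moreover have "N (approx t m x - approx t n x) \<le> N (approx t m x - approx t m f)
       + (N (approx t m f - approx t n f) + N (approx t n f - approx t n x))"
      using N_tri[of "approx t m x" "approx t m f" "approx t n x"]
        N_tri[of "approx t m f" "approx t n f" "approx t n x"] X assms by simp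
    ultimately show ?thesis by simp
  qed
  then show "\<exists>M. \<forall>m\<ge>M. \<forall>n\<ge>M. N (approx t m x - approx t n x) < e" by blast
qed

section \<open>The semigroup and its generator\<close>

definition T :: "real \<Rightarrow> 'b \<Rightarrow> 'b" where
  "T t x = (SOME l. l \<in> X \<and> (\<lambda>k. N (approx t k x - l)) \<longlonglongrightarrow> 0)"

lemma T_props:
  assumes "x \<in> X" "t \<ge> 0"
  shows T_X [simp]: "T t x \<in> X" and T_lim: "(\<lambda>k. N (approx t k x - T t x)) \<longlonglongrightarrow> 0"
proof -
  have "T t x \<in> X \<and> (\<lambda>k. N (approx t k x - T t x)) \<longlonglongrightarrow> 0"
    unfolding T_def by (rule someI_ex) (use approx_convergent[OF assms] in blast)
  then show "T t x \<in> X" "(\<lambda>k. N (approx t k x - T t x)) \<longlonglongrightarrow> 0" by auto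
qed

lemma T_le_lim:
  assumes "x \<in> X" "t \<ge> 0" "y \<in> X" "b \<longlonglongrightarrow> B" "\<And>k. N (approx t k x - y) \<le> b k"
  shows "N (T t x - y) \<le> B"
proof (rule LIMSEQ_le_const)
  show "(\<lambda>k. N (approx t k x - T t x) + b k) \<longlonglongrightarrow> B"
    using tendsto_add[OF T_lim[OF assms(1,2)] assms(4)] by simp
  have "N (T t x - y) \<le> N (approx t k x - T t x) + b k" for k
    using N_tri[of "T t x" "approx t k x" y] N_sym[of "T t x" "approx t k x"] assms(5)[of k] T_X[OF assms(1,2)] assms(1-3)
      approx_X[of x t k] by linarith
  then show "\<exists>K. \<forall>k\<ge>K. N (T t x - y) \<le> N (approx t k x - T t x) + b k" by blast
qed

lemma T_unique:
  assumes "x \<in> X" "t \<ge> 0" "y \<in> X" "b \<longlonglongrightarrow> 0" "\<And>k. N (approx t k x - y) \<le> b k"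
  shows "N (T t x - y) = 0"
  using T_le_lim[OF assms] N_nonneg[of "T t x - y"] T_X[OF assms(1,2)] assms(3) by simp

lemma T_contr:
  assumes "x \<in> X" "y \<in> X" "t \<ge> 0"
  shows "N (T t x - T t y) \<le> N (x - y)"
proof (rule T_le_lim)
  show "(\<lambda>k. N (x - y) + N (approx t k y - T t y)) \<longlonglongrightarrow> N (x - y)"
    using tendsto_add[OF tendsto_const T_lim[OF assms(2,3)]] by simp
  show "N (approx t k x - T t y) \<le> N (x - y) + N (approx t k y - T t y)" for k
    using N_tri[of "approx t k x" "approx t k y" "T t y"] approx_contr[of x y t k] T_X[OF assms(2,3)] assms by simp
qed (use assms in auto)

lemma T_le: "x \<in> X \<Longrightarrow> t \<ge> 0 \<Longrightarrow> N (T t x) \<le> N x"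
  using T_le_lim[of x t 0 "\<lambda>_. N x" "N x"] Jn_le[of _ x] by (simp add: approx_def)

lemma T_add:
  assumes "x \<in> X" "y \<in> X" "t \<ge> 0"
  shows "N (T t (x + y) - (T t x + T t y)) = 0"
proof (rule T_unique)
  let ?b = "\<lambda>k. N (approx t k x - T t x) + N (approx t k y - T t y)"
  show "?b \<longlonglongrightarrow> 0" using tendsto_add[OF T_lim[OF assms(1,3)] T_lim[OF assms(2,3)]] by simp
  fix k
  have "N (approx t k (x + y) - (approx t k x + approx t k y)) = 0"
    unfolding approx_def using assms by (intro Jn_add) auto
  then show "N (approx t k (x + y) - (T t x + T t y)) \<le> ?b k"
    using N_tri[of "approx t k (x + y)" "approx t k x + approx t k y" "T t x + T t y"]
      N_add_diff[of "approx t k x" "approx t k y" "T t x" "T t y"] assms by simp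
qed (use assms in auto)

lemma T_commute_op:
  assumes S: "\<And>x. x \<in> X \<Longrightarrow> S x \<in> X" "\<And>x y. (x, y) \<in> A \<Longrightarrow> (S x, S y) \<in> A"
    and lin: "\<And>x y c. x \<in> X \<Longrightarrow> y \<in> X \<Longrightarrow> S (x + c *\<^sub>R y) = S x + c *\<^sub>R S y"
    and bd: "\<And>x. x \<in> X \<Longrightarrow> N (S x) \<le> C * N x"
    and x: "x \<in> X" "t \<ge> 0"
  shows "N (T t (S x) - S (T t x)) = 0"
proof (rule T_unique)
  let ?b = "\<lambda>k. C * N (approx t k x - T t x)"
  show "?b \<longlonglongrightarrow> 0" using tendsto_mult[OF tendsto_const T_lim[OF x], of C] by simp
  fix k
  have 1: "N (approx t k (S x) - S (approx t k x)) = 0"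
    unfolding approx_def using x by (intro Jn_commute_op[where S = S, OF S lin]) auto
  have "S (approx t k x) - S (T t x) = S (approx t k x - T t x)"
    using lin[of "approx t k x" "T t x" "-1"] x by simp
  then show "N (approx t k (S x) - S (T t x)) \<le> ?b k"
    using 1 N_tri[of "approx t k (S x)" "S (approx t k x)" "S (T t x)"] bd[of "approx t k x - T t x"] x S(1)
    by simp
qed (use x S in auto)

lemma T_0:
  assumes "x \<in> X"
  shows "N (T 0 x - x) = 0"
  by (rule T_unique[where b = "\<lambda>_. 0"]) (use assms in \<open>auto simp: approx_def\<close>)

lemma T_drift:
  assumes "(x, y) \<in> A" "t \<ge> 0"
  shows "N (T t x - x) \<le> t * N y"
proof (rule T_le_lim)
  have X: "x \<in> X" "y \<in> X" using A_X assms by auto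
  fix k
  have "N (approx t k x - x) \<le> real (nat \<lfloor>t * 2 ^ k\<rfloor>) * (1 / 2 ^ k) * N y"
    unfolding approx_def by (rule Jn_drift[OF assms(1)]) auto
  also have "\<dots> \<le> t * N y" using real_nat_floor_mult[OF assms(2)] X by (intro mult_right_mono) auto
  finally show "N (approx t k x - x) \<le> t * N y" .
qed (use A_X assms in auto)

lemma T_continuous:
  assumes "x \<in> X"
  shows "((\<lambda>t. N (T t x - x)) \<longlongrightarrow> 0) (at_right 0)"
proof (rule tendstoI)
  fix e :: real assume e: "e > 0"
  obtain u w where u: "(u, w) \<in> A" "N (u - x) < e / 3" using dense[of x "e / 3"] assms e by auto
  have X: "u \<in> X" "w \<in> X" using A_X u by auto
  have "((\<lambda>t. t * N w) \<longlongrightarrow> 0 * N w) (at_right 0)"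
    by (intro tendsto_intros)
  then have "\<forall>\<^sub>F t in at_right 0. t * N w < e / 3"
    using e by (intro order_tendstoD) auto
  moreover have "\<forall>\<^sub>F t in at_right 0. t > (0::real)"
    by (simp add: eventually_at_right_less)
  ultimately show "\<forall>\<^sub>F t in at_right 0. dist (N (T t x - x)) 0 < e"
  proof eventually_elim
    case (elim t)
    have "N (T t x - x) \<le> N (T t x - T t u) + (N (T t u - u) + N (u - x))"
      using N_tri[of "T t x" "T t u" x] N_tri[of "T t u" u x] T_X[of _ t] elim assms X by simp
    moreover have "N (T t x - T t u) \<le> N (u - x)"
      using T_contr[of x u t] N_sym[of u x] elim assms X by simp
    ultimately show ?case
      using T_drift[OF u(1), of t] elim u(2) T_X[of x t] N_nonneg[of "T t x - x"] assms by simp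
  qed
qed

text \<open>The step counts for \<open>s\<close>, \<open>t\<close> and \<open>s + t\<close> satisfy
  \<open>l = n + m\<close> or \<open>l = n + m + 1\<close>. On the domain of \<open>A\<close> the
  surplus step costs \<open>2^-k N w\<close>, which vanishes in the limit; density and contraction
  remove the restriction to the domain.\<close>

lemma T_semigroup:
  assumes "x \<in> X" "s \<ge> 0" "t \<ge> 0"
  shows "N (T (s + t) x - T s (T t x)) = 0"
proof -
  have core: "N (T (s + t) u - T s (T t u)) = 0" if u: "(u, w) \<in> A" for u w
  proof (rule T_unique)
    have X: "u \<in> X" "w \<in> X" using A_X u by auto
    have TX: "T t u \<in> X" "T s (T t u) \<in> X" using X assms by auto
    let ?b = "\<lambda>k. (1/2) ^ k * N w + (N (approx t k u - T t u) + N (approx s k (T t u) - T s (T t u)))"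
    have "?b \<longlonglongrightarrow> 0 * N w + (0 + 0)"
      using X TX assms by (intro tendsto_intros LIMSEQ_power_zero T_lim) auto
    then show "?b \<longlonglongrightarrow> 0" by simp
    fix k
    define h :: real where "h = 1 / 2 ^ k"
    have h: "h > 0" by (simp add: h_def)
    define n where "n = nat \<lfloor>s * 2 ^ k\<rfloor>"
    define m where "m = nat \<lfloor>t * 2 ^ k\<rfloor>"
    define l where "l = nat \<lfloor>(s + t) * 2 ^ k\<rfloor>"
    have "l = n + m \<or> l = Suc (n + m)"
    proof -
      have "\<lfloor>s * 2 ^ k\<rfloor> \<ge> 0" "\<lfloor>t * 2 ^ k\<rfloor> \<ge> 0" using assms by auto
      then show ?thesis
        using floor_sum[of "s * 2 ^ k" "t * 2 ^ k"] unfolding n_def m_def l_def distrib_right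
        by linarith
    qed
    then have "N (Jn h l u - Jn h (n + m) u) \<le> h * N w"
    proof
      assume "l = Suc (n + m)"
      then show ?thesis using Jn_drift_gen[OF u h, of "n + m"] by simp
    qed (use X h in simp)
    then have 1: "N (approx (s + t) k u - approx s k (approx t k u)) \<le> (1/2) ^ k * N w"
      by (simp add: approx_def h_def l_def n_def m_def funpow_add power_one_over)
    have 2: "N (approx s k (approx t k u) - approx s k (T t u)) \<le> N (approx t k u - T t u)"
      using X TX by (intro approx_contr) auto
    show "N (approx (s + t) k u - T s (T t u)) \<le> ?b k"
      using 1 2 N_tri[of "approx (s + t) k u" "approx s k (approx t k u)" "T s (T t u)"]
       N_tri[of "approx s k (approx t k u)" "approx s k (T t u)" "T s (T t u)"] X TX by simp
  qed (use A_X assms u in auto)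
  have "N (T (s + t) x - T s (T t x)) \<le> 0 + e" if e: "e > 0" for e
  proof -
    obtain u w where u: "(u, w) \<in> A" "N (u - x) < e / 2" using dense[of x "e / 2"] assms e by auto
    have X: "u \<in> X" "w \<in> X" using A_X u by auto
    have st: "s + t \<ge> 0" using assms by simp
    have TX: "T t x \<in> X" "T s (T t x) \<in> X" "T t u \<in> X" "T s (T t u) \<in> X" "T (s + t) x \<in> X" "T (s + t) u \<in> X"
      using X assms by auto
    have "N (T (s + t) x - T s (T t x)) \<le> N (T (s + t) x - T (s + t) u)
      + (N (T (s + t) u - T s (T t u)) + N (T s (T t u) - T s (T t x)))"
      using N_tri[of "T (s + t) x" "T (s + t) u" "T s (T t x)"]
        N_tri[of "T (s + t) u" "T s (T t u)" "T s (T t x)"] TX by simp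
    also have "\<dots> \<le> N (u - x) + (0 + N (u - x))"
      using T_contr[of x u "s + t"] T_contr[of "T t u" "T t x" s] T_contr[of u x t] core[OF u(1)] TX X assms st
        N_sym[of u x] by simp
    also have "\<dots> \<le> e" using u(2) by simp
    finally show ?thesis by simp
  qed
  then have "N (T (s + t) x - T s (T t x)) \<le> 0" by (rule field_le_epsilon)
  then show ?thesis using N_nonneg[of "T (s + t) x - T s (T t x)"] assms by simp
qed

text \<open>The iterates of \<open>y\<close> must stay close to \<open>y\<close>, but
  \<open>y\<close> need not lie in the domain and so has no rate of its own. A nearby
  \<open>y'\<close> in the domain supplies one: the drift of \<open>y'\<close> up to time
  \<open>t\<close> is at most \<open>t N z\<close>, and exchanging \<open>y\<close> for
  \<open>y'\<close> costs \<open>N (y - y')\<close> twice.\<close>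

lemma T_first_order:
  assumes xy: "(x, y) \<in> A" and yz: "(y', z) \<in> A" and t: "t > 0"
  shows "N (T t x - (x - t *\<^sub>R y)) \<le> t * (2 * N (y - y') + t * N z)"
proof (rule T_le_lim)
  have X: "x \<in> X" "y \<in> X" "y' \<in> X" "z \<in> X" using A_X xy yz by auto
  define B where "B = 2 * N (y - y') + t * N z"
  have B0: "B \<ge> 0" using X t by (simp add: B_def)
  let ?n = "\<lambda>k. nat \<lfloor>t * 2 ^ k\<rfloor>"
  let ?h = "\<lambda>k::nat. 1 / 2 ^ k :: real"
  let ?b = "\<lambda>k. t * B + (1/2) ^ k * N y"
  have "?b \<longlonglongrightarrow> t * B + 0 * N y"
    by (intro tendsto_intros LIMSEQ_power_zero) auto
  then show "?b \<longlonglongrightarrow> t * (2 * N (y - y') + t * N z)" by (simp add: B_def)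
  fix k
  have nt: "real (?n k) * ?h k \<le> t" using real_nat_floor_mult[of t k] t by simp
  have "N (Jn (?h k) j y - y) \<le> B" if j: "j \<le> ?n k" for j
  proof -
    have "real j * ?h k \<le> real (?n k) * ?h k" using j by (intro mult_right_mono) auto
    then have "real j * ?h k * N z \<le> t * N z" using nt X by (intro mult_right_mono) auto
    moreover have "N (Jn (?h k) j y' - y') \<le> real j * ?h k * N z" by (rule Jn_drift[OF yz]) simp
    moreover have "N (Jn (?h k) j y - Jn (?h k) j y') \<le> N (y - y')" using X by (intro Jn_contr) auto
    moreover have "N (Jn (?h k) j y - y) \<le> N (Jn (?h k) j y - Jn (?h k) j y') + (N (Jn (?h k) j y' - y') + N (y' - y))"
      using N_tri[of "Jn (?h k) j y" "Jn (?h k) j y'" y] N_tri[of "Jn (?h k) j y'" y' y] X by simp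
    ultimately show ?thesis using N_sym[of y y'] X by (simp add: B_def)
  qed
  then have "N (Jn (?h k) (?n k) x - x + (real (?n k) * ?h k) *\<^sub>R y) \<le> real (?n k) * ?h k * B"
    by (intro Jn_first_order[OF xy]) auto
  also have "\<dots> \<le> t * B" using nt B0 by (intro mult_right_mono) auto
  finally have 1: "N (approx t k x - x + (real (?n k) * ?h k) *\<^sub>R y) \<le> t * B" by (simp add: approx_def)
  \<comment> \<open>The part of \<open>t\<close> lost by rounding down is at most one step
    \<open>2^-k\<close>.\<close>
  have "t * 2 ^ k \<le> real (?n k) + 1" using t by linarith
  then have "t \<le> (real (?n k) + 1) * ?h k" by (simp add: field_simps)
  then have "\<bar>t - real (?n k) * ?h k\<bar> \<le> (1/2) ^ k" using nt by (simp add: algebra_simps power_one_over)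
  then have 2: "N ((t - real (?n k) * ?h k) *\<^sub>R y) \<le> (1/2) ^ k * N y"
    using X by (simp add: N_scale mult_right_mono del: of_nat_nat)
  have "approx t k x - (x - t *\<^sub>R y) = (approx t k x - x + (real (?n k) * ?h k) *\<^sub>R y) + (t - real (?n k) * ?h k) *\<^sub>R y"
    by (simp add: algebra_simps)
  then have "N (approx t k x - (x - t *\<^sub>R y)) \<le> N (approx t k x - x + (real (?n k) * ?h k) *\<^sub>R y)
     + N ((t - real (?n k) * ?h k) *\<^sub>R y)"
    using N_triangle[of "approx t k x - x + (real (?n k) * ?h k) *\<^sub>R y" "(t - real (?n k) * ?h k) *\<^sub>R y"] X
    by (metis X_add X_diff X_scale approx_X)
  then show "N (approx t k x - (x - t *\<^sub>R y)) \<le> t * B + (1/2) ^ k * N y"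
    using 1 2 by linarith
qed (use A_X xy t in auto)

lemma T_generator1:
  assumes xy: "(x, y) \<in> A"
  shows "((\<lambda>t. N ((1 / t) *\<^sub>R (T t x - x) + y)) \<longlongrightarrow> 0) (at_right 0)"
proof (rule tendstoI)
  have X: "x \<in> X" "y \<in> X" using A_X xy by auto
  fix e :: real assume e: "e > 0"
  obtain y' z where y': "(y', z) \<in> A" "N (y' - y) < e / 4" using dense[of y "e / 4"] X e by auto
  have X': "y' \<in> X" "z \<in> X" using A_X y' by auto
  have "((\<lambda>t. t * N z) \<longlongrightarrow> 0 * N z) (at_right 0)"
    by (intro tendsto_intros)
  then have "\<forall>\<^sub>F t in at_right 0. t * N z < e / 2"
    using e by (intro order_tendstoD) auto
  moreover have "\<forall>\<^sub>F t in at_right 0. t > (0::real)"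
    by (simp add: eventually_at_right_less)
  ultimately show "\<forall>\<^sub>F t in at_right 0. dist (N ((1 / t) *\<^sub>R (T t x - x) + y)) 0 < e"
  proof eventually_elim
    case (elim t)
    have TX: "T t x \<in> X" using X elim by simp
    have "(1 / t) *\<^sub>R (T t x - x) + y = (1 / t) *\<^sub>R (T t x - (x - t *\<^sub>R y))"
      using elim by (simp add: algebra_simps)
    then have "N ((1 / t) *\<^sub>R (T t x - x) + y) = (1 / t) * N (T t x - (x - t *\<^sub>R y))"
      using TX X elim by (simp add: N_scale)
    also have "\<dots> \<le> (1 / t) * (t * (2 * N (y - y') + t * N z))"
      using T_first_order[OF xy y'(1), of t] elim by (intro mult_left_mono) auto
    also have "\<dots> < e" using elim y'(2) N_sym[of y y'] X X' by simp
    finally show ?case using N_nonneg[of "(1 / t) *\<^sub>R (T t x - x) + y"] TX X by simp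
  qed
qed

text \<open>The converse is a maximality argument. Solve \<open>u + A u = x - g\<close> and put
  \<open>q = x - u\<close>. The difference quotient of the semigroup at \<open>q\<close> tends to
  \<open>g + w = q\<close> itself, so \<open>T t q\<close> would grow like \<open>(1 + t) q\<close>;
  contraction allows this only if \<open>N q = 0\<close>, and then \<open>(x, -g)\<close> differs
  from a pair of \<open>A\<close> by null elements.\<close>

theorem T_generator:
  assumes X: "x \<in> X" "g \<in> X"
  shows "((\<lambda>t. N ((1 / t) *\<^sub>R (T t x - x) - g)) \<longlongrightarrow> 0) (at_right 0) \<longleftrightarrow> (x, - g) \<in> A"
proof
  assume "(x, - g) \<in> A"
  from T_generator1[OF this] show "((\<lambda>t. N ((1 / t) *\<^sub>R (T t x - x) - g)) \<longlongrightarrow> 0) (at_right 0)" by simp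
next
  assume lim: "((\<lambda>t. N ((1 / t) *\<^sub>R (T t x - x) - g)) \<longlongrightarrow> 0) (at_right 0)"
  obtain u w where u: "(u, w) \<in> A" "u + 1 *\<^sub>R w = x - g" using range[of 1 "x - g"] X by auto
  have UX: "u \<in> X" "w \<in> X" using A_X u by auto
  define q where "q = x - u"
  have qX: "q \<in> X" using X UX by (simp add: q_def)
  have qw: "q = g + w" using u(2) by (simp add: q_def algebra_simps)
  have lim2: "((\<lambda>t. N ((1 / t) *\<^sub>R (T t x - x) - g) + N ((1 / t) *\<^sub>R (T t u - u) + w)) \<longlongrightarrow> 0) (at_right 0)"
    using tendsto_add[OF lim T_generator1[OF u(1)]] by simp
  have "N q \<le> N ((1 / t) *\<^sub>R (T t x - x) - g) + N ((1 / t) *\<^sub>R (T t u - u) + w)" if t: "t > 0" for t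
  proof -
    have TX: "T t x \<in> X" "T t u \<in> X" using X UX t by auto
    let ?r = "((1 / t) *\<^sub>R (T t x - x) - g) - ((1 / t) *\<^sub>R (T t u - u) + w)"
    have "(1 + t) *\<^sub>R q = (T t x - T t u) - t *\<^sub>R ?r"
    proof -
      have "t *\<^sub>R ?r = (T t x - x) - (T t u - u) - t *\<^sub>R (g + w)"
        using t by (simp add: scaleR_diff_right scaleR_add_right)
      then show ?thesis by (simp add: q_def[symmetric] qw[symmetric] scaleR_add_left)
    qed
    then have "N ((1 + t) *\<^sub>R q) \<le> N (T t x - T t u) + N (t *\<^sub>R ?r)"
      using N_diff_le[of "T t x - T t u" "t *\<^sub>R ?r"] TX X UX by simp
    then have "(1 + t) * N q \<le> N q + t * N ?r"
      using T_contr[of x u t] t X UX qX TX by (simp add: N_scale q_def)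
    then have "N q \<le> N ?r" using t by (simp add: algebra_simps)
    also have "\<dots> \<le> N ((1 / t) *\<^sub>R (T t x - x) - g) + N ((1 / t) *\<^sub>R (T t u - u) + w)"
      using TX X UX by (intro N_diff_le) auto
    finally show ?thesis .
  qed
  then have "\<forall>\<^sub>F t in at_right 0. N q \<le> N ((1 / t) *\<^sub>R (T t x - x) - g) + N ((1 / t) *\<^sub>R (T t u - u) + w)"
    by (auto simp: eventually_at_right_field intro: exI[of _ 1])
  from tendsto_lowerbound[OF lim2 this] have "N q \<le> 0" by simp
  then have q0: "N q = 0" using N_nonneg[OF qX] by simp
  have "N (- g - w) = 0"
    using q0 qw N_neg[of "g + w"] X UX by simp
  then show "(x, - g) \<in> A"
    using A_cong[OF u(1), of x "- g"] X q0 by (simp add: q_def)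
qed

end

section \<open>Lebesgue spaces\<close>

text \<open>Young's inequality for the exponents \<open>p / (p - 1)\<close> and \<open>p\<close>.
  Read as a tangent inequality for \<open>t^p\<close> at \<open>a\<close>, it is the common source
  of Minkowski's inequality, of Jensen's inequality for kernels and of the gradient inequality for
  \<open>dualp\<close>.\<close>

lemma young_powr:
  fixes a b p :: real
  assumes "1 < p" "0 \<le> a" "0 \<le> b"
  shows "p * (a powr (p - 1) * b) \<le> (p - 1) * a powr p + b powr p"
proof -
  define q where "q = p / (p - 1)"
  have q: "1 < q" "1 / p + 1 / q = 1" using assms(1) by (auto simp: q_def field_simps)
  have "a powr (p - 1) * b \<le> b powr p / p + (a powr (p - 1)) powr q / q"
    using Youngs_inequality[OF assms(1) q(1) q(2) assms(3), of "a powr (p - 1)"] by (simp add: mult.commute)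
  also have "(a powr (p - 1)) powr q = a powr p" using assms(1) by (simp add: powr_powr q_def)
  finally show ?thesis using assms(1) by (simp add: q_def field_simps)
qed

text \<open>The tangent inequality at the mean \<open>c\<close>, averaged with the weights
  \<open>u\<close> and \<open>v\<close>.\<close>

lemma powr_convex_combination:
  fixes x y u v p :: real
  assumes "1 < p" "0 \<le> x" "0 \<le> y" "0 \<le> u" "0 \<le> v" "u + v = 1"
  shows "(u * x + v * y) powr p \<le> u * x powr p + v * y powr p"
proof -
  define c where "c = u * x + v * y"
  have c: "0 \<le> c" using assms by (simp add: c_def)
  have cp: "c powr p = c powr (p - 1) * c" using c by (cases "c = 0") (auto simp: powr_diff)
  have "u * (p * (c powr (p - 1) * x)) + v * (p * (c powr (p - 1) * y))
     \<le> u * ((p - 1) * c powr p + x powr p) + v * ((p - 1) * c powr p + y powr p)"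
    using young_powr[OF assms(1) c] assms by (intro add_mono mult_left_mono) auto
  moreover have "u * (p * (c powr (p - 1) * x)) + v * (p * (c powr (p - 1) * y)) = p * (c powr (p - 1) * c)"
    by (simp add: c_def algebra_simps)
  moreover have "u * ((p - 1) * c powr p + x powr p) + v * ((p - 1) * c powr p + y powr p)
     = (u + v) * ((p - 1) * c powr p) + (u * x powr p + v * y powr p)"
    by (simp add: algebra_simps)
  ultimately show ?thesis using assms(6) cp unfolding c_def by (simp add: algebra_simps)
qed

lemma powr_add_le:
  fixes a b p :: real
  assumes "0 < p" "0 \<le> a" "0 \<le> b"
  shows "(a + b) powr p \<le> 2 powr p * (a powr p + b powr p)"
proof -
  have "(a + b) powr p \<le> (2 * max a b) powr p" using assms by (intro powr_mono2) auto
  also have "\<dots> = 2 powr p * max a b powr p" using assms by (simp add: powr_mult)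
  also have "max a b powr p \<le> a powr p + b powr p" by (auto simp: max_def)
  finally show ?thesis by simp
qed

section \<open>Minkowski, Hoelder and limits in the seminorm\<close>

lemma Lp_measurable [measurable_dest]: "f \<in> Lp p \<Longrightarrow> f \<in> borel_measurable borel"
  by (simp add: Lp_def)

lemma Lp_integrable: "f \<in> Lp p \<Longrightarrow> integrable lborel (\<lambda>z. norm (f z) powr p)"
  by (simp add: Lp_def)

lemma LpI: "f \<in> borel_measurable borel \<Longrightarrow> integrable lborel (\<lambda>z. norm (f z) powr p) \<Longrightarrow> f \<in> Lp p"
  by (simp add: Lp_def)

lemma Lp_norm_nonneg [simp]: "Lp_norm p f \<ge> 0"
  by (simp add: Lp_norm_def)

lemma Lp_norm_powr: "p > 0 \<Longrightarrow> Lp_norm p f powr p = (\<integral>z. norm (f z) powr p \<partial>lborel)"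
  by (simp add: Lp_norm_def powr_powr)

lemma Lp_norm_leI:
  assumes "p > 0" "c \<ge> 0" "(\<integral>z. norm (f z) powr p \<partial>lborel) \<le> c powr p"
  shows "Lp_norm p f \<le> c"
proof -
  have "Lp_norm p f \<le> (c powr p) powr (1 / p)"
    unfolding Lp_norm_def using assms by (intro powr_mono2) auto
  then show ?thesis using assms by (simp add: powr_powr)
qed

lemma Lp_norm_cong_AE:
  assumes "AE z in lborel. f z = g z" "f \<in> borel_measurable borel" "g \<in> borel_measurable borel"
  shows "Lp_norm p f = Lp_norm p g"
  unfolding Lp_norm_def
  by (rule arg_cong[where f = "\<lambda>x. x powr (1 / p)"], rule integral_cong_AE) (use assms in auto)

lemma Lp_dominated:
  assumes "p > 0" "g \<in> borel_measurable borel" "f \<in> Lp p" "\<And>z. norm (g z) \<le> norm (f z)"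
  shows "g \<in> Lp p" "Lp_norm p g \<le> Lp_norm p f"
proof -
  have le: "norm (g z) powr p \<le> norm (f z) powr p" for z
    using assms by (intro powr_mono2) auto
  have int: "integrable lborel (\<lambda>z. norm (g z) powr p)"
    by (rule Bochner_Integration.integrable_bound[OF Lp_integrable[OF assms(3)]]) (use assms le in auto)
  then show "g \<in> Lp p" using assms by (intro LpI)
  show "Lp_norm p g \<le> Lp_norm p f"
    unfolding Lp_norm_def
    by (rule powr_mono2, use assms(1) in simp, simp)
      (rule integral_mono[OF int Lp_integrable[OF assms(3)] le])
qed

lemma Lp_add:
  assumes p: "p > 0" and "f \<in> Lp p" "g \<in> Lp p"
  shows "(\<lambda>z. f z + g z) \<in> Lp p"
proof (rule LpI)
  have [measurable]: "f \<in> borel_measurable borel" "g \<in> borel_measurable borel" using assms by auto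
  show "(\<lambda>z. f z + g z) \<in> borel_measurable borel" by measurable
  have "norm (f z + g z) powr p \<le> 2 powr p * (norm (f z) powr p + norm (g z) powr p)" for z
    using powr_add_le[OF p, of "norm (f z)" "norm (g z)"] powr_mono2[of p "norm (f z + g z)" "norm (f z) + norm (g z)"]
      norm_triangle_ineq[of "f z" "g z"] p by simp
  moreover have "integrable lborel (\<lambda>z. 2 powr p * (norm (f z) powr p + norm (g z) powr p))"
    using Lp_integrable[OF assms(2)] Lp_integrable[OF assms(3)] by auto
  ultimately show "integrable lborel (\<lambda>z. norm (f z + g z) powr p)"
    by (elim Bochner_Integration.integrable_bound) auto
qed

lemma Lp_cmult:
  assumes "f \<in> Lp p"
  shows "(\<lambda>z. c * f z) \<in> Lp p"
proof (rule LpI)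
  have [measurable]: "f \<in> borel_measurable borel" using assms by auto
  show "(\<lambda>z. c * f z) \<in> borel_measurable borel" by measurable
  show "integrable lborel (\<lambda>z. norm (c * f z) powr p)"
    using Lp_integrable[OF assms] by (simp add: norm_mult powr_mult)
qed

lemma Lp_norm_cmult:
  assumes "p > 0"
  shows "Lp_norm p (\<lambda>z. c * f z) = norm c * Lp_norm p f"
proof -
  have "(\<integral>z. norm (c * f z) powr p \<partial>lborel) = norm c powr p * (\<integral>z. norm (f z) powr p \<partial>lborel)"
    by (simp add: norm_mult powr_mult)
  then show ?thesis
    unfolding Lp_norm_def using assms by (simp add: powr_mult powr_powr)
qed

lemma Lp_scaleR: "f \<in> Lp p \<Longrightarrow> (\<lambda>z. c *\<^sub>R f z) \<in> Lp p"
  using Lp_cmult[of f p "of_real c"] by (simp add: scaleR_conv_of_real)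

lemma Lp_norm_scaleR: "p > 0 \<Longrightarrow> Lp_norm p (\<lambda>z. c *\<^sub>R f z) = \<bar>c\<bar> * Lp_norm p f"
  using Lp_norm_cmult[of p "of_real c" f] by (simp add: scaleR_conv_of_real)

lemma Lp_diff: "p > 0 \<Longrightarrow> f \<in> Lp p \<Longrightarrow> g \<in> Lp p \<Longrightarrow> (\<lambda>z. f z - g z) \<in> Lp p"
  using Lp_add[of p f "\<lambda>z. (-1) * g z"] Lp_cmult[of g p "-1"] by simp

lemma Lp_zero: "(\<lambda>z. 0) \<in> Lp p"
  by (rule LpI) auto

lemma Lp_norm_minus_commute: "Lp_norm p (\<lambda>z. f z - g z) = Lp_norm p (\<lambda>z. g z - f z)"
  by (simp add: Lp_norm_def norm_minus_commute)

lemma Lp_norm_eq_0_iff: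
  assumes "p > 0" "f \<in> Lp p"
  shows "Lp_norm p f = 0 \<longleftrightarrow> (AE z in lborel. f z = 0)"
proof -
  have "Lp_norm p f = 0 \<longleftrightarrow> (\<integral>z. norm (f z) powr p \<partial>lborel) = 0"
    by (simp add: Lp_norm_def)
  also have "\<dots> \<longleftrightarrow> (AE z in lborel. norm (f z) powr p = 0)"
    by (rule integral_nonneg_eq_0_iff_AE[OF Lp_integrable[OF assms(2)]]) auto
  finally show ?thesis by simp
qed

text \<open>Convexity of \<open>t^p\<close> applied to the normalised functions \<open>f / a\<close>
  and \<open>g / b\<close> with weights \<open>a / (a + b)\<close> and \<open>b / (a + b)\<close>. A
  vanishing norm is split off since it cannot be normalised.\<close>

lemma Lp_norm_add:
  assumes p: "1 < p" and f: "f \<in> Lp p" and g: "g \<in> Lp p"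
  shows "Lp_norm p (\<lambda>z. f z + g z) \<le> Lp_norm p f + Lp_norm p g"
proof -
  define a where "a = Lp_norm p f"
  define b where "b = Lp_norm p g"
  have [measurable]: "f \<in> borel_measurable borel" "g \<in> borel_measurable borel" using f g by auto
  have ab: "a \<ge> 0" "b \<ge> 0" by (auto simp: a_def b_def)
  consider "a = 0" | "b = 0" | "a > 0" "b > 0" using ab by linarith
  then show ?thesis
  proof cases
    case 1
    then have "AE z in lborel. f z = 0" using Lp_norm_eq_0_iff[of p f] f p by (simp add: a_def)
    then have "Lp_norm p (\<lambda>z. f z + g z) = Lp_norm p g"
      by (intro Lp_norm_cong_AE) auto
    then show ?thesis by simp
  next
    case 2
    then have "AE z in lborel. g z = 0" using Lp_norm_eq_0_iff[of p g] g p by (simp add: b_def)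
    then have "Lp_norm p (\<lambda>z. f z + g z) = Lp_norm p f"
      by (intro Lp_norm_cong_AE) auto
    then show ?thesis by simp
  next
    case 3
    define u where "u = a / (a + b)"
    define v where "v = b / (a + b)"
    have uv: "u \<ge> 0" "v \<ge> 0" "u + v = 1"
      using 3 by (auto simp: u_def v_def add_divide_distrib[symmetric])
    let ?S = "(a + b) powr p"
    have pw: "norm (f z + g z) powr p \<le> ?S * (u / a powr p * norm (f z) powr p + v / b powr p * norm (g z) powr p)" for z
    proof -
      have eq: "norm (f z) + norm (g z) = (a + b) * (u * (norm (f z) / a) + v * (norm (g z) / b))"
      proof -
        have "(a + b) * u = a" "(a + b) * v = b" using 3 by (auto simp: u_def v_def)
        then have "(a + b) * (u * (norm (f z) / a) + v * (norm (g z) / b)) = a * (norm (f z) / a) + b * (norm (g z) / b)"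
          by (metis distrib_left mult.assoc)
        then show ?thesis using 3 by simp
      qed
      have "norm (f z + g z) powr p \<le> ((a + b) * (u * (norm (f z) / a) + v * (norm (g z) / b))) powr p"
        unfolding eq[symmetric] using p by (intro powr_mono2 norm_triangle_ineq) auto
      also have "\<dots> = ?S * (u * (norm (f z) / a) + v * (norm (g z) / b)) powr p"
        by (simp add: powr_mult)
      also have "\<dots> \<le> ?S * (u * (norm (f z) / a) powr p + v * (norm (g z) / b) powr p)"
        using uv 3 p by (intro mult_left_mono powr_convex_combination) auto
      finally show ?thesis by (simp add: powr_divide)
    qed
    have "(\<integral>z. norm (f z + g z) powr p \<partial>lborel)
      \<le> (\<integral>z. ?S * (u / a powr p * norm (f z) powr p + v / b powr p * norm (g z) powr p) \<partial>lborel)"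
      using pw Lp_integrable[OF f] Lp_integrable[OF g] Lp_integrable[OF Lp_add[of p f g]] p f g
      by (intro integral_mono) auto
    also have "\<dots> = ?S * (u / a powr p * a powr p + v / b powr p * b powr p)"
      unfolding a_def b_def using Lp_integrable[OF f] Lp_integrable[OF g] p by (simp add: Lp_norm_powr)
    also have "\<dots> = ?S" using uv 3 by simp
    finally show ?thesis
      using p ab unfolding a_def[symmetric] b_def[symmetric] by (intro Lp_norm_leI) auto
  qed
qed

lemma Lp_norm_triangle:
  assumes "1 < p" "f \<in> Lp p" "g \<in> Lp p" "h \<in> Lp p"
  shows "Lp_norm p (\<lambda>z. f z - h z) \<le> Lp_norm p (\<lambda>z. f z - g z) + Lp_norm p (\<lambda>z. g z - h z)"
  using Lp_norm_add[OF assms(1) Lp_diff[of p f g] Lp_diff[of p g h]] assms by simp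

lemma Lp_norm_abs_diff:
  assumes p: "1 < p" and f: "f \<in> Lp p" and g: "g \<in> Lp p"
  shows "\<bar>Lp_norm p f - Lp_norm p g\<bar> \<le> Lp_norm p (\<lambda>z. f z - g z)"
  using Lp_norm_triangle[OF p f g Lp_zero] Lp_norm_triangle[OF p g f Lp_zero]
    Lp_norm_minus_commute[of p f g] by simp

lemma Lp_norm_tendsto:
  assumes p: "1 < p" and F: "\<And>k. F k \<in> Lp p" and f: "f \<in> Lp p"
    and lim: "((\<lambda>k. Lp_norm p (\<lambda>z. F k z - f z)) \<longlongrightarrow> 0) net"
  shows "((\<lambda>k. Lp_norm p (F k)) \<longlongrightarrow> Lp_norm p f) net"
proof (rule LIM_zero_cancel, rule tendsto_0_le[OF lim])
  show "\<forall>\<^sub>F k in net. norm (Lp_norm p (F k) - Lp_norm p f) \<le> norm (Lp_norm p (\<lambda>z. F k z - f z)) * 1"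
    using Lp_norm_abs_diff[OF p F f] by (intro always_eventually) simp
qed

text \<open>Integrability follows from Young's inequality as it stands; the product of the norms
  appears when the same inequality is applied to the functions divided by their norms.\<close>

lemma Lp_Holder:
  assumes p: "1 < p" and pq: "1 / p + 1 / q = 1" and f: "f \<in> Lp p" and g: "g \<in> Lp q"
  shows "integrable lborel (\<lambda>z. norm (f z) * norm (g z))"
    and "(\<integral>z. norm (f z) * norm (g z) \<partial>lborel) \<le> Lp_norm p f * Lp_norm q g"
proof -
  have q: "1 < q"
  proof -
    have "1 / p < 1" "0 < 1 / p" using p by auto
    then have "0 < 1 / q" "1 / q < 1" using pq by linarith+
    then show ?thesis by (auto simp: field_simps split: if_splits)
  qed
  have [measurable]: "f \<in> borel_measurable borel" "g \<in> borel_measurable borel" using f g by auto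
  have young: "norm (f z) * norm (g z) \<le> norm (f z) powr p / p + norm (g z) powr q / q" for z
    by (rule Youngs_inequality) (use p q pq in auto)
  have int: "integrable lborel (\<lambda>z. norm (f z) powr p / p + norm (g z) powr q / q)"
    using Lp_integrable[OF f] Lp_integrable[OF g] by auto
  show I: "integrable lborel (\<lambda>z. norm (f z) * norm (g z))"
    by (rule Bochner_Integration.integrable_bound[OF int])
      (use young p q in \<open>auto intro!: AE_I2 simp: add_nonneg_nonneg\<close>)
  define a where "a = Lp_norm p f"
  define b where "b = Lp_norm q g"
  have ab: "a \<ge> 0" "b \<ge> 0" by (auto simp: a_def b_def)
  show "(\<integral>z. norm (f z) * norm (g z) \<partial>lborel) \<le> Lp_norm p f * Lp_norm q g"
  proof (cases "a = 0 \<or> b = 0")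
    case True
    then have "AE z in lborel. norm (f z) * norm (g z) = 0"
      using Lp_norm_eq_0_iff[of p f] Lp_norm_eq_0_iff[of q g] p q f g by (auto simp: a_def b_def)
    then have "(\<integral>z. norm (f z) * norm (g z) \<partial>lborel) = 0"
      using integral_cong_AE[of "\<lambda>z. norm (f z) * norm (g z)" lborel "\<lambda>z. 0"] by simp
    then show ?thesis by simp
  next
    case False
    then have pos: "a > 0" "b > 0" using ab by auto
    have "norm (f z) * norm (g z) \<le> a * b * (norm (f z) powr p / (p * a powr p) + norm (g z) powr q / (q * b powr q))" for z
    proof -
      have "(norm (f z) / a) * (norm (g z) / b) \<le> (norm (f z) / a) powr p / p + (norm (g z) / b) powr q / q"
        by (rule Youngs_inequality) (use p q pq pos in auto)
      then show ?thesis using pos by (simp add: powr_divide field_simps)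
    qed
    then have "(\<integral>z. norm (f z) * norm (g z) \<partial>lborel)
       \<le> (\<integral>z. a * b * (norm (f z) powr p / (p * a powr p) + norm (g z) powr q / (q * b powr q)) \<partial>lborel)"
      using Lp_integrable[OF f] Lp_integrable[OF g] I by (intro integral_mono) auto
    also have "\<dots> = a * b * (a powr p / (p * a powr p) + b powr q / (q * b powr q))"
      unfolding a_def b_def using Lp_integrable[OF f] Lp_integrable[OF g] p q by (simp add: Lp_norm_powr)
    also have "\<dots> = a * b" using pos pq by simp
    finally show ?thesis by (simp add: a_def b_def)
  qed
qed

lemma Lp_pairing:
  assumes p: "1 < p" and pq: "1 / p + 1 / q = 1" and f: "f \<in> Lp p" and g: "g \<in> Lp q"
  shows "integrable lborel (\<lambda>z. f z * g z)"
    and "norm (\<integral>z. f z * g z \<partial>lborel) \<le> Lp_norm p f * Lp_norm q g"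
proof -
  have [measurable]: "f \<in> borel_measurable borel" "g \<in> borel_measurable borel" using f g by auto
  show "integrable lborel (\<lambda>z. f z * g z)"
    by (rule Bochner_Integration.integrable_bound[OF Lp_Holder(1)[OF assms]]) (auto simp: norm_mult)
  have "norm (\<integral>z. f z * g z \<partial>lborel) \<le> (\<integral>z. norm (f z * g z) \<partial>lborel)" by simp
  also have "\<dots> \<le> Lp_norm p f * Lp_norm q g" using Lp_Holder(2)[OF assms] by (simp add: norm_mult)
  finally show "norm (\<integral>z. f z * g z \<partial>lborel) \<le> Lp_norm p f * Lp_norm q g" .
qed

lemma tendsto_powr_0:
  fixes a :: real
  assumes "(x \<longlongrightarrow> 0) F" "a > 0"
  shows "((\<lambda>k. (x k :: real) powr a) \<longlongrightarrow> 0) F"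
proof (rule tendstoI)
  fix e :: real assume e: "e > 0"
  have "\<forall>\<^sub>F k in F. \<bar>x k\<bar> < e powr (1 / a)"
    using tendstoD[OF assms(1), of "e powr (1 / a)"] e by (simp add: dist_real_def)
  then show "\<forall>\<^sub>F k in F. dist (x k powr a) 0 < e"
  proof eventually_elim
    case (elim k)
    have "x k powr a \<le> \<bar>x k\<bar> powr a" by (cases "x k \<ge> 0") (auto simp: powr_def ln_real_def)
    also have "\<dots> < (e powr (1 / a)) powr a" using elim assms(2) by (intro powr_less_mono2) auto
    finally show ?case using e assms(2) by (simp add: powr_powr)
  qed
qed

lemma Lp_norm_tendsto_0_iff:
  assumes "p > 0"
  shows "((\<lambda>k. Lp_norm p (F k)) \<longlongrightarrow> 0) net \<longleftrightarrow> ((\<lambda>k. \<integral>z. norm (F k z) powr p \<partial>lborel) \<longlongrightarrow> 0) net"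
proof
  assume "((\<lambda>k. Lp_norm p (F k)) \<longlongrightarrow> 0) net"
  from tendsto_powr_0[OF this assms] show "((\<lambda>k. \<integral>z. norm (F k z) powr p \<partial>lborel) \<longlongrightarrow> 0) net"
    using assms by (simp add: Lp_norm_powr)
next
  assume "((\<lambda>k. \<integral>z. norm (F k z) powr p \<partial>lborel) \<longlongrightarrow> 0) net"
  from tendsto_powr_0[OF this, of "1 / p"] show "((\<lambda>k. Lp_norm p (F k)) \<longlongrightarrow> 0) net"
    using assms by (simp add: Lp_norm_def)
qed

lemma Lp_norm_dominated_convergence:
  assumes p: "p > 0" and F: "\<And>k. F k \<in> borel_measurable borel" and w: "integrable lborel w"
    and lim: "AE z in lborel. (\<lambda>k. F k z) \<longlonglongrightarrow> 0"
    and bound: "\<And>k. AE z in lborel. norm (F k z) powr p \<le> w z"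
  shows "(\<lambda>k. Lp_norm p (F k)) \<longlonglongrightarrow> 0"
proof -
  have [measurable]: "\<And>k. F k \<in> borel_measurable borel" using F by auto
  have "(\<lambda>k. \<integral>z. norm (F k z) powr p \<partial>lborel) \<longlonglongrightarrow> (\<integral>z. 0 \<partial>(lborel :: 'a measure))"
  proof (rule integral_dominated_convergence[OF _ _ w])
    show "AE z in lborel. (\<lambda>k. norm (F k z) powr p) \<longlonglongrightarrow> 0"
      using lim by eventually_elim (use p in \<open>auto intro!: tendsto_powr_0 tendsto_norm_zero\<close>)
  qed (use bound in auto)
  then show ?thesis by (subst Lp_norm_tendsto_0_iff[OF p]) simp
qed

subsection \<open>Completeness\<close>

text \<open>
  Along a subsequence with \<open>\<integral>|f\<^sub>k\<^sub>+\<^sub>1 - f\<^sub>k|\<^sup>p \<le> 2\<^sup>-\<^sup>k \<sqdot> 2\<^sup>-\<^sup>k\<^sup>p\<close>, the sum \<open>G\<close> of \<open>2\<^sup>k\<^sup>p |f\<^sub>k\<^sub>+\<^sub>1 - f\<^sub>k|\<^sup>p\<close> is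
  integrable, and \<open>|f\<^sub>k\<^sub>+\<^sub>1 - f\<^sub>k| \<le> 2\<^sup>-\<^sup>k G\<^bsup>1/p\<^esup>\<close> makes \<open>f\<^sub>k\<close> converge almost everywhere and in \<open>L\<^sup>p\<close>.
\<close>

lemma Lp_fast_Cauchy:
  assumes p: "1 < p" and f: "\<And>k. f k \<in> Lp p"
    and fast: "\<And>k. Lp_norm p (\<lambda>z. f (Suc k) z - f k z) powr p \<le> (1/2) ^ k * (1/2) powr (k * p)"
  shows "\<exists>l\<in>Lp p. (\<lambda>k. Lp_norm p (\<lambda>z. f k z - l z)) \<longlonglongrightarrow> 0"
proof -
  have [measurable]: "\<And>k. f k \<in> borel_measurable borel" using f by auto
  define d where "d k z = norm (f (Suc k) z - f k z)" for k z
  have [measurable]: "\<And>k. d k \<in> borel_measurable borel" by (simp add: d_def[abs_def])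
  define G where "G z = (\<Sum>k. ennreal (2 powr (k * p) * d k z powr p))" for z
  have [measurable]: "G \<in> borel_measurable borel" unfolding G_def by measurable
  have dint: "integrable lborel (\<lambda>z. d k z powr p)" for k
    unfolding d_def using Lp_integrable[OF Lp_diff[of p "f (Suc k)" "f k"]] f p by simp
  have "(\<integral>\<^sup>+ z. G z \<partial>lborel) = (\<Sum>k. \<integral>\<^sup>+ z. ennreal (2 powr (k * p) * d k z powr p) \<partial>lborel)"
    unfolding G_def by (rule nn_integral_suminf) measurable
  also have "\<dots> \<le> (\<Sum>k. ennreal ((1/2) ^ k))"
  proof (rule suminf_le)
    fix k
    have "(\<integral>\<^sup>+ z. ennreal (2 powr (k * p) * d k z powr p) \<partial>lborel) = ennreal (\<integral>z. 2 powr (k * p) * d k z powr p \<partial>lborel)"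
      using dint by (intro nn_integral_eq_integral) auto
    also have "(\<integral>z. 2 powr (k * p) * d k z powr p \<partial>lborel) = 2 powr (k * p) * Lp_norm p (\<lambda>z. f (Suc k) z - f k z) powr p"
      using p by (simp add: Lp_norm_powr d_def)
    also have "\<dots> \<le> 2 powr (k * p) * ((1/2) ^ k * (1/2) powr (k * p))"
      using fast by (intro mult_left_mono) auto
    also have "\<dots> = (1/2) ^ k" by (simp add: powr_divide)
    finally show "(\<integral>\<^sup>+ z. ennreal (2 powr (k * p) * d k z powr p) \<partial>lborel) \<le> ennreal ((1/2) ^ k)"
      by (simp add: ennreal_leI)
  qed auto
  also have "\<dots> = ennreal (\<Sum>k. (1/2) ^ k)"
    by (rule suminf_ennreal2) (auto intro: summable_geometric)
  finally have Gfin: "(\<integral>\<^sup>+ z. G z \<partial>lborel) < \<infinity>" by (simp add: le_less_trans)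
  then have AEG: "AE z in lborel. G z \<noteq> \<infinity>" by (intro nn_integral_noteq_infinite) auto
  define g where "g z = enn2real (G z)" for z
  have [measurable]: "g \<in> borel_measurable borel" unfolding g_def by measurable
  have gint: "integrable lborel g"
  proof (rule integrableI_nonneg)
    have "(\<integral>\<^sup>+ z. ennreal (g z) \<partial>lborel) = (\<integral>\<^sup>+ z. G z \<partial>lborel)"
      by (rule nn_integral_cong_AE) (use AEG in \<open>auto simp: g_def less_top\<close>)
    then show "(\<integral>\<^sup>+ z. ennreal (g z) \<partial>lborel) < \<infinity>" using Gfin by simp
  qed (auto simp: g_def)
  have dle: "d k z \<le> (1/2) ^ k * g z powr (1/p)" if "G z \<noteq> \<infinity>" for k z
  proof -
    have "(\<Sum>k\<in>{k}. ennreal (2 powr (real k * p) * d k z powr p)) \<le> G z"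
      unfolding G_def by (rule sum_le_suminf) auto
    then have "ennreal (2 powr (real k * p) * d k z powr p) \<le> G z" by simp
    also have "G z = ennreal (g z)" using that by (simp add: g_def less_top)
    finally have "2 powr (k * p) * d k z powr p \<le> g z" by (simp add: g_def)
    then have "(2 powr (k * p) * d k z powr p) powr (1/p) \<le> g z powr (1/p)"
      using p by (intro powr_mono2) auto
    also have "(2 powr (k * p) * d k z powr p) powr (1/p) = 2 ^ k * d k z"
    proof -
      have "(2 powr (k * p) * d k z powr p) powr (1/p) = (2 powr (k * p)) powr (1/p) * (d k z powr p) powr (1/p)"
        by (rule powr_mult)
      also have "(2 powr (k * p)) powr (1/p) = 2 powr real k" using p by (simp add: powr_powr)
      also have "(d k z powr p) powr (1/p) = d k z" using p by (simp add: powr_powr d_def)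
      finally show ?thesis by (simp add: powr_realpow)
    qed
    finally show ?thesis by (simp add: field_simps power_one_over)
  qed
  have tail: "norm (f (k + j) z - f k z) \<le> 2 * (1/2) ^ k * g z powr (1/p)" if "G z \<noteq> \<infinity>" for k j z
  proof -
    let ?c = "g z powr (1/p)"
    have "norm (f (k + j) z - f k z) \<le> 2 * (1/2) ^ k * ?c - 2 * (1/2) ^ (k + j) * ?c"
    proof (induction j)
      case (Suc j)
      have "norm (f (Suc (k + j)) z - f k z) \<le> d (k + j) z + norm (f (k + j) z - f k z)"
        unfolding d_def using norm_triangle_ineq[of "f (Suc (k + j)) z - f (k + j) z" "f (k + j) z - f k z"] by simp
      then show ?case using Suc dle[OF that, of "k + j"] by simp
    qed simp
    then show ?thesis by (smt (verit) mult_nonneg_nonneg powr_ge_zero zero_le_power zero_le_divide_1_iff)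
  qed
  define l where "l z = (if G z \<noteq> \<infinity> then lim (\<lambda>k. f k z) else 0)" for z
  have [measurable]: "l \<in> borel_measurable borel" unfolding l_def by measurable
  have conv: "(\<lambda>k. f k z) \<longlonglongrightarrow> l z" if "G z \<noteq> \<infinity>" for z
  proof -
    let ?c = "2 * g z powr (1/p)"
    have "(\<lambda>k. ?c * (1/2) ^ k) \<longlonglongrightarrow> ?c * 0" by (intro tendsto_intros LIMSEQ_power_zero) auto
    have "Cauchy (\<lambda>k. f k z)"
    proof (rule CauchyI)
      fix e :: real assume "e > 0"
      have "\<forall>\<^sub>F k in sequentially. ?c * (1/2) ^ k < e / 2"
        using \<open>e > 0\<close> \<open>(\<lambda>k. ?c * (1/2) ^ k) \<longlonglongrightarrow> ?c * 0\<close> by (intro order_tendstoD(2)) auto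
      then obtain M where M: "?c * (1/2) ^ M < e / 2" by (auto simp: eventually_sequentially)
      have "norm (f m z - f n z) < e" if "m \<ge> M" "n \<ge> M" for m n
      proof -
        have "norm (f m z - f M z) < e / 2" "norm (f n z - f M z) < e / 2"
          using tail[OF \<open>G z \<noteq> \<infinity>\<close>, of M "m - M"] tail[OF \<open>G z \<noteq> \<infinity>\<close>, of M "n - M"] M that
          by (auto simp: mult_ac)
        then show ?thesis
          using norm_triangle_ineq4[of "f m z - f M z" "f n z - f M z"] by simp
      qed
      then show "\<exists>M. \<forall>m\<ge>M. \<forall>n\<ge>M. norm (f m z - f n z) < e" by blast
    qed
    then show ?thesis using that by (simp add: l_def Cauchy_convergent_iff convergent_LIMSEQ_iff)
  qed
  have le: "norm (f k z - l z) powr p \<le> 2 powr p * (1/2) powr (k * p) * g z" if "G z \<noteq> \<infinity>" for k z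
  proof -
    have "(\<lambda>j. norm (f (j + k) z - f k z)) \<longlonglongrightarrow> norm (l z - f k z)"
      by (intro tendsto_intros LIMSEQ_ignore_initial_segment conv that)
    then have "norm (l z - f k z) \<le> 2 * (1/2) ^ k * g z powr (1/p)"
      using tail[OF that, of k] by (intro LIMSEQ_le_const2) (auto simp: add.commute)
    then have "norm (f k z - l z) powr p \<le> (2 * (1/2) ^ k * g z powr (1/p)) powr p"
      using p by (intro powr_mono2) (auto simp: norm_minus_commute)
    also have "\<dots> = 2 powr p * ((1/2) ^ k) powr p * (g z powr (1/p)) powr p"
      by (simp only: powr_mult)
    also have "((1/2) ^ k) powr p = ((1/2) powr real k) powr p" by (simp add: powr_realpow)
    also have "\<dots> = (1/2) powr (k * p)" by (simp only: powr_powr)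
    also have "(g z powr (1/p)) powr p = g z" using p by (simp add: powr_powr g_def)
    finally show ?thesis .
  qed
  have dl: "(\<lambda>z. f k z - l z) \<in> Lp p" for k
  proof (rule LpI)
    show "integrable lborel (\<lambda>z. norm (f k z - l z) powr p)"
    proof (rule Bochner_Integration.integrable_bound)
      show "integrable lborel (\<lambda>z. 2 powr p * (1/2) powr (k * p) * g z)" using gint by simp
      show "AE z in lborel. norm (norm (f k z - l z) powr p) \<le> norm (2 powr p * (1/2) powr (k * p) * g z)"
        using AEG by eventually_elim (use le in \<open>auto simp: g_def abs_mult\<close>)
    qed measurable
  qed measurable
  have "l \<in> Lp p" using Lp_diff[OF _ f[of 0] dl[of 0]] p by simp
  moreover have "(\<lambda>k. Lp_norm p (\<lambda>z. f k z - l z)) \<longlonglongrightarrow> 0"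
  proof -
    have le2: "(\<integral>z. norm (f k z - l z) powr p \<partial>lborel) \<le> (1/2) ^ k * (2 powr p * (\<integral>z. g z \<partial>lborel))" for k
    proof -
      have "(1/2) powr (k * p) \<le> (1/2) powr (real k :: real)" using p by (intro powr_mono') (auto simp: mult_le_cancel_left1)
      then have 1: "(1/2) powr (k * p) \<le> (1/2) ^ k" by (simp add: powr_realpow)
      have "(\<integral>z. norm (f k z - l z) powr p \<partial>lborel) \<le> (\<integral>z. 2 powr p * (1/2) powr (k * p) * g z \<partial>lborel)"
        using AEG le gint Lp_integrable[OF dl] by (intro integral_mono_AE) auto
      also have "\<dots> = (1/2) powr (k * p) * (2 powr p * (\<integral>z. g z \<partial>lborel))" by simp
      also have "\<dots> \<le> (1/2) ^ k * (2 powr p * (\<integral>z. g z \<partial>lborel))"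
        using 1 by (intro mult_right_mono) (auto simp: g_def)
      finally show ?thesis .
    qed
    have lim: "(\<lambda>k. (1/2) ^ k * (2 powr p * (\<integral>z. g z \<partial>lborel))) \<longlonglongrightarrow> 0"
      by (rule tendsto_mult_left_zero, rule LIMSEQ_power_zero) simp
    have "(\<lambda>k. \<integral>z. norm (f k z - l z) powr p \<partial>lborel) \<longlonglongrightarrow> 0"
      by (rule tendsto_sandwich[OF _ _ tendsto_const lim]) (use le2 in auto)
    then show ?thesis using p by (subst Lp_norm_tendsto_0_iff) auto
  qed
  ultimately show ?thesis by blast
qed

theorem Lp_complete:
  assumes p: "1 < p" and f: "\<And>k::nat. f k \<in> Lp p"
    and Cauchy: "\<And>e. e > 0 \<Longrightarrow> \<exists>M. \<forall>m\<ge>M. \<forall>n\<ge>M. Lp_norm p (\<lambda>z. f m z - f n z) < e"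
  shows "\<exists>l\<in>Lp p. (\<lambda>k. Lp_norm p (\<lambda>z. f k z - l z)) \<longlonglongrightarrow> 0"
proof -
  \<comment> \<open>The \<open>p\<close>-th root of the bound that \<open>Lp_fast_Cauchy\<close>
    asks of consecutive members.\<close>
  define e where "e k = ((1/2) ^ k * (1/2) powr (k * p)) powr (1 / p)" for k :: nat
  have e: "e k > 0" for k by (simp add: e_def)
  have "\<forall>k. \<exists>M. \<forall>m\<ge>M. \<forall>n\<ge>M. Lp_norm p (\<lambda>z. f m z - f n z) < e k" using Cauchy e by blast
  then obtain M where M: "\<And>k m n. m \<ge> M k \<Longrightarrow> n \<ge> M k \<Longrightarrow> Lp_norm p (\<lambda>z. f m z - f n z) < e k" by metis
  \<comment> \<open>Summing the thresholds makes both \<open>r k\<close> and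
    \<open>r (Suc k)\<close> at least \<open>M k\<close>, whether or not \<open>M\<close> is
    monotone; the summand \<open>k\<close> gives \<open>r k \<ge> k\<close>.\<close>
  define r where "r k = (\<Sum>i\<le>k. M i) + k" for k
  have rM: "r k \<ge> M k" for k
    unfolding r_def using member_le_sum[of k "{..k}" M] by simp
  have rS: "r (Suc k) \<ge> M k" for k
    unfolding r_def using member_le_sum[of k "{..Suc k}" M] by simp
  have rk: "r k \<ge> k" for k by (simp add: r_def)
  have "\<exists>l\<in>Lp p. (\<lambda>k. Lp_norm p (\<lambda>z. f (r k) z - l z)) \<longlonglongrightarrow> 0"
  proof (rule Lp_fast_Cauchy[OF p])
    fix k
    have "Lp_norm p (\<lambda>z. f (r (Suc k)) z - f (r k) z) powr p \<le> e k powr p"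
      using M[OF rS rM, of k] p by (intro powr_mono2) auto
    also have "\<dots> = (1/2) ^ k * (1/2) powr (k * p)" using p by (simp add: e_def powr_powr)
    finally show "Lp_norm p (\<lambda>z. f (r (Suc k)) z - f (r k) z) powr p \<le> (1/2) ^ k * (1/2) powr (k * p)" .
  qed (use f in auto)
  then obtain l where l: "l \<in> Lp p" "(\<lambda>k. Lp_norm p (\<lambda>z. f (r k) z - l z)) \<longlonglongrightarrow> 0" by blast
  have "(\<lambda>k. Lp_norm p (\<lambda>z. f k z - l z)) \<longlonglongrightarrow> 0"
  proof (rule LIMSEQ_I)
    fix s :: real assume s: "s > 0"
    obtain K where K: "\<And>m n. m \<ge> K \<Longrightarrow> n \<ge> K \<Longrightarrow> Lp_norm p (\<lambda>z. f m z - f n z) < s / 2"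
      using Cauchy[of "s / 2"] s by auto
    obtain K' where K': "\<And>k. k \<ge> K' \<Longrightarrow> Lp_norm p (\<lambda>z. f (r k) z - l z) < s / 2"
      using LIMSEQ_D[OF l(2), of "s / 2"] s by auto
    have "Lp_norm p (\<lambda>z. f k z - l z) < s" if "k \<ge> max K K'" for k
      using Lp_norm_triangle[OF p f[of k] f[of "r k"] l(1)] K[of k "r k"] K'[of k] rk[of k] that by simp
    then show "\<exists>no. \<forall>n\<ge>no. norm (Lp_norm p (\<lambda>z. f n z - l z) - 0) < s"
      by (intro exI[of _ "max K K'"]) auto
  qed
  then show ?thesis using l by blast
qed

subsection \<open>Approximation by continuous functions\<close>

lemma lborel_integral_shift:
  fixes f :: "'a::euclidean_space \<Rightarrow> 'b::{banach, second_countable_topology}"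
  assumes [measurable]: "f \<in> borel_measurable borel"
  shows "(\<integral>z. f (a + z) \<partial>lborel) = (\<integral>z. f z \<partial>lborel)"
    and "integrable lborel (\<lambda>z. f (a + z)) \<longleftrightarrow> integrable lborel f"
proof -
  show "(\<integral>z. f (a + z) \<partial>lborel) = (\<integral>z. f z \<partial>lborel)"
    using integral_distr[of "(+) a" lborel borel f] by (simp add: lborel_distr_plus)
  show "integrable lborel (\<lambda>z. f (a + z)) \<longleftrightarrow> integrable lborel f"
    using integrable_distr_eq[of "(+) a" lborel borel f] by (simp add: lborel_distr_plus)
qed

lemma Lp_shift:
  assumes "f \<in> Lp p"
  shows "(\<lambda>z. f (a + z)) \<in> Lp p" "Lp_norm p (\<lambda>z. f (a + z)) = Lp_norm p f"
proof -
  have [measurable]: "f \<in> borel_measurable borel" using assms by auto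
  have m: "(\<lambda>z. norm (f z) powr p) \<in> borel_measurable borel" by measurable
  show "(\<lambda>z. f (a + z)) \<in> Lp p"
    using lborel_integral_shift(2)[OF m, of a] Lp_integrable[OF assms] by (intro LpI) auto
  show "Lp_norm p (\<lambda>z. f (a + z)) = Lp_norm p f"
    using lborel_integral_shift(1)[OF m, of a] by (simp add: Lp_norm_def)
qed

lemma integrable_bounded_support:
  fixes g :: "'a::euclidean_space \<Rightarrow> 'b::{banach, second_countable_topology}"
  assumes [measurable]: "g \<in> borel_measurable borel" and "\<And>z. norm (g z) \<le> M" "\<And>z. norm z > R \<Longrightarrow> g z = 0"
  shows "integrable lborel g"
proof (rule Bochner_Integration.integrable_bound)
  show "integrable lborel (\<lambda>z::'a. M * indicator (cball 0 R) z :: real)"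
    using borel_integrable_compact[of "cball 0 R :: 'a set" "\<lambda>_. M"] by (simp add: mult.commute)
  show "AE z in lborel. norm (g z) \<le> norm (M * indicator (cball 0 R) z :: real)"
  proof (rule AE_I2)
    fix z
    show "norm (g z) \<le> norm (M * indicator (cball 0 R) z :: real)"
      using assms(2)[of z] assms(3)[of z] by (cases "norm z > R") (auto simp: indicator_def)
  qed
qed measurable

lemma Lp_bounded_support:
  assumes [measurable]: "g \<in> borel_measurable borel" and M: "\<And>z. norm (g z) \<le> M" and R: "\<And>z. norm z > R \<Longrightarrow> g z = 0"
    and p: "p > 0"
  shows "g \<in> Lp p"
proof (rule LpI)
  show "integrable lborel (\<lambda>z. norm (g z) powr p)"
    by (rule integrable_bounded_support[where M = "M powr p" and R = R])
      (use M R p in \<open>auto intro!: powr_mono2\<close>)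
qed measurable

lemma Lp_truncate:
  assumes p: "p > 0" and f: "f \<in> Lp p" and e: "e > 0"
  obtains g M where "g \<in> borel_measurable borel" "\<And>z. norm (g z) \<le> M" "\<And>z. norm z > M \<Longrightarrow> g z = 0"
    "M \<ge> 0" "Lp_norm p (\<lambda>z. f z - g z) < e"
proof -
  have [measurable]: "f \<in> borel_measurable borel" using f by auto
  define g where "g n z = (if norm z \<le> real n \<and> norm (f z) \<le> real n then f z else 0)" for n z
  have [measurable]: "g n \<in> borel_measurable borel" for n unfolding g_def[abs_def] by measurable
  have "(\<lambda>n. Lp_norm p (\<lambda>z. f z - g n z)) \<longlonglongrightarrow> 0"
  proof (rule Lp_norm_dominated_convergence[OF p _ Lp_integrable[OF f]])
    show "AE z in lborel. (\<lambda>n. f z - g n z) \<longlonglongrightarrow> 0"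
    proof (rule AE_I2)
      fix z
      obtain N :: nat where N: "max (norm z) (norm (f z)) \<le> real N" using real_arch_simple by blast
      have "\<forall>\<^sub>F n in sequentially. f z - g n z = 0"
        unfolding eventually_sequentially
      proof (intro exI[of _ N] allI impI)
        fix n assume "n \<ge> N"
        then have "real N \<le> real n" by simp
        then show "f z - g n z = 0" using N by (auto simp: g_def)
      qed
      then show "(\<lambda>n. f z - g n z) \<longlonglongrightarrow> 0" by (rule tendsto_eventually)
    qed
    show "AE z in lborel. norm (f z - g n z) powr p \<le> norm (f z) powr p" for n
      by (rule AE_I2) (use p in \<open>auto simp: g_def\<close>)
  qed measurable
  from LIMSEQ_D[OF this e] obtain n where "Lp_norm p (\<lambda>z. f z - g n z) < e" by auto
  then show ?thesis
    by (intro that[of "g n" "real n"]) (auto simp: g_def)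
qed

text \<open>
  The approximants given by \<^const>\<open>measurable_on\<close> converge only almost everywhere; clipping their
  size and their support makes dominated convergence applicable.
\<close>

lemma Lp_dense_continuous:
  assumes p: "1 < p" and f: "f \<in> Lp p" and e: "e > 0"
  obtains g R where "continuous_on UNIV g" "\<And>z. norm z > R \<Longrightarrow> g z = 0" "g \<in> Lp p" "Lp_norm p (\<lambda>z. f z - g z) < e"
proof -
  obtain h M where h: "h \<in> borel_measurable borel" "\<And>z. norm (h z) \<le> M" "\<And>z. norm z > M \<Longrightarrow> h z = 0"
    "M \<ge> 0" "Lp_norm p (\<lambda>z. f z - h z) < e / 2"
    using Lp_truncate[of p f "e / 2"] p f e by auto
  note [measurable] = h(1)
  have "h \<in> borel_measurable lebesgue" by (rule measurable_completion) simp
  then have "h measurable_on UNIV" by (rule lebesgue_measurable_imp_measurable_on) simp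
  then obtain N G where N: "negligible N" and G: "\<And>n. continuous_on UNIV (G n)"
    and lim: "\<And>x. x \<notin> N \<Longrightarrow> (\<lambda>n. G n x) \<longlonglongrightarrow> h x"
    unfolding measurable_on_def by auto
  \<comment> \<open>One more than \<open>M\<close>: the cutoff \<open>\<theta>\<close> can then be 1
    on the support of \<open>h\<close> and vanish beyond \<open>M'\<close>, and the clipping radius
    is positive.\<close>
  define M' where "M' = M + 1"
  have M': "M' > 0" using h(4) by (simp add: M'_def)
  define \<theta> :: "'a \<Rightarrow> real" where "\<theta> z = max 0 (min 1 (M' - norm z))" for z
  have \<theta>: "0 \<le> \<theta> z" "\<theta> z \<le> 1" "norm z \<le> M \<Longrightarrow> \<theta> z = 1" "norm z > M' \<Longrightarrow> \<theta> z = 0" for z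
    by (auto simp: \<theta>_def M'_def)
  \<comment> \<open>Radial retraction onto the disc of radius \<open>M'\<close>. It fixes the values
    of \<open>h\<close>, so by continuity the clipped approximants still converge to
    \<open>h\<close>.\<close>
  define cl :: "complex \<Rightarrow> complex" where "cl w = (1 / max 1 (norm w / M')) *\<^sub>R w" for w
  define k where "k n z = \<theta> z *\<^sub>R cl (G n z)" for n z
  have cl: "norm (cl w) \<le> M'" for w
  proof (cases "norm w \<le> M'")
    case True
    then have "max 1 (norm w / M') = 1" using M' by simp
    then show ?thesis using True by (simp add: cl_def)
  next
    case False
    then have "max 1 (norm w / M') = norm w / M'" using M' by (simp add: max_def)
    then show ?thesis using False M' by (simp add: cl_def field_simps)
  qed
  have cl_id: "cl w = w" if "norm w \<le> M" for w
  proof -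
    have "norm w / M' \<le> 1" using that M' by (simp add: M'_def)
    then show ?thesis by (simp add: cl_def max_def)
  qed
  have contcl: "continuous_on UNIV cl" unfolding cl_def using M' by (intro continuous_intros) auto
  have cont\<theta>: "continuous_on UNIV \<theta>" unfolding \<theta>_def by (intro continuous_intros)
  have contk: "continuous_on UNIV (k n)" for n
    unfolding k_def by (intro continuous_intros cont\<theta> continuous_on_compose2[OF contcl G]) auto
  then have [measurable]: "k n \<in> borel_measurable borel" for n by (rule borel_measurable_continuous_onI)
  have kM: "norm (k n z) \<le> M'" for n z
  proof -
    have "norm (k n z) \<le> 1 * M'" unfolding k_def norm_scaleR using \<theta>[of z] cl[of "G n z"] M' by (intro mult_mono) auto
    then show ?thesis by simp
  qed
  have k0: "k n z = 0" if "norm z > M'" for n z using \<theta>(4)[OF that] by (simp add: k_def)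
  have kLp: "k n \<in> Lp p" for n
    by (rule Lp_bounded_support[where M = M' and R = M']) (use kM k0 p in auto)
  have AElim: "AE z in lborel. (\<lambda>n. k n z - h z) \<longlonglongrightarrow> 0"
  proof -
    have "AE z in lebesgue. z \<notin> N"
      using N by (intro AE_not_in) (simp add: negligible_iff_null_sets)
    then have "AE z in lborel. z \<notin> N" by (simp add: AE_completion_iff)
    then show ?thesis
    proof eventually_elim
      case (elim z)
      have "(\<lambda>n. cl (G n z)) \<longlonglongrightarrow> cl (h z)"
        by (rule continuous_on_tendsto_compose[OF contcl lim[OF elim]]) auto
      then have "(\<lambda>n. k n z) \<longlonglongrightarrow> \<theta> z *\<^sub>R cl (h z)"
        unfolding k_def by (intro tendsto_intros)
      also have "\<theta> z *\<^sub>R cl (h z) = h z"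
        using \<theta>(3)[of z] h(3)[of z] cl_id[OF h(2)[of z]] by (cases "norm z \<le> M") auto
      finally show ?case by (simp add: LIM_zero)
    qed
  qed
  have "(\<lambda>n. Lp_norm p (\<lambda>z. k n z - h z)) \<longlonglongrightarrow> 0"
  proof (rule Lp_norm_dominated_convergence[OF _ _ _ AElim, where w = "\<lambda>z. (2 * M') powr p * indicator (cball 0 M') z"])
    show "integrable lborel (\<lambda>z::'a. (2 * M') powr p * indicator (cball 0 M') z :: real)"
      using borel_integrable_compact[of "cball 0 M' :: 'a set" "\<lambda>_. (2 * M') powr p"] by (simp add: mult.commute)
    show "AE z in lborel. norm (k n z - h z) powr p \<le> (2 * M') powr p * indicator (cball 0 M') z" for n
    proof (rule AE_I2)
      fix z :: 'a
      show "norm (k n z - h z) powr p \<le> (2 * M') powr p * indicator (cball 0 M') z"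
      proof (cases "norm z \<le> M'")
        case True
        have "norm (k n z - h z) \<le> M' + M" using norm_triangle_ineq4[of "k n z" "h z"] kM[of n z] h(2)[of z] by simp
        then have "norm (k n z - h z) \<le> 2 * M'" by (simp add: M'_def)
        then show ?thesis using True p by (auto intro!: powr_mono2)
      next
        case False
        then have "norm z > M" by (simp add: M'_def)
        then show ?thesis using False k0[of z n] h(3)[of z] by simp
      qed
    qed
  qed (use p in auto)
  from LIMSEQ_D[OF this, of "e / 2"] e obtain n where n: "Lp_norm p (\<lambda>z. k n z - h z) < e / 2" by auto
  have hLp: "h \<in> Lp p" by (rule Lp_bounded_support[where M = M and R = M]) (use h p in auto)
  have "Lp_norm p (\<lambda>z. f z - k n z) < e"
    using Lp_norm_triangle[OF p f hLp kLp[of n]] n h(5) Lp_norm_minus_commute[of p h "k n"] by simp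
  then show ?thesis using contk k0 kLp by (intro that[of "k n" M']) auto
qed

lemma Lp_translation_continuous:
  assumes p: "1 < p" and f: "f \<in> Lp p" and e: "e > 0"
  obtains d where "d > 0" "\<And>a. norm a < d \<Longrightarrow> Lp_norm p (\<lambda>z. f (a + z) - f z) < e"
proof -
  obtain g R where g: "continuous_on UNIV g" "\<And>z. norm z > R \<Longrightarrow> g z = 0" "g \<in> Lp p" "Lp_norm p (\<lambda>z. f z - g z) < e / 3"
    using Lp_dense_continuous[of p f "e / 3"] p f e by auto
  define R' where "R' = max R 0 + 1"
  define K :: "'a set" where "K = cball 0 (R' + 1)"
  have "compact K" by (simp add: K_def)
  then have uc: "uniformly_continuous_on K g"
    using g(1) by (intro compact_uniformly_continuous) (auto intro: continuous_on_subset)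
  define \<mu> where "\<mu> = measure lborel (cball 0 R' :: 'a set)"
  \<comment> \<open>A difference bounded by \<open>\<eta>\<close> on a ball of measure
    \<open>\<mu>\<close> and zero elsewhere has norm at most \<open>\<eta> \<mu>^(1/p)\<close>; the
    \<open>+ 1\<close> makes that strictly less than \<open>e / 3\<close>.\<close>
  define \<eta> where "\<eta> = e / (3 * (\<mu> powr (1 / p) + 1))"
  have \<mu>1: "\<mu> powr (1 / p) + 1 > 0" by (simp add: add_nonneg_pos)
  then have \<eta>: "\<eta> > 0" using e by (simp add: \<eta>_def)
  then obtain d where d: "d > 0" "\<And>x y. x \<in> K \<Longrightarrow> y \<in> K \<Longrightarrow> dist y x < d \<Longrightarrow> dist (g y) (g x) < \<eta>"
    using uc unfolding uniformly_continuous_on_def by metis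
  define d' where "d' = min d 1"
  have "Lp_norm p (\<lambda>z. f (a + z) - f z) < e" if a: "norm a < d'" for a
  proof -
    have gm [measurable]: "g \<in> borel_measurable borel" using g(3) by auto
    have pw: "norm (g (a + z) - g z) powr p \<le> \<eta> powr p * indicator (cball 0 R') z" for z
    proof (cases "norm z \<le> R'")
      case True
      have "norm (a + z) \<le> R' + 1" using True a norm_triangle_ineq[of a z] by (simp add: d'_def)
      then have "a + z \<in> K" "z \<in> K" using True by (auto simp: K_def)
      moreover have "dist (a + z) z < d" using a by (simp add: dist_norm d'_def)
      ultimately have "norm (g (a + z) - g z) \<le> \<eta>"
        using d(2)[of z "a + z"] by (simp add: dist_norm)
      then show ?thesis using True p by (auto intro!: powr_mono2)
    next
      case False
      have "norm z \<le> norm (a + z) + norm a" using norm_triangle_ineq4[of "a + z" a] by simp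
      then have "norm (a + z) > R" "norm z > R" using False a by (auto simp: R'_def d'_def)
      then show ?thesis using g(2) by simp
    qed
    have "(\<integral>z. norm (g (a + z) - g z) powr p \<partial>lborel) \<le> (\<integral>z. \<eta> powr p * indicator (cball (0::'a) R') z \<partial>lborel)"
    proof (rule integral_mono)
      show "integrable lborel (\<lambda>z. norm (g (a + z) - g z) powr p)"
        using Lp_diff[OF _ Lp_shift(1)[OF g(3)] g(3), of a] p by (intro Lp_integrable) auto
      show "integrable lborel (\<lambda>z::'a. \<eta> powr p * indicator (cball 0 R') z :: real)"
        using borel_integrable_compact[of "cball 0 R' :: 'a set" "\<lambda>_. \<eta> powr p"] by (simp add: mult.commute)
    qed (rule pw)
    also have "\<dots> = \<eta> powr p * \<mu>" by (simp add: \<mu>_def)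
    also have "\<dots> = (\<eta> * \<mu> powr (1 / p)) powr p" using p by (simp add: powr_mult powr_powr \<mu>_def)
    finally have "Lp_norm p (\<lambda>z. g (a + z) - g z) \<le> \<eta> * \<mu> powr (1 / p)"
      using p \<eta> by (intro Lp_norm_leI) auto
    also have "\<dots> < \<eta> * (\<mu> powr (1 / p) + 1)" using \<eta> by simp
    also have "\<dots> = e / 3" using \<mu>1 by (subst \<eta>_def) (simp add: divide_simps del: distrib_left_numeral)
    finally have 1: "Lp_norm p (\<lambda>z. g (a + z) - g z) < e / 3" .
    have 2: "Lp_norm p (\<lambda>z. f (a + z) - g (a + z)) < e / 3"
      using Lp_shift(2)[OF Lp_diff[of p f g], of a] p f g by simp
    have "Lp_norm p (\<lambda>z. f (a + z) - f z) \<le> Lp_norm p (\<lambda>z. f (a + z) - g (a + z)) + Lp_norm p (\<lambda>z. g (a + z) - f z)"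
      by (intro Lp_norm_triangle p f Lp_shift(1) g)
    also have "Lp_norm p (\<lambda>z. g (a + z) - f z) \<le> Lp_norm p (\<lambda>z. g (a + z) - g z) + Lp_norm p (\<lambda>z. g z - f z)"
      by (intro Lp_norm_triangle p f Lp_shift(1) g)
    finally show ?thesis using 1 2 g(4) Lp_norm_minus_commute[of p g f] by simp
  qed
  then show ?thesis using d(1) by (intro that[of d']) (auto simp: d'_def)
qed

subsection \<open>Duality by projection\<close>

text \<open>The duality map of \<open>L^p\<close>, taken pointwise:
  \<open>Re (dualp p w * h)\<close> is the derivative of \<open>|w|^p / p\<close> in the direction
  \<open>h\<close>. The conjugate is there because the pairing is bilinear. At \<open>w = 0\<close>
  the value is 0, also for \<open>p < 2\<close>.\<close>

definition dualp :: "real \<Rightarrow> complex \<Rightarrow> complex" where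
  "dualp p w = of_real (norm w powr (p - 2)) * cnj w"

lemma norm_dualp: "norm (dualp p w) = norm w powr (p - 1)"
proof (cases "w = 0")
  case False
  have "norm w powr (p - 2) * norm w = norm w powr (p - 2) * norm w powr 1" using False by simp
  also have "\<dots> = norm w powr (p - 1)" by (subst powr_add[symmetric]) simp
  finally show ?thesis by (simp add: dualp_def norm_mult)
qed (simp add: dualp_def)

lemma dualp_mult_self: "dualp p w * w = of_real (norm w powr p)"
proof (cases "w = 0")
  case False
  have "cnj w * w = of_real (norm w ^ 2)" by (metis complex_norm_square mult.commute)
  moreover have "norm w powr (p - 2) * (norm w) ^ 2 = norm w powr (p - 2) * norm w powr 2"
    using False by simp
  moreover have "\<dots> = norm w powr p" by (subst powr_add[symmetric]) simp
  ultimately show ?thesis by (metis dualp_def mult.assoc of_real_mult)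
qed (simp add: dualp_def)

lemma continuous_on_dualp: "1 < p \<Longrightarrow> continuous_on UNIV (dualp p)"
proof (rule continuous_at_imp_continuous_on, rule ballI)
  fix w :: complex assume p: "1 < p"
  show "isCont (dualp p) w"
  proof (cases "w = 0")
    case True
    have "((\<lambda>z. norm z powr (p - 1)) \<longlongrightarrow> 0) (at 0)"
      using p by (intro tendsto_powr_0 tendsto_norm_zero tendsto_ident_at) auto
    then have "(dualp p \<longlongrightarrow> 0) (at 0)"
      by (subst tendsto_norm_zero_iff[symmetric]) (simp add: norm_dualp)
    then show ?thesis using True by (simp add: isCont_def dualp_def[of p 0])
  next
    case False
    then show ?thesis unfolding dualp_def by (intro continuous_intros) auto
  qed
qed

text \<open>Convexity of \<open>|.|^p\<close> in subgradient form; \<open>young_powr\<close> bounds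
  the mixed term \<open>|a|^(p-1) |b|\<close>.\<close>

lemma dualp_gradient_ineq:
  assumes "1 < p"
  shows "norm a powr p + p * Re (dualp p a * (b - a)) \<le> norm b powr p"
proof -
  have "Re (dualp p a * b) \<le> norm (dualp p a * b)" by (rule complex_Re_le_cmod)
  also have "\<dots> = norm a powr (p - 1) * norm b" by (simp add: norm_mult norm_dualp)
  finally have "p * Re (dualp p a * b) \<le> p * (norm a powr (p - 1) * norm b)" using assms by simp
  also have "\<dots> \<le> (p - 1) * norm a powr p + norm b powr p" by (rule young_powr) (use assms in auto)
  finally have "p * Re (dualp p a * b) \<le> (p - 1) * norm a powr p + norm b powr p" .
  moreover have "Re (dualp p a * (b - a)) = Re (dualp p a * b) - norm a powr p"
    unfolding right_diff_distrib dualp_mult_self by simp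
  ultimately have "p * Re (dualp p a * (b - a)) \<le> norm b powr p - norm a powr p"
    by (simp only: right_diff_distrib left_diff_distrib)
  then show ?thesis by linarith
qed

lemma Lp_dualp:
  assumes p: "1 < p" and q: "1 / p + 1 / q = 1" and w: "w \<in> Lp p"
  shows "(\<lambda>z. dualp p (w z)) \<in> Lp q"
proof (rule LpI)
  have [measurable]: "w \<in> borel_measurable borel" using w by auto
  have "dualp p \<in> borel_measurable borel"
    using continuous_on_dualp[OF p] by (rule borel_measurable_continuous_onI)
  then show "(\<lambda>z. dualp p (w z)) \<in> borel_measurable borel" by measurable
  have "(p - 1) * q = p"
  proof -
    have "q \<noteq> 0" using p q by auto
    then show ?thesis using p q by (simp add: field_simps)
  qed
  then show "integrable lborel (\<lambda>z. norm (dualp p (w z)) powr q)"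
    using Lp_integrable[OF w] by (simp add: norm_dualp powr_powr)
qed

text \<open>The mean value theorem on \<open>[a, c]\<close> and \<open>[c, b]\<close> with
  \<open>c\<close> the midpoint: the derivative \<open>p t^(p-1)\<close> is strictly increasing, so
  the second increment is larger. Only derivatives in the open intervals occur, which admits
  \<open>a = 0\<close>.\<close>

lemma powr_strict_midpoint:
  fixes a b p :: real
  assumes p: "1 < p" and a: "0 \<le> a" "a < b"
  shows "((a + b) / 2) powr p < (a powr p + b powr p) / 2"
proof -
  define c where "c = (a + b) / 2"
  have c: "a < c" "c < b" using a by (auto simp: c_def)
  have mvt: "\<exists>\<xi>. x < \<xi> \<and> \<xi> < y \<and> y powr p - x powr p = (y - x) * (p * \<xi> powr (p - 1))" if "0 \<le> x" "x < y" for x y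
  proof -
    have "continuous_on {x..y} (\<lambda>t. t powr p)"
      using that p by (intro continuous_on_powr' continuous_intros) auto
    moreover have "((\<lambda>t. t powr p) has_real_derivative p * \<xi> powr (p - 1)) (at \<xi>)" if "x < \<xi>" "\<xi> < y" for \<xi>
      using that \<open>0 \<le> x\<close> by (auto intro!: derivative_eq_intros)
    ultimately show ?thesis
      using MVT[of x y "\<lambda>t. t powr p"] that by (metis DERIV_unique real_differentiable_def)
  qed
  obtain \<xi> where \<xi>: "a < \<xi>" "\<xi> < c" "c powr p - a powr p = (c - a) * (p * \<xi> powr (p - 1))" using mvt[OF a(1) c(1)] by blast
  obtain \<zeta> where \<zeta>: "c < \<zeta>" "\<zeta> < b" "b powr p - c powr p = (b - c) * (p * \<zeta> powr (p - 1))" using mvt[of c b] a c by auto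
  have eq: "c - a = b - c" by (simp add: c_def field_simps)
  have "\<xi> powr (p - 1) < \<zeta> powr (p - 1)" using \<xi> \<zeta> a p by (intro powr_less_mono2) auto
  then have "(b - c) * (p * \<xi> powr (p - 1)) < (b - c) * (p * \<zeta> powr (p - 1))" using p c by simp
  then have "c powr p - a powr p < b powr p - c powr p" using \<xi>(3) \<zeta>(3) eq by simp
  then show ?thesis by (simp add: c_def)
qed

text \<open>The defect in midpoint convexity of \<open>|.|^p\<close>, homogeneous of degree
  \<open>p\<close> and positive off the diagonal. Its integral is small for two near minimisers
  whose mean cannot fall below the infimum.\<close>

definition midgap :: "real \<Rightarrow> complex \<times> complex \<Rightarrow> real" where
  "midgap p = (\<lambda>(a, b). (norm a powr p + norm b powr p) / 2 - norm ((a + b) / 2) powr p)"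

lemma midgap_nonneg: "1 < p \<Longrightarrow> midgap p (a, b) \<ge> 0"
proof -
  assume p: "1 < p"
  have "norm ((a + b) / 2) powr p \<le> (1/2 * norm a + 1/2 * norm b) powr p"
    using p norm_triangle_ineq[of a b] by (intro powr_mono2) (auto simp: norm_divide)
  also have "\<dots> \<le> 1/2 * norm a powr p + 1/2 * norm b powr p"
    by (rule powr_convex_combination) (use p in auto)
  finally show ?thesis by (simp add: midgap_def)
qed

text \<open>Strictness has two sources: strict convexity of \<open>t^p\<close> when the moduli
  differ, and the strict triangle inequality when they agree but the points do not.\<close>

lemma midgap_pos: "1 < p \<Longrightarrow> a \<noteq> b \<Longrightarrow> midgap p (a, b) > 0"
proof -
  assume p: "1 < p" and ab: "a \<noteq> b"
  have le: "norm ((a + b) / 2) \<le> (norm a + norm b) / 2" using norm_triangle_ineq[of a b] by (simp add: norm_divide)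
  consider "norm a < norm b" | "norm b < norm a" | "norm a = norm b" by linarith
  then show ?thesis
  proof cases
    case 1
    then show ?thesis using powr_strict_midpoint[OF p, of "norm a" "norm b"] powr_mono2[OF _ _ le, of p] p
      by (simp add: midgap_def)
  next
    case 2
    then show ?thesis using powr_strict_midpoint[OF p, of "norm b" "norm a"] powr_mono2[OF _ _ le, of p] p
      by (simp add: midgap_def add.commute)
  next
    case 3
    have "norm (a + b) \<noteq> norm a + norm b"
    proof
      assume "norm (a + b) = norm a + norm b"
      then have "norm a *\<^sub>R b = norm b *\<^sub>R a" by (simp add: norm_triangle_eq)
      then show False using 3 ab by (cases "norm b = 0") auto
    qed
    then have "norm ((a + b) / 2) < norm a" using norm_triangle_ineq[of a b] 3 by (simp add: norm_divide)
    then have "norm ((a + b) / 2) powr p < norm a powr p" using p by (intro powr_less_mono2) auto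
    then show ?thesis using 3 by (simp add: midgap_def)
  qed
qed

text \<open>Uniform convexity in a pointwise form that can be integrated. By homogeneity it suffices
  to treat pairs with \<open>|a|^p + |b|^p = 1\<close>: those with \<open>|a - b|^p < e\<close> are
  absorbed by the first term, and the remaining ones form the compact set \<open>S\<close>, on which
  \<open>midgap\<close> has a positive minimum.\<close>

lemma Lp_uniform_convexity:
  assumes p: "1 < p" and e: "e > 0"
  obtains C where "C \<ge> 0" "\<And>a b. norm (a - b) powr p \<le> e * (norm a powr p + norm b powr p) + C * midgap p (a, b)"
proof -
  define S where "S = {(a::complex, b::complex). norm a powr p + norm b powr p = 1 \<and> norm (a - b) powr p \<ge> e}"
  have "closed {x::complex \<times> complex. norm (fst x) powr p + norm (snd x) powr p = 1}"
    using p by (intro closed_Collect_eq continuous_intros continuous_on_powr') auto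
  moreover have "closed {x::complex \<times> complex. e \<le> norm (fst x - snd x) powr p}"
    using p by (intro closed_Collect_le continuous_intros continuous_on_powr') auto
  ultimately have "closed ({x::complex \<times> complex. norm (fst x) powr p + norm (snd x) powr p = 1} \<inter>
      {x. e \<le> norm (fst x - snd x) powr p})" by (rule closed_Int)
  also have "\<dots> = S" by (auto simp: S_def)
  finally have "closed S" .
  have le1: "t \<le> 1" if "t powr p \<le> 1" for t :: real
  proof (rule ccontr)
    assume "\<not> t \<le> 1"
    then have "1 powr p < t powr p" using p by (intro powr_less_mono2) auto
    then show False using that by simp
  qed
  have S1: "norm a \<le> 1" "norm b \<le> 1" if "(a, b) \<in> S" for a b
    using that le1[of "norm a"] le1[of "norm b"] powr_ge_zero[of "norm a" p] powr_ge_zero[of "norm b" p]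
    unfolding S_def by auto
  have "S \<subseteq> cball 0 1 \<times> cball 0 1" using S1 by auto
  then have "bounded S" by (rule bounded_subset[OF bounded_Times[OF bounded_cball bounded_cball]])
  then have "compact S" using \<open>closed S\<close> compact_eq_bounded_closed by blast
  have contD: "continuous_on S (midgap p)"
    unfolding midgap_def case_prod_unfold using p by (intro continuous_intros continuous_on_powr') auto
  obtain C where C: "C \<ge> 0" "\<And>a b. (a, b) \<in> S \<Longrightarrow> norm (a - b) powr p \<le> C * midgap p (a, b)"
  proof (cases "S = {}")
    case False
    from continuous_attains_inf[OF \<open>compact S\<close> False contD]
    obtain s where s: "s \<in> S" "\<And>x. x \<in> S \<Longrightarrow> midgap p s \<le> midgap p x" by blast
    obtain s1 s2 where s12: "s = (s1, s2)" by (cases s)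
    have "s1 \<noteq> s2" using s(1) e p s12 by (auto simp: S_def)
    then have pos: "midgap p s > 0" using midgap_pos p s12 by simp
    \<comment> \<open>\<open>2^p\<close> bounds \<open>|a - b|^p\<close> on \<open>S\<close>, where
      both moduli are at most 1.\<close>
    show ?thesis
    proof (rule that[of "2 powr p / midgap p s"])
      fix a b assume ab: "(a, b) \<in> S"
      have "norm (a - b) \<le> 2" using S1[OF ab] norm_triangle_ineq4[of a b] by linarith
      then have "norm (a - b) powr p \<le> 2 powr p" using p by (intro powr_mono2) auto
      also have "\<dots> = 2 powr p / midgap p s * midgap p s" using pos by simp
      also have "\<dots> \<le> 2 powr p / midgap p s * midgap p (a, b)" using s(2)[OF ab] pos by (intro mult_left_mono) auto
      finally show "norm (a - b) powr p \<le> 2 powr p / midgap p s * midgap p (a, b)" .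
    qed (use pos in auto)
  qed (use that in auto)
  show ?thesis
  proof (rule that[OF C(1)])
    fix a b :: complex
    define s where "s = norm a powr p + norm b powr p"
    show "norm (a - b) powr p \<le> e * (norm a powr p + norm b powr p) + C * midgap p (a, b)"
    proof (cases "s = 0")
      case True
      then have "a = 0" "b = 0"
        using powr_ge_zero[of "norm a" p] powr_ge_zero[of "norm b" p] by (auto simp: s_def add_nonneg_eq_0_iff)
      then show ?thesis using p by (simp add: midgap_def)
    next
      case False
      have s: "s > 0" using False by (simp add: s_def order_less_le)
      \<comment> \<open>The scaling factor that brings the pair onto the sphere:
        \<open>t^p s = 1\<close>.\<close>
      define t where "t = s powr (- 1 / p)"
      have t: "t > 0" using s by (simp add: t_def)
      have tp: "t powr p * s = 1"
      proof -
        have "t powr p = s powr (- 1 / p * p)" unfolding t_def by (rule powr_powr)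
        also have "- 1 / p * p = - 1" using p by simp
        finally show ?thesis using s by (simp add: powr_minus)
      qed
      have sc: "norm (t *\<^sub>R x) powr p = t powr p * norm x powr p" for x :: complex
        using t by (simp add: powr_mult)
      have gap: "midgap p (t *\<^sub>R a, t *\<^sub>R b) = t powr p * midgap p (a, b)"
      proof -
        have "(t *\<^sub>R a + t *\<^sub>R b) / 2 = t *\<^sub>R ((a + b) / 2)" by (simp add: scaleR_conv_of_real algebra_simps)
        then show ?thesis unfolding midgap_def prod.case by (simp only: sc right_diff_distrib distrib_left times_divide_eq_right)
      qed
      have nd: "norm (t *\<^sub>R a - t *\<^sub>R b) powr p = t powr p * norm (a - b) powr p"
        using sc[of "a - b"] by (simp add: scaleR_diff_right)
      have "t powr p * norm (a - b) powr p \<le> t powr p * (e * s + C * midgap p (a, b))"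
      proof (cases "norm (t *\<^sub>R a - t *\<^sub>R b) powr p \<ge> e")
        case True
        have "t powr p * norm a powr p + t powr p * norm b powr p = 1"
          using tp by (simp add: s_def algebra_simps)
        then have "(t *\<^sub>R a, t *\<^sub>R b) \<in> S" using True by (simp only: S_def mem_Collect_eq prod.case sc)
        from C(2)[OF this] have "t powr p * norm (a - b) powr p \<le> C * (t powr p * midgap p (a, b))"
          by (simp only: nd gap)
        also have "\<dots> \<le> t powr p * (e * s + C * midgap p (a, b))" using e s by (simp add: algebra_simps)
        finally show ?thesis .
      next
        case False
        then have "t powr p * norm (a - b) powr p \<le> e" by (simp only: nd not_le less_imp_le)
        also have "\<dots> = t powr p * (e * s)" using tp by (simp add: algebra_simps)
        also have "\<dots> \<le> t powr p * (e * s + C * midgap p (a, b))"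
          using C(1) midgap_nonneg[OF p, of a b] by (intro mult_left_mono) auto
        finally show ?thesis .
      qed
      then show ?thesis using t unfolding s_def[symmetric] by simp
    qed
  qed
qed


text \<open>Best approximation from the subspace \<open>R\<close>, which need not be closed; hence a
  minimising sequence \<open>r k\<close> in \<open>R\<close> is returned together with the limit
  \<open>w\<close> of the residuals \<open>f - r k\<close>. Uniform convexity makes the residuals
  Cauchy, and minimality of \<open>w\<close> under perturbation by \<open>R\<close> gives the
  orthogonality relation, the Euler equation of the problem.\<close>

lemma Lp_projection:
  assumes p: "1 < p" and f: "f \<in> Lp p" and R: "R \<subseteq> Lp p" "R \<noteq> {}"
    and add: "\<And>r s. r \<in> R \<Longrightarrow> s \<in> R \<Longrightarrow> (\<lambda>z. r z + s z) \<in> R"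
    and cmult: "\<And>r c. r \<in> R \<Longrightarrow> (\<lambda>z. c * r z) \<in> R"
  obtains r w where "\<And>k. r k \<in> R" "w \<in> Lp p" "(\<lambda>k. Lp_norm p (\<lambda>z. (f z - r k z) - w z)) \<longlonglongrightarrow> 0"
    "\<And>s. s \<in> R \<Longrightarrow> (\<integral>z. dualp p (w z) * s z \<partial>lborel) = 0"
proof -
  define F where "F g = (\<integral>z. norm (g z) powr p \<partial>lborel)" for g :: "'a \<Rightarrow> complex"
  have F0: "F g \<ge> 0" for g by (simp add: F_def)
  define D where "D = (\<lambda>r. F (\<lambda>z. f z - r z)) ` R"
  define d where "d = Inf D"
  have D: "D \<noteq> {}" "bdd_below D" using R F0 by (auto simp: D_def intro!: bdd_belowI[of _ 0])
  have d_le: "d \<le> F (\<lambda>z. f z - r z)" if "r \<in> R" for r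
    unfolding d_def using D(2) that by (intro cInf_lower) (auto simp: D_def)
  have "\<exists>r\<in>R. F (\<lambda>z. f z - r z) < d + 1 / Suc k" for k
  proof -
    have "Inf D < d + 1 / Suc k" by (simp add: d_def)
    then obtain x where "x \<in> D" "x < d + 1 / Suc k" using D cInf_less_iff by metis
    then show ?thesis by (auto simp: D_def)
  qed
  then obtain r where r: "\<And>k. r k \<in> R" "\<And>k. F (\<lambda>z. f z - r k z) < d + 1 / Suc k" by metis
  have rLp: "r k \<in> Lp p" for k using r R by auto
  define v where "v k z = f z - r k z" for k z
  have v: "v k \<in> Lp p" for k unfolding v_def[abs_def] using p f rLp by (intro Lp_diff) auto
  have Fv: "F (v k) < d + 1 / Suc k" for k using r(2) by (simp add: v_def[abs_def])
  have Cauchy: "\<exists>M. \<forall>m\<ge>M. \<forall>n\<ge>M. Lp_norm p (\<lambda>z. v m z - v n z) < e" if e: "e > 0" for e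
  proof -
    have d0: "d \<ge> 0" unfolding d_def using D F0 by (intro cInf_greatest) (auto simp: D_def)
    \<comment> \<open>Both energies are at most \<open>d + 1\<close>, so the first term of the
      convexity bound is then at most \<open>e^p / 2\<close>; the choice of \<open>M\<close> keeps
      the second below \<open>e^p / 2\<close>.\<close>
    define \<epsilon> where "\<epsilon> = e powr p / (4 * (d + 1))"
    have \<epsilon>: "\<epsilon> > 0" using e d0 by (simp add: \<epsilon>_def)
    obtain C where C: "C \<ge> 0" "\<And>a b. norm (a - b) powr p \<le> \<epsilon> * (norm a powr p + norm b powr p) + C * midgap p (a, b)"
      using Lp_uniform_convexity[OF p \<epsilon>] by blast
    obtain M :: nat where M: "2 * C / e powr p < M" using reals_Archimedean2 by blast
    have "Lp_norm p (\<lambda>z. v m z - v n z) < e" if mn: "m \<ge> M" "n \<ge> M" for m n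
    proof -
      have i1: "integrable lborel (\<lambda>z. norm (v m z) powr p)" "integrable lborel (\<lambda>z. norm (v n z) powr p)"
        using v Lp_integrable by auto
      have half: "(\<lambda>z. (v m z + v n z) / 2) \<in> Lp p"
        using Lp_cmult[OF Lp_add[of p "v m" "v n"], of "1/2"] v p by simp
      \<comment> \<open>The mean of two residuals is the residual of an element of \<open>R\<close>,
        so its energy is at least \<open>d\<close>.\<close>
      have "(\<lambda>z. (1/2) * (r m z + r n z)) \<in> R" using r add cmult by blast
      from d_le[OF this] have half_d: "d \<le> F (\<lambda>z. (v m z + v n z) / 2)"
        by (simp add: v_def field_simps)
      have "F (\<lambda>z. v m z - v n z) \<le> (\<integral>z. \<epsilon> * (norm (v m z) powr p + norm (v n z) powr p) +
         C * ((norm (v m z) powr p + norm (v n z) powr p) / 2 - norm ((v m z + v n z) / 2) powr p) \<partial>lborel)"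
        unfolding F_def
      proof (rule integral_mono)
        show "integrable lborel (\<lambda>z. norm (v m z - v n z) powr p)"
          by (intro Lp_integrable Lp_diff v) (use p in auto)
        show "integrable lborel (\<lambda>z. \<epsilon> * (norm (v m z) powr p + norm (v n z) powr p) +
         C * ((norm (v m z) powr p + norm (v n z) powr p) / 2 - norm ((v m z + v n z) / 2) powr p))"
          using i1 Lp_integrable[OF half] by auto
        show "norm (v m z - v n z) powr p \<le> \<epsilon> * (norm (v m z) powr p + norm (v n z) powr p) +
         C * ((norm (v m z) powr p + norm (v n z) powr p) / 2 - norm ((v m z + v n z) / 2) powr p)" for z
          using C(2)[of "v m z" "v n z"] by (simp add: midgap_def)
      qed
      also have "\<dots> = \<epsilon> * (F (v m) + F (v n)) + C * ((F (v m) + F (v n)) / 2 - F (\<lambda>z. (v m z + v n z) / 2))"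
        unfolding F_def using i1 Lp_integrable[OF half] by simp
      also have "\<dots> \<le> \<epsilon> * (2 * (d + 1)) + C * (1 / Suc M)"
      proof (intro add_mono mult_left_mono)
        have "F (v k) \<le> d + 1" for k
          by (rule order_trans[OF less_imp_le[OF Fv]]) simp
        from this[of m] this[of n] show "F (v m) + F (v n) \<le> 2 * (d + 1)" by simp
        have "F (v k) \<le> d + 1 / Suc M" if "k \<ge> M" for k
          by (rule order_trans[OF less_imp_le[OF Fv]]) (use that in \<open>auto intro!: divide_left_mono\<close>)
        note FM = this
        have aux: "(x + y) / 2 - z \<le> \<delta>" if "x \<le> d + \<delta>" "y \<le> d + \<delta>" "d \<le> z" for x y z \<delta> :: real
          using that by (simp add: field_simps)
        show "(F (v m) + F (v n)) / 2 - F (\<lambda>z. (v m z + v n z) / 2) \<le> 1 / Suc M"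
          by (rule aux[OF FM[OF mn(1)] FM[OF mn(2)] half_d])
      qed (use \<epsilon> C in auto)
      also have "\<dots> < e powr p"
      proof -
        have "\<epsilon> * (2 * (d + 1)) = e powr p / 2" using d0 by (simp add: \<epsilon>_def field_simps)
        moreover have "C * (1 / Suc M) < e powr p / 2"
        proof -
          have "2 * C < M * e powr p" using M e by (simp add: field_simps)
          also have "\<dots> \<le> Suc M * e powr p" by (intro mult_right_mono) auto
          finally show ?thesis by (simp add: field_simps)
        qed
        ultimately show ?thesis by linarith
      qed
      finally have "Lp_norm p (\<lambda>z. v m z - v n z) powr p < e powr p"
        using p by (simp add: Lp_norm_powr F_def)
      then show ?thesis using e p powr_mono2[of p e "Lp_norm p (\<lambda>z. v m z - v n z)"] by linarith
    qed
    then show ?thesis by blast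
  qed
  obtain w where w: "w \<in> Lp p" "(\<lambda>k. Lp_norm p (\<lambda>z. v k z - w z)) \<longlonglongrightarrow> 0"
    using Lp_complete[OF p v Cauchy] by blast
  have Fpow: "F g = Lp_norm p g powr p" for g using p by (simp add: F_def Lp_norm_powr)
  have F_lim: "(\<lambda>k. F (\<lambda>z. v k z - s z)) \<longlonglongrightarrow> F (\<lambda>z. w z - s z)" if s: "s \<in> Lp p" for s
  proof -
    have "(\<lambda>k. Lp_norm p (\<lambda>z. v k z - s z)) \<longlonglongrightarrow> Lp_norm p (\<lambda>z. w z - s z)"
      using w s v p by (intro Lp_norm_tendsto Lp_diff) auto
    then show ?thesis unfolding Fpow using p by (intro tendsto_powr2) auto
  qed
  have "F w \<le> d"
  proof (rule LIMSEQ_le)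
    show "(\<lambda>k. F (v k)) \<longlonglongrightarrow> F w" using F_lim[OF Lp_zero] by simp
    have "(\<lambda>k. d + 1 / Suc k) \<longlonglongrightarrow> d + 0"
      by (intro tendsto_intros) (use LIMSEQ_inverse_real_of_nat in \<open>simp add: inverse_eq_divide\<close>)
    then show "(\<lambda>k. d + 1 / Suc k) \<longlonglongrightarrow> d" by simp
    show "\<exists>N. \<forall>n\<ge>N. F (v n) \<le> d + 1 / Suc n" using Fv by (auto intro: less_imp_le)
  qed
  have d_le_w: "d \<le> F (\<lambda>z. w z - s z)" if "s \<in> R" for s
  proof (rule LIMSEQ_le_const[OF F_lim])
    have "d \<le> F (\<lambda>z. v k z - s z)" for k
      using d_le[OF add[OF r(1)[of k] that]] by (simp add: v_def algebra_simps)
    then show "\<exists>N. \<forall>n\<ge>N. d \<le> F (\<lambda>z. v n z - s z)" by blast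
  qed (use that R in auto)
  have Re_nonneg: "Re (\<integral>z. dualp p (w z) * s z \<partial>lborel) \<ge> 0" if s: "s \<in> R" for s
  proof -
    have sLp: "s \<in> Lp p" using s R by auto
    have [measurable]: "w \<in> borel_measurable borel" "s \<in> borel_measurable borel" using w sLp by auto
    have [measurable]: "dualp p \<in> borel_measurable borel"
      using continuous_on_dualp[OF p] by (rule borel_measurable_continuous_onI)
    \<comment> \<open>One-sided variation along \<open>a k = w + t k * s\<close>. The subgradient
      inequality at the perturbed point \<open>a k\<close>, compared with
      \<open>F w \<le> F (a k)\<close>, gives the sign for each \<open>k\<close>. As
      \<open>t k\<close> tends to 0 only a limit of integrands dominated by \<open>u\<close> has to
      be taken.\<close>
    define t where "t k = 1 / real (Suc k)" for k
    have t: "t k > 0" "t k \<le> 1" for k by (auto simp: t_def)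
    have tlim: "t \<longlonglongrightarrow> 0" using LIMSEQ_inverse_real_of_nat by (simp add: t_def[abs_def] inverse_eq_divide)
    define a where "a k z = w z + of_real (t k) * s z" for k z
    have aLp: "a k \<in> Lp p" for k unfolding a_def[abs_def] using w sLp p by (intro Lp_add Lp_cmult) auto
    have [measurable]: "a k \<in> borel_measurable borel" for k using aLp by auto
    define u where "u = (\<lambda>z. (norm (w z) + norm (s z)) powr p)"
    have u: "integrable lborel u"
    proof -
      have 1: "(\<lambda>z. of_real (norm (w z)) :: complex) \<in> Lp p" "(\<lambda>z. of_real (norm (s z)) :: complex) \<in> Lp p"
        using Lp_integrable[OF w(1)] Lp_integrable[OF sLp] by (auto intro!: LpI)
      have "integrable lborel (\<lambda>z. norm (of_real (norm (w z)) + of_real (norm (s z)) :: complex) powr p)"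
        using 1 p by (intro Lp_integrable Lp_add) auto
      moreover have "norm (of_real (norm (w z)) + of_real (norm (s z)) :: complex) = norm (w z) + norm (s z)" for z
        by (metis abs_of_nonneg add_nonneg_nonneg norm_ge_zero norm_of_real of_real_add)
      ultimately show ?thesis by (simp add: u_def)
    qed
    have bound: "norm (dualp p (a k z) * s z) \<le> u z" for k z
    proof -
      have "norm (a k z) \<le> norm (w z) + norm (s z)"
      proof -
        have "norm (a k z) \<le> norm (w z) + norm (of_real (t k) * s z)" unfolding a_def by (rule norm_triangle_ineq)
        also have "norm (of_real (t k) * s z) \<le> 1 * norm (s z)" using t[of k] unfolding norm_mult
          by (intro mult_right_mono) auto
        finally show ?thesis by simp
      qed
      then have "norm (dualp p (a k z)) \<le> (norm (w z) + norm (s z)) powr (p - 1)"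
        unfolding norm_dualp using p by (intro powr_mono2) auto
      then have "norm (dualp p (a k z) * s z) \<le> (norm (w z) + norm (s z)) powr (p - 1) * (norm (w z) + norm (s z))"
        unfolding norm_mult by (intro mult_mono) auto
      also have "\<dots> = u z"
        by (cases "norm (w z) + norm (s z) = 0") (auto simp: u_def powr_diff)
      finally show ?thesis .
    qed
    have lim: "(\<lambda>k. \<integral>z. dualp p (a k z) * s z \<partial>lborel) \<longlonglongrightarrow> (\<integral>z. dualp p (w z) * s z \<partial>lborel)"
    proof (rule integral_dominated_convergence[OF _ _ u])
      show "AE z in lborel. (\<lambda>k. dualp p (a k z) * s z) \<longlonglongrightarrow> dualp p (w z) * s z"
      proof (rule AE_I2)
        fix z
        have "(\<lambda>k. a k z) \<longlonglongrightarrow> w z + of_real 0 * s z" unfolding a_def by (intro tendsto_intros tlim)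
        then have "(\<lambda>k. a k z) \<longlonglongrightarrow> w z" by simp
        then have "(\<lambda>k. dualp p (a k z)) \<longlonglongrightarrow> dualp p (w z)"
          by (rule continuous_on_tendsto_compose[OF continuous_on_dualp[OF p]]) auto
        then show "(\<lambda>k. dualp p (a k z) * s z) \<longlonglongrightarrow> dualp p (w z) * s z" by (intro tendsto_intros)
      qed
    qed (use bound in auto)
    have nonneg: "Re (\<integral>z. dualp p (a k z) * s z \<partial>lborel) \<ge> 0" for k
    proof -
      have int: "integrable lborel (\<lambda>z. dualp p (a k z) * s z)"
        by (rule Bochner_Integration.integrable_bound[OF u]) (use bound in \<open>auto simp: u_def\<close>)
      have "F w \<le> F (a k)"
      proof -
        have "(\<lambda>z. - of_real (t k) * s z) \<in> R" by (rule cmult[OF s])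
        from d_le_w[OF this] show ?thesis using \<open>F w \<le> d\<close> by (simp add: a_def[abs_def])
      qed
      have "(\<integral>z. norm (a k z) powr p - p * t k * Re (dualp p (a k z) * s z) \<partial>lborel) \<le> F w"
        unfolding F_def
      proof (rule integral_mono)
        fix z
        have "dualp p (a k z) * (w z - a k z) = of_real (- t k) * (dualp p (a k z) * s z)" by (simp add: a_def algebra_simps)
        then have "Re (dualp p (a k z) * (w z - a k z)) = - t k * Re (dualp p (a k z) * s z)"
          by (simp del: times_complex.sel) (simp add: algebra_simps)
        then show "norm (a k z) powr p - p * t k * Re (dualp p (a k z) * s z) \<le> norm (w z) powr p"
          using dualp_gradient_ineq[OF p, of "a k z" "w z"] by simp
      qed (use int Lp_integrable[OF aLp] Lp_integrable[OF w(1)] in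
          \<open>auto intro!: Bochner_Integration.integrable_diff integrable_mult_right integrable_Re simp del: times_complex.sel\<close>)
      also have "(\<integral>z. norm (a k z) powr p - p * t k * Re (dualp p (a k z) * s z) \<partial>lborel) =
         F (a k) - p * t k * Re (\<integral>z. dualp p (a k z) * s z \<partial>lborel)"
        unfolding F_def integral_Re[OF int, symmetric] using integrable_Re[OF int] Lp_integrable[OF aLp]
        by (simp del: times_complex.sel)
      finally have "0 \<le> p * t k * Re (\<integral>z. dualp p (a k z) * s z \<partial>lborel)" using \<open>F w \<le> F (a k)\<close> by simp
      moreover have "p * t k > 0" using p t[of k] by simp
      ultimately show ?thesis by (simp only: zero_le_mult_iff) linarith
    qed
    show ?thesis by (rule LIMSEQ_le_const[OF tendsto_Re[OF lim]]) (use nonneg in auto)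
  qed
  have "(\<integral>z. dualp p (w z) * s z \<partial>lborel) = 0" if s: "s \<in> R" for s
  proof -
    let ?I = "\<integral>z. dualp p (w z) * s z \<partial>lborel"
    have "Re (c * ?I) \<ge> 0" for c
    proof -
      have "(\<integral>z. dualp p (w z) * (c * s z) \<partial>lborel) = c * ?I"
        by (subst integral_mult_right_zero[symmetric]) (simp add: mult_ac)
      then show ?thesis using Re_nonneg[OF cmult[OF s, of c]] by simp
    qed
    \<comment> \<open>The four directions 1, -1, i and -i determine both parts of the
      integral.\<close>
    from this[of 1] this[of "-1"] this[of \<i>] this[of "-\<i>"] show ?thesis by (simp add: complex_eq_iff)
  qed
  then show ?thesis using r w by (intro that[of r w]) (auto simp: v_def)
qed

section \<open>Smooth functions and mollification\<close>

lemma dir_deriv_eqI: "(f has_derivative D) (at z) \<Longrightarrow> dir_deriv e f z = D e"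
  unfolding dir_deriv_def by (metis frechet_derivative_at)

lemma has_derivative_dir_deriv:
  assumes "f differentiable (at z)"
  shows "(f has_derivative (\<lambda>h. dir_deriv h f z)) (at z)"
  using assms unfolding dir_deriv_def by (simp add: frechet_derivative_works)

lemma has_derivative_Basis:
  assumes "f differentiable (at z)"
  shows "(f has_derivative (\<lambda>h. \<Sum>e\<in>Basis. (h \<bullet> e) *\<^sub>R dir_deriv e f z)) (at z)"
proof -
  have D: "(f has_derivative (\<lambda>h. dir_deriv h f z)) (at z)" by (rule has_derivative_dir_deriv[OF assms])
  then have lin: "linear (\<lambda>h. dir_deriv h f z)" by (rule has_derivative_linear)
  have "dir_deriv h f z = (\<Sum>e\<in>Basis. (h \<bullet> e) *\<^sub>R dir_deriv e f z)" for h
  proof -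
    have "dir_deriv h f z = dir_deriv (\<Sum>e\<in>Basis. (h \<bullet> e) *\<^sub>R e) f z" by (simp only: euclidean_representation)
    also have "\<dots> = (\<Sum>e\<in>Basis. dir_deriv ((h \<bullet> e) *\<^sub>R e) f z)" by (rule linear_sum[OF lin])
    also have "\<dots> = (\<Sum>e\<in>Basis. (h \<bullet> e) *\<^sub>R dir_deriv e f z)" by (simp only: linear_scale[OF lin])
    finally show ?thesis .
  qed
  then have "(\<lambda>h. dir_deriv h f z) = (\<lambda>h. \<Sum>e\<in>Basis. (h \<bullet> e) *\<^sub>R dir_deriv e f z)" by (rule ext)
  then show ?thesis by (rule has_derivative_eq_rhs[OF D])
qed

lemma has_vector_derivative_line:
  assumes "f differentiable (at (z + t *\<^sub>R e))"
  shows "((\<lambda>t. f (z + t *\<^sub>R e)) has_vector_derivative dir_deriv e f (z + t *\<^sub>R e)) (at t)"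
proof -
  have D: "(f has_derivative (\<lambda>h. dir_deriv h f (z + t *\<^sub>R e))) (at (z + t *\<^sub>R e))"
    by (rule has_derivative_dir_deriv[OF assms])
  have "((\<lambda>t. z + t *\<^sub>R e) has_derivative (\<lambda>s. s *\<^sub>R e)) (at t)"
    by (auto intro!: derivative_eq_intros)
  from diff_chain_at[OF this D] have "((\<lambda>t. f (z + t *\<^sub>R e)) has_derivative (\<lambda>s. dir_deriv (s *\<^sub>R e) f (z + t *\<^sub>R e))) (at t)"
    by (simp add: o_def)
  moreover have "dir_deriv (s *\<^sub>R e) f (z + t *\<^sub>R e) = s *\<^sub>R dir_deriv e f (z + t *\<^sub>R e)" for s
    using linear_scale[OF has_derivative_linear[OF D]] by blast
  ultimately show ?thesis by (simp add: has_vector_derivative_def)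
qed

lemma Ck_differentiable: "Ck (Suc k) f \<Longrightarrow> f differentiable (at z)"
  by simp

lemma Ck_continuous: "Ck k f \<Longrightarrow> continuous_on UNIV f"
  by (cases k) (auto intro!: continuous_at_imp_continuous_on differentiable_imp_continuous_within)

lemma Ck_Suc_D: "Ck (Suc k) f \<Longrightarrow> Ck k f"
proof (induction k arbitrary: f)
  case 0
  show ?case using Ck_continuous[OF 0] by simp
qed auto

lemma Ck_linear_comp:
  assumes T: "bounded_linear T" and "Ck k f"
  shows "Ck k (\<lambda>z. T (f z))"
  using assms(2)
proof (induction k arbitrary: f)
  case 0
  then show ?case using bounded_linear.continuous_on[OF T] by auto
next
  case (Suc k)
  have D: "((\<lambda>z. T (f z)) has_derivative (\<lambda>h. T (dir_deriv h f z))) (at z)" for z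
    using bounded_linear.has_derivative[OF T has_derivative_dir_deriv[OF Ck_differentiable[OF Suc.prems]]] .
  then have "dir_deriv e (\<lambda>z. T (f z)) = (\<lambda>z. T (dir_deriv e f z))" for e
    by (intro ext dir_deriv_eqI)
  then show ?case using Suc D by (auto simp: differentiable_def)
qed

lemma dir_deriv_add:
  assumes "f differentiable (at z)" "g differentiable (at z)"
  shows "dir_deriv e (\<lambda>z. f z + g z) z = dir_deriv e f z + dir_deriv e g z"
  by (rule dir_deriv_eqI) (intro has_derivative_add has_derivative_dir_deriv assms)

lemma Ck_add: "Ck k f \<Longrightarrow> Ck k g \<Longrightarrow> Ck k (\<lambda>z. f z + g z)"
proof (induction k arbitrary: f g)
  case 0
  then show ?case by (auto intro: continuous_intros)
next
  case (Suc k)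
  have "dir_deriv e (\<lambda>z. f z + g z) = (\<lambda>z. dir_deriv e f z + dir_deriv e g z)" for e
    using Suc.prems by (intro ext dir_deriv_add) auto
  then show ?case using Suc by (auto intro: differentiable_add)
qed

lemma Ck_const: "Ck k (\<lambda>z::'a::euclidean_space. c)"
proof (induction k arbitrary: c)
  case (Suc k)
  have "dir_deriv e (\<lambda>z. c) = (\<lambda>z. 0)" for e :: 'a
    by (intro ext dir_deriv_eqI) auto
  then show ?case using Suc by simp
qed auto

lemma dir_deriv_mult:
  fixes f :: "'a::euclidean_space \<Rightarrow> 'b::real_normed_vector"
  assumes "a differentiable (at z)" "f differentiable (at z)"
  shows "dir_deriv e (\<lambda>z. a z *\<^sub>R f z) z = a z *\<^sub>R dir_deriv e f z + dir_deriv e a z *\<^sub>R f z"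
  by (rule dir_deriv_eqI) (intro has_derivative_scaleR has_derivative_dir_deriv assms)

lemma Ck_scaleR: "Ck k a \<Longrightarrow> Ck k f \<Longrightarrow> Ck k (\<lambda>z. a z *\<^sub>R f z)"
proof (induction k arbitrary: a f)
  case 0
  then show ?case by (auto intro: continuous_intros)
next
  case (Suc k)
  have "dir_deriv e (\<lambda>z. a z *\<^sub>R f z) = (\<lambda>z. a z *\<^sub>R dir_deriv e f z + dir_deriv e a z *\<^sub>R f z)" for e
    using Suc.prems by (intro ext dir_deriv_mult) auto
  then show ?case
    using Suc.prems Suc.IH Ck_Suc_D[OF Suc.prems(1)] Ck_Suc_D[OF Suc.prems(2)] by (auto intro!: Ck_add)
qed

lemma Ck_inner: "Ck k (\<lambda>z. z \<bullet> e)"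
proof (cases k)
  case (Suc j)
  have D: "((\<lambda>z. z \<bullet> e) has_derivative (\<lambda>h. h \<bullet> e)) (at z)" for z
    by (auto intro!: derivative_eq_intros)
  have "dir_deriv e' (\<lambda>z. z \<bullet> e) = (\<lambda>z. e' \<bullet> e)" for e'
    by (intro ext dir_deriv_eqI D)
  then show ?thesis using Suc differentiableI[OF D] by (simp add: Ck_const)
qed (auto intro!: continuous_intros)

lemma dir_deriv_affine:
  assumes "f differentiable (at (a + c *\<^sub>R z))"
  shows "((\<lambda>z. f (a + c *\<^sub>R z)) has_derivative (\<lambda>h. c *\<^sub>R dir_deriv h f (a + c *\<^sub>R z))) (at z)"
    and "dir_deriv e (\<lambda>z. f (a + c *\<^sub>R z)) z = c *\<^sub>R dir_deriv e f (a + c *\<^sub>R z)"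
proof -
  have D: "(f has_derivative (\<lambda>h. dir_deriv h f (a + c *\<^sub>R z))) (at (a + c *\<^sub>R z))"
    by (rule has_derivative_dir_deriv[OF assms])
  have "((\<lambda>z. a + c *\<^sub>R z) has_derivative (\<lambda>h. c *\<^sub>R h)) (at z)"
    by (auto intro!: derivative_eq_intros)
  from diff_chain_at[OF this D] linear_scale[OF has_derivative_linear[OF D]]
  show "((\<lambda>z. f (a + c *\<^sub>R z)) has_derivative (\<lambda>h. c *\<^sub>R dir_deriv h f (a + c *\<^sub>R z))) (at z)"
    by (simp add: o_def)
  then show "dir_deriv e (\<lambda>z. f (a + c *\<^sub>R z)) z = c *\<^sub>R dir_deriv e f (a + c *\<^sub>R z)" by (rule dir_deriv_eqI)
qed

lemma Ck_affine: "Ck k f \<Longrightarrow> Ck k (\<lambda>z. f (a + c *\<^sub>R z))"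
proof (induction k arbitrary: f)
  case 0
  then show ?case by (auto intro!: continuous_intros continuous_on_compose2[of UNIV f])
next
  case (Suc k)
  have "dir_deriv e (\<lambda>z. f (a + c *\<^sub>R z)) = (\<lambda>z. c *\<^sub>R dir_deriv e f (a + c *\<^sub>R z))" for e
    using Suc.prems by (intro ext dir_deriv_affine) auto
  moreover have "(\<lambda>z. f (a + c *\<^sub>R z)) differentiable (at z)" for z
    using dir_deriv_affine(1)[of f a c z] Suc.prems by (auto simp: differentiable_def)
  ultimately show ?case using Suc by (auto intro!: Ck_linear_comp[OF bounded_linear_scaleR_right])
qed

subsection \<open>Compactly supported functions\<close>

text \<open>Continuity is bundled with vanishing outside a ball: together they give boundedness,
  integrability and membership in every \<open>L^p\<close>, and products with continuous
  coefficients stay in the class.\<close>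

definition csupp :: "('a::euclidean_space \<Rightarrow> 'b::real_normed_vector) \<Rightarrow> bool" where
  "csupp g \<longleftrightarrow> continuous_on UNIV g \<and> (\<exists>R. \<forall>z. norm z > R \<longrightarrow> g z = 0)"

lemma csupp_bounded:
  assumes "csupp g"
  obtains M where "M \<ge> 0" "\<And>z. norm (g z) \<le> M"
proof -
  obtain R where R: "\<And>z. norm z > R \<Longrightarrow> g z = 0" using assms by (auto simp: csupp_def)
  have "compact (g ` cball 0 R)"
    using assms by (intro compact_continuous_image) (auto simp: csupp_def intro: continuous_on_subset)
  then have "bounded (g ` cball 0 R)" by (rule compact_imp_bounded)
  then obtain M where M: "\<And>z. z \<in> cball 0 R \<Longrightarrow> norm (g z) \<le> M"
    unfolding bounded_iff by blast
  show ?thesis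
  proof (rule that[of "max M 0"])
    show "norm (g z) \<le> max M 0" for z
      using M[of z] R[of z] by (cases "norm z \<le> R") auto
  qed simp
qed

lemma csupp_measurable: "csupp g \<Longrightarrow> g \<in> borel_measurable borel"
  by (auto simp: csupp_def intro: borel_measurable_continuous_onI)

lemma csupp_integrable:
  fixes g :: "'a::euclidean_space \<Rightarrow> 'b::{banach, second_countable_topology}"
  assumes "csupp g" shows "integrable lborel g"
proof -
  obtain M where "\<And>z. norm (g z) \<le> M" using csupp_bounded[OF assms] by blast
  moreover obtain R where "\<And>z. norm z > R \<Longrightarrow> g z = 0" using assms by (auto simp: csupp_def)
  ultimately show ?thesis by (intro integrable_bounded_support csupp_measurable assms)
qed

lemma csupp_Lp: "csupp g \<Longrightarrow> p > 0 \<Longrightarrow> g \<in> Lp p"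
proof -
  assume g: "csupp g" and p: "p > 0"
  obtain M where M: "\<And>z. norm (g z) \<le> M" using csupp_bounded[OF g] by blast
  obtain R where R: "\<And>z. norm z > R \<Longrightarrow> g z = 0" using g by (auto simp: csupp_def)
  show "g \<in> Lp p" by (rule Lp_bounded_support[OF csupp_measurable[OF g] M R p])
qed

lemma csupp_dominated: "csupp g \<Longrightarrow> continuous_on UNIV h \<Longrightarrow> (\<And>z. g z = 0 \<Longrightarrow> h z = 0) \<Longrightarrow> csupp h"
  unfolding csupp_def by metis

lemma csupp_scaleR: "continuous_on UNIV a \<Longrightarrow> csupp g \<Longrightarrow> csupp (\<lambda>z. a z *\<^sub>R g z)"
  by (rule csupp_dominated[of g]) (auto simp: csupp_def intro: continuous_intros)

lemma csupp_mult:
  fixes g :: "'a::euclidean_space \<Rightarrow> 'b::real_normed_algebra"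
  shows "continuous_on UNIV a \<Longrightarrow> csupp g \<Longrightarrow> csupp (\<lambda>z. a z * g z)"
  by (rule csupp_dominated[of g]) (auto simp: csupp_def intro: continuous_intros)

lemma csupp_add:
  assumes "csupp f" "csupp g" shows "csupp (\<lambda>z. f z + g z)"
proof -
  obtain R S where "\<And>z. norm z > R \<Longrightarrow> f z = 0" "\<And>z. norm z > S \<Longrightarrow> g z = 0"
    using assms by (auto simp: csupp_def)
  then show ?thesis using assms
    by (auto simp: csupp_def intro!: continuous_intros exI[of _ "max R S"])
qed

lemma csupp_zero: "csupp (\<lambda>z. 0)"
  by (auto simp: csupp_def)

lemma csupp_sum: "(\<And>i. i \<in> I \<Longrightarrow> csupp (f i)) \<Longrightarrow> csupp (\<lambda>z. \<Sum>i\<in>I. f i z)"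
  by (induction I rule: infinite_finite_induct) (auto intro: csupp_add csupp_zero)

lemma csupp_affine:
  assumes g: "csupp g" and c: "c \<noteq> 0"
  shows "csupp (\<lambda>z. g (a + c *\<^sub>R z))"
proof -
  obtain R where R: "\<And>z. norm z > R \<Longrightarrow> g z = 0" using g by (auto simp: csupp_def)
  have "g (a + c *\<^sub>R z) = 0" if "norm z > (R + norm a) / \<bar>c\<bar>" for z
  proof (rule R)
    have "R + norm a < norm (c *\<^sub>R z)" using that c by (simp add: field_simps)
    also have "\<dots> \<le> norm (a + c *\<^sub>R z) + norm a" using norm_triangle_ineq4[of "a + c *\<^sub>R z" a] by simp
    finally show "norm (a + c *\<^sub>R z) > R" by simp
  qed
  moreover have "continuous_on UNIV (\<lambda>z. g (a + c *\<^sub>R z))"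
    using g by (auto simp: csupp_def intro!: continuous_intros continuous_on_compose2[of UNIV g])
  ultimately show ?thesis by (auto simp: csupp_def)
qed

lemma Cc_inf_iff: "\<phi> \<in> Cc_inf \<longleftrightarrow> (\<forall>k. Ck k \<phi>) \<and> csupp \<phi>"
proof -
  have "compact (closure {z. \<phi> z \<noteq> 0}) \<longleftrightarrow> (\<exists>R. \<forall>z. norm z > R \<longrightarrow> \<phi> z = 0)"
  proof
    assume "compact (closure {z. \<phi> z \<noteq> 0})"
    then have "bounded {z. \<phi> z \<noteq> 0}" using compact_imp_bounded bounded_subset closure_subset by metis
    then show "\<exists>R. \<forall>z. norm z > R \<longrightarrow> \<phi> z = 0" unfolding bounded_iff by (metis linorder_not_le mem_Collect_eq)
  next
    assume "\<exists>R. \<forall>z. norm z > R \<longrightarrow> \<phi> z = 0"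
    then have "bounded {z. \<phi> z \<noteq> 0}" unfolding bounded_iff by (metis linorder_not_le mem_Collect_eq)
    then show "compact (closure {z. \<phi> z \<noteq> 0})" by (simp add: compact_eq_bounded_closed bounded_closure)
  qed
  then show ?thesis by (auto simp: Cc_inf_def csupp_def intro: Ck_continuous)
qed

lemma dir_deriv_zero_outside:
  assumes "\<And>z. norm z > R \<Longrightarrow> f z = 0" "norm z > R"
  shows "dir_deriv e f z = 0"
proof -
  have "open {z. norm z > R}" by (intro open_Collect_less continuous_intros)
  then have "(f has_derivative (\<lambda>h. 0)) (at z)"
    by (rule has_derivative_transform_within_open[of "\<lambda>z. 0", rotated]) (use assms in auto)
  then show ?thesis by (rule dir_deriv_eqI)
qed

lemma Cc_inf_dir_deriv: "\<phi> \<in> Cc_inf \<Longrightarrow> e \<in> Basis \<Longrightarrow> dir_deriv e \<phi> \<in> Cc_inf"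
proof -
  assume \<phi>: "\<phi> \<in> Cc_inf" and e: "e \<in> Basis"
  then have k: "Ck (Suc k) \<phi>" for k by (simp only: Cc_inf_iff)
  then have k': "Ck k (dir_deriv e \<phi>)" for k using e by auto
  obtain R where "\<And>z. norm z > R \<Longrightarrow> \<phi> z = 0" using \<phi> by (auto simp: Cc_inf_iff csupp_def)
  then have "\<And>z. norm z > R \<Longrightarrow> dir_deriv e \<phi> z = 0" by (rule dir_deriv_zero_outside)
  then show ?thesis using k' Ck_continuous[OF k'] by (auto simp: Cc_inf_iff csupp_def)
qed

lemma Cc_inf_Ck: "\<phi> \<in> Cc_inf \<Longrightarrow> Ck k \<phi>" and Cc_inf_csupp: "\<phi> \<in> Cc_inf \<Longrightarrow> csupp \<phi>"
  by (auto simp: Cc_inf_iff)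

lemma Cc_inf_differentiable: "\<phi> \<in> Cc_inf \<Longrightarrow> \<phi> differentiable (at z)"
  by (rule Ck_differentiable[OF Cc_inf_Ck])

lemma Cc_inf_add: "\<phi> \<in> Cc_inf \<Longrightarrow> \<psi> \<in> Cc_inf \<Longrightarrow> (\<lambda>z. \<phi> z + \<psi> z) \<in> Cc_inf"
  by (auto simp: Cc_inf_iff intro: Ck_add csupp_add)

lemma Cc_inf_cmult: "\<phi> \<in> Cc_inf \<Longrightarrow> (\<lambda>z. c * \<phi> z) \<in> Cc_inf"
  by (auto simp: Cc_inf_iff intro: Ck_linear_comp[OF bounded_linear_mult_right] csupp_mult continuous_intros)

lemma Cc_inf_affine: "\<phi> \<in> Cc_inf \<Longrightarrow> c \<noteq> 0 \<Longrightarrow> (\<lambda>z. \<phi> (a + c *\<^sub>R z)) \<in> Cc_inf"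
  by (auto simp: Cc_inf_iff intro: Ck_affine csupp_affine)

lemma Cc_inf_Lp: "\<phi> \<in> Cc_inf \<Longrightarrow> p > 0 \<Longrightarrow> \<phi> \<in> Lp p"
  using Cc_inf_csupp csupp_Lp by blast

lemma onorm_Basis_sum:
  fixes c :: "'a::euclidean_space \<Rightarrow> 'b::real_normed_vector" and M :: real
  assumes "\<And>e. e \<in> Basis \<Longrightarrow> norm (c e) \<le> M"
  shows "norm (\<Sum>e\<in>Basis. (h \<bullet> e) *\<^sub>R c e) \<le> (DIM('a) * M) * norm h"
proof -
  have "norm (\<Sum>e\<in>Basis. (h \<bullet> e) *\<^sub>R c e) \<le> (\<Sum>e\<in>(Basis::'a set). norm h * M)"
    using assms Basis_le_norm by (intro sum_norm_le) (auto intro!: mult_mono)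
  then show ?thesis by (simp add: mult_ac)
qed

lemma bounded_derivatives_lipschitz:
  fixes f :: "'a::euclidean_space \<Rightarrow> 'b::real_normed_vector"
  assumes d: "\<And>z. f differentiable (at z)" and bd: "\<And>e. e \<in> Basis \<Longrightarrow> \<exists>M. \<forall>z. norm (dir_deriv e f z) \<le> M"
  obtains L where "L \<ge> 0" "\<And>x y. norm (f x - f y) \<le> L * norm (x - y)"
proof -
  have "\<exists>M\<ge>0. \<forall>z. norm (dir_deriv e f z) \<le> M" if "e \<in> Basis" for e
    using bd[OF that] by (meson norm_ge_zero order_trans)
  then obtain M where M: "\<And>e. e \<in> Basis \<Longrightarrow> M e \<ge> 0" "\<And>e z. e \<in> Basis \<Longrightarrow> norm (dir_deriv e f z) \<le> M e" by metis
  define K where "K = (\<Sum>e\<in>Basis. M e)"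
  have MK: "M e \<le> K" if "e \<in> Basis" for e unfolding K_def using that M(1) by (intro member_le_sum) auto
  have K0: "K \<ge> 0" unfolding K_def using M(1) by (intro sum_nonneg) auto
  have "norm (f x - f y) \<le> DIM('a) * K * norm (x - y)" for x y
  proof (rule differentiable_bound[of UNIV])
    show "(f has_derivative (\<lambda>h. \<Sum>e\<in>Basis. (h \<bullet> e) *\<^sub>R dir_deriv e f z)) (at z within UNIV)" for z
      using has_derivative_Basis[OF d] by simp
    show "onorm (\<lambda>h. \<Sum>e\<in>Basis. (h \<bullet> e) *\<^sub>R dir_deriv e f z) \<le> DIM('a) * K" for z
    proof (rule onorm_le)
      fix h
      show "norm (\<Sum>e\<in>Basis. (h \<bullet> e) *\<^sub>R dir_deriv e f z) \<le> DIM('a) * K * norm h"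
      proof (rule onorm_Basis_sum)
        show "norm (dir_deriv e f z) \<le> K" if "e \<in> Basis" for e
          using M(2)[OF that, of z] MK[OF that] by linarith
      qed
    qed
  qed auto
  then show ?thesis using K0 by (intro that[of "DIM('a) * K"]) auto
qed

text \<open>The mean value inequality applied to the Lipschitz first derivatives. That
  \<open>C\<close> serves all \<open>x\<close> at once is what allows a convolution to be
  differentiated by integrating the Taylor remainder.\<close>

lemma Cc_inf_quadratic:
  fixes \<phi> :: "'a::euclidean_space \<Rightarrow> complex"
  assumes \<phi>: "\<phi> \<in> Cc_inf"
  obtains C where "C \<ge> 0"
    "\<And>x h. norm (\<phi> (x + h) - \<phi> x - (\<Sum>e\<in>Basis. (h \<bullet> e) *\<^sub>R dir_deriv e \<phi> x)) \<le> C * (norm h)\<^sup>2"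
proof -
  have "\<forall>e\<in>Basis. \<exists>L\<ge>0. \<forall>x y. norm (dir_deriv e \<phi> x - dir_deriv e \<phi> y) \<le> L * norm (x - y)"
  proof
    fix e :: 'a assume e: "e \<in> Basis"
    have d: "dir_deriv e \<phi> \<in> Cc_inf" by (rule Cc_inf_dir_deriv[OF \<phi> e])
    show "\<exists>L\<ge>0. \<forall>x y. norm (dir_deriv e \<phi> x - dir_deriv e \<phi> y) \<le> L * norm (x - y)"
    proof (rule bounded_derivatives_lipschitz[OF Cc_inf_differentiable[OF d]])
      show "\<exists>M. \<forall>z. norm (dir_deriv e' (dir_deriv e \<phi>) z) \<le> M" if "e' \<in> Basis" for e'
        by (rule csupp_bounded[OF Cc_inf_csupp[OF Cc_inf_dir_deriv[OF d that]]]) blast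
    qed blast
  qed
  then obtain L where L: "\<And>e. e \<in> Basis \<Longrightarrow> L e \<ge> 0"
    "\<And>e x y. e \<in> Basis \<Longrightarrow> norm (dir_deriv e \<phi> x - dir_deriv e \<phi> y) \<le> L e * norm (x - y)" by metis
  define K where "K = (\<Sum>e\<in>Basis. L e)"
  have LK: "L e \<le> K" if "e \<in> Basis" for e unfolding K_def using that L(1) by (intro member_le_sum) auto
  have K0: "K \<ge> 0" unfolding K_def using L(1) by (intro sum_nonneg) auto
  let ?D = "\<lambda>x h. \<Sum>e\<in>Basis. (h \<bullet> e) *\<^sub>R dir_deriv e \<phi> x"
  have "norm (\<phi> (x + h) - \<phi> x - ?D x h) \<le> DIM('a) * K * (norm h)\<^sup>2" for x h
  proof -
    have "norm (\<phi> (x + h) - \<phi> x - ?D x (x + h - x)) \<le> norm (x + h - x) * (DIM('a) * (K * norm h))"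
    proof (rule differentiable_bound_linearization[where S = "cball x (norm h)"])
      show "x + t *\<^sub>R (x + h - x) \<in> cball x (norm h)" if "t \<in> {0..1}" for t
        using that by (auto simp: dist_norm mult_left_le_one_le)
      show "(\<phi> has_derivative ?D y) (at y within cball x (norm h))" for y
        using has_derivative_Basis[OF Cc_inf_differentiable[OF \<phi>]] by (rule has_derivative_at_withinI)
      show "onorm (?D y - ?D x) \<le> DIM('a) * (K * norm h)" if "y \<in> cball x (norm h)" for y
      proof (rule onorm_le)
        fix k
        have "(?D y - ?D x) k = (\<Sum>e\<in>Basis. (k \<bullet> e) *\<^sub>R (dir_deriv e \<phi> y - dir_deriv e \<phi> x))"
          by (simp add: scaleR_diff_right sum_subtractf)
        also have "norm \<dots> \<le> DIM('a) * (K * norm h) * norm k"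
        proof (rule onorm_Basis_sum)
          fix e :: 'a assume e: "e \<in> Basis"
          have "norm (dir_deriv e \<phi> y - dir_deriv e \<phi> x) \<le> L e * norm (y - x)" by (rule L(2)[OF e])
          also have "\<dots> \<le> K * norm h" using LK[OF e] K0 that by (intro mult_mono) (auto simp: dist_norm norm_minus_commute)
          finally show "norm (dir_deriv e \<phi> y - dir_deriv e \<phi> x) \<le> K * norm h" .
        qed
        finally show "norm ((?D y - ?D x) k) \<le> DIM('a) * (K * norm h) * norm k" .
      qed
    qed auto
    then show ?thesis by (simp add: power2_eq_square mult_ac)
  qed
  then show ?thesis using K0 by (intro that[of "DIM('a) * K"]) auto
qed

subsection \<open>A mollifier\<close>

text \<open>Dividing by powers of \<open>t\<close> makes the span of the family closed under
  differentiation, so that smoothness of \<open>bump j\<close> follows by induction on the order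
  with \<open>j\<close> arbitrary.\<close>

definition bump1 :: "nat \<Rightarrow> real \<Rightarrow> real" where
  "bump1 j t = (if t > 0 then exp (- (1 / t)) / t ^ j else 0)"

lemma bump1_tendsto_0: "(bump1 j \<longlongrightarrow> 0) (at 0)"
proof -
  have "((\<lambda>t. (inverse t) ^ j / exp (inverse t)) \<longlongrightarrow> (0::real)) (at_right 0)"
    by (rule filterlim_compose[OF tendsto_power_div_exp_0 filterlim_inverse_at_top_right])
  moreover have "\<forall>\<^sub>F t in at_right 0. (inverse t) ^ j / exp (inverse t) = bump1 j t"
    using eventually_at_right_less[of "0::real"]
    by eventually_elim (simp add: bump1_def exp_minus field_simps inverse_eq_divide power_one_over)
  ultimately have "(bump1 j \<longlongrightarrow> 0) (at_right 0)" by (rule Lim_transform_eventually)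
  moreover have "(bump1 j \<longlongrightarrow> 0) (at_left 0)"
    by (rule tendsto_eventually) (auto simp: eventually_at_left_field bump1_def intro!: exI[of _ "-1"])
  ultimately show ?thesis by (simp add: filterlim_at_split)
qed

lemma bump1_deriv: "(bump1 j has_real_derivative (bump1 (Suc (Suc j)) t - j * bump1 (Suc j) t)) (at t)"
proof -
  consider "t > 0" | "t < 0" | "t = 0" by linarith
  then show ?thesis
  proof cases
    case 1
    have "((\<lambda>t. exp (- (1 / t)) / t ^ j) has_real_derivative (bump1 (Suc (Suc j)) t - j * bump1 (Suc j) t)) (at t)"
    proof -
      have D1: "((\<lambda>t. exp (- (1 / t))) has_real_derivative exp (- (1 / t)) / t\<^sup>2) (at t)"
        using 1 by (auto intro!: derivative_eq_intros simp: power2_eq_square)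
      have D2: "((\<lambda>t. t ^ j) has_real_derivative j * t ^ (j - 1)) (at t)"
        by (auto intro!: derivative_eq_intros)
      have "(exp (- (1 / t)) / t\<^sup>2 * t ^ j - exp (- (1 / t)) * (j * t ^ (j - 1))) / (t ^ j * t ^ j)
        = bump1 (Suc (Suc j)) t - j * bump1 (Suc j) t"
      proof (cases j)
        case (Suc i)
        have "t ^ i \<noteq> 0" using 1 by simp
        then show ?thesis using 1 Suc by (simp add: bump1_def power2_eq_square divide_simps) (simp add: algebra_simps)
      qed (use 1 in \<open>simp add: bump1_def power2_eq_square\<close>)
      then show ?thesis using DERIV_divide[OF D1 D2] 1 by simp
    qed
    then show ?thesis
      by (rule has_field_derivative_transform_within_open[of _ _ _ "{0<..}"]) (use 1 in \<open>auto simp: bump1_def\<close>)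
  next
    case 2
    have "((\<lambda>t. 0) has_real_derivative 0) (at t)" by simp
    then have "(bump1 j has_real_derivative 0) (at t)"
      by (rule has_field_derivative_transform_within_open[of _ _ _ "{..<0}"]) (use 2 in \<open>auto simp: bump1_def\<close>)
    then show ?thesis using 2 by (simp add: bump1_def)
  next
    case 3
    \<comment> \<open>Away from 0 this difference quotient is \<open>bump1 (Suc j)\<close>, which
      tends to 0.\<close>
    have "((\<lambda>h. (bump1 j (0 + h) - bump1 j 0) / h) \<longlongrightarrow> 0) (at 0)"
      by (rule Lim_transform_eventually[OF bump1_tendsto_0[of "Suc j"]])
        (auto simp: bump1_def eventually_at intro!: exI[of _ 1])
    then show ?thesis using 3 by (simp add: DERIV_def bump1_def)
  qed
qed

definition bump :: "nat \<Rightarrow> 'a::euclidean_space \<Rightarrow> real" where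
  "bump j z = bump1 j (1 - z \<bullet> z)"

lemma bump_Ck: "Ck k (bump j :: 'a::euclidean_space \<Rightarrow> real)"
proof (induction k arbitrary: j)
  case 0
  have "continuous_on UNIV (bump1 j)" using bump1_deriv by (intro DERIV_continuous_on) (auto intro: has_field_derivative_at_within)
  then show ?case unfolding bump_def by (auto intro!: continuous_intros continuous_on_compose2[of UNIV "bump1 j"])
next
  case (Suc k)
  have D: "(bump j has_derivative (\<lambda>h. - 2 * (z \<bullet> h) * (bump (Suc (Suc j)) z - j * bump (Suc j) z))) (at z)" for z :: 'a
  proof -
    have "((\<lambda>z::'a. 1 - z \<bullet> z) has_derivative (\<lambda>h. - 2 * (z \<bullet> h))) (at z)"
      by (auto intro!: derivative_eq_intros simp: inner_commute)
    from diff_chain_at[OF this bump1_deriv[unfolded has_field_derivative_def]]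
    show ?thesis by (simp add: o_def bump_def[abs_def] mult_ac)
  qed
  have "dir_deriv e (bump j) = (\<lambda>z::'a. (z \<bullet> (- 2 *\<^sub>R e)) *\<^sub>R (bump (Suc (Suc j)) z + (- real j) *\<^sub>R bump (Suc j) z))" for e
    by (intro ext, subst dir_deriv_eqI[OF D]) simp
  moreover have "Ck k (\<lambda>z::'a. (z \<bullet> (- 2 *\<^sub>R e)) *\<^sub>R (bump (Suc (Suc j)) z + (- real j) *\<^sub>R bump (Suc j) z))" for e
    by (intro Ck_scaleR Ck_inner Ck_add Suc Ck_const)
  ultimately show ?case using D by (auto simp: differentiable_def)
qed

lemma bump_pos: "norm z < 1 \<Longrightarrow> bump j z > 0" and bump_zero: "norm z \<ge> 1 \<Longrightarrow> bump j z = 0"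
  and bump_nonneg: "bump j z \<ge> 0"
proof -
  have 1: "1 - z \<bullet> z > 0 \<longleftrightarrow> norm z < 1"
    unfolding dot_square_norm using abs_square_less_1[of "norm z"] by simp
  show "norm z < 1 \<Longrightarrow> bump j z > 0" "norm z \<ge> 1 \<Longrightarrow> bump j z = 0" "bump j z \<ge> 0"
    using 1 by (auto simp: bump_def bump1_def)
qed

lemma bump_csupp: "csupp (bump j)"
  using Ck_continuous[OF bump_Ck] bump_zero[OF less_imp_le] by (auto simp: csupp_def intro!: exI[of _ 1])

text \<open>A vanishing integral would make the open unit ball negligible.\<close>

lemma bump_integral_pos: "(\<integral>z. bump 0 z \<partial>(lborel :: 'a::euclidean_space measure)) > 0"
proof -
  have int: "integrable lborel (bump 0 :: 'a \<Rightarrow> real)" by (rule csupp_integrable[OF bump_csupp])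
  have "(\<integral>z. bump 0 z \<partial>(lborel :: 'a measure)) \<noteq> 0"
  proof
    assume "(\<integral>z. bump 0 z \<partial>(lborel :: 'a measure)) = 0"
    then have "AE z in lborel. bump 0 (z::'a) = 0"
      using integral_nonneg_eq_0_iff_AE[OF int] bump_nonneg by auto
    then have "AE z in lborel. (z::'a) \<notin> ball 0 1"
      by eventually_elim (metis bump_pos dist_0_norm mem_ball less_irrefl)
    then have "emeasure lborel (ball (0::'a) 1) = 0"
      by (subst (asm) AE_iff_measurable[of "ball 0 1"]) auto
    then show False using open_not_negligible[of "ball (0::'a) 1"]
      by (auto simp: negligible_iff_null_sets null_sets_def)
  qed
  moreover have "(\<integral>z. bump 0 z \<partial>(lborel :: 'a measure)) \<ge> 0" by (simp add: bump_nonneg)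
  ultimately show ?thesis by linarith
qed

definition rho :: "'a::euclidean_space \<Rightarrow> real" where
  "rho z = bump 0 z / (\<integral>z. bump 0 z \<partial>(lborel :: 'a measure))"

lemma rho_nonneg: "rho z \<ge> 0"
  using bump_integral_pos[where 'a = 'a] bump_nonneg[of 0 z] by (simp add: rho_def less_imp_le)

lemma rho_zero: "norm z \<ge> 1 \<Longrightarrow> rho z = 0"
  by (simp add: rho_def bump_zero)

lemma rho_integral: "(\<integral>z. rho z \<partial>(lborel :: 'a::euclidean_space measure)) = 1"
  using bump_integral_pos[where 'a = 'a] by (simp add: rho_def)

lemma rho_Ck: "Ck k rho"
  using Ck_linear_comp[OF bounded_linear_divide bump_Ck] by (simp add: rho_def[abs_def])

lemma rho_csupp: "csupp rho"
  using Ck_continuous[OF rho_Ck] rho_zero[OF less_imp_le] by (auto simp: csupp_def intro!: exI[of _ 1])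

definition rhoc :: "'a::euclidean_space \<Rightarrow> complex" where
  "rhoc z = of_real (rho z)"

lemma rhoc_Cc_inf: "rhoc \<in> Cc_inf"
proof -
  have *: "Ck k (rhoc :: 'a \<Rightarrow> complex)" for k
    using Ck_linear_comp[OF bounded_linear_of_real rho_Ck] by (simp add: rhoc_def[abs_def])
  then show ?thesis using Ck_continuous[OF *] rho_zero[OF less_imp_le]
    by (auto simp: Cc_inf_iff csupp_def rhoc_def[abs_def] intro!: exI[of _ 1])
qed

text \<open>The approximate identity, of integral one and supported in the ball of radius
  \<open>\<epsilon>\<close>. The summand 0 matches the shape \<open>a + c *\<^sub>R z\<close> of the
  lemmas on affine substitutions.\<close>

definition moll :: "real \<Rightarrow> 'a::euclidean_space \<Rightarrow> complex" where
  "moll \<epsilon> z = of_real ((1 / \<epsilon>) ^ DIM('a)) * rhoc (0 + (1 / \<epsilon>) *\<^sub>R z)"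

lemma moll_Cc_inf: "\<epsilon> > 0 \<Longrightarrow> moll \<epsilon> \<in> Cc_inf"
  unfolding moll_def[abs_def] by (intro Cc_inf_cmult Cc_inf_affine rhoc_Cc_inf) auto

lemma dir_deriv_moll:
  fixes z :: "'a::euclidean_space"
  assumes "\<epsilon> > 0"
  shows "dir_deriv e (moll \<epsilon>) z = of_real ((1 / \<epsilon>) ^ DIM('a) * (1 / \<epsilon>)) * dir_deriv e rhoc ((1 / \<epsilon>) *\<^sub>R z)"
proof -
  have "((\<lambda>z::'a. rhoc (0 + (1 / \<epsilon>) *\<^sub>R z)) has_derivative (\<lambda>h. (1 / \<epsilon>) *\<^sub>R dir_deriv h rhoc (0 + (1 / \<epsilon>) *\<^sub>R z))) (at z)"
    by (rule dir_deriv_affine(1)[OF Cc_inf_differentiable[OF rhoc_Cc_inf]])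
  from has_derivative_mult_right[OF this, of "of_real ((1 / \<epsilon>) ^ DIM('a))"]
  show ?thesis
    by (subst dir_deriv_eqI[of "moll \<epsilon>"]) (auto simp: moll_def[abs_def] scaleR_conv_of_real)
qed


subsection \<open>Convolution with a test function\<close>

lemma Holder_conjugate:
  fixes p :: real
  assumes "1 < p"
  obtains q where "1 < q" "1 / p + 1 / q = 1"
proof (rule that[of "p / (p - 1)"])
  show "1 < p / (p - 1)" "1 / p + 1 / (p / (p - 1)) = 1" using assms by (auto simp: field_simps)
qed

lemma Lp_integrable_csupp:
  assumes p: "1 < p" and f: "f \<in> Lp p" and g: "csupp g"
  shows "integrable lborel (\<lambda>z. f z * g z)"
proof -
  obtain q where q: "1 < q" "1 / p + 1 / q = 1" using Holder_conjugate[OF p] .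
  show ?thesis using Lp_pairing(1)[OF p q(2) f csupp_Lp[OF g]] q by simp
qed

lemma Lp_integrable_on_ball:
  fixes f :: "'a::euclidean_space \<Rightarrow> complex"
  assumes p: "1 < p" and f: "f \<in> Lp p"
  shows "integrable lborel (\<lambda>z. norm (f z) * indicator (cball a R) z)"
proof -
  have [measurable]: "f \<in> borel_measurable borel" using f by auto
  obtain q where q: "1 < q" "1 / p + 1 / q = 1" using Holder_conjugate[OF p] .
  have "(\<lambda>z. indicator (cball a R) z :: complex) \<in> Lp q"
  proof (rule Lp_bounded_support[where M = 1 and R = "norm a + R"])
    fix z :: 'a assume "norm a + R < norm z"
    then have "norm (z - a) > R" using norm_triangle_ineq2[of z a] by linarith
    then show "indicator (cball a R) z = (0 :: complex)" by (auto simp: dist_norm norm_minus_commute)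
  qed (use q in \<open>auto simp: indicator_def\<close>)
  from Lp_Holder(1)[OF p q(2) f this]
  have "integrable lborel (\<lambda>z. norm (f z) * norm (indicator (cball a R) z :: complex))" .
  moreover have "norm (indicator (cball a R) z :: complex) = indicator (cball a R) z" for z
    by (simp add: indicator_def)
  ultimately show ?thesis by simp
qed

text \<open>The argument \<open>z - y\<close> is spelled \<open>z + (-1) *\<^sub>R y\<close> so that
  the lemmas on affine substitutions apply verbatim.\<close>

definition conv :: "('a::euclidean_space \<Rightarrow> complex) \<Rightarrow> ('a \<Rightarrow> complex) \<Rightarrow> 'a \<Rightarrow> complex" where
  "conv f \<phi> z = (\<integral>y. f y * \<phi> (z + (-1) *\<^sub>R y) \<partial>lborel)"

lemma has_derivative_quadratic:
  assumes D: "bounded_linear D" and K: "\<And>h. norm h \<le> 1 \<Longrightarrow> norm (F (z + h) - F z - D h) \<le> K * (norm h)\<^sup>2"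
  shows "(F has_derivative D) (at z)"
  unfolding has_derivative_at
proof
  have "((\<lambda>h. K * norm h) \<longlongrightarrow> K * 0) (at 0)" by (intro tendsto_intros tendsto_norm_zero tendsto_ident_at)
  then have lim: "((\<lambda>h. K * norm h) \<longlongrightarrow> 0) (at 0)" by simp
  show "(\<lambda>h. norm (F (z + h) - F z - D h) / norm h) \<midarrow>0\<rightarrow> 0"
  proof (rule tendsto_sandwich[OF _ _ tendsto_const lim])
    show "\<forall>\<^sub>F h in at 0. norm (F (z + h) - F z - D h) / norm h \<le> K * norm h"
      unfolding eventually_at
    proof (intro exI[of _ 1] conjI ballI impI)
      fix h :: 'a assume h: "h \<noteq> 0 \<and> dist h 0 < 1"
      then have "norm (F (z + h) - F z - D h) \<le> K * norm h * norm h" using K[of h] by (simp add: power2_eq_square mult.assoc)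
      then show "norm (F (z + h) - F z - D h) / norm h \<le> K * norm h" using h by (simp add: divide_le_eq)
    qed simp
  qed auto
qed (rule D)

lemma conv_integrable:
  assumes "1 < p" "f \<in> Lp p" "csupp \<phi>"
  shows "integrable lborel (\<lambda>y. f y * \<phi> (z + (-1) *\<^sub>R y))"
  by (rule Lp_integrable_csupp[OF assms(1,2) csupp_affine[OF assms(3)]]) simp

text \<open>The quadratic Taylor remainder of \<open>\<phi>\<close> is integrated against
  \<open>f\<close>. For \<open>|h| \<le> 1\<close> it vanishes unless \<open>y\<close> is within
  \<open>R + 1\<close> of \<open>z\<close>, and \<open>|f|\<close> is integrable on that ball, so
  the error is a constant times \<open>|h|^2\<close>.\<close>

lemma conv_derivative:
  assumes p: "1 < p" and f: "f \<in> Lp p" and \<phi>: "\<phi> \<in> Cc_inf"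
  shows "(conv f \<phi> has_derivative (\<lambda>h. \<Sum>e\<in>Basis. (h \<bullet> e) *\<^sub>R conv f (dir_deriv e \<phi>) z)) (at z)"
proof -
  have [measurable]: "f \<in> borel_measurable borel" using f by auto
  obtain C where C: "C \<ge> 0"
    "\<And>x h. norm (\<phi> (x + h) - \<phi> x - (\<Sum>e\<in>Basis. (h \<bullet> e) *\<^sub>R dir_deriv e \<phi> x)) \<le> C * (norm h)\<^sup>2"
    using Cc_inf_quadratic[OF \<phi>] by blast
  obtain R where R: "\<And>z. norm z > R \<Longrightarrow> \<phi> z = 0" using Cc_inf_csupp[OF \<phi>] by (auto simp: csupp_def)
  have dR: "dir_deriv e \<phi> z = 0" if "norm z > R" for e z by (rule dir_deriv_zero_outside[OF R that])
  let ?I = "\<integral>y. norm (f y) * indicator (cball z (R + 1)) y \<partial>lborel"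
  show ?thesis
  proof (rule has_derivative_quadratic[where K = "C * ?I"])
    show "bounded_linear (\<lambda>h. \<Sum>e\<in>Basis. (h \<bullet> e) *\<^sub>R conv f (dir_deriv e \<phi>) z)"
      by (intro bounded_linear_sum bounded_linear_scaleR_const bounded_linear_inner_left)
    fix h :: 'a assume h: "norm h \<le> 1"
    define r where "r y = \<phi> (z + h + (-1) *\<^sub>R y) - \<phi> (z + (-1) *\<^sub>R y) - (\<Sum>e\<in>Basis. (h \<bullet> e) *\<^sub>R dir_deriv e \<phi> (z + (-1) *\<^sub>R y))" for y
    have r: "norm (r y) \<le> C * (norm h)\<^sup>2 * indicator (cball z (R + 1)) y" for y
    proof (cases "norm (z - y) \<le> R + 1")
      case True
      have "r y = \<phi> ((z - y) + h) - \<phi> (z - y) - (\<Sum>e\<in>Basis. (h \<bullet> e) *\<^sub>R dir_deriv e \<phi> (z - y))"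
        by (simp add: r_def algebra_simps)
      then show ?thesis using C(2)[of "z - y" h] True by (simp add: dist_norm)
    next
      case False
      have "norm (z - y) \<le> norm (z + h - y) + norm h" using norm_triangle_ineq4[of "z + h - y" h] by (simp add: algebra_simps)
      then have "norm (z + h - y) > R" using False h by linarith
      then have "r y = 0" using False R[of "z + h - y"] R[of "z - y"] dR[of "z - y"] by (simp add: r_def)
      then show ?thesis using C(1) by (simp add: indicator_def)
    qed
    note i = conv_integrable[OF p f]
    have i1: "integrable lborel (\<lambda>y. f y * \<phi> (z + h + (-1) *\<^sub>R y))" "integrable lborel (\<lambda>y. f y * \<phi> (z + (-1) *\<^sub>R y))"
      using Cc_inf_csupp[OF \<phi>] by (intro i; simp)+
    have i2: "integrable lborel (\<lambda>y. f y * dir_deriv e \<phi> (z + (-1) *\<^sub>R y))" if "e \<in> Basis" for e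
      by (rule i[OF Cc_inf_csupp[OF Cc_inf_dir_deriv[OF \<phi> that]]])
    have fr: "f y * r y = f y * \<phi> (z + h + (-1) *\<^sub>R y) - f y * \<phi> (z + (-1) *\<^sub>R y)
      - (\<Sum>e\<in>Basis. (h \<bullet> e) *\<^sub>R (f y * dir_deriv e \<phi> (z + (-1) *\<^sub>R y)))" for y
      by (simp add: r_def right_diff_distrib sum_distrib_left)
    have ir: "integrable lborel (\<lambda>y. f y * r y)"
      unfolding fr by (intro Bochner_Integration.integrable_diff Bochner_Integration.integrable_sum integrable_scaleR_right i1 i2)
    have "conv f \<phi> (z + h) - conv f \<phi> z - (\<Sum>e\<in>Basis. (h \<bullet> e) *\<^sub>R conv f (dir_deriv e \<phi>) z) = (\<integral>y. f y * r y \<partial>lborel)"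
    proof -
      have "(\<integral>y. f y * r y \<partial>lborel) = (\<integral>y. f y * \<phi> (z + h + (-1) *\<^sub>R y) - f y * \<phi> (z + (-1) *\<^sub>R y) \<partial>lborel)
        - (\<integral>y. (\<Sum>e\<in>Basis. (h \<bullet> e) *\<^sub>R (f y * dir_deriv e \<phi> (z + (-1) *\<^sub>R y))) \<partial>lborel)"
        unfolding fr by (intro Bochner_Integration.integral_diff Bochner_Integration.integrable_diff Bochner_Integration.integrable_sum integrable_scaleR_right i1 i2)
      also have "(\<integral>y. f y * \<phi> (z + h + (-1) *\<^sub>R y) - f y * \<phi> (z + (-1) *\<^sub>R y) \<partial>lborel) = conv f \<phi> (z + h) - conv f \<phi> z"
        unfolding conv_def by (rule Bochner_Integration.integral_diff[OF i1])
      also have "(\<integral>y. (\<Sum>e\<in>Basis. (h \<bullet> e) *\<^sub>R (f y * dir_deriv e \<phi> (z + (-1) *\<^sub>R y))) \<partial>lborel)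
         = (\<Sum>e\<in>Basis. \<integral>y. (h \<bullet> e) *\<^sub>R (f y * dir_deriv e \<phi> (z + (-1) *\<^sub>R y)) \<partial>lborel)"
        by (rule Bochner_Integration.integral_sum) (intro integrable_scaleR_right i2)
      also have "\<dots> = (\<Sum>e\<in>Basis. (h \<bullet> e) *\<^sub>R conv f (dir_deriv e \<phi>) z)"
        unfolding conv_def by (rule sum.cong[OF refl]) (rule integral_scaleR_right)
      finally show ?thesis by simp
    qed
    also have "norm \<dots> \<le> (\<integral>y. norm (f y * r y) \<partial>lborel)" by (rule integral_norm_bound)
    also have "\<dots> \<le> (\<integral>y. C * (norm h)\<^sup>2 * (norm (f y) * indicator (cball z (R + 1)) y) \<partial>lborel)"
    proof (rule integral_mono)
      show "integrable lborel (\<lambda>y. norm (f y * r y))" using ir by (rule integrable_norm)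
      show "integrable lborel (\<lambda>y. C * (norm h)\<^sup>2 * (norm (f y) * indicator (cball z (R + 1)) y))"
        by (intro integrable_mult_right Lp_integrable_on_ball[OF p f])
      fix y
      have "norm (f y) * norm (r y) \<le> norm (f y) * (C * (norm h)\<^sup>2 * indicator (cball z (R + 1)) y)"
        by (intro mult_left_mono r) simp
      then show "norm (f y * r y) \<le> C * (norm h)\<^sup>2 * (norm (f y) * indicator (cball z (R + 1)) y)"
        by (simp add: norm_mult mult_ac)
    qed
    also have "\<dots> = C * ?I * (norm h)\<^sup>2" by simp
    finally show "norm (conv f \<phi> (z + h) - conv f \<phi> z - (\<Sum>e\<in>Basis. (h \<bullet> e) *\<^sub>R conv f (dir_deriv e \<phi>) z)) \<le> C * ?I * (norm h)\<^sup>2" .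
  qed
qed

lemma conv_dir_deriv:
  assumes "1 < p" "f \<in> Lp p" "\<phi> \<in> Cc_inf" "e \<in> Basis"
  shows "dir_deriv e (conv f \<phi>) = conv f (dir_deriv e \<phi>)"
proof
  fix z
  have "(\<Sum>e'\<in>Basis. (e \<bullet> e') *\<^sub>R conv f (dir_deriv e' \<phi>) z) = (\<Sum>e'\<in>Basis. if e' = e then conv f (dir_deriv e \<phi>) z else 0)"
    by (rule sum.cong[OF refl]) (use assms(4) in \<open>auto simp: inner_Basis\<close>)
  also have "\<dots> = conv f (dir_deriv e \<phi>) z" using assms(4) by simp
  finally show "dir_deriv e (conv f \<phi>) z = conv f (dir_deriv e \<phi>) z"
    using dir_deriv_eqI[OF conv_derivative[OF assms(1-3)], of e] by simp
qed

lemma conv_Ck: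
  assumes "1 < p" "f \<in> Lp p" "\<phi> \<in> Cc_inf"
  shows "Ck k (conv f \<phi>)"
  using assms(3)
proof (induction k arbitrary: \<phi>)
  case 0
  have "conv f \<phi> differentiable (at z)" for z by (rule differentiableI[OF conv_derivative[OF assms(1,2) 0]])
  then show ?case by (auto intro!: continuous_at_imp_continuous_on differentiable_imp_continuous_within)
next
  case (Suc k)
  have "conv f \<phi> differentiable (at z)" for z by (rule differentiableI[OF conv_derivative[OF assms(1,2) Suc.prems]])
  moreover have "Ck k (dir_deriv e (conv f \<phi>))" if "e \<in> Basis" for e
    using Suc.IH[OF Cc_inf_dir_deriv[OF Suc.prems that]] conv_dir_deriv[OF assms(1,2) Suc.prems that] by simp
  ultimately show ?case by simp
qed

lemma conv_csupp_Cc_inf: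
  fixes g :: "'a::euclidean_space \<Rightarrow> complex" and p :: real
  assumes p: "1 < p" and g: "csupp g" and \<phi>: "\<phi> \<in> Cc_inf"
  shows "conv g \<phi> \<in> Cc_inf"
proof -
  have gp: "g \<in> Lp p" using csupp_Lp[OF g] p by simp
  obtain R where R: "\<And>z. norm z > R \<Longrightarrow> \<phi> z = 0" using Cc_inf_csupp[OF \<phi>] by (auto simp: csupp_def)
  obtain S where S: "\<And>z. norm z > S \<Longrightarrow> g z = 0" using g by (auto simp: csupp_def)
  have "conv g \<phi> z = 0" if z: "norm z > R + S" for z
  proof -
    have "g y * \<phi> (z + (-1) *\<^sub>R y) = 0" for y
    proof (cases "norm y > S")
      case False
      have "norm z \<le> norm (z - y) + norm y" using norm_triangle_ineq[of "z - y" y] by simp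
      then have "norm (z - y) > R" using False z by linarith
      then show ?thesis using R[of "z - y"] by simp
    qed (use S in simp)
    then have "(\<lambda>y. g y * \<phi> (z + (-1) *\<^sub>R y)) = (\<lambda>y. 0)" by (rule ext)
    then show ?thesis unfolding conv_def by (simp only: integral_zero)
  qed
  then have "csupp (conv g \<phi>)" using Ck_continuous[OF conv_Ck[OF p gp \<phi>]] by (auto simp: csupp_def)
  then show ?thesis using conv_Ck[OF p gp \<phi>] by (simp add: Cc_inf_iff)
qed

text \<open>
  Minkowski's integral inequality for a kernel supported in the unit ball: Jensen's inequality in
  the form \<open>p \<mu>\<^bsup>p-1\<^esup> F \<le> (p - 1) \<mu>\<^sup>p + F\<^sup>p\<close> with \<open>\<mu>\<close> the mean of \<open>F\<close>, followed by Tonelli.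
\<close>

lemma Lp_norm_kernel_le:
  fixes F :: "'a::euclidean_space \<Rightarrow> 'a \<Rightarrow> real"
  assumes p: "1 < p" and K: "K > 0" "(\<integral>w. k w \<partial>lborel) = K" and k: "csupp k" "\<And>w. k w \<ge> 0" "\<And>w. norm w > 1 \<Longrightarrow> k w = 0"
    and F: "(\<lambda>(z, w). F z w) \<in> borel_measurable (borel \<Otimes>\<^sub>M borel)" "\<And>z w. F z w \<ge> 0"
    and Fint: "\<And>w. norm w \<le> 1 \<Longrightarrow> integrable lborel (\<lambda>z. F z w powr p)"
    and Fle: "\<And>w. norm w \<le> 1 \<Longrightarrow> (\<integral>z. F z w powr p \<partial>lborel) \<le> \<delta> powr p" and \<delta>: "\<delta> \<ge> 0"
    and g: "g \<in> borel_measurable borel" "\<And>z. norm (g z) \<le> (\<integral>w. F z w * k w \<partial>lborel)"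
  shows "g \<in> Lp p" "Lp_norm p g \<le> K * \<delta>"
proof -
  note [measurable] = g(1) F(1)
  have [measurable]: "k \<in> borel_measurable borel" by (rule csupp_measurable[OF k(1)])
  have [measurable]: "(\<lambda>w. F z w) \<in> borel_measurable borel" for z
    using measurable_compose[OF measurable_Pair1' F(1), of z] by simp
  have kint: "integrable lborel k" by (rule csupp_integrable[OF k(1)])
  have pw: "ennreal (norm (g z) powr p) \<le> (\<integral>\<^sup>+ w. ennreal (K powr (p - 1)) * ennreal (k w * F z w powr p) \<partial>lborel)" for z
  proof (cases "integrable lborel (\<lambda>w. F z w * k w) \<and> integrable lborel (\<lambda>w. k w * F z w powr p)")
    case True
    then have i: "integrable lborel (\<lambda>w. F z w * k w)" "integrable lborel (\<lambda>w. k w * F z w powr p)" by auto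
    define I where "I = (\<integral>w. F z w * k w \<partial>lborel)"
    have I0: "I \<ge> 0" unfolding I_def using F(2) k(2) by (intro integral_nonneg_AE) auto
    define \<mu> where "\<mu> = I / K"
    have \<mu>: "\<mu> \<ge> 0" "I = K * \<mu>" using I0 K(1) by (auto simp: \<mu>_def)
    have "(\<integral>w. p * \<mu> powr (p - 1) * (F z w * k w) \<partial>lborel) \<le> (\<integral>w. (p - 1) * \<mu> powr p * k w + k w * F z w powr p \<partial>lborel)"
    proof (rule integral_mono)
      fix w
      have "k w * (p * (\<mu> powr (p - 1) * F z w)) \<le> k w * ((p - 1) * \<mu> powr p + F z w powr p)"
        by (intro mult_left_mono young_powr p \<mu> F k)
      then show "p * \<mu> powr (p - 1) * (F z w * k w) \<le> (p - 1) * \<mu> powr p * k w + k w * F z w powr p"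
        by (simp add: algebra_simps)
    qed (use i kint in auto)
    then have "p * \<mu> powr (p - 1) * I \<le> (p - 1) * \<mu> powr p * K + (\<integral>w. k w * F z w powr p \<partial>lborel)"
      using i kint K(2) by (simp add: I_def)
    moreover have "p * \<mu> powr (p - 1) * I = p * \<mu> powr p * K"
      using \<mu> by (cases "\<mu> = 0") (auto simp: powr_diff)
    ultimately have "p * \<mu> powr p * K \<le> (p - 1) * \<mu> powr p * K + (\<integral>w. k w * F z w powr p \<partial>lborel)" by simp
    then have *: "K * \<mu> powr p \<le> (\<integral>w. k w * F z w powr p \<partial>lborel)" by (simp add: algebra_simps)
    have "norm (g z) powr p \<le> (K * \<mu>) powr p"
      using g(2)[of z] p by (intro powr_mono2) (auto simp: \<mu>(2)[symmetric] I_def)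
    also have "\<dots> = K powr (p - 1) * (K * \<mu> powr p)"
      using K(1) by (simp add: powr_mult powr_diff)
    also have "\<dots> \<le> K powr (p - 1) * (\<integral>w. k w * F z w powr p \<partial>lborel)" using * by (intro mult_left_mono) auto
    also have "\<dots> = (\<integral>w. K powr (p - 1) * (k w * F z w powr p) \<partial>lborel)" by simp
    finally have "ennreal (norm (g z) powr p) \<le> ennreal (\<integral>w. K powr (p - 1) * (k w * F z w powr p) \<partial>lborel)"
      by (rule ennreal_leI)
    also have "\<dots> = (\<integral>\<^sup>+ w. ennreal (K powr (p - 1) * (k w * F z w powr p)) \<partial>lborel)"
      using i k(2) by (intro nn_integral_eq_integral[symmetric]) auto
    finally show ?thesis using k(2) by (simp add: ennreal_mult)
  next
    \<comment> \<open>A Bochner integral of a non-integrable function is 0. If this happens to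
      \<open>F z w * k w\<close>, the bound forces \<open>g z = 0\<close>; if only the
      \<open>p\<close>-th powers fail to be integrable, the right-hand side is infinite.\<close>
    case False
    show ?thesis
    proof (cases "integrable lborel (\<lambda>w. F z w * k w)")
      case True
      then have "\<not> integrable lborel (\<lambda>w. k w * F z w powr p)" using False by blast
      then have "(\<integral>\<^sup>+ w. ennreal (k w * F z w powr p) \<partial>lborel) = \<infinity>"
        using k(2) by (subst (asm) integrable_iff_bounded) (auto simp: not_less top_unique abs_mult)
      then have "(\<integral>\<^sup>+ w. ennreal (K powr (p - 1)) * ennreal (k w * F z w powr p) \<partial>lborel) = \<infinity>"
        using K(1) by (subst nn_integral_cmult) (auto simp: ennreal_mult_top)
      then show ?thesis by simp
    next
      case False
      then have "norm (g z) \<le> 0" using g(2)[of z] by (simp add: not_integrable_integral_eq)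
      then show ?thesis by simp
    qed
  qed
  have "(\<integral>\<^sup>+ z. ennreal (norm (g z) powr p) \<partial>lborel)
    \<le> (\<integral>\<^sup>+ z. (\<integral>\<^sup>+ w. ennreal (K powr (p - 1)) * ennreal (k w * F z w powr p) \<partial>lborel) \<partial>lborel)"
    by (intro nn_integral_mono pw)
  also have "\<dots> = (\<integral>\<^sup>+ w. (\<integral>\<^sup>+ z. ennreal (K powr (p - 1)) * ennreal (k w * F z w powr p) \<partial>lborel) \<partial>lborel)"
    by (rule lborel_pair.Fubini'[symmetric]) measurable
  also have "\<dots> \<le> (\<integral>\<^sup>+ w. ennreal (K powr (p - 1) * \<delta> powr p * k w) \<partial>lborel)"
  proof (rule nn_integral_mono)
    fix w
    show "(\<integral>\<^sup>+ z. ennreal (K powr (p - 1)) * ennreal (k w * F z w powr p) \<partial>lborel) \<le> ennreal (K powr (p - 1) * \<delta> powr p * k w)"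
    proof (cases "norm w \<le> 1")
      case True
      have "(\<integral>\<^sup>+ z. ennreal (K powr (p - 1)) * ennreal (k w * F z w powr p) \<partial>lborel)
        = (\<integral>\<^sup>+ z. ennreal (K powr (p - 1) * (k w * F z w powr p)) \<partial>lborel)"
        using k(2) by (simp add: ennreal_mult)
      also have "\<dots> = ennreal (\<integral>z. K powr (p - 1) * (k w * F z w powr p) \<partial>lborel)"
        using Fint[OF True] k(2) by (intro nn_integral_eq_integral) auto
      also have "\<dots> = ennreal (K powr (p - 1) * (k w * (\<integral>z. F z w powr p \<partial>lborel)))" by simp
      also have "\<dots> \<le> ennreal (K powr (p - 1) * (k w * \<delta> powr p))"
        using Fle[OF True] k(2) by (intro ennreal_leI mult_left_mono) auto
      finally show ?thesis by (simp add: mult_ac)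
    qed (use k(3) in simp)
  qed
  also have "\<dots> = ennreal (\<integral>w. K powr (p - 1) * \<delta> powr p * k w \<partial>lborel)"
    using kint k(2) by (intro nn_integral_eq_integral) auto
  also have "(\<integral>w. K powr (p - 1) * \<delta> powr p * k w \<partial>lborel) = (K * \<delta>) powr p"
    using K by (simp add: powr_mult powr_diff)
  finally have le: "(\<integral>\<^sup>+ z. ennreal (norm (g z) powr p) \<partial>lborel) \<le> ennreal ((K * \<delta>) powr p)" .
  have int: "integrable lborel (\<lambda>z. norm (g z) powr p)"
    using le by (intro integrableI_bounded) (auto simp: le_less_trans)
  then show "g \<in> Lp p" by (intro LpI) auto
  have "ennreal (\<integral>z. norm (g z) powr p \<partial>lborel) \<le> ennreal ((K * \<delta>) powr p)"
    using le nn_integral_eq_integral[OF int] by simp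
  then have "(\<integral>z. norm (g z) powr p \<partial>lborel) \<le> (K * \<delta>) powr p" by simp
  then show "Lp_norm p g \<le> K * \<delta>" using p K \<delta> by (intro Lp_norm_leI) auto
qed


lemma lborel_integral_reflect_scale:
  fixes g :: "'a::euclidean_space \<Rightarrow> complex"
  assumes [measurable]: "g \<in> borel_measurable borel" and \<epsilon>: "\<epsilon> > 0"
  shows "(\<integral>y. g y \<partial>lborel) = of_real (\<epsilon> ^ DIM('a)) * (\<integral>w. g (z + (- \<epsilon>) *\<^sub>R w) \<partial>lborel)"
proof -
  have "(\<integral>y. g y \<partial>lborel) = (\<integral>y. g y \<partial>density (distr lborel borel (\<lambda>x. z + (- \<epsilon>) *\<^sub>R x)) (\<lambda>_. ennreal (\<bar>- \<epsilon>\<bar> ^ DIM('a))))"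
    using lborel_affine[of "- \<epsilon>" z] \<epsilon> by simp
  also have "\<dots> = (\<integral>y. (\<epsilon> ^ DIM('a)) *\<^sub>R g y \<partial>distr lborel borel (\<lambda>x. z + (- \<epsilon>) *\<^sub>R x))"
    using \<epsilon> by (subst integral_density) auto
  also have "\<dots> = (\<integral>w. (\<epsilon> ^ DIM('a)) *\<^sub>R g (z + (- \<epsilon>) *\<^sub>R w) \<partial>lborel)"
    by (rule integral_distr) auto
  also have "\<dots> = (\<epsilon> ^ DIM('a)) *\<^sub>R (\<integral>w. g (z + (- \<epsilon>) *\<^sub>R w) \<partial>lborel)" by (rule integral_scaleR_right)
  finally show ?thesis by (simp add: scaleR_conv_of_real)
qed

lemma Lp_translation_sup:
  assumes p: "1 < p" and f: "f \<in> Lp p" and e: "e > 0"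
  obtains \<epsilon>0 where "\<epsilon>0 > 0"
    "\<And>\<epsilon> w. 0 < \<epsilon> \<Longrightarrow> \<epsilon> < \<epsilon>0 \<Longrightarrow> norm w \<le> 1 \<Longrightarrow> (\<integral>z. norm (f (z + (- \<epsilon>) *\<^sub>R w) - f z) powr p \<partial>lborel) \<le> e powr p"
proof -
  obtain d where d: "d > 0" "\<And>a. norm a < d \<Longrightarrow> Lp_norm p (\<lambda>z. f (a + z) - f z) < e"
    using Lp_translation_continuous[OF p f e] by blast
  show ?thesis
  proof (rule that[OF d(1)])
    fix \<epsilon> :: real and w :: 'a assume *: "0 < \<epsilon>" "\<epsilon> < d" "norm w \<le> 1"
    have "norm ((- \<epsilon>) *\<^sub>R w) \<le> \<epsilon> * 1" using * by (simp add: mult_left_le)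
    then have "norm ((- \<epsilon>) *\<^sub>R w) < d" using * by linarith
    then have "Lp_norm p (\<lambda>z. f ((- \<epsilon>) *\<^sub>R w + z) - f z) < e" by (rule d(2))
    then have "Lp_norm p (\<lambda>z. f ((- \<epsilon>) *\<^sub>R w + z) - f z) powr p \<le> e powr p"
      using p by (intro powr_mono2) auto
    then show "(\<integral>z. norm (f (z + (- \<epsilon>) *\<^sub>R w) - f z) powr p \<partial>lborel) \<le> e powr p"
      using p by (simp add: Lp_norm_powr add.commute)
  qed
qed

lemma conv_moll:
  fixes f :: "'a::euclidean_space \<Rightarrow> complex"
  assumes f: "f \<in> Lp p" and \<epsilon>: "\<epsilon> > 0"
  shows "conv f (moll \<epsilon>) z = (\<integral>w. f (z + (- \<epsilon>) *\<^sub>R w) * rhoc w \<partial>lborel)"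
proof -
  have [measurable]: "f \<in> borel_measurable borel" using f by auto
  have [measurable]: "moll \<epsilon> \<in> borel_measurable (borel :: 'a measure)"
    by (rule csupp_measurable[OF Cc_inf_csupp[OF moll_Cc_inf[OF \<epsilon>]]])
  have "conv f (moll \<epsilon>) z = of_real (\<epsilon> ^ DIM('a)) * (\<integral>w. f (z + (- \<epsilon>) *\<^sub>R w) * moll \<epsilon> (z + (-1) *\<^sub>R (z + (- \<epsilon>) *\<^sub>R w)) \<partial>lborel)"
    unfolding conv_def by (rule lborel_integral_reflect_scale[OF _ \<epsilon>]) measurable
  also have "\<dots> = (\<integral>w. of_real (\<epsilon> ^ DIM('a)) * (f (z + (- \<epsilon>) *\<^sub>R w) * moll \<epsilon> (z + (-1) *\<^sub>R (z + (- \<epsilon>) *\<^sub>R w))) \<partial>lborel)"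
    by simp
  also have "\<dots> = (\<integral>w. f (z + (- \<epsilon>) *\<^sub>R w) * rhoc w \<partial>lborel)"
    using \<epsilon> by (intro Bochner_Integration.integral_cong) (auto simp: moll_def power_one_over)
  finally show ?thesis .
qed

lemma csupp_imp_rhoc: "csupp (rhoc :: 'a::euclidean_space \<Rightarrow> complex)"
  by (rule Cc_inf_csupp[OF rhoc_Cc_inf])

text \<open>By \<open>conv_moll\<close> and \<open>rho_integral\<close> the difference is an average
  of \<open>f (z - \<epsilon> w) - f z\<close> over the unit ball, and
  \<open>Lp_norm_kernel_le\<close> bounds its norm by a common bound for these translation
  differences.\<close>

lemma conv_moll_tendsto:
  fixes f :: "'a::euclidean_space \<Rightarrow> complex"
  assumes p: "1 < p" and f: "f \<in> Lp p"
  shows "((\<lambda>\<epsilon>. Lp_norm p (\<lambda>z. conv f (moll \<epsilon>) z - f z)) \<longlongrightarrow> 0) (at_right 0)"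
    and "\<epsilon> > 0 \<Longrightarrow> conv f (moll \<epsilon>) \<in> Lp p"
proof -
  have [measurable]: "f \<in> borel_measurable borel" using f by auto
  have cm: "conv f (moll \<epsilon>) \<in> borel_measurable borel" if "\<epsilon> > 0" for \<epsilon>
    using Ck_continuous[OF conv_Ck[OF p f moll_Cc_inf[OF that]]] by (rule borel_measurable_continuous_onI)
  have le: "norm (conv f (moll \<epsilon>) z - f z) \<le> (\<integral>w. norm (f (z + (- \<epsilon>) *\<^sub>R w) - f z) * rho w \<partial>lborel)" if \<epsilon>: "\<epsilon> > 0" for \<epsilon> z
  proof -
    have fs: "(\<lambda>w. f (z + (- \<epsilon>) *\<^sub>R w)) \<in> borel_measurable borel" by measurable
    have rm [measurable]: "rhoc \<in> borel_measurable (borel :: 'a measure)" by (rule csupp_measurable[OF csupp_imp_rhoc])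
    have i1: "integrable lborel (\<lambda>w. f (z + (- \<epsilon>) *\<^sub>R w) * rhoc w)"
    proof -
      have "integrable lborel (\<lambda>y. f y * moll \<epsilon> (z + (-1) *\<^sub>R y))"
        by (rule conv_integrable[OF p f Cc_inf_csupp[OF moll_Cc_inf[OF \<epsilon>]]])
      then have "integrable (density (distr lborel borel (\<lambda>x. z + (- \<epsilon>) *\<^sub>R x)) (\<lambda>_. ennreal (\<bar>- \<epsilon>\<bar> ^ DIM('a)))) (\<lambda>y. f y * moll \<epsilon> (z + (-1) *\<^sub>R y))"
        using lborel_affine[of "- \<epsilon>" z] \<epsilon> by simp
      moreover have [measurable]: "moll \<epsilon> \<in> borel_measurable (borel :: 'a measure)"
        by (rule csupp_measurable[OF Cc_inf_csupp[OF moll_Cc_inf[OF \<epsilon>]]])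
      ultimately have "integrable (distr lborel borel (\<lambda>x. z + (- \<epsilon>) *\<^sub>R x)) (\<lambda>y. (\<bar>- \<epsilon>\<bar> ^ DIM('a)) *\<^sub>R (f y * moll \<epsilon> (z + (-1) *\<^sub>R y)))"
        by (subst (asm) integrable_density) auto
      then have "integrable lborel (\<lambda>w. (\<bar>- \<epsilon>\<bar> ^ DIM('a)) *\<^sub>R (f (z + (- \<epsilon>) *\<^sub>R w) * moll \<epsilon> (z + (-1) *\<^sub>R (z + (- \<epsilon>) *\<^sub>R w))))"
        by (subst (asm) integrable_distr_eq) auto
      moreover have "(\<bar>- \<epsilon>\<bar> ^ DIM('a)) *\<^sub>R (f (z + (- \<epsilon>) *\<^sub>R w) * moll \<epsilon> (z + (-1) *\<^sub>R (z + (- \<epsilon>) *\<^sub>R w)))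
        = f (z + (- \<epsilon>) *\<^sub>R w) * rhoc w" for w
        using \<epsilon> by (simp add: moll_def power_one_over scaleR_conv_of_real)
      ultimately show ?thesis by (simp only:)
    qed
    have i2: "integrable lborel (\<lambda>w. f z * rhoc (w::'a))"
      by (intro integrable_mult_right csupp_integrable csupp_imp_rhoc)
    have "(\<integral>w. rhoc (w::'a) \<partial>lborel) = 1"
      using rho_integral[where 'a = 'a] by (simp add: rhoc_def)
    then have "conv f (moll \<epsilon>) z - f z = (\<integral>w. f (z + (- \<epsilon>) *\<^sub>R w) * rhoc w \<partial>lborel) - (\<integral>w. f z * rhoc (w::'a) \<partial>lborel)"
      by (simp add: conv_moll[OF f \<epsilon>])
    also have "\<dots> = (\<integral>w. f (z + (- \<epsilon>) *\<^sub>R w) * rhoc w - f z * rhoc w \<partial>lborel)"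
      using i1 i2 by simp
    also have "norm \<dots> \<le> (\<integral>w. norm (f (z + (- \<epsilon>) *\<^sub>R w) * rhoc w - f z * rhoc w) \<partial>lborel)" by (rule integral_norm_bound)
    also have "\<dots> = (\<integral>w. norm (f (z + (- \<epsilon>) *\<^sub>R w) - f z) * rho w \<partial>lborel)"
      by (intro Bochner_Integration.integral_cong) (auto simp: left_diff_distrib[symmetric] norm_mult rhoc_def rho_nonneg)
    finally show ?thesis .
  qed
  \<comment> \<open>Used twice: with a small \<open>\<delta>\<close> from the continuity of
    translations, and with the crude \<open>\<delta> = 2 * Lp_norm p f\<close> to see that the
    convolution lies in \<open>L^p\<close> for every \<open>\<epsilon> > 0\<close>.\<close>
  have bound: "(\<lambda>z. conv f (moll \<epsilon>) z - f z) \<in> Lp p \<and> Lp_norm p (\<lambda>z. conv f (moll \<epsilon>) z - f z) \<le> \<delta>"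
    if \<epsilon>: "\<epsilon> > 0" and \<delta>: "\<delta> \<ge> 0" "\<And>w. norm w \<le> 1 \<Longrightarrow> (\<integral>z. norm (f (z + (- \<epsilon>) *\<^sub>R w) - f z) powr p \<partial>lborel) \<le> \<delta> powr p" for \<epsilon> \<delta>
  proof -
    have Fint: "integrable lborel (\<lambda>z. norm (f (z + (- \<epsilon>) *\<^sub>R w) - f z) powr p)" for w
      using Lp_integrable[OF Lp_diff[OF _ Lp_shift(1)[OF f, of "(- \<epsilon>) *\<^sub>R w"] f]] p by (simp add: add.commute)
    note * = Lp_norm_kernel_le[OF p zero_less_one rho_integral rho_csupp rho_nonneg _ _ _ Fint \<delta>(2) \<delta>(1) _ le[OF \<epsilon>]]
    show ?thesis
      using *(1) *(2) cm[OF \<epsilon>] by (simp add: rho_zero)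
  qed
  show "((\<lambda>\<epsilon>. Lp_norm p (\<lambda>z. conv f (moll \<epsilon>) z - f z)) \<longlongrightarrow> 0) (at_right 0)"
  proof (rule tendstoI)
    fix e :: real assume e: "e > 0"
    then obtain \<epsilon>0 where \<epsilon>0: "\<epsilon>0 > 0"
      "\<And>\<epsilon> w. 0 < \<epsilon> \<Longrightarrow> \<epsilon> < \<epsilon>0 \<Longrightarrow> norm w \<le> 1 \<Longrightarrow> (\<integral>z. norm (f (z + (- \<epsilon>) *\<^sub>R w) - f z) powr p \<partial>lborel) \<le> (e / 2) powr p"
      using Lp_translation_sup[OF p f, of "e / 2"] by auto
    have "Lp_norm p (\<lambda>z. conv f (moll \<epsilon>) z - f z) < e" if "0 < \<epsilon>" "\<epsilon> < \<epsilon>0" for \<epsilon>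
      using bound[OF that(1), of "e / 2"] \<epsilon>0(2)[OF that] e by fastforce
    then show "\<forall>\<^sub>F \<epsilon> in at_right 0. dist (Lp_norm p (\<lambda>z. conv f (moll \<epsilon>) z - f z)) 0 < e"
      using \<epsilon>0(1) by (auto simp: eventually_at_right_field intro!: exI[of _ \<epsilon>0])
  qed
  show "conv f (moll \<epsilon>) \<in> Lp p" if \<epsilon>: "\<epsilon> > 0"
  proof -
    define \<delta> where "\<delta> = 2 * Lp_norm p f"
    have "(\<integral>z. norm (f (z + (- \<epsilon>) *\<^sub>R w) - f z) powr p \<partial>lborel) \<le> \<delta> powr p" for w
    proof -
      have "Lp_norm p (\<lambda>z. f ((- \<epsilon>) *\<^sub>R w + z) - f z) \<le> \<delta>"
        using Lp_norm_triangle[OF p Lp_shift(1)[OF f] Lp_zero f, of "(- \<epsilon>) *\<^sub>R w"] Lp_shift(2)[OF f, of "(- \<epsilon>) *\<^sub>R w"]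
          Lp_norm_minus_commute[of p "\<lambda>z. 0" f] by (simp add: \<delta>_def)
      then have "Lp_norm p (\<lambda>z. f ((- \<epsilon>) *\<^sub>R w + z) - f z) powr p \<le> \<delta> powr p" using p by (intro powr_mono2) auto
      then show ?thesis using p by (simp add: Lp_norm_powr add.commute)
    qed
    then have "(\<lambda>z. conv f (moll \<epsilon>) z - f z) \<in> Lp p" using bound[OF \<epsilon>, of \<delta>] by (simp add: \<delta>_def)
    from Lp_add[OF _ this f] p show ?thesis by simp
  qed
qed

lemma Lp_dense_Cc_inf:
  assumes p: "1 < p" and f: "f \<in> Lp p" and e: "e > 0"
  obtains \<phi> where "\<phi> \<in> Cc_inf" "Lp_norm p (\<lambda>z. \<phi> z - f z) < e"
proof -
  obtain g R where g: "continuous_on UNIV g" "\<And>z. norm z > R \<Longrightarrow> g z = 0" "g \<in> Lp p" "Lp_norm p (\<lambda>z. f z - g z) < e / 2"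
    using Lp_dense_continuous[of p f "e / 2"] p f e by auto
  have cs: "csupp g" using g by (auto simp: csupp_def)
  have "\<forall>\<^sub>F \<epsilon> in at_right 0. Lp_norm p (\<lambda>z. conv g (moll \<epsilon>) z - g z) < e / 2"
    using order_tendstoD(2)[OF conv_moll_tendsto(1)[OF p g(3)], of "e / 2"] e by simp
  moreover have "\<forall>\<^sub>F \<epsilon> in at_right 0. \<epsilon> > (0::real)" by (simp add: eventually_at_right_less)
  ultimately have "\<forall>\<^sub>F \<epsilon> in at_right 0. \<epsilon> > 0 \<and> Lp_norm p (\<lambda>z. conv g (moll \<epsilon>) z - g z) < e / 2"
    by eventually_elim simp
  then obtain \<epsilon> where \<epsilon>: "\<epsilon> > 0" "Lp_norm p (\<lambda>z. conv g (moll \<epsilon>) z - g z) < e / 2"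
    using eventually_happens[of _ "at_right (0::real)"] by auto
  have "Lp_norm p (\<lambda>z. conv g (moll \<epsilon>) z - f z) < e"
    using Lp_norm_triangle[OF p conv_moll_tendsto(2)[OF p g(3) \<epsilon>(1)] g(3) f] \<epsilon>(2) g(4) Lp_norm_minus_commute[of p g f] by simp
  then show ?thesis using conv_csupp_Cc_inf[OF p cs moll_Cc_inf[OF \<epsilon>(1)]] that by blast
qed

text \<open>Each value of the convolution with \<open>moll \<epsilon>\<close> is a pairing of
  \<open>f\<close> with a test function, hence zero, and these convolutions converge to
  \<open>f\<close>.\<close>

lemma Lp_fundamental_lemma:
  assumes p: "1 < p" and f: "f \<in> Lp p" and 0: "\<And>\<phi>. \<phi> \<in> Cc_inf \<Longrightarrow> (\<integral>z. f z * \<phi> z \<partial>lborel) = 0"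
  shows "AE z in lborel. f z = 0"
proof -
  have "conv f (moll \<epsilon>) z = 0" if "\<epsilon> > 0" for \<epsilon> z
    unfolding conv_def by (rule 0[OF Cc_inf_affine[OF moll_Cc_inf[OF that]]]) simp
  then have "\<forall>\<^sub>F \<epsilon> in at_right 0. Lp_norm p (\<lambda>z. conv f (moll \<epsilon>) z - f z) = Lp_norm p f"
    by (auto simp: eventually_at_right_field Lp_norm_def intro!: exI[of _ 1])
  then have "((\<lambda>\<epsilon>::real. Lp_norm p f) \<longlongrightarrow> 0) (at_right 0)"
    using conv_moll_tendsto(1)[OF p f] by (rule Lim_transform_eventually[rotated])
  then have "Lp_norm p f = 0" by (simp add: tendsto_const_iff)
  then show ?thesis using Lp_norm_eq_0_iff[of p f] p f by simp
qed

section \<open>Energy estimates\<close>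

lemma inner_has_real_derivative:
  assumes "(f has_vector_derivative f') (at t)" "(g has_vector_derivative g') (at t)"
  shows "((\<lambda>t. f t \<bullet> g t) has_real_derivative (f t \<bullet> g' + f' \<bullet> g t)) (at t)"
  using has_derivative_inner[OF assms[unfolded has_vector_derivative_def]]
  unfolding has_field_derivative_def by (rule has_derivative_eq_rhs) (auto simp: algebra_simps)

text \<open>Integration by parts in which the coefficient \<open>a\<close> is merely continuous:
  being constant along \<open>e\<close>, it passes through the difference quotient, whose integral
  is zero by translation invariance. The limit is dominated because by the mean value theorem the
  quotients are values of \<open>g'\<close>.\<close>

lemma integral_derivative_eq_0:
  fixes a g g' :: "'a::euclidean_space \<Rightarrow> real"
  assumes a: "continuous_on UNIV a" "\<And>z t. a (z + t *\<^sub>R e) = a z" and g: "csupp g" and g': "csupp g'"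
    and D: "\<And>z. ((\<lambda>t. g (z + t *\<^sub>R e)) has_real_derivative g' z) (at 0)"
  shows "(\<integral>z. a z * g' z \<partial>lborel) = 0"
proof -
  have D': "((\<lambda>t. g (z + t *\<^sub>R e)) has_real_derivative g' (z + t *\<^sub>R e)) (at t)" for z t
    using D[of "z + t *\<^sub>R e"] DERIV_shift[of "\<lambda>s. g (z + s *\<^sub>R e)" "g' (z + t *\<^sub>R e)" 0 t]
    by (simp add: algebra_simps)
  obtain M where M: "M \<ge> 0" "\<And>z. norm (g' z) \<le> M" using csupp_bounded[OF g'] by blast
  obtain R where R: "\<And>z. norm z > R \<Longrightarrow> g z = 0" using g by (auto simp: csupp_def)
  \<comment> \<open>Shifts by \<open>t k *\<^sub>R e\<close> with \<open>t k \<le> 1\<close> enlarge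
    the support by at most \<open>|e|\<close>.\<close>
  define S where "S = R + norm e"
  define t where "t k = 1 / real (Suc k)" for k
  have t: "t k > 0" "t k \<le> 1" for k by (auto simp: t_def)
  have tlim: "t \<longlonglongrightarrow> 0" using LIMSEQ_inverse_real_of_nat by (simp add: t_def[abs_def] inverse_eq_divide)
  define q where "q k z = (g (z + t k *\<^sub>R e) - g z) / t k" for k z
  have [measurable]: "a \<in> borel_measurable borel" using a(1) by (rule borel_measurable_continuous_onI)
  have [measurable]: "g \<in> borel_measurable borel" "g' \<in> borel_measurable borel"
    using g g' by (auto intro: csupp_measurable)
  have ag: "integrable lborel (\<lambda>z. a z * g z)" by (rule csupp_integrable[OF csupp_mult[OF a(1) g]])
  have q0: "(\<integral>z. a z * q k z \<partial>lborel) = 0" for k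
  proof -
    have m: "(\<lambda>z. a z * g z) \<in> borel_measurable borel" by measurable
    have eq: "a z * q k z = (1 / t k) * (a (t k *\<^sub>R e + z) * g (t k *\<^sub>R e + z) - a z * g z)" for z
      using a(2)[of z "t k"] by (simp add: q_def add.commute algebra_simps diff_divide_distrib)
    show ?thesis unfolding eq
      using lborel_integral_shift[OF m, of "t k *\<^sub>R e"] ag by simp
  qed
  have qM: "\<bar>q k z\<bar> \<le> M" for k z
  proof -
    obtain \<xi> where "0 < \<xi>" "\<xi> < t k" "g (z + t k *\<^sub>R e) - g (z + 0 *\<^sub>R e) = (t k - 0) * g' (z + \<xi> *\<^sub>R e)"
      using MVT2[of 0 "t k" "\<lambda>t. g (z + t *\<^sub>R e)" "\<lambda>t. g' (z + t *\<^sub>R e)"] D' t by blast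
    then have "q k z = g' (z + \<xi> *\<^sub>R e)" using t[of k] by (simp add: q_def)
    then show ?thesis using M(2) by simp
  qed
  have qS: "q k z = 0" if "norm z > S" for k z
  proof -
    have "norm z \<le> norm (z + t k *\<^sub>R e) + norm (t k *\<^sub>R e)" using norm_triangle_ineq4[of "z + t k *\<^sub>R e" "t k *\<^sub>R e"] by simp
    also have "norm (t k *\<^sub>R e) \<le> norm e" using t[of k] by (simp add: mult_left_le_one_le)
    finally have "norm (z + t k *\<^sub>R e) > R" using that by (simp add: S_def)
    moreover have "norm z > R" using that norm_ge_zero[of e] unfolding S_def by linarith
    ultimately show ?thesis using R by (simp add: q_def)
  qed
  have "(\<lambda>k. \<integral>z. a z * q k z \<partial>lborel) \<longlonglongrightarrow> (\<integral>z. a z * g' z \<partial>lborel)"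
  proof (rule integral_dominated_convergence[where w = "\<lambda>z. indicator (cball 0 S) z *\<^sub>R (M * \<bar>a z\<bar>)"])
    show "integrable lborel (\<lambda>z. indicator (cball 0 S) z *\<^sub>R (M * \<bar>a z\<bar>))"
      using a(1) by (intro borel_integrable_compact continuous_intros) (auto intro: continuous_on_subset)
    show "AE z in lborel. (\<lambda>k. a z * q k z) \<longlonglongrightarrow> a z * g' z"
    proof (rule AE_I2)
      fix z
      have "((\<lambda>h. (g (z + (0 + h) *\<^sub>R e) - g (z + 0 *\<^sub>R e)) / h) \<longlongrightarrow> g' z) (at 0)"
        using D[of z] by (simp add: DERIV_def)
      moreover have "filterlim t (at 0) sequentially"
        using tlim t by (auto simp: filterlim_at less_imp_neq[THEN not_sym])
      ultimately have "(\<lambda>k. (g (z + (0 + t k) *\<^sub>R e) - g (z + 0 *\<^sub>R e)) / t k) \<longlonglongrightarrow> g' z"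
        by (rule filterlim_compose)
      then have "(\<lambda>k. q k z) \<longlonglongrightarrow> g' z" by (simp add: q_def)
      then show "(\<lambda>k. a z * q k z) \<longlonglongrightarrow> a z * g' z" by (rule tendsto_mult_left)
    qed
    show "AE z in lborel. norm (a z * q k z) \<le> indicator (cball 0 S) z *\<^sub>R (M * \<bar>a z\<bar>)" for k
    proof (rule AE_I2)
      fix z
      have "\<bar>a z\<bar> * \<bar>q k z\<bar> \<le> \<bar>a z\<bar> * M" by (intro mult_left_mono qM) simp
      then show "norm (a z * q k z) \<le> indicator (cball 0 S) z *\<^sub>R (M * \<bar>a z\<bar>)"
        using qS[of z k] by (cases "norm z > S") (auto simp: abs_mult mult.commute)
    qed
  qed (auto simp: q_def)
  then show ?thesis using q0 by (simp add: LIMSEQ_const_iff)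
qed

lemma pospart_power_deriv:
  "((\<lambda>s. (max 0 s) ^ Suc (Suc n)) has_real_derivative real (Suc (Suc n)) * (max 0 s) ^ Suc n) (at s)"
proof -
  consider "s > 0" | "s < 0" | "s = 0" by linarith
  then show ?thesis
  proof cases
    case 1
    have "((\<lambda>s. s ^ Suc (Suc n)) has_real_derivative real (Suc (Suc n)) * (max 0 s) ^ Suc n) (at s)"
      using 1 DERIV_pow[of "Suc (Suc n)" s] by (simp only: max_def diff_Suc_Suc diff_zero) simp
    then show ?thesis
      by (rule has_field_derivative_transform_within_open[of _ _ _ "{0<..}"]) (use 1 in auto)
  next
    case 2
    have "((\<lambda>s. 0) has_real_derivative real (Suc (Suc n)) * (max 0 s) ^ Suc n) (at s)"
      using 2 by (simp add: max_def)
    then show ?thesis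
      by (rule has_field_derivative_transform_within_open[of _ _ _ "{..<0}"]) (use 2 in auto)
  next
    case 3
    have "((\<lambda>h::real. (max 0 h) ^ Suc n) \<longlongrightarrow> (max 0 0) ^ Suc n) (at 0)"
      by (intro tendsto_intros)
    then have "((\<lambda>h::real. (max 0 h) ^ Suc n) \<longlongrightarrow> 0) (at 0)" by simp
    then have "((\<lambda>h. ((max 0 (0 + h)) ^ Suc (Suc n) - (max 0 0) ^ Suc (Suc n)) / h) \<longlongrightarrow> (0::real)) (at 0)"
      by (rule Lim_transform_eventually) (auto simp: eventually_at max_def intro!: exI[of _ 1])
    then show ?thesis using 3 by (simp add: DERIV_def)
  qed
qed

text \<open>
  The cutoff \<open>(1 - |z|\<^sup>2/R\<^sup>2)\<^sub>+\<^sup>3\<close> is only \<open>C\<^sup>2\<close>, which is all the energy estimate needs; the other two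
  functions are its first and second derivatives in the direction \<open>e\<close>.
\<close>

definition cutb :: "real \<Rightarrow> 'a::euclidean_space \<Rightarrow> real" where
  "cutb R z = max 0 (1 - (z \<bullet> z) / R\<^sup>2)"

definition cut0 :: "real \<Rightarrow> 'a::euclidean_space \<Rightarrow> real" where
  "cut0 R z = (cutb R z) ^ 3"

definition cut1 :: "real \<Rightarrow> 'a \<Rightarrow> 'a::euclidean_space \<Rightarrow> real" where
  "cut1 R e z = - (6 / R\<^sup>2) * (z \<bullet> e) * (cutb R z)\<^sup>2"

definition cut2 :: "real \<Rightarrow> 'a \<Rightarrow> 'a::euclidean_space \<Rightarrow> real" where
  "cut2 R e z = 24 / R ^ 4 * (z \<bullet> e)\<^sup>2 * cutb R z - 6 / R\<^sup>2 * (cutb R z)\<^sup>2"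

lemma cutb_zero: "R > 0 \<Longrightarrow> norm z \<ge> R \<Longrightarrow> cutb R z = 0"
proof -
  assume R: "R > 0" "norm z \<ge> R"
  then have "R\<^sup>2 \<le> z \<bullet> z" unfolding dot_square_norm by (intro power_mono) auto
  then show ?thesis using R by (simp add: cutb_def)
qed

lemma cutb_range: "0 \<le> cutb R z" "cutb R z \<le> 1"
  by (auto simp: cutb_def)

lemma continuous_cutb: "continuous_on UNIV (cutb R)"
  unfolding cutb_def divide_inverse by (intro continuous_intros)

lemma csupp_cut:
  fixes e :: "'a::euclidean_space"
  assumes "R > 0"
  shows "csupp (cut0 R :: 'a \<Rightarrow> real)" "csupp (cut1 R e)" "csupp (cut2 R e)"
proof -
  have "csupp (cutb R :: 'a \<Rightarrow> real)"
    using continuous_cutb cutb_zero[OF assms less_imp_le] by (auto simp: csupp_def)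
  then have cs: "csupp h" if "continuous_on UNIV h" "\<And>z. cutb R z = 0 \<Longrightarrow> h z = 0" for h :: "'a \<Rightarrow> real"
    using csupp_dominated that by blast
  show "csupp (cut0 R :: 'a \<Rightarrow> real)" "csupp (cut1 R e)" "csupp (cut2 R e)"
    by (rule cs; simp add: cut0_def[abs_def] cut1_def[abs_def] cut2_def[abs_def] divide_inverse del: inverse_eq_divide;
      intro continuous_intros continuous_cutb)+
qed

lemma cut_deriv:
  assumes R: "R > 0" and e: "e \<in> Basis"
  shows "((\<lambda>t. cut0 R (z + t *\<^sub>R e)) has_real_derivative cut1 R e z) (at 0)"
    and "((\<lambda>t. cut1 R e (z + t *\<^sub>R e)) has_real_derivative cut2 R e z) (at 0)"
proof -
  have ee: "e \<bullet> e = 1" using e by simp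
  define s where "s t = 1 - ((z + t *\<^sub>R e) \<bullet> (z + t *\<^sub>R e)) / R\<^sup>2" for t
  have s_eq: "s t = 1 - (z \<bullet> z + 2 * t * (z \<bullet> e) + t\<^sup>2) / R\<^sup>2" for t
    by (simp add: s_def inner_add_left inner_add_right ee inner_commute power2_eq_square algebra_simps)
  have s0: "s 0 = 1 - (z \<bullet> z) / R\<^sup>2" by (simp add: s_def)
  have ds: "(s has_real_derivative - 2 * (z \<bullet> e) / R\<^sup>2) (at 0)"
    unfolding s_eq[abs_def] using R
    by (auto intro!: derivative_eq_intros simp: power2_eq_square field_simps)
  have c: "cutb R (z + t *\<^sub>R e) = max 0 (s t)" for t by (simp add: cutb_def s_def)
  have c0: "cutb R z = max 0 (s 0)" using c[of 0] by simp
  have d3: "((\<lambda>t. (max 0 (s t)) ^ 3) has_real_derivative 3 * (max 0 (s 0))\<^sup>2 * (- 2 * (z \<bullet> e) / R\<^sup>2)) (at 0)"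
    using DERIV_chain2[OF pospart_power_deriv[of 1] ds] by (simp add: numeral_eq_Suc)
  have d2: "((\<lambda>t. (max 0 (s t))\<^sup>2) has_real_derivative 2 * (max 0 (s 0)) * (- 2 * (z \<bullet> e) / R\<^sup>2)) (at 0)"
    using DERIV_chain2[OF pospart_power_deriv[of 0] ds] by (simp add: numeral_eq_Suc)
  show "((\<lambda>t. cut0 R (z + t *\<^sub>R e)) has_real_derivative cut1 R e z) (at 0)"
    unfolding cut0_def cut1_def c c0 using d3 by (rule DERIV_cong) simp
  have di: "((\<lambda>t. (z + t *\<^sub>R e) \<bullet> e) has_real_derivative 1) (at 0)"
    unfolding inner_add_left inner_scaleR_left ee by (auto intro!: derivative_eq_intros)
  have "((\<lambda>t. - (6 / R\<^sup>2) * ((z + t *\<^sub>R e) \<bullet> e) * (max 0 (s t))\<^sup>2) has_real_derivative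
     - (6 / R\<^sup>2) * (((z + 0 *\<^sub>R e) \<bullet> e) * (2 * (max 0 (s 0)) * (- 2 * (z \<bullet> e) / R\<^sup>2)) + 1 * (max 0 (s 0))\<^sup>2)) (at 0)"
    unfolding mult.assoc by (intro DERIV_cmult) (use DERIV_mult[OF di d2] in \<open>simp add: mult_ac add.commute\<close>)
  then show "((\<lambda>t. cut1 R e (z + t *\<^sub>R e)) has_real_derivative cut2 R e z) (at 0)"
    unfolding cut1_def cut2_def c c0 by (rule DERIV_cong) (use R in \<open>simp add: field_simps power2_eq_square eval_nat_numeral\<close>)
qed

text \<open>\<open>B_invariant\<close> says that no component of \<open>B\<close> depends on its own
  coordinate, a form of being divergence free that involves no derivative; for
  \<open>(m v, - \<nabla>V(x))\<close> it holds because each half depends on the other variable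
  only. \<open>W_lipschitz\<close> has the shape satisfied by \<open>|v|^2\<close>, and
  \<open>d\<close> is the threshold that the spectral parameter \<open>\<mu>\<close> has to
  exceed.\<close>

locale transport_diffusion =
  fixes B :: "'a::euclidean_space \<Rightarrow> 'a" and E :: "'a set" and \<kappa> d L Lw :: real and W :: "'a \<Rightarrow> real"
  assumes B_lipschitz: "norm (B x - B y) \<le> L * norm (x - y)"
    and B_invariant: "e \<in> Basis \<Longrightarrow> B (z + t *\<^sub>R e) \<bullet> e = B z \<bullet> e"
    and E_Basis: "E \<subseteq> Basis" and kappa_nonneg: "\<kappa> \<ge> 0"
    and W_ge: "W z \<ge> - d"
    and W_lipschitz: "\<bar>W x - W y\<bar> \<le> Lw * (1 + norm x + norm y) * norm (x - y)"
    and L_nonneg: "L \<ge> 0" "Lw \<ge> 0"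
begin

definition Pop :: "('a \<Rightarrow> complex) \<Rightarrow> 'a \<Rightarrow> complex" where
  "Pop u z = (\<Sum>e\<in>Basis. (B z \<bullet> e) *\<^sub>R dir_deriv e u z)
     - \<kappa> *\<^sub>R (\<Sum>e\<in>E. dir_deriv e (dir_deriv e u) z) + W z *\<^sub>R u z"

text \<open>The transpose for the bilinear pairing, so nothing is conjugated. Since \<open>B\<close>
  is divergence free, only the sign of the transport term changes.\<close>

definition Pop_adj :: "('a \<Rightarrow> complex) \<Rightarrow> 'a \<Rightarrow> complex" where
  "Pop_adj u z = - (\<Sum>e\<in>Basis. (B z \<bullet> e) *\<^sub>R dir_deriv e u z)
     - \<kappa> *\<^sub>R (\<Sum>e\<in>E. dir_deriv e (dir_deriv e u) z) + W z *\<^sub>R u z"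

lemma continuous_B: "continuous_on S B"
proof (rule continuous_on_subset[of UNIV])
  show "continuous_on UNIV B"
    unfolding continuous_on_iff
  proof (intro ballI allI impI)
    fix x and \<epsilon> :: real assume "\<epsilon> > 0"
    show "\<exists>\<delta>>0. \<forall>x'\<in>UNIV. dist x' x < \<delta> \<longrightarrow> dist (B x') (B x) < \<epsilon>"
    proof (intro exI[of _ "\<epsilon> / (L + 1)"] conjI ballI impI)
      show "\<epsilon> / (L + 1) > 0" using \<open>\<epsilon> > 0\<close> L_nonneg by simp
      fix x' assume "dist x' x < \<epsilon> / (L + 1)"
      then have "(L + 1) * norm (x' - x) < \<epsilon>" using L_nonneg by (simp add: dist_norm field_simps)
      moreover have "L * norm (x' - x) \<le> (L + 1) * norm (x' - x)" by (simp add: distrib_right)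
      ultimately show "dist (B x') (B x) < \<epsilon>" using B_lipschitz[of x' x] by (simp add: dist_norm)
    qed
  qed
qed simp

lemma continuous_W: "continuous_on S W"
proof (rule continuous_on_subset[of UNIV])
  have "isCont W x" for x
    unfolding isCont_def
  proof (rule LIM_zero_cancel, rule tendsto_rabs_zero_cancel, rule tendsto_sandwich[OF _ _ tendsto_const])
    have "((\<lambda>y. Lw * (1 + norm y + norm x) * norm (y - x)) \<longlongrightarrow> Lw * (1 + norm x + norm x) * norm (x - x)) (at x)"
      by (intro tendsto_intros)
    then show "((\<lambda>y. Lw * (1 + norm y + norm x) * norm (y - x)) \<longlongrightarrow> 0) (at x)" by simp
  qed (use W_lipschitz in auto)
  then show "continuous_on UNIV W" by (simp add: continuous_at_imp_continuous_on)
qed simp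

lemma continuous_Pop:
  assumes u: "Ck 2 u"
  shows "continuous_on UNIV (Pop u)"
proof -
  have 1: "continuous_on UNIV u" by (rule Ck_continuous[OF u])
  have 2: "continuous_on UNIV (dir_deriv e u)" if "e \<in> Basis" for e
    by (rule Ck_continuous[of 1]) (use u that in \<open>simp add: numeral_2_eq_2\<close>)
  have 3: "continuous_on UNIV (dir_deriv e (dir_deriv e u))" if "e \<in> E" for e
    by (rule Ck_continuous[of 0]) (use u that E_Basis in \<open>auto simp: numeral_2_eq_2\<close>)
  show ?thesis
    unfolding Pop_def
    by (intro continuous_on_add continuous_on_diff continuous_on_scaleR continuous_on_sum continuous_on_const
        continuous_on_inner continuous_B continuous_W 1 2 3)
qed

lemma csupp_Pop: "\<phi> \<in> Cc_inf \<Longrightarrow> csupp (Pop \<phi>)"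
proof -
  assume \<phi>: "\<phi> \<in> Cc_inf"
  obtain R where R: "\<And>z. norm z > R \<Longrightarrow> \<phi> z = 0" using Cc_inf_csupp[OF \<phi>] by (auto simp: csupp_def)
  have 1: "\<And>z. norm z > R \<Longrightarrow> dir_deriv e \<phi> z = 0" for e by (rule dir_deriv_zero_outside[OF R])
  have 2: "\<And>z. norm z > R \<Longrightarrow> dir_deriv e (dir_deriv e \<phi>) z = 0" for e by (rule dir_deriv_zero_outside[OF 1])
  show ?thesis
    using continuous_Pop[OF Cc_inf_Ck[OF \<phi>]] R 1 2 by (auto simp: csupp_def Pop_def intro!: exI[of _ R])
qed

text \<open>
  The flux term below: multiplying \<open>\<mu>u + Pu\<close> by \<open>\<chi> \<Phi>'(u)\<close> with the convex function
  \<open>\<Phi>(w) = (|w|\<^sup>2 + \<delta>\<^sup>2)\<^bsup>p/2\<^esup>\<close>, everything but a nonnegative term is an exact derivative.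
\<close>

definition Flux :: "real \<Rightarrow> 'a \<Rightarrow> real" where
  "Flux R z = (\<Sum>e\<in>Basis. (B z \<bullet> e) * cut1 R e z) + \<kappa> * (\<Sum>e\<in>E. cut2 R e z)"

lemma csupp_Flux: "R > 0 \<Longrightarrow> csupp (Flux R)"
  unfolding Flux_def
  by (intro csupp_add csupp_sum csupp_mult csupp_cut continuous_intros continuous_B) auto

lemma energy_regularized:
  assumes p: "1 < p" and u: "Ck 2 u" and R: "R > 0" and \<delta>: "\<delta> > 0"
  defines "N \<equiv> \<lambda>z. (norm (u z))\<^sup>2 + \<delta>\<^sup>2"
  shows "0 \<le> (\<integral>z. cut0 R z * (p * N z powr (p / 2 - 1) * (u z \<bullet> (\<mu> *\<^sub>R u z + Pop u z))
      - p * (\<mu> - d) * (N z powr (p / 2 - 1) * (norm (u z))\<^sup>2)) + N z powr (p / 2) * Flux R z \<partial>lborel)"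
proof -
  have N0: "N z > 0" for z using \<delta> by (simp add: N_def add_nonneg_pos)
  have u_diff: "u differentiable (at z)" and du: "e \<in> Basis \<Longrightarrow> dir_deriv e u differentiable (at z)"
    and cdu: "e \<in> Basis \<Longrightarrow> continuous_on UNIV (dir_deriv e u)"
    and cddu: "e \<in> Basis \<Longrightarrow> continuous_on UNIV (dir_deriv e (dir_deriv e u))" for z e
    using u Ck_continuous[of 1 "dir_deriv e u"] by (auto simp: numeral_2_eq_2)
  have cu: "continuous_on UNIV u" by (rule Ck_continuous[OF u])
  have cN: "continuous_on UNIV N" unfolding N_def by (intro continuous_intros cu)
  \<comment> \<open>\<open>Q\<close> is \<open>\<Phi>(u)\<close>; \<open>Q1 e\<close> and
    \<open>Q2 e\<close> are its first and second derivatives along \<open>e\<close>. The shift by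
    \<open>\<delta>^2\<close> keeps the base \<open>N\<close> positive, so that its powers are
    differentiable also for \<open>p < 2\<close>.\<close>
  define \<psi> where "\<psi> z = N z powr (p / 2 - 1)" for z
  define Q where "Q z = N z powr (p / 2)" for z
  define Q1 where "Q1 e z = p * \<psi> z * (u z \<bullet> dir_deriv e u z)" for e z
  define Q2 where "Q2 e z = p * \<psi> z * (dir_deriv e u z \<bullet> dir_deriv e u z + u z \<bullet> dir_deriv e (dir_deriv e u) z)
     + p * (p - 2) * N z powr (p / 2 - 2) * (u z \<bullet> dir_deriv e u z)\<^sup>2" for e z
  have c\<psi>: "continuous_on UNIV \<psi>" "continuous_on UNIV Q"
    "continuous_on UNIV (\<lambda>z. N z powr (p / 2 - 2))"
    unfolding \<psi>_def Q_def by (intro continuous_intros cN; use N0 in \<open>simp add: less_imp_neq[THEN not_sym]\<close>)+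
  have cQ: "continuous_on UNIV (Q1 e)" "continuous_on UNIV (Q2 e)" if "e \<in> Basis" for e
    unfolding Q1_def Q2_def by (intro continuous_intros c\<psi> cu cdu cddu that)+
  have dN: "((\<lambda>t. N (z + t *\<^sub>R e)) has_real_derivative 2 * (u z \<bullet> dir_deriv e u z)) (at 0)" for z e
  proof -
    have "((\<lambda>t. u (z + t *\<^sub>R e)) has_vector_derivative dir_deriv e u z) (at 0)"
      using has_vector_derivative_line[of u z 0 e] u_diff by simp
    from DERIV_add[OF inner_has_real_derivative[OF this this] DERIV_const[of "\<delta>\<^sup>2"]]
    show ?thesis by (simp add: N_def dot_square_norm inner_commute)
  qed
  have dQ: "((\<lambda>t. Q (z + t *\<^sub>R e)) has_real_derivative Q1 e z) (at 0)" for z e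
    unfolding Q_def by (rule DERIV_cong[OF DERIV_fun_powr[OF dN, of z e "p / 2"]]) (use N0[of z] in \<open>auto simp: Q1_def \<psi>_def\<close>)
  have dQ1: "((\<lambda>t. Q1 e (z + t *\<^sub>R e)) has_real_derivative Q2 e z) (at 0)" if e: "e \<in> Basis" for z e
  proof -
    have 1: "((\<lambda>t. u (z + t *\<^sub>R e)) has_vector_derivative dir_deriv e u z) (at 0)"
      using has_vector_derivative_line[of u z 0 e] u_diff by simp
    have 2: "((\<lambda>t. dir_deriv e u (z + t *\<^sub>R e)) has_vector_derivative dir_deriv e (dir_deriv e u) z) (at 0)"
      using has_vector_derivative_line[of "dir_deriv e u" z 0 e] du[OF e] by simp
    have 3: "((\<lambda>t. \<psi> (z + t *\<^sub>R e)) has_real_derivative (p - 2) * N z powr (p / 2 - 2) * (u z \<bullet> dir_deriv e u z)) (at 0)"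
      unfolding \<psi>_def by (rule DERIV_cong[OF DERIV_fun_powr[OF dN, of z e "p / 2 - 1"]])
        (use N0[of z] in \<open>auto simp: algebra_simps\<close>)
    have "((\<lambda>t. p * (\<psi> (z + t *\<^sub>R e) * (u (z + t *\<^sub>R e) \<bullet> dir_deriv e u (z + t *\<^sub>R e)))) has_real_derivative Q2 e z) (at 0)"
      using DERIV_cmult[OF DERIV_mult[OF 3 inner_has_real_derivative[OF 1 2]], of p]
      by (rule DERIV_cong) (simp add: Q2_def power2_eq_square algebra_simps)
    then show ?thesis by (simp add: Q1_def mult.assoc)
  qed
  \<comment> \<open>With \<open>u'\<close> the derivative of \<open>u\<close> along
    \<open>e\<close>, the difference is \<open>p N^(p/2-2)\<close> times
    \<open>N |u'|^2 + (p - 2) (u \<bullet> u')^2\<close>. By Cauchy-Schwarz the latter is at least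
    \<open>(p - 1) (u \<bullet> u')^2\<close>, nonnegative also for \<open>p < 2\<close>.\<close>
  have convex: "p * \<psi> z * (u z \<bullet> dir_deriv e (dir_deriv e u) z) \<le> Q2 e z" for e z
  proof -
    let ?a = "u z \<bullet> dir_deriv e u z" and ?b = "norm (dir_deriv e u z)"
    have split: "\<psi> z = N z powr (p / 2 - 2) * N z"
      using powr_add[of "N z" "p / 2 - 2" 1] N0[of z] by (simp add: \<psi>_def)
    have "?a\<^sup>2 \<le> (norm (u z) * ?b)\<^sup>2" using Cauchy_Schwarz_ineq2[of "u z" "dir_deriv e u z"] by (metis abs_le_square_iff abs_mult abs_norm_cancel)
    also have "\<dots> \<le> N z * ?b\<^sup>2" by (simp add: N_def power_mult_distrib mult_right_mono)
    finally have "?a\<^sup>2 \<le> N z * ?b\<^sup>2" .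
    moreover have "(p - 1) * ?a\<^sup>2 \<ge> 0" using p by simp
    ultimately have "0 \<le> N z * ?b\<^sup>2 + (p - 2) * ?a\<^sup>2" by (simp add: algebra_simps)
    then have "0 \<le> p * N z powr (p / 2 - 2) * (N z * ?b\<^sup>2 + (p - 2) * ?a\<^sup>2)" using p by simp
    also have "\<dots> = Q2 e z - p * \<psi> z * (u z \<bullet> dir_deriv e (dir_deriv e u) z)"
      by (simp add: Q2_def split dot_square_norm algebra_simps)
    finally show ?thesis by simp
  qed
  define h where "h z = cut0 R z * (p * \<psi> z * (u z \<bullet> (\<mu> *\<^sub>R u z + Pop u z))
      - p * (\<mu> - d) * (\<psi> z * (norm (u z))\<^sup>2)) + Q z * Flux R z" for z
  \<comment> \<open>The exact part of the integrand: derivatives along \<open>e\<close> of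
    \<open>cut0 * Q\<close>, weighted by \<open>B \<bullet> e\<close>, and of
    \<open>cut0 * Q1 - cut1 * Q\<close>, in which the two mixed terms \<open>cut1 * Q1\<close>
    cancel.\<close>
  define h0 where "h0 z = (\<Sum>e\<in>Basis. (B z \<bullet> e) * (cut0 R z * Q1 e z + cut1 R e z * Q z))
     - \<kappa> * (\<Sum>e\<in>E. 1 * (cut0 R z * Q2 e z - cut2 R e z * Q z))" for z
  have h0_le: "h0 z \<le> h z" for z
  proof -
    have c0: "cut0 R z \<ge> 0" using cutb_range(1)[of R z] by (simp add: cut0_def)
    have X: "u z \<bullet> (\<mu> *\<^sub>R u z + Pop u z) = (\<mu> + W z) * (norm (u z))\<^sup>2 + (\<Sum>e\<in>Basis. (B z \<bullet> e) * (u z \<bullet> dir_deriv e u z))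
       - \<kappa> * (\<Sum>e\<in>E. u z \<bullet> dir_deriv e (dir_deriv e u) z)"
      by (simp add: Pop_def inner_add_right inner_diff_right inner_sum_right dot_square_norm algebra_simps)
    have "p * \<psi> z * (u z \<bullet> (\<mu> *\<^sub>R u z + Pop u z)) = p * \<psi> z * ((\<mu> + W z) * (norm (u z))\<^sup>2)
       + (\<Sum>e\<in>Basis. (B z \<bullet> e) * Q1 e z) - \<kappa> * (\<Sum>e\<in>E. p * \<psi> z * (u z \<bullet> dir_deriv e (dir_deriv e u) z))"
      unfolding X by (simp add: Q1_def sum_distrib_left algebra_simps)
    moreover have "p * \<psi> z * ((\<mu> - d) * (norm (u z))\<^sup>2) \<le> p * \<psi> z * ((\<mu> + W z) * (norm (u z))\<^sup>2)"
      using W_ge[of z] p by (intro mult_left_mono mult_right_mono) (auto simp: \<psi>_def)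
    moreover have "\<kappa> * (\<Sum>e\<in>E. p * \<psi> z * (u z \<bullet> dir_deriv e (dir_deriv e u) z)) \<le> \<kappa> * (\<Sum>e\<in>E. Q2 e z)"
      by (intro mult_left_mono sum_mono convex kappa_nonneg)
    ultimately have "(\<Sum>e\<in>Basis. (B z \<bullet> e) * Q1 e z) - \<kappa> * (\<Sum>e\<in>E. Q2 e z)
       \<le> p * \<psi> z * (u z \<bullet> (\<mu> *\<^sub>R u z + Pop u z)) - p * (\<mu> - d) * (\<psi> z * (norm (u z))\<^sup>2)"
      by (simp add: mult_ac)
    from mult_left_mono[OF this c0]
    show ?thesis
      by (simp add: h0_def h_def Flux_def sum_distrib_left sum.distrib sum_subtractf algebra_simps)
  qed
  have c1: "csupp (\<lambda>z. cut0 R z * Q1 e z + cut1 R e z * Q z)" if "e \<in> Basis" for e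
    using csupp_mult[OF cQ(1)[OF that] csupp_cut(1)[OF R]] csupp_mult[OF c\<psi>(2) csupp_cut(2)[OF R, of e]]
    by (intro csupp_add) (simp_all add: mult.commute)
  have c2: "csupp (\<lambda>z. cut0 R z * Q2 e z - cut2 R e z * Q z)" if "e \<in> Basis" for e
    using csupp_add[OF csupp_mult[OF cQ(2)[OF that] csupp_cut(1)[OF R]]
      csupp_mult[OF continuous_on_minus[OF c\<psi>(2)] csupp_cut(3)[OF R, of e]]]
    by (simp add: mult.commute)
  have c3: "csupp (\<lambda>z. cut0 R z * Q1 e z - cut1 R e z * Q z)" if "e \<in> Basis" for e
    using csupp_add[OF csupp_mult[OF cQ(1)[OF that] csupp_cut(1)[OF R]]
      csupp_mult[OF continuous_on_minus[OF c\<psi>(2)] csupp_cut(2)[OF R, of e]]]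
    by (simp add: mult.commute)
  have c4: "csupp (\<lambda>z. cut0 R z * Q z)"
    using csupp_mult[OF c\<psi>(2) csupp_cut(1)[OF R]] by (simp add: mult.commute)
  have cB: "continuous_on UNIV (\<lambda>z. B z \<bullet> e)" for e by (intro continuous_intros continuous_B)
  have i1: "(\<integral>z. (B z \<bullet> e) * (cut0 R z * Q1 e z + cut1 R e z * Q z) \<partial>lborel) = 0" if e: "e \<in> Basis" for e
  proof (rule integral_derivative_eq_0[OF cB _ c4 c1[OF e]])
    show "B (z + t *\<^sub>R e) \<bullet> e = B z \<bullet> e" for z t by (rule B_invariant[OF e])
    show "((\<lambda>t. cut0 R (z + t *\<^sub>R e) * Q (z + t *\<^sub>R e)) has_real_derivative cut0 R z * Q1 e z + cut1 R e z * Q z) (at 0)" for z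
      using DERIV_mult[OF cut_deriv(1)[OF R e] dQ] by (rule DERIV_cong) (simp add: mult_ac)
  qed
  have i2: "(\<integral>z. 1 * (cut0 R z * Q2 e z - cut2 R e z * Q z) \<partial>lborel) = 0" if e: "e \<in> Basis" for e
  proof (rule integral_derivative_eq_0[OF _ _ c3[OF e] c2[OF e]])
    show "((\<lambda>t. cut0 R (z + t *\<^sub>R e) * Q1 e (z + t *\<^sub>R e) - cut1 R e (z + t *\<^sub>R e) * Q (z + t *\<^sub>R e)) has_real_derivative
       cut0 R z * Q2 e z - cut2 R e z * Q z) (at 0)" for z
      using DERIV_diff[OF DERIV_mult[OF cut_deriv(1)[OF R e] dQ1[OF e]] DERIV_mult[OF cut_deriv(2)[OF R e] dQ]]
      by (rule DERIV_cong) (simp add: algebra_simps)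
  qed auto
  have int1: "integrable lborel (\<lambda>z. (B z \<bullet> e) * (cut0 R z * Q1 e z + cut1 R e z * Q z))" if "e \<in> Basis" for e
    by (rule csupp_integrable[OF csupp_mult[OF cB c1[OF that]]])
  have int2: "integrable lborel (\<lambda>z. 1 * (cut0 R z * Q2 e z - cut2 R e z * Q z))" if "e \<in> E" for e
    using csupp_integrable[OF c2] that E_Basis by auto
  have int_h0: "integrable lborel h0"
    unfolding h0_def by (intro Bochner_Integration.integrable_diff Bochner_Integration.integrable_sum integrable_mult_right int1 int2)
  have "(\<integral>z. h0 z \<partial>lborel) = (\<integral>z. (\<Sum>e\<in>Basis. (B z \<bullet> e) * (cut0 R z * Q1 e z + cut1 R e z * Q z)) \<partial>lborel)
     - (\<integral>z. \<kappa> * (\<Sum>e\<in>E. 1 * (cut0 R z * Q2 e z - cut2 R e z * Q z)) \<partial>lborel)"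
    unfolding h0_def by (intro Bochner_Integration.integral_diff Bochner_Integration.integrable_sum integrable_mult_right int1 int2)
  also have "(\<integral>z. (\<Sum>e\<in>Basis. (B z \<bullet> e) * (cut0 R z * Q1 e z + cut1 R e z * Q z)) \<partial>lborel) = 0"
  proof -
    have "(\<integral>z. (\<Sum>e\<in>Basis. (B z \<bullet> e) * (cut0 R z * Q1 e z + cut1 R e z * Q z)) \<partial>lborel)
      = (\<Sum>e\<in>Basis. \<integral>z. (B z \<bullet> e) * (cut0 R z * Q1 e z + cut1 R e z * Q z) \<partial>lborel)"
      by (rule Bochner_Integration.integral_sum[OF int1])
    also have "\<dots> = 0" by (rule sum.neutral) (use i1 in blast)
    finally show ?thesis .
  qed
  also have "(\<integral>z. \<kappa> * (\<Sum>e\<in>E. 1 * (cut0 R z * Q2 e z - cut2 R e z * Q z)) \<partial>lborel) = 0"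
  proof -
    have "(\<integral>z. (\<Sum>e\<in>E. 1 * (cut0 R z * Q2 e z - cut2 R e z * Q z)) \<partial>lborel) = 0"
      by (subst Bochner_Integration.integral_sum[OF int2]) (use i2 E_Basis in \<open>auto intro!: sum.neutral simp del: mult_1\<close>)
    then show ?thesis by (simp only: integral_mult_right_zero mult_zero_right)
  qed
  finally have "(\<integral>z. h0 z \<partial>lborel) = 0" by simp
  moreover have "(\<integral>z. h0 z \<partial>lborel) \<le> (\<integral>z. h z \<partial>lborel)"
  proof (rule integral_mono[OF int_h0 _ h0_le])
    have "csupp (\<lambda>z. (p * \<psi> z * (u z \<bullet> (\<mu> *\<^sub>R u z + Pop u z)) - p * (\<mu> - d) * (\<psi> z * (norm (u z))\<^sup>2)) * cut0 R z + Q z * Flux R z)"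
      by (intro csupp_add csupp_mult csupp_Flux csupp_cut R c\<psi> continuous_intros cu continuous_Pop u)
    from csupp_integrable[OF this] show "integrable lborel h" by (simp add: h_def[abs_def] mult.commute)
  qed
  ultimately have "0 \<le> (\<integral>z. h z \<partial>lborel)" by simp
  then show ?thesis by (simp only: h_def \<psi>_def Q_def)
qed

end

text \<open>Hoelder's inequality for the image of \<open>f\<close> under \<open>dualp p\<close>,
  whose norm in \<open>L^q\<close> is the power \<open>p - 1\<close> of the norm of
  \<open>f\<close>.\<close>

lemma Lp_Holder_power:
  assumes p: "1 < p" and f: "f \<in> Lp p" and g: "g \<in> Lp p"
  shows "integrable lborel (\<lambda>z. norm (f z) powr (p - 1) * norm (g z))"
    and "(\<integral>z. norm (f z) powr (p - 1) * norm (g z) \<partial>lborel) \<le> Lp_norm p f powr (p - 1) * Lp_norm p g"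
proof -
  obtain q where q: "1 < q" "1 / p + 1 / q = 1" using Holder_conjugate[OF p] .
  have qp: "1 / q + 1 / p = 1" using q by simp
  note d = Lp_dualp[OF p q(2) f]
  have pq: "(p - 1) * q = p"
    using q p by (simp add: field_simps)
  have "Lp_norm q (\<lambda>z. dualp p (f z)) = (\<integral>z. norm (f z) powr p \<partial>lborel) powr (1 / q)"
    by (simp add: Lp_norm_def norm_dualp powr_powr pq)
  also have "1 / q = (1 / p) * (p - 1)" using q p by (simp add: field_simps)
  also have "(\<integral>z. norm (f z) powr p \<partial>lborel) powr ((1 / p) * (p - 1)) = Lp_norm p f powr (p - 1)"
    by (simp only: Lp_norm_def powr_powr)
  finally have n: "Lp_norm q (\<lambda>z. dualp p (f z)) = Lp_norm p f powr (p - 1)" .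
  show "integrable lborel (\<lambda>z. norm (f z) powr (p - 1) * norm (g z))"
    using Lp_Holder(1)[OF q(1) qp d g] by (simp add: norm_dualp)
  show "(\<integral>z. norm (f z) powr (p - 1) * norm (g z) \<partial>lborel) \<le> Lp_norm p f powr (p - 1) * Lp_norm p g"
    using Lp_Holder(2)[OF q(1) qp d g] by (simp add: norm_dualp n)
qed

text \<open>Multiplication by \<open>w^(1/p)\<close> is bounded on \<open>L^p\<close> and turns the
  weighted integral into the \<open>p\<close>-th power of a norm, which is continuous.\<close>

lemma Lp_weighted_tendsto:
  assumes p: "1 < p" and F: "\<And>k. F k \<in> Lp p" and f: "f \<in> Lp p"
    and lim: "(\<lambda>k. Lp_norm p (\<lambda>z. F k z - f z)) \<longlonglongrightarrow> 0"
    and w: "w \<in> borel_measurable borel" "\<And>z. 0 \<le> w z" "\<And>z. w z \<le> C"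
  shows "(\<lambda>k. \<integral>z. w z * norm (F k z) powr p \<partial>lborel) \<longlonglongrightarrow> (\<integral>z. w z * norm (f z) powr p \<partial>lborel)"
proof -
  note [measurable] = w(1)
  define v where "v z = complex_of_real (w z powr (1 / p))" for z
  have [measurable]: "v \<in> borel_measurable borel" unfolding v_def[abs_def] by measurable
  define c where "c = complex_of_real (C powr (1 / p))"
  have vc: "norm (v z * x) \<le> norm (c * x)" for z x
    unfolding v_def c_def norm_mult using p w(2,3)[of z] by (intro mult_right_mono) (auto intro: powr_mono2)
  have vL: "(\<lambda>z. v z * g z) \<in> Lp p" and vN: "Lp_norm p (\<lambda>z. v z * g z) \<le> norm c * Lp_norm p g" if g: "g \<in> Lp p" for g
  proof -
    have [measurable]: "g \<in> borel_measurable borel" using g by auto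
    have m: "(\<lambda>z. v z * g z) \<in> borel_measurable borel" by measurable
    show "(\<lambda>z. v z * g z) \<in> Lp p" by (rule Lp_dominated(1)[OF _ m Lp_cmult[OF g]]) (use p vc in auto)
    show "Lp_norm p (\<lambda>z. v z * g z) \<le> norm c * Lp_norm p g"
      using Lp_dominated(2)[OF _ m Lp_cmult[OF g], of c] p vc Lp_norm_cmult[of p c g] by simp
  qed
  have "(\<lambda>k. Lp_norm p (\<lambda>z. v z * F k z - v z * f z)) \<longlonglongrightarrow> 0"
  proof (rule tendsto_sandwich[OF _ _ tendsto_const])
    show "(\<lambda>k. norm c * Lp_norm p (\<lambda>z. F k z - f z)) \<longlonglongrightarrow> 0" using tendsto_mult_right_zero[OF lim] .
    show "\<forall>\<^sub>F k in sequentially. Lp_norm p (\<lambda>z. v z * F k z - v z * f z) \<le> norm c * Lp_norm p (\<lambda>z. F k z - f z)"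
      using vN[OF Lp_diff[OF _ F f]] p by (auto simp: right_diff_distrib)
  qed auto
  then have "(\<lambda>k. Lp_norm p (\<lambda>z. v z * F k z)) \<longlonglongrightarrow> Lp_norm p (\<lambda>z. v z * f z)"
    by (intro Lp_norm_tendsto p vL F f)
  then have "(\<lambda>k. Lp_norm p (\<lambda>z. v z * F k z) powr p) \<longlonglongrightarrow> Lp_norm p (\<lambda>z. v z * f z) powr p"
    using p by (intro tendsto_powr2) auto
  moreover have "Lp_norm p (\<lambda>z. v z * g z) powr p = (\<integral>z. w z * norm (g z) powr p \<partial>lborel)" for g
    using p w(2) by (simp add: Lp_norm_powr v_def norm_mult powr_mult powr_powr)
  ultimately show ?thesis by simp
qed

lemma integrable_affine:
  fixes g :: "'a::euclidean_space \<Rightarrow> 'b::{banach, second_countable_topology}"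
  assumes g: "integrable lborel g" and c: "c \<noteq> 0"
  shows "integrable lborel (\<lambda>w. g (a + c *\<^sub>R w))"
proof -
  have [measurable]: "g \<in> borel_measurable borel" using g by auto
  have "integrable (density (distr lborel borel (\<lambda>x. a + c *\<^sub>R x)) (\<lambda>_. ennreal (\<bar>c\<bar> ^ DIM('a)))) g"
    using lborel_affine[OF c, of a] g by simp
  then have "integrable (distr lborel borel (\<lambda>x. a + c *\<^sub>R x)) (\<lambda>y. (\<bar>c\<bar> ^ DIM('a)) *\<^sub>R g y)"
    by (subst (asm) integrable_density) auto
  then have "integrable lborel (\<lambda>w. (\<bar>c\<bar> ^ DIM('a)) *\<^sub>R g (a + c *\<^sub>R w))"
    by (subst (asm) integrable_distr_eq) auto
  then have "integrable lborel (\<lambda>w. (1 / \<bar>c\<bar> ^ DIM('a)) *\<^sub>R (\<bar>c\<bar> ^ DIM('a)) *\<^sub>R g (a + c *\<^sub>R w))"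
    by (rule integrable_scaleR_right)
  then show ?thesis using c by simp
qed

lemma Lp_affine:
  assumes "f \<in> Lp p" "c \<noteq> 0"
  shows "(\<lambda>w. f (a + c *\<^sub>R w)) \<in> Lp p"
proof (rule LpI)
  have [measurable]: "f \<in> borel_measurable borel" using assms by auto
  show "(\<lambda>w. f (a + c *\<^sub>R w)) \<in> borel_measurable borel" by measurable
  show "integrable lborel (\<lambda>w. norm (f (a + c *\<^sub>R w)) powr p)"
    by (rule integrable_affine[OF Lp_integrable[OF assms(1)] assms(2)])
qed

lemma integral_derivative_eq_0_complex:
  fixes g g' :: "'a::euclidean_space \<Rightarrow> complex"
  assumes a: "continuous_on UNIV a" "\<And>z t. a (z + t *\<^sub>R e) = a z" and g: "csupp g" and g': "csupp g'"
    and D: "\<And>z. ((\<lambda>t. g (z + t *\<^sub>R e)) has_vector_derivative g' z) (at 0)"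
  shows "(\<integral>z. a z *\<^sub>R g' z \<partial>lborel) = 0"
proof -
  have int: "integrable lborel (\<lambda>z. a z *\<^sub>R g' z)" by (rule csupp_integrable[OF csupp_scaleR[OF a(1) g']])
  have comp: "csupp (\<lambda>z. T (h z))" if "bounded_linear T" "csupp h" for T :: "complex \<Rightarrow> real" and h :: "'a \<Rightarrow> complex"
    using that(2) bounded_linear.continuous_on[OF that(1)] linear_0[OF bounded_linear.linear[OF that(1)]]
    by (intro csupp_dominated[OF that(2)]) (auto simp: csupp_def)
  have T0: "(\<integral>z. a z * T (g' z) \<partial>lborel) = 0" if T: "bounded_linear T" for T :: "complex \<Rightarrow> real"
  proof (rule integral_derivative_eq_0[OF a comp[OF T g] comp[OF T g']])
    show "((\<lambda>t. T (g (z + t *\<^sub>R e))) has_real_derivative T (g' z)) (at 0)" for z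
      using bounded_linear.has_vector_derivative[OF T D] by (simp add: has_real_derivative_iff_has_vector_derivative)
  qed
  show ?thesis
  proof (rule complex_eqI)
    show "Re (\<integral>z. a z *\<^sub>R g' z \<partial>lborel) = Re 0"
      using integral_Re[OF int] T0[OF bounded_linear_Re] by simp
    show "Im (\<integral>z. a z *\<^sub>R g' z \<partial>lborel) = Im 0"
      using integral_Im[OF int] T0[OF bounded_linear_Im] by simp
  qed
qed

context transport_diffusion
begin

text \<open>The limit \<open>\<delta> \<rightarrow> 0\<close> of \<open>energy_regularized\<close>.
  For \<open>p < 2\<close> the factor \<open>N^(p/2-1)\<close> blows up at zeros of
  \<open>u\<close>, but it always meets a factor \<open>|u|\<close>, and the product is dominated by
  a power of \<open>N1\<close>, the value of \<open>N\<close> for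
  \<open>\<delta> = 1\<close>.\<close>

lemma energy:
  assumes p: "1 < p" and u: "Ck 2 u" and R: "R > 0"
  shows "p * (\<mu> - d) * (\<integral>z. cut0 R z * norm (u z) powr p \<partial>lborel)
    \<le> p * (\<integral>z. cut0 R z * (norm (u z) powr (p - 1) * norm (\<mu> *\<^sub>R u z + Pop u z)) \<partial>lborel)
      + (\<integral>z. \<bar>Flux R z\<bar> * norm (u z) powr p \<partial>lborel)"
proof -
  define Lu where "Lu z = \<mu> *\<^sub>R u z + Pop u z" for z
  have cu: "continuous_on UNIV u" by (rule Ck_continuous[OF u])
  have cLu: "continuous_on UNIV Lu" unfolding Lu_def by (intro continuous_intros cu continuous_Pop u)
  have cF: "continuous_on UNIV (Flux R)" "continuous_on UNIV (cut0 R :: 'a \<Rightarrow> real)"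
    using csupp_Flux[OF R] csupp_cut(1)[OF R] by (auto simp: csupp_def)
  have [measurable]: "u \<in> borel_measurable borel" "Lu \<in> borel_measurable borel"
    "Flux R \<in> borel_measurable borel" "cut0 R \<in> borel_measurable (borel :: 'a measure)"
    using cu cLu cF by (auto intro: borel_measurable_continuous_onI)
  define \<delta> where "\<delta> k = 1 / real (Suc k)" for k
  have \<delta>: "\<delta> k > 0" "\<delta> k \<le> 1" for k by (auto simp: \<delta>_def)
  have \<delta>lim: "\<delta> \<longlonglongrightarrow> 0" using LIMSEQ_inverse_real_of_nat by (simp add: \<delta>_def[abs_def] inverse_eq_divide)
  define N where "N k z = (norm (u z))\<^sup>2 + (\<delta> k)\<^sup>2" for k z
  define N1 where "N1 z = (norm (u z))\<^sup>2 + 1" for z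
  have [measurable]: "N k \<in> borel_measurable borel" for k unfolding N_def[abs_def] by measurable
  have N: "N k z > 0" "N k z \<le> N1 z" "(norm (u z))\<^sup>2 \<le> N k z" for k z
    using \<delta>[of k] by (auto simp: N_def N1_def add_nonneg_pos power_le_one)
  have N1pos: "N1 z > 0" for z by (simp add: N1_def add_nonneg_pos)
  have Nlim: "(\<lambda>k. N k z) \<longlonglongrightarrow> (norm (u z))\<^sup>2" for z
  proof -
    have "(\<lambda>k. N k z) \<longlonglongrightarrow> (norm (u z))\<^sup>2 + 0\<^sup>2" unfolding N_def by (intro tendsto_intros \<delta>lim)
    then show ?thesis by simp
  qed
  define h where "h k z = cut0 R z * (p * N k z powr (p / 2 - 1) * (u z \<bullet> Lu z)
      - p * (\<mu> - d) * (N k z powr (p / 2 - 1) * (norm (u z))\<^sup>2)) + N k z powr (p / 2) * Flux R z" for k z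
  define H where "H z = cut0 R z * (p * norm (u z) powr (p - 2) * (u z \<bullet> Lu z)
      - p * (\<mu> - d) * norm (u z) powr p) + norm (u z) powr p * Flux R z" for z
  define b where "b z = \<bar>cut0 R z\<bar> * (p * N1 z powr ((p - 1) / 2) * norm (Lu z) + \<bar>p * (\<mu> - d)\<bar> * N1 z powr (p / 2))
      + N1 z powr (p / 2) * \<bar>Flux R z\<bar>" for z
  have h0: "0 \<le> (\<integral>z. h k z \<partial>lborel)" for k
    using energy_regularized[OF p u R \<delta>(1)[of k], of \<mu>] unfolding h_def N_def Lu_def .
  \<comment> \<open>\<open>|u| \<le> N^(1/2)\<close> turns the possibly negative exponent
    \<open>p/2 - 1\<close> into the positive \<open>(p - 1)/2\<close>, and then the power is
    monotone in \<open>N\<close>.\<close>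
  have e1: "N k z powr (p / 2 - 1) * norm (u z) \<le> N1 z powr ((p - 1) / 2)" for k z
  proof -
    have "norm (u z) = ((norm (u z))\<^sup>2) powr (1 / 2)" by (simp add: powr_half_sqrt)
    also have "\<dots> \<le> N k z powr (1 / 2)" using N(3)[of z k] by (intro powr_mono2) auto
    finally have "N k z powr (p / 2 - 1) * norm (u z) \<le> N k z powr (p / 2 - 1) * N k z powr (1 / 2)"
      by (intro mult_left_mono) auto
    also have "\<dots> = N k z powr ((p - 1) / 2)" by (simp add: powr_add[symmetric] field_simps)
    also have "\<dots> \<le> N1 z powr ((p - 1) / 2)" using N(1,2)[of k z] p by (intro powr_mono2) auto
    finally show ?thesis .
  qed
  have e2: "N k z powr (p / 2) \<le> N1 z powr (p / 2)" for k z
    using N(1,2)[of k z] p by (intro powr_mono2) auto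
  have e3: "N k z powr (p / 2 - 1) * (norm (u z))\<^sup>2 \<le> N1 z powr (p / 2)" for k z
  proof -
    have "N k z powr (p / 2 - 1) * (norm (u z))\<^sup>2 \<le> N k z powr (p / 2 - 1) * N k z powr 1"
      using N(1)[of k z] N(3)[of z k] by (intro mult_left_mono) (auto simp: less_imp_le)
    also have "\<dots> = N k z powr (p / 2 - 1 + 1)" by (rule powr_add[symmetric])
    also have "\<dots> = N k z powr (p / 2)" by simp
    finally show ?thesis using e2[of k z] by simp
  qed
  have hb: "norm (h k z) \<le> b z" for k z
  proof -
    have a1: "\<bar>p * N k z powr (p / 2 - 1) * (u z \<bullet> Lu z)\<bar> \<le> p * N1 z powr ((p - 1) / 2) * norm (Lu z)"
    proof -
      have "\<bar>p * N k z powr (p / 2 - 1) * (u z \<bullet> Lu z)\<bar> = p * N k z powr (p / 2 - 1) * \<bar>u z \<bullet> Lu z\<bar>"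
        using p by (simp add: abs_mult)
      also have "\<dots> \<le> p * N k z powr (p / 2 - 1) * (norm (u z) * norm (Lu z))"
        using p by (intro mult_left_mono Cauchy_Schwarz_ineq2) auto
      also have "\<dots> = p * (N k z powr (p / 2 - 1) * norm (u z)) * norm (Lu z)" by simp
      also have "\<dots> \<le> p * N1 z powr ((p - 1) / 2) * norm (Lu z)"
        using p by (intro mult_right_mono mult_left_mono e1) auto
      finally show ?thesis .
    qed
    have a2: "\<bar>p * (\<mu> - d) * (N k z powr (p / 2 - 1) * (norm (u z))\<^sup>2)\<bar> \<le> \<bar>p * (\<mu> - d)\<bar> * N1 z powr (p / 2)"
      unfolding abs_mult[of "p * (\<mu> - d)"] using e3[of k z] by (intro mult_left_mono) auto
    have a3: "\<bar>N k z powr (p / 2) * Flux R z\<bar> \<le> N1 z powr (p / 2) * \<bar>Flux R z\<bar>"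
      using e2[of k z] by (simp add: abs_mult mult_right_mono)
    have "norm (h k z) \<le> \<bar>cut0 R z\<bar> * \<bar>p * N k z powr (p / 2 - 1) * (u z \<bullet> Lu z)
      - p * (\<mu> - d) * (N k z powr (p / 2 - 1) * (norm (u z))\<^sup>2)\<bar> + \<bar>N k z powr (p / 2) * Flux R z\<bar>"
      unfolding h_def real_norm_def abs_mult[symmetric] by (rule abs_triangle_ineq)
    also have "\<dots> \<le> b z"
      unfolding b_def using a1 a2 a3 by (intro add_mono mult_left_mono) auto
    finally show ?thesis .
  qed
  have cb: "integrable lborel b"
  proof (rule csupp_integrable)
    have cN1: "continuous_on UNIV N1" unfolding N1_def by (intro continuous_intros cu)
    have cN1p: "continuous_on UNIV (\<lambda>z. N1 z powr r)" for r
      by (intro continuous_intros cN1) (use N1pos in \<open>simp add: less_imp_neq[THEN not_sym]\<close>)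
    have ab: "csupp (\<lambda>z. \<bar>g z\<bar>)" if "csupp g" for g :: "'a \<Rightarrow> real"
      using that by (intro csupp_dominated[OF that]) (auto simp: csupp_def intro: continuous_intros)
    have "csupp (\<lambda>z. (p * N1 z powr ((p - 1) / 2) * norm (Lu z) + \<bar>p * (\<mu> - d)\<bar> * N1 z powr (p / 2)) * \<bar>cut0 R z\<bar>
      + N1 z powr (p / 2) * \<bar>Flux R z\<bar>)"
      by (intro csupp_add csupp_mult ab csupp_Flux csupp_cut R continuous_intros cN1p cLu)
    then show "csupp b" by (simp add: b_def[abs_def] mult.commute)
  qed
  have hlim: "(\<lambda>k. h k z) \<longlonglongrightarrow> H z" for z
  proof -
    have l1: "(\<lambda>k. N k z powr (p / 2)) \<longlonglongrightarrow> norm (u z) powr p"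
    proof -
      have "(\<lambda>k. N k z powr (p / 2)) \<longlonglongrightarrow> ((norm (u z))\<^sup>2) powr (p / 2)"
        using p N(1) by (intro tendsto_powr2 Nlim tendsto_const) (auto simp: less_imp_le)
      also have "((norm (u z))\<^sup>2) powr (p / 2) = norm (u z) powr p"
        by (cases "u z = 0") (auto simp: powr_powr simp flip: powr_numeral)
      finally show ?thesis .
    qed
    have l2: "(\<lambda>k. p * N k z powr (p / 2 - 1) * (u z \<bullet> Lu z)) \<longlonglongrightarrow> p * norm (u z) powr (p - 2) * (u z \<bullet> Lu z)"
      and l3: "(\<lambda>k. N k z powr (p / 2 - 1) * (norm (u z))\<^sup>2) \<longlonglongrightarrow> norm (u z) powr p"
    proof -
      \<comment> \<open>A power with a possibly negative exponent converges in general only away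
        from the zeros of \<open>u\<close>; at a zero both products vanish for every
        \<open>k\<close>.\<close>
      have *: "(\<lambda>k. N k z powr (p / 2 - 1)) \<longlonglongrightarrow> norm (u z) powr (p - 2)" if "u z \<noteq> 0"
      proof -
        have "(\<lambda>k. N k z powr (p / 2 - 1)) \<longlonglongrightarrow> ((norm (u z))\<^sup>2) powr (p / 2 - 1)"
          using that by (intro tendsto_powr Nlim tendsto_const) auto
        also have "((norm (u z))\<^sup>2) powr (p / 2 - 1) = norm (u z) powr (2 * (p / 2 - 1))"
          using that by (simp add: powr_powr flip: powr_numeral)
        also have "2 * (p / 2 - 1) = p - 2" by simp
        finally show ?thesis .
      qed
      show "(\<lambda>k. p * N k z powr (p / 2 - 1) * (u z \<bullet> Lu z)) \<longlonglongrightarrow> p * norm (u z) powr (p - 2) * (u z \<bullet> Lu z)"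
      proof (cases "u z = 0")
        case False
        then show ?thesis by (intro tendsto_mult tendsto_const *)
      qed simp
      have "norm (u z) powr (p - 2) * (norm (u z))\<^sup>2 = norm (u z) powr p" if "u z \<noteq> 0"
        using that by (simp add: powr_add[symmetric] flip: powr_numeral)
      then show "(\<lambda>k. N k z powr (p / 2 - 1) * (norm (u z))\<^sup>2) \<longlonglongrightarrow> norm (u z) powr p"
        using tendsto_mult[OF * tendsto_const, of "(norm (u z))\<^sup>2"] by (cases "u z = 0") auto
    qed
    show ?thesis unfolding h_def H_def by (intro tendsto_intros l1 l2 l3)
  qed
  have mh: "h k \<in> borel_measurable borel" for k unfolding h_def[abs_def] by measurable
  have mH: "H \<in> borel_measurable borel" unfolding H_def[abs_def] by measurable
  have lim: "(\<lambda>k. \<integral>z. h k z \<partial>lborel) \<longlonglongrightarrow> (\<integral>z. H z \<partial>lborel)" and intH: "integrable lborel H"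
    using integral_dominated_convergence[of H lborel h b] integrable_dominated_convergence[of H lborel h b] cb hlim hb mh mH by auto
  have H0: "0 \<le> (\<integral>z. H z \<partial>lborel)" by (rule LIMSEQ_le_const[OF lim]) (use h0 in auto)
  have cup: "continuous_on UNIV (\<lambda>z. norm (u z) powr r)" if "r > 0" for r
    by (rule continuous_on_powr') (use that in \<open>auto intro!: continuous_intros cu\<close>)
  have i1: "integrable lborel (\<lambda>z. cut0 R z * (norm (u z) powr (p - 1) * norm (Lu z)))"
    using csupp_integrable[OF csupp_mult[OF _ csupp_cut(1)[OF R], of "\<lambda>z. norm (u z) powr (p - 1) * norm (Lu z)"]]
      cup[of "p - 1"] p cLu by (simp add: mult.commute continuous_intros)
  have i2: "integrable lborel (\<lambda>z. cut0 R z * norm (u z) powr p)"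
    using csupp_integrable[OF csupp_mult[OF cup csupp_cut(1)[OF R], of p]] p by (simp add: mult.commute)
  have i3: "integrable lborel (\<lambda>z. \<bar>Flux R z\<bar> * norm (u z) powr p)"
    using integrable_abs[OF csupp_integrable[OF csupp_mult[OF cup csupp_Flux[OF R], of p]]] p by (simp add: abs_mult mult.commute)
  have "(\<integral>z. H z \<partial>lborel) \<le> (\<integral>z. p * (cut0 R z * (norm (u z) powr (p - 1) * norm (Lu z)))
      - p * (\<mu> - d) * (cut0 R z * norm (u z) powr p) + \<bar>Flux R z\<bar> * norm (u z) powr p \<partial>lborel)"
  proof (rule integral_mono[OF intH])
    show "integrable lborel (\<lambda>z. p * (cut0 R z * (norm (u z) powr (p - 1) * norm (Lu z)))
      - p * (\<mu> - d) * (cut0 R z * norm (u z) powr p) + \<bar>Flux R z\<bar> * norm (u z) powr p)"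
      by (intro Bochner_Integration.integrable_add Bochner_Integration.integrable_diff integrable_mult_right i1 i2 i3)
    fix z :: 'a
    have c0: "cut0 R z \<ge> 0" using cutb_range(1)[of R z] by (simp add: cut0_def)
    have "norm (u z) powr (p - 2) * (u z \<bullet> Lu z) \<le> norm (u z) powr (p - 2) * (norm (u z) * norm (Lu z))"
      by (intro mult_left_mono norm_cauchy_schwarz) auto
    also have "\<dots> = norm (u z) powr (p - 1) * norm (Lu z)"
      by (cases "u z = 0") (auto simp: powr_mult_base mult.assoc[symmetric] mult.commute[of _ "norm (u z)"])
    finally have "p * norm (u z) powr (p - 2) * (u z \<bullet> Lu z) \<le> p * (norm (u z) powr (p - 1) * norm (Lu z))"
      using p by (simp add: mult.assoc)
    then have "cut0 R z * (p * norm (u z) powr (p - 2) * (u z \<bullet> Lu z) - p * (\<mu> - d) * norm (u z) powr p)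
      \<le> cut0 R z * (p * (norm (u z) powr (p - 1) * norm (Lu z)) - p * (\<mu> - d) * norm (u z) powr p)"
      using c0 by (intro mult_left_mono) auto
    moreover have "norm (u z) powr p * Flux R z \<le> \<bar>Flux R z\<bar> * norm (u z) powr p"
      by (subst mult.commute) (intro mult_right_mono, auto)
    ultimately show "H z \<le> p * (cut0 R z * (norm (u z) powr (p - 1) * norm (Lu z)))
      - p * (\<mu> - d) * (cut0 R z * norm (u z) powr p) + \<bar>Flux R z\<bar> * norm (u z) powr p"
      unfolding H_def by (simp add: algebra_simps)
  qed
  also have "\<dots> = p * (\<integral>z. cut0 R z * (norm (u z) powr (p - 1) * norm (Lu z)) \<partial>lborel)
     - p * (\<mu> - d) * (\<integral>z. cut0 R z * norm (u z) powr p \<partial>lborel) + (\<integral>z. \<bar>Flux R z\<bar> * norm (u z) powr p \<partial>lborel)"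
    using i1 i2 i3 by simp
  finally show ?thesis using H0 unfolding Lu_def by linarith
qed

section \<open>Removing the cutoff\<close>

definition Flux_const :: real where
  "Flux_const = 6 * (norm (B 0) + L) + \<kappa> * (30 * card E)"

text \<open>The cutoff derivatives carry a factor \<open>1 / R^2\<close>. For fixed \<open>z\<close>
  this makes the flux vanish in the limit, while for \<open>|z| \<le> R\<close> it compensates the
  growth of \<open>|B z| |z|\<close>, which gives the uniform \<open>Flux_const\<close> with 6 from
  \<open>cut1\<close> and 30 = 24 + 6 from \<open>cut2\<close>. Dominated convergence in
  \<open>cutoff_limits\<close> uses both facts.\<close>

lemma Flux_le:
  assumes R: "R \<ge> 1"
  shows "\<bar>Flux R z\<bar> \<le> (6 * norm (B z) * norm z + \<kappa> * (card E * (24 * (norm z)\<^sup>2 + 6))) / R\<^sup>2"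
proof -
  have c: "0 \<le> cutb R z" "cutb R z \<le> 1" "(cutb R z)\<^sup>2 \<le> 1"
    using cutb_range[of R z] by (auto simp: power_le_one)
  have "(\<Sum>e\<in>Basis. (B z \<bullet> e) * cut1 R e z) = - (6 / R\<^sup>2) * (cutb R z)\<^sup>2 * (\<Sum>e\<in>Basis. (B z \<bullet> e) * (z \<bullet> e))"
    by (simp add: cut1_def sum_distrib_left sum_divide_distrib sum_negf mult_ac)
  also have "(\<Sum>e\<in>Basis. (B z \<bullet> e) * (z \<bullet> e)) = B z \<bullet> z" by (rule euclidean_inner[symmetric])
  finally have 1: "\<bar>\<Sum>e\<in>Basis. (B z \<bullet> e) * cut1 R e z\<bar> \<le> 6 * norm (B z) * norm z / R\<^sup>2"
  proof -
    assume eq: "(\<Sum>e\<in>Basis. (B z \<bullet> e) * cut1 R e z) = - (6 / R\<^sup>2) * (cutb R z)\<^sup>2 * (B z \<bullet> z)"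
    have "\<bar>- (6 / R\<^sup>2) * (cutb R z)\<^sup>2 * (B z \<bullet> z)\<bar> = (6 / R\<^sup>2) * ((cutb R z)\<^sup>2 * \<bar>B z \<bullet> z\<bar>)"
      by (simp add: abs_mult)
    also have "\<dots> \<le> (6 / R\<^sup>2) * (1 * (norm (B z) * norm z))"
      using c by (intro mult_left_mono mult_mono Cauchy_Schwarz_ineq2) auto
    finally show ?thesis using eq by simp
  qed
  have "\<bar>cut2 R e z\<bar> \<le> (24 * (norm z)\<^sup>2 + 6) / R\<^sup>2" if e: "e \<in> E" for e
  proof -
    have "\<bar>z \<bullet> e\<bar> \<le> norm z" using Basis_le_norm E_Basis e by blast
    then have ze: "(z \<bullet> e)\<^sup>2 \<le> (norm z)\<^sup>2" by (metis abs_le_square_iff abs_norm_cancel)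
    have R4: "24 / R ^ 4 \<le> 24 / R\<^sup>2" using R by (intro divide_left_mono power_increasing) auto
    have "\<bar>cut2 R e z\<bar> \<le> 24 / R ^ 4 * (z \<bullet> e)\<^sup>2 * cutb R z + 6 / R\<^sup>2 * (cutb R z)\<^sup>2"
      unfolding cut2_def using c by (intro order_trans[OF abs_triangle_ineq4]) (simp add: abs_mult)
    also have "\<dots> \<le> 24 / R\<^sup>2 * (norm z)\<^sup>2 * 1 + 6 / R\<^sup>2 * 1"
      using c ze R4 R by (intro add_mono mult_mono) auto
    finally show ?thesis by (simp add: add_divide_distrib)
  qed
  then have *: "\<bar>\<Sum>e\<in>E. cut2 R e z\<bar> \<le> card E * ((24 * (norm z)\<^sup>2 + 6) / R\<^sup>2)"
    by (intro order_trans[OF sum_abs] sum_bounded_above)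
  then have 2: "\<bar>\<kappa> * (\<Sum>e\<in>E. cut2 R e z)\<bar> \<le> \<kappa> * (card E * ((24 * (norm z)\<^sup>2 + 6) / R\<^sup>2))"
    unfolding abs_mult using kappa_nonneg mult_left_mono[OF * kappa_nonneg] by simp
  show ?thesis
    unfolding Flux_def using abs_triangle_ineq[of "\<Sum>e\<in>Basis. (B z \<bullet> e) * cut1 R e z" "\<kappa> * (\<Sum>e\<in>E. cut2 R e z)"] 1 2
    by (simp add: add_divide_distrib distrib_left)
qed

lemma Flux_bounded:
  assumes R: "R \<ge> 1"
  shows "\<bar>Flux R z\<bar> \<le> Flux_const"
proof (cases "norm z \<ge> R")
  case True
  then have "cutb R z = 0" using R by (intro cutb_zero) auto
  then have "Flux R z = 0" by (simp add: Flux_def cut1_def cut2_def)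
  then show ?thesis using L_nonneg kappa_nonneg by (simp add: Flux_const_def)
next
  case False
  then have z: "norm z \<le> R" by simp
  have "norm (B z) \<le> norm (B 0) + norm (B z - B 0)" using norm_triangle_ineq[of "B 0" "B z - B 0"] by simp
  also have "norm (B z - B 0) \<le> L * norm z" using B_lipschitz[of z 0] by simp
  also have "norm (B 0) + L * norm z \<le> norm (B 0) * R + L * R"
    using R z L_nonneg by (intro add_mono mult_left_mono) (auto simp: mult_le_cancel_left1)
  finally have "norm (B z) \<le> (norm (B 0) + L) * R" by (simp add: distrib_right)
  then have "norm (B z) * norm z \<le> ((norm (B 0) + L) * R) * R"
    using z R L_nonneg by (intro mult_mono) auto
  then have 1: "6 * norm (B z) * norm z \<le> 6 * (norm (B 0) + L) * R\<^sup>2" by (simp add: power2_eq_square algebra_simps)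
  have "(norm z)\<^sup>2 \<le> R\<^sup>2" "1 \<le> R\<^sup>2" using z R by (auto intro: power_mono)
  then have "24 * (norm z)\<^sup>2 + 6 \<le> 30 * R\<^sup>2" by simp
  then have "\<kappa> * (card E * (24 * (norm z)\<^sup>2 + 6)) \<le> \<kappa> * (card E * (30 * R\<^sup>2))"
    using kappa_nonneg by (intro mult_left_mono) auto
  then have "6 * norm (B z) * norm z + \<kappa> * (card E * (24 * (norm z)\<^sup>2 + 6)) \<le> Flux_const * R\<^sup>2"
    using 1 by (simp add: Flux_const_def algebra_simps)
  moreover have "R\<^sup>2 > 0" using R by simp
  ultimately have "(6 * norm (B z) * norm z + \<kappa> * (card E * (24 * (norm z)\<^sup>2 + 6))) / R\<^sup>2 \<le> Flux_const"
    by (simp add: divide_le_eq)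
  then show ?thesis using Flux_le[OF R, of z] by simp
qed

lemma Flux_tendsto: "(\<lambda>k. Flux (real (Suc k)) z) \<longlonglongrightarrow> 0"
proof (rule tendsto_rabs_zero_cancel, rule tendsto_sandwich[OF _ _ tendsto_const])
  let ?C = "6 * norm (B z) * norm z + \<kappa> * (card E * (24 * (norm z)\<^sup>2 + 6))"
  have "(\<lambda>k. ?C * (inverse (real (Suc k)))\<^sup>2) \<longlonglongrightarrow> ?C * 0\<^sup>2"
    by (intro tendsto_intros LIMSEQ_inverse_real_of_nat)
  then show "(\<lambda>k. ?C / (real (Suc k))\<^sup>2) \<longlonglongrightarrow> 0" by (simp add: divide_inverse power_inverse)
  show "\<forall>\<^sub>F k in sequentially. \<bar>Flux (real (Suc k)) z\<bar> \<le> ?C / (real (Suc k))\<^sup>2"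
    by (intro always_eventually allI Flux_le) simp
qed auto

lemma cut0_range: "0 \<le> cut0 R z" "cut0 R z \<le> 1"
  using cutb_range[of R z] by (auto simp: cut0_def power_le_one)

lemma cut0_tendsto: "(\<lambda>k. cut0 (real (Suc k)) z) \<longlonglongrightarrow> 1"
proof -
  have "(\<lambda>k. (max 0 (1 - (z \<bullet> z) * (inverse (real (Suc k)))\<^sup>2)) ^ 3) \<longlonglongrightarrow> (max 0 (1 - (z \<bullet> z) * 0\<^sup>2)) ^ 3"
    by (intro tendsto_intros LIMSEQ_inverse_real_of_nat)
  then show ?thesis by (simp add: cut0_def cutb_def divide_inverse power_inverse)
qed

lemma cutoff_limits:
  fixes f :: "'a \<Rightarrow> complex"
  assumes p: "1 < p" and f: "f \<in> Lp p"
  shows "(\<lambda>k. \<integral>z. cut0 (real (Suc k)) z * norm (f z) powr p \<partial>lborel) \<longlonglongrightarrow> (\<integral>z. norm (f z) powr p \<partial>lborel)"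
    and "(\<lambda>k. \<integral>z. \<bar>Flux (real (Suc k)) z\<bar> * norm (f z) powr p \<partial>lborel) \<longlonglongrightarrow> 0"
proof -
  have [measurable]: "f \<in> borel_measurable borel" using f by auto
  have [measurable]: "Flux (real (Suc k)) \<in> borel_measurable borel"
    "cut0 (real (Suc k)) \<in> borel_measurable (borel :: 'a measure)" for k
    by (rule csupp_measurable, rule csupp_Flux csupp_cut, simp)+
  show "(\<lambda>k. \<integral>z. cut0 (real (Suc k)) z * norm (f z) powr p \<partial>lborel) \<longlonglongrightarrow> (\<integral>z. norm (f z) powr p \<partial>lborel)"
  proof (rule integral_dominated_convergence[OF _ _ Lp_integrable[OF f]])
    show "AE z in lborel. (\<lambda>k. cut0 (real (Suc k)) z * norm (f z) powr p) \<longlonglongrightarrow> norm (f z) powr p"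
      using tendsto_mult[OF cut0_tendsto tendsto_const] by (intro AE_I2) fastforce
    show "AE z in lborel. norm (cut0 (real (Suc k)) z * norm (f z) powr p) \<le> norm (f z) powr p" for k
      by (intro AE_I2) (simp add: abs_mult mult_left_le_one_le cut0_range)
  qed (auto simp del: of_nat_Suc)
  have "(\<lambda>k. \<integral>z. \<bar>Flux (real (Suc k)) z\<bar> * norm (f z) powr p \<partial>lborel) \<longlonglongrightarrow> (\<integral>z. 0 \<partial>(lborel :: 'a measure))"
  proof (rule integral_dominated_convergence[where w = "\<lambda>z. Flux_const * norm (f z) powr p"])
    show "AE z in lborel. (\<lambda>k. \<bar>Flux (real (Suc k)) z\<bar> * norm (f z) powr p) \<longlonglongrightarrow> 0"
      using tendsto_mult_left_zero[OF tendsto_rabs_zero[OF Flux_tendsto]] by (intro AE_I2) fastforce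
    show "AE z in lborel. norm (\<bar>Flux (real (Suc k)) z\<bar> * norm (f z) powr p) \<le> Flux_const * norm (f z) powr p" for k
      using Flux_bounded[of "real (Suc k)"] by (intro AE_I2) (auto simp: abs_mult intro: mult_right_mono)
  qed (use Lp_integrable[OF f] in \<open>auto simp del: of_nat_Suc\<close>)
  then show "(\<lambda>k. \<integral>z. \<bar>Flux (real (Suc k)) z\<bar> * norm (f z) powr p \<partial>lborel) \<longlonglongrightarrow> 0" by simp
qed

text \<open>In \<open>energy\<close> the cutoff is sent to 1 and the flux to 0; Hoelder's inequality
  then leaves a factor \<open>Lp_norm p \<phi> powr (p - 1)\<close> on both sides, which is
  cancelled.\<close>

theorem accretive_Cc_inf:
  assumes p: "1 < p" and \<phi>: "\<phi> \<in> Cc_inf"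
  shows "(\<mu> - d) * Lp_norm p \<phi> \<le> Lp_norm p (\<lambda>z. \<mu> *\<^sub>R \<phi> z + Pop \<phi> z)"
proof -
  define Lu where "Lu z = \<mu> *\<^sub>R \<phi> z + Pop \<phi> z" for z
  have fp: "\<phi> \<in> Lp p" using Cc_inf_Lp[OF \<phi>] p by simp
  have csL: "csupp Lu" unfolding Lu_def[abs_def]
    by (intro csupp_add csupp_scaleR csupp_Pop \<phi> Cc_inf_csupp continuous_intros)
  then have Lp: "Lu \<in> Lp p" using p by (intro csupp_Lp) auto
  let ?H = "\<integral>z. norm (\<phi> z) powr (p - 1) * norm (Lu z) \<partial>lborel"
  note H = Lp_Holder_power[OF p fp Lp]
  have le: "p * (\<mu> - d) * (\<integral>z. cut0 (real (Suc k)) z * norm (\<phi> z) powr p \<partial>lborel)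
    \<le> p * ?H + (\<integral>z. \<bar>Flux (real (Suc k)) z\<bar> * norm (\<phi> z) powr p \<partial>lborel)" for k
  proof -
    have [measurable]: "\<phi> \<in> borel_measurable borel" "Lu \<in> borel_measurable borel"
      "cut0 (real (Suc k)) \<in> borel_measurable (borel :: 'a measure)"
      using fp Lp csupp_measurable[OF csupp_cut(1)[of "real (Suc k)"]] by auto
    have pw: "cut0 (real (Suc k)) z * (norm (\<phi> z) powr (p - 1) * norm (Lu z)) \<le> norm (\<phi> z) powr (p - 1) * norm (Lu z)" for z
      by (simp add: mult_left_le_one_le cut0_range)
    have "(\<integral>z. cut0 (real (Suc k)) z * (norm (\<phi> z) powr (p - 1) * norm (Lu z)) \<partial>lborel) \<le> ?H"
    proof (rule integral_mono[OF _ H(1) pw])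
      show "integrable lborel (\<lambda>z. cut0 (real (Suc k)) z * (norm (\<phi> z) powr (p - 1) * norm (Lu z)))"
        by (rule Bochner_Integration.integrable_bound[OF H(1)]) (use pw in \<open>auto simp: abs_mult cut0_range simp del: of_nat_Suc\<close>)
    qed
    then show ?thesis
      using energy[OF p Cc_inf_Ck[OF \<phi>], of "real (Suc k)" \<mu>] p unfolding Lu_def
      by (smt (verit, best) mult_left_mono of_nat_0_less_iff zero_less_Suc)
  qed
  have "p * (\<mu> - d) * (\<integral>z. norm (\<phi> z) powr p \<partial>lborel) \<le> p * ?H + 0"
    by (rule LIMSEQ_le[OF tendsto_mult_left[OF cutoff_limits(1)[OF p fp]] tendsto_add[OF tendsto_const cutoff_limits(2)[OF p fp]]])
      (use le in blast)
  then have "(\<mu> - d) * Lp_norm p \<phi> powr p \<le> ?H" using p by (simp add: Lp_norm_powr mult.assoc)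
  also have "\<dots> \<le> Lp_norm p \<phi> powr (p - 1) * Lp_norm p Lu" by (rule H(2))
  finally have *: "(\<mu> - d) * Lp_norm p \<phi> powr p \<le> Lp_norm p \<phi> powr (p - 1) * Lp_norm p Lu" .
  show ?thesis
  proof (cases "Lp_norm p \<phi> = 0")
    case False
    then have pos: "Lp_norm p \<phi> > 0" using Lp_norm_nonneg[of p \<phi>] by linarith
    have "Lp_norm p \<phi> powr p = Lp_norm p \<phi> powr (p - 1) * Lp_norm p \<phi>"
      using pos by (simp add: powr_diff)
    then have "Lp_norm p \<phi> powr (p - 1) * ((\<mu> - d) * Lp_norm p \<phi>) \<le> Lp_norm p \<phi> powr (p - 1) * Lp_norm p Lu"
      using * by (simp add: mult_ac)
    then show ?thesis using pos by (simp add: Lu_def[abs_def])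
  qed simp
qed

end

lemma csupp_diff: "csupp f \<Longrightarrow> csupp g \<Longrightarrow> csupp (\<lambda>z. f z - g z)"
  using csupp_add[of f "\<lambda>z. (-1) *\<^sub>R g z"] csupp_scaleR[of "\<lambda>_. -1" g] by simp

lemma Lp_pairing_csupp_linear:
  assumes p: "1 < p" and f: "f \<in> Lp p"
  shows Lp_pairing_add: "csupp g \<Longrightarrow> csupp h \<Longrightarrow>
      (\<integral>y. f y * (g y + h y) \<partial>lborel) = (\<integral>y. f y * g y \<partial>lborel) + (\<integral>y. f y * h y \<partial>lborel)"
    and Lp_pairing_diff: "csupp g \<Longrightarrow> csupp h \<Longrightarrow>
      (\<integral>y. f y * (g y - h y) \<partial>lborel) = (\<integral>y. f y * g y \<partial>lborel) - (\<integral>y. f y * h y \<partial>lborel)"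
    and Lp_pairing_scaleR: "(\<integral>y. f y * (c *\<^sub>R g y) \<partial>lborel) = c *\<^sub>R (\<integral>y. f y * g y \<partial>lborel)"
    and Lp_pairing_sum: "(\<And>i. i \<in> I \<Longrightarrow> csupp (G i)) \<Longrightarrow>
      (\<integral>y. f y * (\<Sum>i\<in>I. G i y) \<partial>lborel) = (\<Sum>i\<in>I. \<integral>y. f y * G i y \<partial>lborel)"
proof -
  note i = Lp_integrable_csupp[OF p f]
  show "csupp g \<Longrightarrow> csupp h \<Longrightarrow>
      (\<integral>y. f y * (g y + h y) \<partial>lborel) = (\<integral>y. f y * g y \<partial>lborel) + (\<integral>y. f y * h y \<partial>lborel)"
    unfolding distrib_left by (rule Bochner_Integration.integral_add[OF i i])
  show "csupp g \<Longrightarrow> csupp h \<Longrightarrow>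
      (\<integral>y. f y * (g y - h y) \<partial>lborel) = (\<integral>y. f y * g y \<partial>lborel) - (\<integral>y. f y * h y \<partial>lborel)"
    unfolding right_diff_distrib by (rule Bochner_Integration.integral_diff[OF i i])
  show "(\<integral>y. f y * (c *\<^sub>R g y) \<partial>lborel) = c *\<^sub>R (\<integral>y. f y * g y \<partial>lborel)"
    unfolding mult_scaleR_right by (rule integral_scaleR_right)
  show "(\<integral>y. f y * (\<Sum>i\<in>I. G i y) \<partial>lborel) = (\<Sum>i\<in>I. \<integral>y. f y * G i y \<partial>lborel)"
    if "\<And>i. i \<in> I \<Longrightarrow> csupp (G i)"
    unfolding sum_distrib_left by (rule Bochner_Integration.integral_sum[OF i[OF that]])
qed

section \<open>Uniqueness of weak solutions\<close>

context transport_diffusion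
begin

lemma dir_deriv_reflect:
  assumes "\<phi> \<in> Cc_inf" "e \<in> Basis"
  shows "dir_deriv e (\<lambda>y. \<phi> (z + (-1) *\<^sub>R y)) = (\<lambda>y. (-1) *\<^sub>R dir_deriv e \<phi> (z + (-1) *\<^sub>R y))"
    and "dir_deriv e (dir_deriv e (\<lambda>y. \<phi> (z + (-1) *\<^sub>R y))) = (\<lambda>y. dir_deriv e (dir_deriv e \<phi>) (z + (-1) *\<^sub>R y))"
proof -
  show 1: "dir_deriv e (\<lambda>y. \<phi> (z + (-1) *\<^sub>R y)) = (\<lambda>y. (-1) *\<^sub>R dir_deriv e \<phi> (z + (-1) *\<^sub>R y))"
    by (intro ext dir_deriv_affine(2) Cc_inf_differentiable assms)
  have "((\<lambda>y. (-1) *\<^sub>R dir_deriv e \<phi> (z + (-1) *\<^sub>R y)) has_derivative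
     (\<lambda>h. (-1) *\<^sub>R ((-1) *\<^sub>R dir_deriv h (dir_deriv e \<phi>) (z + (-1) *\<^sub>R y)))) (at y)" for y
    by (intro has_derivative_scaleR_right dir_deriv_affine(1) Cc_inf_differentiable Cc_inf_dir_deriv assms)
  from dir_deriv_eqI[OF this, of e]
  show "dir_deriv e (dir_deriv e (\<lambda>y. \<phi> (z + (-1) *\<^sub>R y))) = (\<lambda>y. dir_deriv e (dir_deriv e \<phi>) (z + (-1) *\<^sub>R y))"
    unfolding 1 by (intro ext) simp
qed

text \<open>
  Mollifying a weak solution leaves a commutator. Since \<open>B\<close> is divergence free, \<open>f(y)\<close> may be replaced
  by \<open>f(y) - f(z)\<close> in its first order part.
\<close>

lemma commutator_representation:
  assumes p: "1 < p" and f: "f \<in> Lp p" and \<phi>: "\<phi> \<in> Cc_inf"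
    and weak: "\<And>\<phi>. \<phi> \<in> Cc_inf \<Longrightarrow> (\<integral>y. f y * (\<mu> *\<^sub>R \<phi> y + Pop_adj \<phi> y) \<partial>lborel) = 0"
  defines "K1 \<equiv> \<lambda>z y. \<Sum>e\<in>Basis. ((B z - B y) \<bullet> e) *\<^sub>R dir_deriv e \<phi> (z + (-1) *\<^sub>R y)"
    and "K2 \<equiv> \<lambda>z y. (W z - W y) *\<^sub>R \<phi> (z + (-1) *\<^sub>R y)"
  shows "integrable lborel (\<lambda>y. (f y - f z) * K1 z y + f y * K2 z y)"
    and "\<mu> *\<^sub>R conv f \<phi> z + Pop (conv f \<phi>) z = (\<integral>y. (f y - f z) * K1 z y + f y * K2 z y \<partial>lborel)"
proof -
  define m where "m y = \<phi> (z + (-1) *\<^sub>R y)" for y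
  define D where "D e y = dir_deriv e \<phi> (z + (-1) *\<^sub>R y)" for e y
  define DD where "DD e y = dir_deriv e (dir_deriv e \<phi>) (z + (-1) *\<^sub>R y)" for e y
  have dC: "dir_deriv e \<phi> \<in> Cc_inf" "dir_deriv e (dir_deriv e \<phi>) \<in> Cc_inf" if "e \<in> Basis" for e
    using Cc_inf_dir_deriv \<phi> that by auto
  have cm: "csupp m" unfolding m_def by (intro csupp_affine Cc_inf_csupp \<phi>) simp
  have cD: "csupp (D e)" "csupp (DD e)" if "e \<in> Basis" for e
    unfolding D_def DD_def by (intro csupp_affine Cc_inf_csupp dC that; simp)+
  have cDD: "csupp (DD e)" if "e \<in> E" for e using cD that E_Basis by auto
  have mC: "m \<in> Cc_inf" unfolding m_def by (rule Cc_inf_affine[OF \<phi>]) simp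
  note lin = Lp_pairing_add[OF p f] Lp_pairing_diff[OF p f] Lp_pairing_scaleR[OF p f] Lp_pairing_sum[OF p f]
  \<comment> \<open>\<open>X\<close> has the coefficients frozen at \<open>z\<close>, so its pairing
    with \<open>f\<close> is the operator applied to the convolution. \<open>Y\<close> has them at
    \<open>y\<close> and equals \<open>\<mu> m + Pop_adj m\<close>, the reflection in
    \<open>y\<close> having turned the sign of the first derivatives; its pairing vanishes by
    hypothesis. The commutator is the pairing with \<open>X - Y\<close>.\<close>
  define X where "X y = \<mu> *\<^sub>R m y + ((\<Sum>e\<in>Basis. (B z \<bullet> e) *\<^sub>R D e y) - \<kappa> *\<^sub>R (\<Sum>e\<in>E. DD e y) + W z *\<^sub>R m y)" for y
  define Y where "Y y = \<mu> *\<^sub>R m y + ((\<Sum>e\<in>Basis. (B y \<bullet> e) *\<^sub>R D e y) - \<kappa> *\<^sub>R (\<Sum>e\<in>E. DD e y) + W y *\<^sub>R m y)" for y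
  have cX: "csupp X" unfolding X_def
    by (intro csupp_add csupp_diff csupp_scaleR csupp_sum cm cD cDD continuous_intros)
  have cY: "csupp Y" unfolding Y_def
    by (intro csupp_add csupp_diff csupp_scaleR csupp_sum cm cD cDD continuous_intros continuous_B continuous_W)
  have Y_eq: "Y y = \<mu> *\<^sub>R m y + Pop_adj m y" for y
  proof -
    have "dir_deriv e m y = - D e y" if "e \<in> Basis" for e
      using dir_deriv_reflect(1)[OF \<phi> that, of z] unfolding m_def[symmetric] D_def by simp
    moreover have "dir_deriv e (dir_deriv e m) y = DD e y" if "e \<in> E" for e
      using dir_deriv_reflect(2)[OF \<phi>, of e z] that E_Basis unfolding m_def[symmetric] DD_def by auto
    ultimately show ?thesis by (simp add: Y_def Pop_adj_def sum_negf)
  qed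
  have "(\<integral>y. f y * Y y \<partial>lborel) = 0" unfolding Y_eq by (rule weak[OF mC])
  have conv_eq: "conv f \<phi> z = (\<integral>y. f y * m y \<partial>lborel)"
    "e \<in> Basis \<Longrightarrow> conv f (dir_deriv e \<phi>) z = (\<integral>y. f y * D e y \<partial>lborel)"
    "e \<in> Basis \<Longrightarrow> conv f (dir_deriv e (dir_deriv e \<phi>)) z = (\<integral>y. f y * DD e y \<partial>lborel)" for e
    by (simp_all only: conv_def m_def D_def DD_def)
  have Xint: "(\<integral>y. f y * X y \<partial>lborel) = \<mu> *\<^sub>R conv f \<phi> z + Pop (conv f \<phi>) z"
  proof -
    have "(\<integral>y. f y * X y \<partial>lborel) = (\<integral>y. f y * (\<mu> *\<^sub>R m y) \<partial>lborel)
       + ((\<integral>y. f y * (\<Sum>e\<in>Basis. (B z \<bullet> e) *\<^sub>R D e y) \<partial>lborel) - (\<integral>y. f y * (\<kappa> *\<^sub>R (\<Sum>e\<in>E. DD e y)) \<partial>lborel)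
       + (\<integral>y. f y * (W z *\<^sub>R m y) \<partial>lborel))"
    proof -
      have s: "csupp (\<lambda>y. \<mu> *\<^sub>R m y)" "csupp (\<lambda>y. \<Sum>e\<in>Basis. (B z \<bullet> e) *\<^sub>R D e y)"
        "csupp (\<lambda>y. \<kappa> *\<^sub>R (\<Sum>e\<in>E. DD e y))" "csupp (\<lambda>y. W z *\<^sub>R m y)"
        by (intro csupp_scaleR csupp_sum cm cD cDD continuous_intros; assumption?)+
      show ?thesis
        unfolding X_def lin(1)[OF s(1) csupp_add[OF csupp_diff[OF s(2,3)] s(4)]]
          lin(1)[OF csupp_diff[OF s(2,3)] s(4)] lin(2)[OF s(2,3)] ..
    qed
    also have "(\<integral>y. f y * (\<Sum>e\<in>Basis. (B z \<bullet> e) *\<^sub>R D e y) \<partial>lborel) = (\<Sum>e\<in>Basis. (B z \<bullet> e) *\<^sub>R (\<integral>y. f y * D e y \<partial>lborel))"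
      by (subst lin(4)) (auto intro!: csupp_scaleR cD simp: lin(3))
    also have "(\<integral>y. f y * (\<kappa> *\<^sub>R (\<Sum>e\<in>E. DD e y)) \<partial>lborel) = \<kappa> *\<^sub>R (\<Sum>e\<in>E. \<integral>y. f y * DD e y \<partial>lborel)"
      by (subst lin(3), subst lin(4)) (auto intro!: cDD)
    also have "(\<integral>y. f y * (\<mu> *\<^sub>R m y) \<partial>lborel) = \<mu> *\<^sub>R conv f \<phi> z" by (simp only: lin(3) conv_eq)
    also have "(\<integral>y. f y * (W z *\<^sub>R m y) \<partial>lborel) = W z *\<^sub>R conv f \<phi> z" by (simp only: lin(3) conv_eq)
    also have "(\<Sum>e\<in>Basis. (B z \<bullet> e) *\<^sub>R (\<integral>y. f y * D e y \<partial>lborel)) = (\<Sum>e\<in>Basis. (B z \<bullet> e) *\<^sub>R dir_deriv e (conv f \<phi>) z)"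
      by (rule sum.cong[OF refl]) (simp add: conv_dir_deriv[OF p f \<phi>] conv_eq)
    also have "(\<Sum>e\<in>E. \<integral>y. f y * DD e y \<partial>lborel) = (\<Sum>e\<in>E. dir_deriv e (dir_deriv e (conv f \<phi>)) z)"
    proof (rule sum.cong[OF refl])
      fix e assume "e \<in> E"
      then have e: "e \<in> Basis" using E_Basis by auto
      show "(\<integral>y. f y * DD e y \<partial>lborel) = dir_deriv e (dir_deriv e (conv f \<phi>)) z"
        using conv_dir_deriv[OF p f \<phi> e] conv_dir_deriv[OF p f dC(1)[OF e] e] conv_eq(3)[OF e] by simp
    qed
    finally show ?thesis by (simp add: Pop_def)
  qed
  have cK: "csupp (K1 z)" "csupp (K2 z)"
    unfolding K1_def K2_def D_def[symmetric] m_def[symmetric]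
    by (intro csupp_sum csupp_scaleR cD cm continuous_intros continuous_B continuous_W; assumption?)+
  have XY: "X y - Y y = K1 z y + K2 z y" for y
    by (simp add: X_def Y_def K1_def K2_def D_def m_def inner_diff_left scaleR_diff_left sum_subtractf)
  have K1_0: "(\<integral>y. K1 z y \<partial>lborel) = 0"
  proof -
    have D0: "(\<integral>y. a y *\<^sub>R D e y \<partial>lborel) = 0"
      if e: "e \<in> Basis" and a: "continuous_on UNIV a" "\<And>y t. a (y + t *\<^sub>R e) = a y" for a e
    proof -
      have "(\<integral>y. a y *\<^sub>R ((-1) *\<^sub>R D e y) \<partial>lborel) = 0"
      proof (rule integral_derivative_eq_0_complex[OF a cm])
        show "csupp (\<lambda>y. (-1) *\<^sub>R D e y)" by (rule csupp_scaleR[OF _ cD(1)[OF e]]) simp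
        show "((\<lambda>t. m (y + t *\<^sub>R e)) has_vector_derivative (-1) *\<^sub>R D e y) (at 0)" for y
          using has_vector_derivative_line[of m y 0 e] Cc_inf_differentiable[OF mC] dir_deriv_reflect(1)[OF \<phi> e, of z]
          unfolding m_def[symmetric] D_def by simp
      qed
      moreover have "(\<integral>y. a y *\<^sub>R ((-1) *\<^sub>R D e y) \<partial>lborel) = - (\<integral>y. a y *\<^sub>R D e y \<partial>lborel)" by simp
      ultimately show ?thesis by simp
    qed
    have iD: "integrable lborel (\<lambda>y. a y *\<^sub>R D e y)" if "e \<in> Basis" "continuous_on UNIV a" for a e
      by (rule csupp_integrable[OF csupp_scaleR[OF that(2) cD(1)[OF that(1)]]])
    have cB: "continuous_on UNIV (\<lambda>y. (B z - B y) \<bullet> e)" for e by (intro continuous_intros continuous_B)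
    have "(\<integral>y. ((B z - B y) \<bullet> e) *\<^sub>R D e y \<partial>lborel) = 0" if "e \<in> Basis" for e
      by (rule D0[OF that cB]) (simp add: inner_diff_left B_invariant[OF that])
    then show ?thesis
      unfolding K1_def D_def[symmetric] by (subst Bochner_Integration.integral_sum) (auto intro!: iD cB)
  qed
  have i1: "integrable lborel (\<lambda>y. f y * (K1 z y + K2 z y))"
    by (rule Lp_integrable_csupp[OF p f csupp_add[OF cK]])
  have i2: "integrable lborel (\<lambda>y. f z * K1 z y)"
    by (intro integrable_mult_right csupp_integrable cK)
  have eq: "(f y - f z) * K1 z y + f y * K2 z y = f y * (K1 z y + K2 z y) - f z * K1 z y" for y
    by (simp add: algebra_simps)
  show "integrable lborel (\<lambda>y. (f y - f z) * K1 z y + f y * K2 z y)"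
    unfolding eq by (rule Bochner_Integration.integrable_diff[OF i1 i2])
  have "(\<integral>y. (f y - f z) * K1 z y + f y * K2 z y \<partial>lborel) = (\<integral>y. f y * (K1 z y + K2 z y) \<partial>lborel) - (\<integral>y. f z * K1 z y \<partial>lborel)"
    unfolding eq by (rule Bochner_Integration.integral_diff[OF i1 i2])
  also have "(\<integral>y. f z * K1 z y \<partial>lborel) = 0" using K1_0 by simp
  also have "(\<integral>y. f y * (K1 z y + K2 z y) \<partial>lborel) = (\<integral>y. f y * X y \<partial>lborel) - (\<integral>y. f y * Y y \<partial>lborel)"
    unfolding XY[symmetric] by (rule lin(2)[OF cX cY])
  finally show "\<mu> *\<^sub>R conv f \<phi> z + Pop (conv f \<phi>) z = (\<integral>y. (f y - f z) * K1 z y + f y * K2 z y \<partial>lborel)"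
    using Xint \<open>(\<integral>y. f y * Y y \<partial>lborel) = 0\<close> by simp
qed

text \<open>A majorant for both commutator kernels after the substitution
  \<open>y = z - \<epsilon> w\<close>. The first part is free of \<open>\<epsilon>\<close>, because
  the factor \<open>\<epsilon>\<close> from the Lipschitz bound on \<open>B\<close> cancels the
  \<open>1 / \<epsilon>\<close> from differentiating the mollifier; \<open>rho\<close> serves the
  potential.\<close>

definition ker :: "'a \<Rightarrow> real" where
  "ker w = L * (norm w * (\<Sum>e\<in>Basis. norm (dir_deriv e rhoc w))) + rho w"

lemma ker_props: "csupp ker" "ker w \<ge> 0" "norm w > 1 \<Longrightarrow> ker w = 0" "(\<integral>w. ker w \<partial>lborel) > 0"
proof -
  have c: "csupp (\<lambda>w. norm (dir_deriv e rhoc w))" if "e \<in> Basis" for e :: 'a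
    using Cc_inf_csupp[OF Cc_inf_dir_deriv[OF rhoc_Cc_inf that]]
    by (auto simp: csupp_def intro: continuous_on_norm)
  have 1: "csupp (\<lambda>w::'a. L * (norm w * (\<Sum>e\<in>Basis. norm (dir_deriv e rhoc w))))"
    by (intro csupp_mult csupp_sum c continuous_intros)
  show ck: "csupp ker" unfolding ker_def[abs_def] by (intro csupp_add 1 rho_csupp)
  show k0: "ker w \<ge> 0" for w
    using L_nonneg rho_nonneg[of w] by (auto simp: ker_def intro!: add_nonneg_nonneg mult_nonneg_nonneg sum_nonneg)
  show "ker w = 0" if "norm w > 1"
  proof -
    have "rhoc z = 0" if "norm z > 1" for z :: 'a using rho_zero[of z] that by (simp add: rhoc_def)
    from dir_deriv_zero_outside[OF this that] show ?thesis using rho_zero[of w] that by (simp add: ker_def)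
  qed
  have "(\<integral>w. rho w \<partial>(lborel :: 'a measure)) \<le> (\<integral>w. ker w \<partial>lborel)"
    by (rule integral_mono[OF csupp_integrable[OF rho_csupp] csupp_integrable[OF ck]])
      (use L_nonneg in \<open>auto simp: ker_def intro!: mult_nonneg_nonneg sum_nonneg\<close>)
  then show "(\<integral>w. ker w \<partial>lborel) > 0" using rho_integral[where 'a = 'a] by simp
qed

text \<open>The transport kernel is only bounded, so its contribution can be small only through
  \<open>f (z - \<epsilon> w) - f z\<close>; the potential contributes an explicit factor
  \<open>\<epsilon>\<close>, at the price of a constant growing with \<open>R\<close>.\<close>

lemma commutator_bound:
  assumes p: "1 < p" and f: "f \<in> Lp p" and \<epsilon>: "0 < \<epsilon>" "\<epsilon> \<le> 1" and z: "norm z \<le> R"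
    and weak: "\<And>\<phi>. \<phi> \<in> Cc_inf \<Longrightarrow> (\<integral>y. f y * (\<mu> *\<^sub>R \<phi> y + Pop_adj \<phi> y) \<partial>lborel) = 0"
  defines "c \<equiv> Lw * (2 + 2 * R)"
  shows "norm (\<mu> *\<^sub>R conv f (moll \<epsilon>) z + Pop (conv f (moll \<epsilon>)) z)
    \<le> (\<integral>w. (norm (f (z + (- \<epsilon>) *\<^sub>R w) - f z) + c * \<epsilon> * norm (f (z + (- \<epsilon>) *\<^sub>R w))) * ker w \<partial>lborel)"
proof -
  note mC = moll_Cc_inf[OF \<epsilon>(1), where 'a = 'a]
  define K1 where "K1 y = (\<Sum>e\<in>Basis. ((B z - B y) \<bullet> e) *\<^sub>R dir_deriv e (moll \<epsilon>) (z + (-1) *\<^sub>R y))" for y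
  define K2 where "K2 y = (W z - W y) *\<^sub>R moll \<epsilon> (z + (-1) *\<^sub>R y)" for y
  define G where "G y = (f y - f z) * K1 y + f y * K2 y" for y
  have iG: "integrable lborel G" and rG: "\<mu> *\<^sub>R conv f (moll \<epsilon>) z + Pop (conv f (moll \<epsilon>)) z = (\<integral>y. G y \<partial>lborel)"
    using commutator_representation[OF p f mC weak, of z] unfolding G_def[abs_def] K1_def K2_def by auto
  have [measurable]: "G \<in> borel_measurable borel" using iG by auto
  let ?y = "\<lambda>w. z + (- \<epsilon>) *\<^sub>R w"
  let ?\<eta> = "\<epsilon> ^ DIM('a)"
  have \<eta>: "?\<eta> > 0" using \<epsilon> by simp
  have zy: "z + (-1) *\<^sub>R ?y w = \<epsilon> *\<^sub>R w" for w by simp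
  have c0: "c \<ge> 0" using L_nonneg z order_trans[OF norm_ge_zero z] by (simp add: c_def)
  have k1: "?\<eta> * norm (K1 (?y w)) \<le> L * (norm w * (\<Sum>e\<in>Basis. norm (dir_deriv e rhoc w)))" for w
  proof -
    have Bw: "norm (B z - B (?y w)) \<le> L * (\<epsilon> * norm w)"
      using B_lipschitz[of z "?y w"] \<epsilon> by simp
    have t: "?\<eta> * norm (((B z - B (?y w)) \<bullet> e) *\<^sub>R dir_deriv e (moll \<epsilon>) (\<epsilon> *\<^sub>R w)) \<le> L * (norm w * norm (dir_deriv e rhoc w))"
      if e: "e \<in> Basis" for e
    proof -
      have "\<bar>(B z - B (?y w)) \<bullet> e\<bar> \<le> L * (\<epsilon> * norm w)" using Basis_le_norm[OF e, of "B z - B (?y w)"] Bw by linarith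
      moreover have "?\<eta> * norm (dir_deriv e (moll \<epsilon>) (\<epsilon> *\<^sub>R w)) = (1 / \<epsilon>) * norm (dir_deriv e rhoc w)"
        using \<epsilon> by (subst dir_deriv_moll[OF \<epsilon>(1)]) (simp add: norm_mult norm_power norm_divide power_one_over field_simps)
      moreover have "?\<eta> * norm (((B z - B (?y w)) \<bullet> e) *\<^sub>R dir_deriv e (moll \<epsilon>) (\<epsilon> *\<^sub>R w))
        = \<bar>(B z - B (?y w)) \<bullet> e\<bar> * (?\<eta> * norm (dir_deriv e (moll \<epsilon>) (\<epsilon> *\<^sub>R w)))" by simp
      ultimately have "?\<eta> * norm (((B z - B (?y w)) \<bullet> e) *\<^sub>R dir_deriv e (moll \<epsilon>) (\<epsilon> *\<^sub>R w))
        \<le> L * (\<epsilon> * norm w) * ((1 / \<epsilon>) * norm (dir_deriv e rhoc w))"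
        using \<epsilon> by (simp only:) (intro mult_right_mono, auto)
      also have "\<dots> = L * (norm w * norm (dir_deriv e rhoc w))" using \<epsilon> by simp
      finally show ?thesis .
    qed
    have "?\<eta> * norm (K1 (?y w)) \<le> ?\<eta> * (\<Sum>e\<in>Basis. norm (((B z - B (?y w)) \<bullet> e) *\<^sub>R dir_deriv e (moll \<epsilon>) (\<epsilon> *\<^sub>R w)))"
      unfolding K1_def zy using \<eta> by (intro mult_left_mono norm_sum) auto
    also have "\<dots> \<le> (\<Sum>e\<in>Basis. L * (norm w * norm (dir_deriv e rhoc w)))"
      unfolding sum_distrib_left by (intro sum_mono t)
    finally show ?thesis by (simp add: sum_distrib_left)
  qed
  have k2: "?\<eta> * norm (K2 (?y w)) \<le> c * \<epsilon> * rho w" for w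
  proof (cases "norm w \<le> 1")
    case True
    \<comment> \<open>With \<open>|w| \<le> 1\<close> and \<open>\<epsilon> \<le> 1\<close> the
      shifted point has norm at most \<open>R + 1\<close>, whence the \<open>2 + 2 * R\<close> in
      \<open>c\<close>.\<close>
    have ew: "\<epsilon> * norm w \<le> \<epsilon>" "\<epsilon> * norm w \<le> 1" using \<epsilon> True by (auto simp: mult_left_le mult_le_one)
    have "norm (?y w) \<le> norm z + norm ((- \<epsilon>) *\<^sub>R w)" by (rule norm_triangle_ineq)
    also have "norm ((- \<epsilon>) *\<^sub>R w) \<le> 1" using ew \<epsilon> by simp
    finally have "1 + norm z + norm (?y w) \<le> 2 + 2 * R" using z by simp
    then have "Lw * (1 + norm z + norm (?y w)) * norm (z - ?y w) \<le> Lw * (2 + 2 * R) * \<epsilon>"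
      using L_nonneg ew \<epsilon> z by (intro mult_mono) (auto simp: order_trans[OF norm_ge_zero z])
    then have "\<bar>W z - W (?y w)\<bar> \<le> c * \<epsilon>" using W_lipschitz[of z "?y w"] by (simp add: c_def)
    moreover have "?\<eta> * norm (moll \<epsilon> (\<epsilon> *\<^sub>R w)) = rho w"
      using \<epsilon> rho_nonneg[of w] by (simp add: moll_def rhoc_def norm_mult norm_power norm_divide power_one_over)
    moreover have "?\<eta> * norm (K2 (?y w)) = \<bar>W z - W (?y w)\<bar> * (?\<eta> * norm (moll \<epsilon> (\<epsilon> *\<^sub>R w)))"
      unfolding K2_def zy by simp
    ultimately show ?thesis using rho_nonneg[of w] by (simp add: mult_right_mono)
  next
    case False
    then have "moll \<epsilon> (\<epsilon> *\<^sub>R w) = 0" using \<epsilon> rho_zero[of w] by (simp add: moll_def rhoc_def)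
    then show ?thesis unfolding K2_def zy using c0 \<epsilon> rho_nonneg[of w] by simp
  qed
  have pw: "norm (?\<eta> *\<^sub>R G (?y w)) \<le> (norm (f (?y w) - f z) + c * \<epsilon> * norm (f (?y w))) * ker w" for w
  proof -
    let ?S = "L * (norm w * (\<Sum>e\<in>Basis. norm (dir_deriv e rhoc w)))"
    have S0: "?S \<ge> 0" using L_nonneg by (intro mult_nonneg_nonneg sum_nonneg) auto
    have "norm (?\<eta> *\<^sub>R G (?y w)) = ?\<eta> * norm (G (?y w))" using \<eta> by simp
    also have "\<dots> \<le> ?\<eta> * (norm (f (?y w) - f z) * norm (K1 (?y w)) + norm (f (?y w)) * norm (K2 (?y w)))"
      using \<eta> norm_triangle_ineq[of "(f (?y w) - f z) * K1 (?y w)" "f (?y w) * K2 (?y w)"]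
      unfolding G_def by (intro mult_left_mono) (auto simp: norm_mult)
    also have "\<dots> = norm (f (?y w) - f z) * (?\<eta> * norm (K1 (?y w))) + norm (f (?y w)) * (?\<eta> * norm (K2 (?y w)))"
      by (simp add: algebra_simps)
    also have "\<dots> \<le> norm (f (?y w) - f z) * ?S + norm (f (?y w)) * (c * \<epsilon> * rho w)"
      by (intro add_mono mult_left_mono k1 k2) auto
    also have "\<dots> \<le> norm (f (?y w) - f z) * ker w + norm (f (?y w)) * (c * \<epsilon> * ker w)"
      using c0 \<epsilon> S0 rho_nonneg[of w] by (intro add_mono mult_left_mono) (auto simp: ker_def)
    finally show ?thesis by (simp add: algebra_simps)
  qed
  have "(\<integral>y. G y \<partial>lborel) = (\<integral>w. ?\<eta> *\<^sub>R G (?y w) \<partial>lborel)"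
    using lborel_integral_reflect_scale[of G \<epsilon> z] \<epsilon> by (simp add: scaleR_conv_of_real)
  also have "norm \<dots> \<le> (\<integral>w. norm (?\<eta> *\<^sub>R G (?y w)) \<partial>lborel)" by (rule integral_norm_bound)
  also have "\<dots> \<le> (\<integral>w. (norm (f (?y w) - f z) + c * \<epsilon> * norm (f (?y w))) * ker w \<partial>lborel)"
  proof (rule integral_mono[OF _ _ pw])
    show "integrable lborel (\<lambda>w. norm (?\<eta> *\<^sub>R G (?y w)))"
      using \<epsilon> by (intro integrable_norm integrable_scaleR_right integrable_affine[OF iG]) auto
    have kc: "csupp (\<lambda>w. complex_of_real (ker w))"
      using ker_props(1) by (auto simp: csupp_def intro: continuous_intros)
    have "integrable lborel (\<lambda>w. f (?y w) * complex_of_real (ker w))"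
      by (rule Lp_integrable_csupp[OF p Lp_affine[OF f] kc]) (use \<epsilon> in simp)
    note i1 = integrable_norm[OF this]
    have "integrable lborel (\<lambda>w. f (?y w) * complex_of_real (ker w) - f z * complex_of_real (ker w))"
      using csupp_integrable[OF kc]
      by (intro Bochner_Integration.integrable_diff integrable_mult_right Lp_integrable_csupp[OF p Lp_affine[OF f] kc]) (use \<epsilon> in auto)
    note i2 = integrable_norm[OF this]
    have "integrable lborel (\<lambda>w. norm (f (?y w) * complex_of_real (ker w) - f z * complex_of_real (ker w))
       + c * \<epsilon> * norm (f (?y w) * complex_of_real (ker w)))"
      by (intro Bochner_Integration.integrable_add integrable_mult_right i1 i2)
    moreover have "norm (f (?y w) * complex_of_real (ker w) - f z * complex_of_real (ker w))
       + c * \<epsilon> * norm (f (?y w) * complex_of_real (ker w)) = (norm (f (?y w) - f z) + c * \<epsilon> * norm (f (?y w))) * ker w" for w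
      using ker_props(2)[of w] by (simp add: left_diff_distrib[symmetric] norm_mult distrib_right)
    ultimately show "integrable lborel (\<lambda>w. (norm (f (?y w) - f z) + c * \<epsilon> * norm (f (?y w))) * ker w)" by simp
  qed
  finally show ?thesis unfolding rG .
qed

lemma commutator_small:
  assumes p: "1 < p" and f: "f \<in> Lp p" and \<delta>: "\<delta> > 0" and R: "R \<ge> 0"
    and weak: "\<And>\<phi>. \<phi> \<in> Cc_inf \<Longrightarrow> (\<integral>y. f y * (\<mu> *\<^sub>R \<phi> y + Pop_adj \<phi> y) \<partial>lborel) = 0"
  defines "g \<equiv> \<lambda>\<epsilon> z. if norm z \<le> R then \<mu> *\<^sub>R conv f (moll \<epsilon>) z + Pop (conv f (moll \<epsilon>)) z else 0"
  shows "\<exists>\<epsilon>0>0. \<forall>\<epsilon>. 0 < \<epsilon> \<and> \<epsilon> < \<epsilon>0 \<longrightarrow> g \<epsilon> \<in> Lp p \<and> Lp_norm p (g \<epsilon>) \<le> (\<integral>w. ker w \<partial>lborel) * \<delta>"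
proof -
  have fm [measurable]: "f \<in> borel_measurable borel" using f by auto
  define c where "c = Lw * (2 + 2 * R)"
  have c0: "c \<ge> 0" using L_nonneg R by (simp add: c_def)
  obtain \<epsilon>1 where \<epsilon>1: "\<epsilon>1 > 0"
    "\<And>\<epsilon> w. 0 < \<epsilon> \<Longrightarrow> \<epsilon> < \<epsilon>1 \<Longrightarrow> norm w \<le> 1 \<Longrightarrow> (\<integral>z. norm (f (z + (- \<epsilon>) *\<^sub>R w) - f z) powr p \<partial>lborel) \<le> (\<delta> / 2) powr p"
    using Lp_translation_sup[OF p f, of "\<delta> / 2"] \<delta> by auto
  define nf where "nf = Lp_norm p f"
  \<comment> \<open>Chosen so that the potential part \<open>c * \<epsilon> * nf\<close> is at most
    \<open>\<delta> / 2\<close>, with \<open>+ 1\<close> to avoid division by zero. The translation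
    part gets the other half through \<open>\<epsilon>1\<close>.\<close>
  define \<epsilon>2 where "\<epsilon>2 = \<delta> / (2 * (c * nf + 1))"
  have cn: "c * nf + 1 > 0" using c0 by (simp add: nf_def add_nonneg_pos)
  have \<epsilon>2: "\<epsilon>2 > 0" using \<delta> cn by (simp add: \<epsilon>2_def)
  show ?thesis
  proof (intro exI[of _ "min 1 (min \<epsilon>1 \<epsilon>2)"] conjI allI impI)
    show "min 1 (min \<epsilon>1 \<epsilon>2) > 0" using \<epsilon>1 \<epsilon>2 by simp
    fix \<epsilon> assume "0 < \<epsilon> \<and> \<epsilon> < min 1 (min \<epsilon>1 \<epsilon>2)"
    then have \<epsilon>: "0 < \<epsilon>" "\<epsilon> \<le> 1" "\<epsilon> < \<epsilon>1" "\<epsilon> < \<epsilon>2" by auto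
    have small: "c * \<epsilon> * nf \<le> \<delta> / 2"
    proof -
      have "c * nf * \<epsilon> \<le> (c * nf + 1) * \<epsilon>2"
        using \<epsilon> c0 by (intro mult_mono) (auto simp: nf_def)
      also have "\<dots> = \<delta> / 2"
      proof -
        have "t * (\<delta> / (2 * t)) = \<delta> / 2" if "t > 0" for t :: real using that by simp
        from this[OF cn] show ?thesis unfolding \<epsilon>2_def .
      qed
      finally show ?thesis by (simp add: mult_ac)
    qed
    define F where "F z w = norm (f (z + (- \<epsilon>) *\<^sub>R w) - f z) + c * \<epsilon> * norm (f (z + (- \<epsilon>) *\<^sub>R w))" for z w
    have Fm: "(\<lambda>(z, w). F z w) \<in> borel_measurable (borel \<Otimes>\<^sub>M borel)" unfolding F_def by measurable
    have F0: "F z w \<ge> 0" for z w using c0 \<epsilon> by (simp add: F_def)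
    have FL: "integrable lborel (\<lambda>z. F z w powr p) \<and> (\<integral>z. F z w powr p \<partial>lborel) \<le> \<delta> powr p" if w: "norm w \<le> 1" for w
    proof -
      define a where "a z = complex_of_real (norm (f (z + (- \<epsilon>) *\<^sub>R w) - f z))" for z
      define b where "b z = complex_of_real (c * \<epsilon> * norm (f (z + (- \<epsilon>) *\<^sub>R w)))" for z
      have sh: "(\<lambda>z. f (z + (- \<epsilon>) *\<^sub>R w)) \<in> Lp p" "Lp_norm p (\<lambda>z. f (z + (- \<epsilon>) *\<^sub>R w)) = nf"
        using Lp_shift[OF f, of "(- \<epsilon>) *\<^sub>R w"] by (simp_all add: add.commute nf_def)
      have d: "(\<lambda>z. f (z + (- \<epsilon>) *\<^sub>R w) - f z) \<in> Lp p" using Lp_diff[OF _ sh(1) f] p by simp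
      have am [measurable]: "a \<in> borel_measurable borel" "b \<in> borel_measurable borel"
        unfolding a_def[abs_def] b_def[abs_def] by measurable
      have aL: "a \<in> Lp p" "Lp_norm p a \<le> \<delta> / 2"
      proof -
        show "a \<in> Lp p" by (rule Lp_dominated(1)[OF _ _ d]) (use p in \<open>auto simp: a_def\<close>)
        have "Lp_norm p a = Lp_norm p (\<lambda>z. f (z + (- \<epsilon>) *\<^sub>R w) - f z)" by (simp add: Lp_norm_def a_def)
        also have "\<dots> \<le> \<delta> / 2" using \<epsilon>1(2)[OF \<epsilon>(1,3) w] p \<delta> by (intro Lp_norm_leI) auto
        finally show "Lp_norm p a \<le> \<delta> / 2" .
      qed
      have bL: "b \<in> Lp p" "Lp_norm p b \<le> \<delta> / 2"
      proof -
        have nb: "norm (b z) = norm ((c * \<epsilon>) *\<^sub>R f (z + (- \<epsilon>) *\<^sub>R w))" for z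
          using c0 \<epsilon> by (simp add: b_def norm_mult)
        show "b \<in> Lp p" by (rule Lp_dominated(1)[OF _ _ Lp_scaleR[OF sh(1), of "c * \<epsilon>"]]) (use p nb in auto)
        have "Lp_norm p b = Lp_norm p (\<lambda>z. (c * \<epsilon>) *\<^sub>R f (z + (- \<epsilon>) *\<^sub>R w))" unfolding Lp_norm_def nb ..
        also have "\<dots> = c * \<epsilon> * nf" using Lp_norm_scaleR[of p "c * \<epsilon>" "\<lambda>z. f (z + (- \<epsilon>) *\<^sub>R w)"] p c0 \<epsilon> unfolding sh(2) by simp
        finally show "Lp_norm p b \<le> \<delta> / 2" using small by simp
      qed
      have ab: "(\<lambda>z. a z + b z) \<in> Lp p" "Lp_norm p (\<lambda>z. a z + b z) \<le> \<delta>"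
        using Lp_add[OF _ aL(1) bL(1)] Lp_norm_add[OF p aL(1) bL(1)] aL bL p by auto
      have nab: "norm (a z + b z) = F z w" for z
      proof -
        have "a z + b z = complex_of_real (F z w)" by (simp add: a_def b_def F_def)
        then show ?thesis using F0[of z w] by (simp only: norm_of_real)
      qed
      have "Lp_norm p (\<lambda>z. a z + b z) powr p \<le> \<delta> powr p" using ab(2) p by (intro powr_mono2) auto
      then show ?thesis using Lp_integrable[OF ab(1)] p by (simp add: nab Lp_norm_powr)
    qed
    have gm: "g \<epsilon> \<in> borel_measurable borel"
    proof -
      have C: "Ck 2 (conv f (moll \<epsilon>))" by (rule conv_Ck[OF p f moll_Cc_inf[OF \<epsilon>(1)]])
      have [measurable]: "conv f (moll \<epsilon>) \<in> borel_measurable borel" "Pop (conv f (moll \<epsilon>)) \<in> borel_measurable borel"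
        using Ck_continuous[OF C] continuous_Pop[OF C] by (auto intro: borel_measurable_continuous_onI)
      show ?thesis unfolding g_def by measurable
    qed
    have gle: "norm (g \<epsilon> z) \<le> (\<integral>w. F z w * ker w \<partial>lborel)" for z
    proof (cases "norm z \<le> R")
      case True
      then show ?thesis
        using commutator_bound[OF p f \<epsilon>(1,2) True weak] by (simp add: g_def F_def c_def)
    next
      case False
      have "(\<integral>w. F z w * ker w \<partial>lborel) \<ge> 0"
        using F0 ker_props(2) by (intro integral_nonneg_AE) auto
      then show ?thesis using False by (simp add: g_def)
    qed
    have "\<delta> \<ge> 0" using \<delta> by simp
    from Lp_norm_kernel_le[OF p ker_props(4) refl ker_props(1,2,3) Fm F0 _ _ this gm gle] FL
    show "g \<epsilon> \<in> Lp p" "Lp_norm p (g \<epsilon>) \<le> (\<integral>w. ker w \<partial>lborel) * \<delta>" by auto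
  qed
qed

text \<open>The order of the limits is essential. At fixed \<open>R\<close> the commutator tends to
  0 with \<open>\<epsilon>\<close>, but it is controlled on the ball of radius \<open>R\<close>
  only; then \<open>R \<rightarrow> \<infinity>\<close> removes the flux, whose weight is by now the
  fixed integrable function \<open>|f|^p\<close>.\<close>

theorem weak_solution_unique:
  assumes p: "1 < p" and f: "f \<in> Lp p" and \<mu>: "\<mu> > d"
    and weak: "\<And>\<phi>. \<phi> \<in> Cc_inf \<Longrightarrow> (\<integral>y. f y * (\<mu> *\<^sub>R \<phi> y + Pop_adj \<phi> y) \<partial>lborel) = 0"
  shows "AE z in lborel. f z = 0"
proof -
  define \<epsilon> where "\<epsilon> j = 1 / real (Suc j)" for j
  have \<epsilon>: "\<epsilon> j > 0" for j by (simp add: \<epsilon>_def)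
  have \<epsilon>lim: "\<epsilon> \<longlonglongrightarrow> 0" using LIMSEQ_inverse_real_of_nat by (simp add: \<epsilon>_def[abs_def] inverse_eq_divide)
  then have \<epsilon>filt: "filterlim \<epsilon> (at_right 0) sequentially"
    using \<epsilon> by (auto simp: filterlim_at less_imp_neq[THEN not_sym])
  define u where "u j = conv f (moll (\<epsilon> j))" for j
  have u: "u j \<in> Lp p" "Ck 2 (u j)" for j
    unfolding u_def using conv_moll_tendsto(2)[OF p f \<epsilon>] conv_Ck[OF p f moll_Cc_inf[OF \<epsilon>]] by auto
  have ulim: "(\<lambda>j. Lp_norm p (\<lambda>z. u j z - f z)) \<longlonglongrightarrow> 0"
    unfolding u_def by (rule filterlim_compose[OF conv_moll_tendsto(1)[OF p f] \<epsilon>filt])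
  have main: "p * (\<mu> - d) * (\<integral>z. cut0 R z * norm (f z) powr p \<partial>lborel) \<le> (\<integral>z. \<bar>Flux R z\<bar> * norm (f z) powr p \<partial>lborel)"
    if R: "R \<ge> 1" for R
  proof -
    have R0: "R > 0" "R \<ge> 0" using R by auto
    \<comment> \<open>Restricted to the ball where the commutator is controlled;
      \<open>cut0 R\<close> vanishes outside it, so the energy inequality is not affected.\<close>
    define g where "g j z = (if norm z \<le> R then \<mu> *\<^sub>R u j z + Pop (u j) z else 0)" for j z
    let ?K = "\<integral>w. ker w \<partial>lborel"
    have Fm: "Flux R \<in> borel_measurable borel" and cm: "cut0 R \<in> borel_measurable (borel :: 'a measure)"
      using csupp_measurable[OF csupp_Flux[OF R0(1)]] csupp_measurable[OF csupp_cut(1)[OF R0(1)]] by auto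
    note [measurable] = cm
    have small: "\<forall>\<^sub>F j in sequentially. g j \<in> Lp p \<and> Lp_norm p (g j) < s" if s: "s > 0" for s
    proof -
      define \<delta> where "\<delta> = s / (2 * ?K)"
      have \<delta>: "\<delta> > 0" "?K * \<delta> < s" using s ker_props(4) by (auto simp: \<delta>_def)
      obtain \<epsilon>0 where \<epsilon>0: "\<epsilon>0 > 0" "\<And>e. 0 < e \<Longrightarrow> e < \<epsilon>0 \<Longrightarrow>
        (\<lambda>z. if norm z \<le> R then \<mu> *\<^sub>R conv f (moll e) z + Pop (conv f (moll e)) z else 0) \<in> Lp p \<and>
        Lp_norm p (\<lambda>z. if norm z \<le> R then \<mu> *\<^sub>R conv f (moll e) z + Pop (conv f (moll e)) z else 0) \<le> ?K * \<delta>"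
        using commutator_small[OF p f \<delta>(1) R0(2) weak] by auto
      have "\<forall>\<^sub>F j in sequentially. \<epsilon> j < \<epsilon>0" using \<epsilon>lim \<epsilon>0(1) by (rule order_tendstoD(2))
      then show ?thesis
      proof eventually_elim
        case (elim j)
        show ?case using \<epsilon>0(2)[OF \<epsilon> elim] \<delta>(2) unfolding g_def u_def by (auto intro: le_less_trans)
      qed
    qed
    have gL: "\<forall>\<^sub>F j in sequentially. g j \<in> Lp p" using small[OF zero_less_one] by eventually_elim simp
    have glim: "(\<lambda>j. Lp_norm p (g j)) \<longlonglongrightarrow> 0"
    proof (rule tendstoI)
      fix s :: real assume "s > 0"
      from small[OF this] show "\<forall>\<^sub>F j in sequentially. dist (Lp_norm p (g j)) 0 < s" by eventually_elim simp
    qed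
    have un: "(\<lambda>j. Lp_norm p (u j)) \<longlonglongrightarrow> Lp_norm p f" by (rule Lp_norm_tendsto[OF p u(1) f ulim])
    have "(\<lambda>j. p * (Lp_norm p (u j) powr (p - 1) * Lp_norm p (g j)) + (\<integral>z. \<bar>Flux R z\<bar> * norm (u j z) powr p \<partial>lborel))
      \<longlonglongrightarrow> p * (Lp_norm p f powr (p - 1) * 0) + (\<integral>z. \<bar>Flux R z\<bar> * norm (f z) powr p \<partial>lborel)"
    proof (intro tendsto_add tendsto_mult tendsto_const glim)
      show "(\<lambda>j. Lp_norm p (u j) powr (p - 1)) \<longlonglongrightarrow> Lp_norm p f powr (p - 1)"
        using p by (intro tendsto_powr2 un tendsto_const) auto
      show "(\<lambda>j. \<integral>z. \<bar>Flux R z\<bar> * norm (u j z) powr p \<partial>lborel) \<longlonglongrightarrow> (\<integral>z. \<bar>Flux R z\<bar> * norm (f z) powr p \<partial>lborel)"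
        by (rule Lp_weighted_tendsto[OF p u(1) f ulim, where C = Flux_const]) (use Fm Flux_bounded[OF R] in auto)
    qed
    moreover have "(\<lambda>j. p * (\<mu> - d) * (\<integral>z. cut0 R z * norm (u j z) powr p \<partial>lborel)) \<longlonglongrightarrow> p * (\<mu> - d) * (\<integral>z. cut0 R z * norm (f z) powr p \<partial>lborel)"
      by (intro tendsto_mult_left Lp_weighted_tendsto[OF p u(1) f ulim, where C = 1]) (auto simp: cut0_range)
    moreover have "\<forall>\<^sub>F j in sequentially. p * (\<mu> - d) * (\<integral>z. cut0 R z * norm (u j z) powr p \<partial>lborel)
       \<le> p * (Lp_norm p (u j) powr (p - 1) * Lp_norm p (g j)) + (\<integral>z. \<bar>Flux R z\<bar> * norm (u j z) powr p \<partial>lborel)"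
      using gL
    proof eventually_elim
      case (elim j)
      note H = Lp_Holder_power[OF p u(1)[of j] elim]
      have [measurable]: "u j \<in> borel_measurable borel" "g j \<in> borel_measurable borel" using u(1)[of j] elim by auto
      have eq: "cut0 R z * (norm (u j z) powr (p - 1) * norm (\<mu> *\<^sub>R u j z + Pop (u j) z))
        = cut0 R z * (norm (u j z) powr (p - 1) * norm (g j z))" for z
      proof (cases "norm z \<le> R")
        case False
        then have "cut0 R z = 0" using cutb_zero[of R z] R0 by (simp add: cut0_def)
        then show ?thesis by simp
      qed (simp add: g_def)
      have le: "cut0 R z * (norm (u j z) powr (p - 1) * norm (g j z)) \<le> norm (u j z) powr (p - 1) * norm (g j z)" for z
        by (simp add: mult_left_le_one_le cut0_range)
      have "(\<integral>z. cut0 R z * (norm (u j z) powr (p - 1) * norm (g j z)) \<partial>lborel) \<le> (\<integral>z. norm (u j z) powr (p - 1) * norm (g j z) \<partial>lborel)"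
      proof (rule integral_mono[OF _ H(1) le])
        show "integrable lborel (\<lambda>z. cut0 R z * (norm (u j z) powr (p - 1) * norm (g j z)))"
          by (rule Bochner_Integration.integrable_bound[OF H(1)]) (use le in \<open>auto simp: abs_mult cut0_range\<close>)
      qed
      also note H(2)
      finally have "p * (\<integral>z. cut0 R z * (norm (u j z) powr (p - 1) * norm (\<mu> *\<^sub>R u j z + Pop (u j) z)) \<partial>lborel)
         \<le> p * (Lp_norm p (u j) powr (p - 1) * Lp_norm p (g j))"
        unfolding eq using p by (intro mult_left_mono) auto
      then show ?case using energy[OF p u(2) R0(1), of \<mu> j] by linarith
    qed
    ultimately have "p * (\<mu> - d) * (\<integral>z. cut0 R z * norm (f z) powr p \<partial>lborel)
      \<le> p * (Lp_norm p f powr (p - 1) * 0) + (\<integral>z. \<bar>Flux R z\<bar> * norm (f z) powr p \<partial>lborel)"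
      by (intro tendsto_le[OF sequentially_bot])
    then show ?thesis by simp
  qed
  have "p * (\<mu> - d) * (\<integral>z. norm (f z) powr p \<partial>lborel) \<le> 0"
    by (rule LIMSEQ_le[OF tendsto_mult_left[OF cutoff_limits(1)[OF p f]] cutoff_limits(2)[OF p f]]) (use main in auto)
  then have "(\<integral>z. norm (f z) powr p \<partial>lborel) \<le> 0" using p \<mu> by (simp add: mult_le_0_iff)
  then have "Lp_norm p f = 0" by (simp add: Lp_norm_def integral_nonneg_AE antisym)
  then show ?thesis using Lp_norm_eq_0_iff[of p f] p f by simp
qed

end

text \<open>The pointwise structure that makes \<open>Lp p\<close> a subspace, so that the abstract
  semigroup theory applies to functions.\<close>

instantiation "fun" :: (type, real_vector) real_vector
begin

definition scaleR_fun :: "real \<Rightarrow> ('a \<Rightarrow> 'b) \<Rightarrow> 'a \<Rightarrow> 'b" where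
  "scaleR_fun c f = (\<lambda>x. c *\<^sub>R f x)"

instance
  by standard (auto simp: scaleR_fun_def fun_eq_iff scaleR_add_right scaleR_add_left)

end

section \<open>The closed operator and its semigroup\<close>

lemma Lp_complete_seminorm: "1 < p \<Longrightarrow> complete_seminorm (Lp p) (Lp_norm p)"
proof
  assume p: "1 < p"
  show "subspace (Lp p :: ('a \<Rightarrow> complex) set)"
    using p by (auto simp: subspace_def zero_fun_def plus_fun_def scaleR_fun_def intro: Lp_zero Lp_add Lp_scaleR)
  show "Lp_norm p (x + y) \<le> Lp_norm p x + Lp_norm p y" if "x \<in> Lp p" "y \<in> Lp p" for x y :: "'a \<Rightarrow> complex"
    using Lp_norm_add[OF p that] by (simp add: plus_fun_def)
  show "Lp_norm p (c *\<^sub>R x) = \<bar>c\<bar> * Lp_norm p x" if "x \<in> Lp p" for x :: "'a \<Rightarrow> complex" and c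
    using Lp_norm_scaleR[of p c x] p by (simp add: scaleR_fun_def)
  show "\<exists>l\<in>Lp p. (\<lambda>n. Lp_norm p (s n - l)) \<longlonglongrightarrow> 0"
    if "\<And>n. s n \<in> Lp p" "\<And>e. 0 < e \<Longrightarrow> \<exists>M. \<forall>m\<ge>M. \<forall>n\<ge>M. Lp_norm p (s m - s n) < e" for s :: "nat \<Rightarrow> 'a \<Rightarrow> complex"
    using Lp_complete[OF p that(1)] that(2) by (simp add: fun_diff_def)
qed

lemma ae_eq_iff_Lp_norm:
  assumes "1 < p" "f \<in> Lp p" "g \<in> Lp p"
  shows "ae_eq f g \<longleftrightarrow> Lp_norm p (\<lambda>z. f z - g z) = 0"
  using Lp_norm_eq_0_iff[OF _ Lp_diff[OF _ assms(2,3)]] assms(1) by (simp add: ae_eq_def)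

text \<open>The product rule at \<open>t = 0\<close>: multiplication by \<open>exp (b * t)\<close>
  adds \<open>b\<close> to the generator. Applied with both signs of \<open>b\<close>, it yields an
  equivalence.\<close>

lemma rescaled_difference_quotient:
  fixes S :: "real \<Rightarrow> 'a::euclidean_space \<Rightarrow> complex"
  assumes p: "1 < p" and f: "f \<in> Lp p" and g: "g \<in> Lp p" and S: "\<And>t. t \<ge> 0 \<Longrightarrow> S t \<in> Lp p"
    and lim: "((\<lambda>t. Lp_norm p (\<lambda>z. (1 / t) *\<^sub>R (S t z - f z) - g z)) \<longlongrightarrow> 0) (at_right 0)"
  shows "((\<lambda>t. Lp_norm p (\<lambda>z. (1 / t) *\<^sub>R (exp (b * t) *\<^sub>R S t z - f z) - (g z + b *\<^sub>R f z))) \<longlongrightarrow> 0) (at_right 0)"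
proof (rule tendsto_sandwich[OF _ _ tendsto_const])
  let ?q = "\<lambda>t z. (1 / t) *\<^sub>R (S t z - f z) - g z"
  let ?h = "\<lambda>t. exp (b * t) * Lp_norm p (?q t) + \<bar>exp (b * t) - 1\<bar> * Lp_norm p g + \<bar>(exp (b * t) - 1) / t - b\<bar> * Lp_norm p f"
  have e: "((\<lambda>t. exp (b * t)) \<longlongrightarrow> exp (b * 0)) (at_right 0)" by (intro tendsto_intros)
  have "((\<lambda>t. exp (b * t)) has_real_derivative b * exp (b * 0)) (at 0)"
    by (auto intro!: derivative_eq_intros)
  then have "((\<lambda>t. (exp (b * t) - 1) / t) \<longlongrightarrow> b) (at 0)" by (simp add: DERIV_def)
  then have d: "((\<lambda>t. (exp (b * t) - 1) / t) \<longlongrightarrow> b) (at_right 0)" by (rule tendsto_mono[OF at_le[OF subset_UNIV]])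
  have "(?h \<longlongrightarrow> exp (b * 0) * 0 + \<bar>exp (b * 0) - 1\<bar> * Lp_norm p g + \<bar>b - b\<bar> * Lp_norm p f) (at_right 0)"
    by (intro tendsto_intros e d lim)
  then show "(?h \<longlongrightarrow> 0) (at_right 0)" by simp
  have "Lp_norm p (\<lambda>z. (1 / t) *\<^sub>R (exp (b * t) *\<^sub>R S t z - f z) - (g z + b *\<^sub>R f z)) \<le> ?h t" if t: "t > 0" for t
  proof -
    have q: "?q t \<in> Lp p" using S[of t] t f g p by (intro Lp_diff Lp_scaleR) auto
    have eq: "(1 / t) *\<^sub>R (exp (b * t) *\<^sub>R S t z - f z) - (g z + b *\<^sub>R f z)
      = exp (b * t) *\<^sub>R ?q t z + ((exp (b * t) - 1) *\<^sub>R g z + ((exp (b * t) - 1) / t - b) *\<^sub>R f z)" for z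
      by (simp add: scaleR_diff_right scaleR_diff_left scaleR_add_right scaleR_add_left diff_divide_distrib)
    have "Lp_norm p (\<lambda>z. exp (b * t) *\<^sub>R ?q t z + ((exp (b * t) - 1) *\<^sub>R g z + ((exp (b * t) - 1) / t - b) *\<^sub>R f z))
      \<le> Lp_norm p (\<lambda>z. exp (b * t) *\<^sub>R ?q t z) + Lp_norm p (\<lambda>z. (exp (b * t) - 1) *\<^sub>R g z + ((exp (b * t) - 1) / t - b) *\<^sub>R f z)"
      using q f g p by (intro Lp_norm_add Lp_add Lp_scaleR) auto
    also have "Lp_norm p (\<lambda>z. (exp (b * t) - 1) *\<^sub>R g z + ((exp (b * t) - 1) / t - b) *\<^sub>R f z)
      \<le> Lp_norm p (\<lambda>z. (exp (b * t) - 1) *\<^sub>R g z) + Lp_norm p (\<lambda>z. ((exp (b * t) - 1) / t - b) *\<^sub>R f z)"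
      using f g p by (intro Lp_norm_add Lp_scaleR) auto
    also have "Lp_norm p (\<lambda>z. exp (b * t) *\<^sub>R ?q t z) = exp (b * t) * Lp_norm p (?q t)"
      using Lp_norm_scaleR[of p "exp (b * t)" "?q t"] p by simp
    also have "Lp_norm p (\<lambda>z. (exp (b * t) - 1) *\<^sub>R g z) = \<bar>exp (b * t) - 1\<bar> * Lp_norm p g"
      using Lp_norm_scaleR[of p "exp (b * t) - 1" g] p by simp
    also have "Lp_norm p (\<lambda>z. ((exp (b * t) - 1) / t - b) *\<^sub>R f z) = \<bar>(exp (b * t) - 1) / t - b\<bar> * Lp_norm p f"
      using Lp_norm_scaleR[of p "(exp (b * t) - 1) / t - b" f] p by simp
    finally show ?thesis unfolding eq by (simp add: add.assoc)
  qed
  then show "\<forall>\<^sub>F t in at_right 0. Lp_norm p (\<lambda>z. (1 / t) *\<^sub>R (exp (b * t) *\<^sub>R S t z - f z) - (g z + b *\<^sub>R f z)) \<le> ?h t"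
    by (auto simp: eventually_at_right_field intro: exI[of _ 1])
qed (auto intro: always_eventually)

context transport_diffusion
begin

section \<open>Adjoint and density of the range\<close>

lemma adjoint_locale: "transport_diffusion (\<lambda>z. - B z) E \<kappa> d L Lw W"
proof
  show "norm (- B x - - B y) \<le> L * norm (x - y)" for x y
    using B_lipschitz[of y x] by (simp add: norm_minus_commute)
  show "e \<in> Basis \<Longrightarrow> - B (z + t *\<^sub>R e) \<bullet> e = - B z \<bullet> e" for e z t by (simp add: B_invariant)
qed (use E_Basis kappa_nonneg W_ge W_lipschitz L_nonneg in auto)

lemma Pop_adjoint: "transport_diffusion.Pop (\<lambda>z. - B z) E \<kappa> W = Pop_adj"
  "transport_diffusion.Pop_adj (\<lambda>z. - B z) E \<kappa> W = Pop"
proof -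
  interpret adj: transport_diffusion "\<lambda>z. - B z" E \<kappa> d L Lw W by (rule adjoint_locale)
  show "adj.Pop = Pop_adj" "adj.Pop_adj = Pop"
    by (intro ext, simp add: adj.Pop_def adj.Pop_adj_def Pop_def Pop_adj_def sum_negf)+
qed

lemma csupp_Pop_adj: "\<phi> \<in> Cc_inf \<Longrightarrow> csupp (Pop_adj \<phi>)"
  using transport_diffusion.csupp_Pop[OF adjoint_locale] by (simp add: Pop_adjoint)

lemma Pop_add:
  assumes "\<phi> \<in> Cc_inf" "\<psi> \<in> Cc_inf"
  shows "Pop (\<lambda>z. \<phi> z + \<psi> z) z = Pop \<phi> z + Pop \<psi> z"
proof -
  have 1: "dir_deriv e (\<lambda>z. \<phi> z + \<psi> z) = (\<lambda>z. dir_deriv e \<phi> z + dir_deriv e \<psi> z)" for e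
    by (intro ext dir_deriv_add Cc_inf_differentiable assms)
  have 2: "dir_deriv e (dir_deriv e (\<lambda>z. \<phi> z + \<psi> z)) z = dir_deriv e (dir_deriv e \<phi>) z + dir_deriv e (dir_deriv e \<psi>) z"
    if "e \<in> E" for e
    unfolding 1 using that E_Basis by (intro dir_deriv_add Cc_inf_differentiable Cc_inf_dir_deriv assms) auto
  show ?thesis
    using 2 by (simp add: Pop_def 1 scaleR_add_right sum.distrib)
qed

lemma dir_deriv_cmult:
  fixes \<phi> :: "'a \<Rightarrow> complex"
  assumes "\<phi> differentiable (at z)"
  shows "dir_deriv e (\<lambda>z. c * \<phi> z) z = c * dir_deriv e \<phi> z"
  by (rule dir_deriv_eqI[OF has_derivative_mult_right[OF has_derivative_dir_deriv[OF assms]]])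

lemma Pop_cmult:
  assumes "\<phi> \<in> Cc_inf"
  shows "Pop (\<lambda>z. c * \<phi> z) z = c * Pop \<phi> z"
proof -
  have 1: "dir_deriv e (\<lambda>z. c * \<phi> z) = (\<lambda>z. c * dir_deriv e \<phi> z)" for e
    by (intro ext dir_deriv_cmult Cc_inf_differentiable assms)
  have 2: "dir_deriv e (dir_deriv e (\<lambda>z. c * \<phi> z)) z = c * dir_deriv e (dir_deriv e \<phi>) z"
    if "e \<in> E" for e
    unfolding 1 using that E_Basis by (intro dir_deriv_cmult Cc_inf_differentiable Cc_inf_dir_deriv assms) auto
  show ?thesis
    using 2 by (simp add: Pop_def 1 algebra_simps sum_distrib_left)
qed

text \<open>The difference of the integrands is a sum of exact derivatives along axes, up to
  constants: of the product of \<open>\<psi>\<close> and \<open>\<phi>\<close>, weighted by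
  \<open>B \<bullet> e\<close>, and of the Wronskian of \<open>\<psi>\<close> and
  \<open>\<phi>\<close> in the directions of \<open>E\<close>.\<close>

lemma integral_by_parts:
  assumes \<psi>: "\<psi> \<in> Cc_inf" and \<phi>: "\<phi> \<in> Cc_inf"
  shows "(\<integral>z. Pop \<psi> z * \<phi> z \<partial>lborel) = (\<integral>z. \<psi> z * Pop_adj \<phi> z \<partial>lborel)"
proof -
  let ?d = "\<lambda>e u z. dir_deriv e u z"
  have dC: "dir_deriv e u \<in> Cc_inf" "dir_deriv e (dir_deriv e u) \<in> Cc_inf" if "e \<in> Basis" "u \<in> Cc_inf" for e and u :: "'a \<Rightarrow> complex"
    using Cc_inf_dir_deriv that by auto
  have cc: "continuous_on UNIV u" if "u \<in> Cc_inf" for u :: "'a \<Rightarrow> complex" using Cc_inf_csupp[OF that] by (simp add: csupp_def)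
  have cs: "csupp (\<lambda>z. u z * w z)" if "u \<in> Cc_inf" "w \<in> Cc_inf" for u w :: "'a \<Rightarrow> complex"
    by (rule csupp_mult[OF cc Cc_inf_csupp]) (use that in auto)
  have line: "((\<lambda>t. u (z + t *\<^sub>R e)) has_vector_derivative ?d e u z) (at 0)" if "u \<in> Cc_inf" for u :: "'a \<Rightarrow> complex" and z e
    using has_vector_derivative_line[of u z 0 e] Cc_inf_differentiable[OF that] by simp
  have cB: "continuous_on UNIV (\<lambda>z. B z \<bullet> e)" for e by (intro continuous_intros continuous_B)
  have s1: "csupp (\<lambda>z. \<psi> z * ?d e \<phi> z + ?d e \<psi> z * \<phi> z)" if e: "e \<in> Basis" for e
    by (intro csupp_add cs \<psi> \<phi> dC e)
  have i1: "(\<integral>z. (B z \<bullet> e) *\<^sub>R (\<psi> z * ?d e \<phi> z + ?d e \<psi> z * \<phi> z) \<partial>lborel) = 0" if e: "e \<in> Basis" for e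
  proof (rule integral_derivative_eq_0_complex[OF cB _ cs[OF \<psi> \<phi>] s1[OF e]])
    show "B (z + t *\<^sub>R e) \<bullet> e = B z \<bullet> e" for z t by (rule B_invariant[OF e])
    show "((\<lambda>t. \<psi> (z + t *\<^sub>R e) * \<phi> (z + t *\<^sub>R e)) has_vector_derivative \<psi> z * ?d e \<phi> z + ?d e \<psi> z * \<phi> z) (at 0)" for z
      using has_vector_derivative_mult[OF line[OF \<psi>] line[OF \<phi>], of z e z e] by simp
  qed
  have s2: "csupp (\<lambda>z. \<psi> z * ?d e (?d e \<phi>) z - ?d e (?d e \<psi>) z * \<phi> z)" if e: "e \<in> Basis" for e
    by (intro csupp_diff cs \<psi> \<phi> dC e)
  have i2: "(\<integral>z. 1 *\<^sub>R (\<psi> z * ?d e (?d e \<phi>) z - ?d e (?d e \<psi>) z * \<phi> z) \<partial>lborel) = 0" if e: "e \<in> Basis" for e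
  proof (rule integral_derivative_eq_0_complex[OF continuous_on_const _ _ s2[OF e]])
    show "csupp (\<lambda>z. \<psi> z * ?d e \<phi> z - ?d e \<psi> z * \<phi> z)" by (intro csupp_diff cs \<psi> \<phi> dC e)
    show "((\<lambda>t. \<psi> (z + t *\<^sub>R e) * ?d e \<phi> (z + t *\<^sub>R e) - ?d e \<psi> (z + t *\<^sub>R e) * \<phi> (z + t *\<^sub>R e))
      has_vector_derivative \<psi> z * ?d e (?d e \<phi>) z - ?d e (?d e \<psi>) z * \<phi> z) (at 0)" for z
      using has_vector_derivative_diff[OF
          has_vector_derivative_mult[OF line[OF \<psi>] line[OF dC(1)[OF e \<phi>]], of z e z e]
          has_vector_derivative_mult[OF line[OF dC(1)[OF e \<psi>]] line[OF \<phi>], of z e z e]] by simp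
  qed simp
  have eq: "\<psi> z * Pop_adj \<phi> z - Pop \<psi> z * \<phi> z =
     - (\<Sum>e\<in>Basis. (B z \<bullet> e) *\<^sub>R (\<psi> z * ?d e \<phi> z + ?d e \<psi> z * \<phi> z))
     - (\<Sum>e\<in>E. \<kappa> *\<^sub>R (1 *\<^sub>R (\<psi> z * ?d e (?d e \<phi>) z - ?d e (?d e \<psi>) z * \<phi> z)))" for z
    by (simp add: Pop_def Pop_adj_def algebra_simps sum_distrib_left sum.distrib sum_subtractf scaleR_sum_right)
  have I1: "integrable lborel (\<lambda>z. (B z \<bullet> e) *\<^sub>R (\<psi> z * ?d e \<phi> z + ?d e \<psi> z * \<phi> z))" if "e \<in> Basis" for e
    by (rule csupp_integrable[OF csupp_scaleR[OF cB s1[OF that]]])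
  have I2: "integrable lborel (\<lambda>z. \<kappa> *\<^sub>R (1 *\<^sub>R (\<psi> z * ?d e (?d e \<phi>) z - ?d e (?d e \<psi>) z * \<phi> z)))" if "e \<in> E" for e
    using s2[of e] that E_Basis by (intro integrable_scaleR_right csupp_integrable) auto
  have "(\<integral>z. \<psi> z * Pop_adj \<phi> z - Pop \<psi> z * \<phi> z \<partial>lborel)
    = - (\<integral>z. (\<Sum>e\<in>Basis. (B z \<bullet> e) *\<^sub>R (\<psi> z * ?d e \<phi> z + ?d e \<psi> z * \<phi> z)) \<partial>lborel)
      - (\<integral>z. (\<Sum>e\<in>E. \<kappa> *\<^sub>R (1 *\<^sub>R (\<psi> z * ?d e (?d e \<phi>) z - ?d e (?d e \<psi>) z * \<phi> z))) \<partial>lborel)"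
    unfolding eq
  proof -
    let ?A = "\<lambda>z. \<Sum>e\<in>Basis. (B z \<bullet> e) *\<^sub>R (\<psi> z * ?d e \<phi> z + ?d e \<psi> z * \<phi> z)"
    let ?B = "\<lambda>z. \<Sum>e\<in>E. \<kappa> *\<^sub>R (1 *\<^sub>R (\<psi> z * ?d e (?d e \<phi>) z - ?d e (?d e \<psi>) z * \<phi> z))"
    have "integrable lborel ?A" "integrable lborel ?B"
      by (rule Bochner_Integration.integrable_sum[OF I1], simp) (rule Bochner_Integration.integrable_sum[OF I2], simp)
    then have "(\<integral>z. - ?A z - ?B z \<partial>lborel) = (\<integral>z. - ?A z \<partial>lborel) - (\<integral>z. ?B z \<partial>lborel)"
      by (intro Bochner_Integration.integral_diff integrable_minus)
    then show "(\<integral>z. - ?A z - ?B z \<partial>lborel) = - (\<integral>z. ?A z \<partial>lborel) - (\<integral>z. ?B z \<partial>lborel)"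
      by (simp only: integral_minus)
  qed
  also have "(\<integral>z. (\<Sum>e\<in>Basis. (B z \<bullet> e) *\<^sub>R (\<psi> z * ?d e \<phi> z + ?d e \<psi> z * \<phi> z)) \<partial>lborel) = 0"
    by (subst Bochner_Integration.integral_sum[OF I1]) (auto intro!: sum.neutral i1)
  also have "(\<integral>z. (\<Sum>e\<in>E. \<kappa> *\<^sub>R (1 *\<^sub>R (\<psi> z * ?d e (?d e \<phi>) z - ?d e (?d e \<psi>) z * \<phi> z))) \<partial>lborel) = 0"
    by (subst Bochner_Integration.integral_sum[OF I2]) (use i2 E_Basis in \<open>auto intro!: sum.neutral simp del: scaleR_one\<close>)
  finally have "(\<integral>z. \<psi> z * Pop_adj \<phi> z - Pop \<psi> z * \<phi> z \<partial>lborel) = 0" by simp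
  moreover have "integrable lborel (\<lambda>z. \<psi> z * Pop_adj \<phi> z)"
    by (rule csupp_integrable[OF csupp_mult[OF cc[OF \<psi>] csupp_Pop_adj[OF \<phi>]]])
  moreover have "integrable lborel (\<lambda>z. Pop \<psi> z * \<phi> z)"
    by (rule csupp_integrable[OF csupp_mult[OF continuous_Pop[OF Cc_inf_Ck[OF \<psi>]] Cc_inf_csupp[OF \<phi>]]])
  ultimately show ?thesis by simp
qed

text \<open>Let \<open>w\<close> be the residual of the best approximation of \<open>h\<close> from
  the range. Orthogonality says that \<open>dualp p\<close> of \<open>w\<close>, an element of
  \<open>L^q\<close>, solves the adjoint equation weakly; uniqueness for the drift \<open>-B\<close>
  and the exponent \<open>q\<close> makes it vanish, and with it \<open>w\<close>.\<close>

theorem range_dense: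
  assumes p: "1 < p" and \<mu>: "\<mu> > d" and h: "h \<in> Lp p" and e: "e > 0"
  obtains \<phi> where "\<phi> \<in> Cc_inf" "Lp_norm p (\<lambda>z. (\<mu> *\<^sub>R \<phi> z + Pop \<phi> z) - h z) < e"
proof -
  define R where "R = (\<lambda>\<phi> z. \<mu> *\<^sub>R \<phi> z + Pop \<phi> z) ` Cc_inf"
  have cs: "csupp (\<lambda>z. \<mu> *\<^sub>R \<phi> z + Pop \<phi> z)" if "\<phi> \<in> Cc_inf" for \<phi>
    by (intro csupp_add csupp_scaleR csupp_Pop Cc_inf_csupp that continuous_intros)
  have R1: "R \<subseteq> Lp p" using p by (auto simp: R_def intro!: csupp_Lp cs)
  have R2: "R \<noteq> {}" using rhoc_Cc_inf by (auto simp: R_def)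
  have add: "(\<lambda>z. r z + s z) \<in> R" if rs: "r \<in> R" "s \<in> R" for r s
  proof -
    obtain \<phi> \<psi> where \<phi>: "\<phi> \<in> Cc_inf" "\<psi> \<in> Cc_inf" "r = (\<lambda>z. \<mu> *\<^sub>R \<phi> z + Pop \<phi> z)" "s = (\<lambda>z. \<mu> *\<^sub>R \<psi> z + Pop \<psi> z)"
      using rs unfolding R_def image_iff by blast
    then have "(\<lambda>z. r z + s z) = (\<lambda>z. \<mu> *\<^sub>R (\<phi> z + \<psi> z) + Pop (\<lambda>z. \<phi> z + \<psi> z) z)"
      by (simp add: Pop_add algebra_simps)
    then show ?thesis using Cc_inf_add[OF \<phi>(1,2)] by (auto simp: R_def)
  qed
  have cmult: "(\<lambda>z. c * r z) \<in> R" if rR: "r \<in> R" for r c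
  proof -
    obtain \<phi> where \<phi>: "\<phi> \<in> Cc_inf" "r = (\<lambda>z. \<mu> *\<^sub>R \<phi> z + Pop \<phi> z)" using rR unfolding R_def image_iff by blast
    then have "(\<lambda>z. c * r z) = (\<lambda>z. \<mu> *\<^sub>R (c * \<phi> z) + Pop (\<lambda>z. c * \<phi> z) z)"
      by (simp add: Pop_cmult algebra_simps)
    then show ?thesis using Cc_inf_cmult[OF \<phi>(1)] by (auto simp: R_def)
  qed
  obtain r w where r: "\<And>k. r k \<in> R" and w: "w \<in> Lp p" and lim: "(\<lambda>k. Lp_norm p (\<lambda>z. (h z - r k z) - w z)) \<longlonglongrightarrow> 0"
    and orth: "\<And>s. s \<in> R \<Longrightarrow> (\<integral>z. dualp p (w z) * s z \<partial>lborel) = 0"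
    using Lp_projection[OF p h R1 R2 add cmult] by blast
  obtain q where q: "1 < q" "1 / p + 1 / q = 1" using Holder_conjugate[OF p] .
  interpret adj: transport_diffusion "\<lambda>z. - B z" E \<kappa> d L Lw W by (rule adjoint_locale)
  have "AE z in lborel. dualp p (w z) = 0"
  proof (rule adj.weak_solution_unique[OF q(1) Lp_dualp[OF p q(2) w] \<mu>])
    show "(\<integral>y. dualp p (w y) * (\<mu> *\<^sub>R \<phi> y + adj.Pop_adj \<phi> y) \<partial>lborel) = 0" if "\<phi> \<in> Cc_inf" for \<phi>
      unfolding Pop_adjoint using that by (intro orth) (auto simp: R_def)
  qed
  then have w0: "AE z in lborel. w z = 0"
  proof eventually_elim
    case (elim z)
    then have "norm (w z) powr (p - 1) = 0" by (simp flip: norm_dualp)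
    then show ?case by simp
  qed
  obtain k where k: "Lp_norm p (\<lambda>z. (h z - r k z) - w z) < e" using LIMSEQ_D[OF lim e] by auto
  have rk: "r k \<in> Lp p" using r R1 by auto
  have [measurable]: "h \<in> borel_measurable borel" "r k \<in> borel_measurable borel" "w \<in> borel_measurable borel"
    using h rk w by auto
  have "Lp_norm p (\<lambda>z. (h z - r k z) - w z) = Lp_norm p (\<lambda>z. h z - r k z)"
    using w0 by (intro Lp_norm_cong_AE) auto
  then have "Lp_norm p (\<lambda>z. r k z - h z) < e" using k Lp_norm_minus_commute[of p h "r k"] by simp
  moreover obtain \<phi> where "\<phi> \<in> Cc_inf" "r k = (\<lambda>z. \<mu> *\<^sub>R \<phi> z + Pop \<phi> z)" using r[of k] unfolding R_def image_iff by blast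
  ultimately show ?thesis using that by simp
qed

section \<open>Closure and weak graph\<close>

definition test_graph :: "'a op_graph" where
  "test_graph = {(\<phi>, Pop \<phi>) |\<phi>. \<phi> \<in> Cc_inf}"

text \<open>The maximal operator. All derivatives sit on the test function, so the condition makes
  sense for every pair in \<open>L^p\<close>.\<close>

definition weak_graph :: "real \<Rightarrow> 'a op_graph" where
  "weak_graph p = {(f, g). f \<in> Lp p \<and> g \<in> Lp p \<and>
     (\<forall>\<phi>\<in>Cc_inf. (\<integral>z. f z * Pop_adj \<phi> z \<partial>lborel) = (\<integral>z. g z * \<phi> z \<partial>lborel))}"

lemma Pop_Lp: "\<phi> \<in> Cc_inf \<Longrightarrow> 0 < p \<Longrightarrow> Pop \<phi> \<in> Lp p"
  using csupp_Lp[OF csupp_Pop] by blast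

lemma closure_approx:
  assumes "(f, g) \<in> graph_closure p test_graph" "e > 0"
  obtains \<phi> where "\<phi> \<in> Cc_inf" "Lp_norm p (\<lambda>z. \<phi> z - f z) < e" "Lp_norm p (\<lambda>z. Pop \<phi> z - g z) < e"
proof -
  obtain u w where "(u, w) \<in> test_graph" "Lp_norm p (\<lambda>z. u z - f z) < e" "Lp_norm p (\<lambda>z. w z - g z) < e"
    using assms unfolding graph_closure_def by blast
  then show ?thesis using that by (auto simp: test_graph_def)
qed

text \<open>By Hoelder's inequality both sides of the weak equation are continuous in the graph
  seminorm, and on test functions the equation is \<open>integral_by_parts\<close>.\<close>

lemma closure_subset_weak:
  assumes p: "1 < p"
  shows "graph_closure p test_graph \<subseteq> weak_graph p"
proof clarify
  fix f g assume fg: "(f, g) \<in> graph_closure p test_graph"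
  then have Lp: "f \<in> Lp p" "g \<in> Lp p" by (auto simp: graph_closure_def)
  obtain q where q: "1 < q" "1 / p + 1 / q = 1" using Holder_conjugate[OF p] .
  have "(\<integral>z. f z * Pop_adj \<phi> z \<partial>lborel) = (\<integral>z. g z * \<phi> z \<partial>lborel)" if \<phi>: "\<phi> \<in> Cc_inf" for \<phi>
  proof -
    let ?I = "\<integral>z. f z * Pop_adj \<phi> z \<partial>lborel" and ?J = "\<integral>z. g z * \<phi> z \<partial>lborel"
    let ?C = "Lp_norm q (Pop_adj \<phi>) + Lp_norm q \<phi>"
    have aq: "Pop_adj \<phi> \<in> Lp q" "\<phi> \<in> Lp q" using csupp_Lp[OF csupp_Pop_adj[OF \<phi>]] Cc_inf_Lp[OF \<phi>] q by auto
    have le: "norm (?I - ?J) \<le> e * ?C" if e: "e > 0" for e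
    proof -
      obtain \<psi> where \<psi>: "\<psi> \<in> Cc_inf" "Lp_norm p (\<lambda>z. \<psi> z - f z) < e" "Lp_norm p (\<lambda>z. Pop \<psi> z - g z) < e"
        using closure_approx[OF fg e] .
      have \<psi>p: "\<psi> \<in> Lp p" "Pop \<psi> \<in> Lp p" using Cc_inf_Lp[OF \<psi>(1)] Pop_Lp[OF \<psi>(1)] p by auto
      note i = Lp_pairing(1)[OF p q(2)]
      have 1: "(\<integral>z. (\<psi> z - f z) * Pop_adj \<phi> z \<partial>lborel) = (\<integral>z. \<psi> z * Pop_adj \<phi> z \<partial>lborel) - ?I"
        using i[OF \<psi>p(1) aq(1)] i[OF Lp(1) aq(1)] by (simp add: left_diff_distrib)
      have 2: "(\<integral>z. (Pop \<psi> z - g z) * \<phi> z \<partial>lborel) = (\<integral>z. Pop \<psi> z * \<phi> z \<partial>lborel) - ?J"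
        using i[OF \<psi>p(2) aq(2)] i[OF Lp(2) aq(2)] by (simp add: left_diff_distrib)
      have IJ: "?I - ?J = (\<integral>z. (Pop \<psi> z - g z) * \<phi> z \<partial>lborel) - (\<integral>z. (\<psi> z - f z) * Pop_adj \<phi> z \<partial>lborel)"
        using 1 2 integral_by_parts[OF \<psi>(1) \<phi>] by simp
      have "norm (?I - ?J) \<le> norm (\<integral>z. (Pop \<psi> z - g z) * \<phi> z \<partial>lborel) + norm (\<integral>z. (\<psi> z - f z) * Pop_adj \<phi> z \<partial>lborel)"
        unfolding IJ by (rule norm_triangle_ineq4)
      also have "\<dots> \<le> Lp_norm p (\<lambda>z. Pop \<psi> z - g z) * Lp_norm q \<phi> + Lp_norm p (\<lambda>z. \<psi> z - f z) * Lp_norm q (Pop_adj \<phi>)"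
      proof -
        have "(\<lambda>z. Pop \<psi> z - g z) \<in> Lp p" "(\<lambda>z. \<psi> z - f z) \<in> Lp p" using \<psi>p Lp p by (simp_all add: Lp_diff)
        from Lp_pairing(2)[OF p q(2) this(1) aq(2)] Lp_pairing(2)[OF p q(2) this(2) aq(1)]
        show ?thesis by (rule add_mono)
      qed
      also have "\<dots> \<le> e * Lp_norm q \<phi> + e * Lp_norm q (Pop_adj \<phi>)"
        using \<psi> by (intro add_mono mult_right_mono) auto
      finally show ?thesis by (simp add: algebra_simps)
    qed
    have C: "?C \<ge> 0" by simp
    have "norm (?I - ?J) \<le> 0 + e" if "e > 0" for e
    proof -
      have "norm (?I - ?J) \<le> e / (?C + 1) * ?C" by (rule le) (use that C in \<open>simp add: add_nonneg_pos\<close>)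
      also have "\<dots> \<le> e" using that C by (simp add: divide_le_eq add_nonneg_pos mult_left_mono)
      finally show ?thesis by simp
    qed
    then have "norm (?I - ?J) \<le> 0" by (rule field_le_epsilon)
    then show ?thesis by simp
  qed
  then show "(f, g) \<in> weak_graph p" using Lp by (simp add: weak_graph_def)
qed

lemma closure_surj:
  assumes p: "1 < p" and \<mu>: "\<mu> > d" and h: "h \<in> Lp p"
  obtains f where "(f, \<lambda>z. h z - \<mu> *\<^sub>R f z) \<in> graph_closure p test_graph"
proof -
  have "\<exists>\<phi>. \<phi> \<in> Cc_inf \<and> Lp_norm p (\<lambda>z. (\<mu> *\<^sub>R \<phi> z + Pop \<phi> z) - h z) < 1 / real (Suc k)" for k
    using range_dense[OF p \<mu> h, of "1 / real (Suc k)"] by (metis of_nat_0_less_iff zero_less_Suc zero_less_divide_1_iff)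
  then obtain \<phi> where \<phi>: "\<And>k. \<phi> k \<in> Cc_inf" "\<And>k. Lp_norm p (\<lambda>z. (\<mu> *\<^sub>R \<phi> k z + Pop (\<phi> k) z) - h z) < 1 / real (Suc k)"
    by metis
  define r where "r k z = \<mu> *\<^sub>R \<phi> k z + Pop (\<phi> k) z" for k z
  have \<phi>p: "\<phi> k \<in> Lp p" "Pop (\<phi> k) \<in> Lp p" for k using Cc_inf_Lp[OF \<phi>(1)] Pop_Lp[OF \<phi>(1)] p by auto
  have rp: "r k \<in> Lp p" for k unfolding r_def[abs_def] using \<phi>p p by (intro Lp_add Lp_scaleR) auto
  have rlt: "Lp_norm p (\<lambda>z. r k z - h z) < 1 / real (Suc k)" for k using \<phi>(2) by (simp add: r_def)
  have zero: "(\<lambda>k. 1 / real (Suc k)) \<longlonglongrightarrow> 0" using LIMSEQ_inverse_real_of_nat by (simp add: inverse_eq_divide)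
  have rlim: "(\<lambda>k. Lp_norm p (\<lambda>z. r k z - h z)) \<longlonglongrightarrow> 0"
    by (rule tendsto_sandwich[OF _ _ tendsto_const zero]) (use rlt in \<open>auto intro!: always_eventually less_imp_le simp del: of_nat_Suc\<close>)
  have diff: "(\<mu> - d) * Lp_norm p (\<lambda>z. \<phi> m z - \<phi> n z) \<le> Lp_norm p (\<lambda>z. r m z - r n z)" for m n
  proof -
    have c: "(\<lambda>z. (-1) * \<phi> n z) \<in> Cc_inf" by (rule Cc_inf_cmult[OF \<phi>(1)])
    from accretive_Cc_inf[OF p Cc_inf_add[OF \<phi>(1)[of m] c], of \<mu>]
    show ?thesis
      by (simp only: Pop_add[OF \<phi>(1) c] Pop_cmult[OF \<phi>(1)]) (simp add: r_def algebra_simps)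
  qed
  have "\<exists>f\<in>Lp p. (\<lambda>k. Lp_norm p (\<lambda>z. \<phi> k z - f z)) \<longlonglongrightarrow> 0"
  proof (rule Lp_complete[OF p \<phi>p(1)])
    fix e :: real assume e: "e > 0"
    \<comment> \<open>Two distances to \<open>h\<close>, each below \<open>e'\<close>, and the
      factor \<open>\<mu> - d\<close> in \<open>diff\<close> together give \<open>e\<close>.\<close>
    define e' where "e' = (\<mu> - d) * e / 2"
    have e': "e' > 0" using e \<mu> by (simp add: e'_def)
    then obtain M where M: "\<And>k. k \<ge> M \<Longrightarrow> Lp_norm p (\<lambda>z. r k z - h z) < e'"
      using LIMSEQ_D[OF rlim, of e'] by auto
    have "Lp_norm p (\<lambda>z. \<phi> m z - \<phi> n z) < e" if "m \<ge> M" "n \<ge> M" for m n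
    proof -
      have "(\<mu> - d) * Lp_norm p (\<lambda>z. \<phi> m z - \<phi> n z) < (\<mu> - d) * e"
        using diff[of m n] Lp_norm_triangle[OF p rp[of m] h rp[of n]] M[OF that(1)] M[OF that(2)]
          Lp_norm_minus_commute[of p h "r n"] by (simp add: e'_def)
      then show ?thesis using \<mu> by simp
    qed
    then show "\<exists>M. \<forall>m\<ge>M. \<forall>n\<ge>M. Lp_norm p (\<lambda>z. \<phi> m z - \<phi> n z) < e" by blast
  qed
  then obtain f where f: "f \<in> Lp p" "(\<lambda>k. Lp_norm p (\<lambda>z. \<phi> k z - f z)) \<longlonglongrightarrow> 0" by blast
  let ?g = "\<lambda>z. h z - \<mu> *\<^sub>R f z"
  have g: "?g \<in> Lp p" using h f p by (intro Lp_diff Lp_scaleR) auto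
  have glim: "(\<lambda>k. Lp_norm p (\<lambda>z. Pop (\<phi> k) z - ?g z)) \<longlonglongrightarrow> 0"
  proof (rule tendsto_sandwich[OF _ _ tendsto_const])
    show "(\<lambda>k. Lp_norm p (\<lambda>z. r k z - h z) + \<bar>\<mu>\<bar> * Lp_norm p (\<lambda>z. \<phi> k z - f z)) \<longlonglongrightarrow> 0"
      using tendsto_add[OF rlim tendsto_mult_right_zero[OF f(2), of "\<bar>\<mu>\<bar>"]] by simp
    have "Lp_norm p (\<lambda>z. Pop (\<phi> k) z - ?g z) \<le> Lp_norm p (\<lambda>z. r k z - h z) + \<bar>\<mu>\<bar> * Lp_norm p (\<lambda>z. \<phi> k z - f z)" for k
    proof -
      have "Lp_norm p (\<lambda>z. Pop (\<phi> k) z - ?g z) = Lp_norm p (\<lambda>z. (r k z - h z) + (- \<mu>) *\<^sub>R (\<phi> k z - f z))"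
        by (simp add: r_def algebra_simps)
      moreover have "Lp_norm p (\<lambda>z. (r k z - h z) + (- \<mu>) *\<^sub>R (\<phi> k z - f z))
        \<le> Lp_norm p (\<lambda>z. r k z - h z) + Lp_norm p (\<lambda>z. (- \<mu>) *\<^sub>R (\<phi> k z - f z))"
        using rp h \<phi>p f p by (intro Lp_norm_add Lp_diff Lp_scaleR) auto
      moreover have "Lp_norm p (\<lambda>z. (- \<mu>) *\<^sub>R (\<phi> k z - f z)) = \<bar>\<mu>\<bar> * Lp_norm p (\<lambda>z. \<phi> k z - f z)"
        using Lp_norm_scaleR[of p "- \<mu>" "\<lambda>z. \<phi> k z - f z"] p by simp
      ultimately show ?thesis by simp
    qed
    then show "\<forall>\<^sub>F k in sequentially. Lp_norm p (\<lambda>z. Pop (\<phi> k) z - ?g z) \<le> Lp_norm p (\<lambda>z. r k z - h z) + \<bar>\<mu>\<bar> * Lp_norm p (\<lambda>z. \<phi> k z - f z)"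
      by (intro always_eventually allI)
  qed (auto intro: always_eventually)
  have "(f, ?g) \<in> graph_closure p test_graph"
    unfolding graph_closure_def mem_Collect_eq prod.case
  proof (intro conjI allI impI f(1) g)
    fix e :: real assume e: "e > 0"
    have "\<forall>\<^sub>F k in sequentially. Lp_norm p (\<lambda>z. \<phi> k z - f z) < e \<and> Lp_norm p (\<lambda>z. Pop (\<phi> k) z - ?g z) < e"
      using order_tendstoD(2)[OF f(2) e] order_tendstoD(2)[OF glim e] by (rule eventually_conj)
    then obtain k where "Lp_norm p (\<lambda>z. \<phi> k z - f z) < e \<and> Lp_norm p (\<lambda>z. Pop (\<phi> k) z - ?g z) < e"
      by (auto simp: eventually_sequentially)
    moreover have "(\<phi> k, Pop (\<phi> k)) \<in> test_graph" using \<phi>(1) by (auto simp: test_graph_def)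
    ultimately show "\<exists>(u, w)\<in>test_graph. Lp_norm p (\<lambda>z. u z - f z) < e \<and> Lp_norm p (\<lambda>z. w z - ?g z) < e" by blast
  qed
  then show ?thesis using that by blast
qed

lemma graph_closure_cong_AE:
  assumes p: "1 < p" and fg: "(f, g) \<in> graph_closure p test_graph" and Lp: "f' \<in> Lp p" "g' \<in> Lp p"
    and ae: "AE z in lborel. f z = f' z" "AE z in lborel. g z = g' z"
  shows "(f', g') \<in> graph_closure p test_graph"
  unfolding graph_closure_def mem_Collect_eq prod.case
proof (intro conjI allI impI Lp)
  fix e :: real assume "e > 0"
  obtain \<phi> where \<phi>: "\<phi> \<in> Cc_inf" "Lp_norm p (\<lambda>z. \<phi> z - f z) < e" "Lp_norm p (\<lambda>z. Pop \<phi> z - g z) < e"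
    using closure_approx[OF fg \<open>e > 0\<close>] .
  have [measurable]: "f \<in> borel_measurable borel" "g \<in> borel_measurable borel"
    using fg by (auto simp: graph_closure_def)
  have [measurable]: "f' \<in> borel_measurable borel" "g' \<in> borel_measurable borel" using Lp by auto
  have [measurable]: "\<phi> \<in> borel_measurable borel" "Pop \<phi> \<in> borel_measurable borel"
    using csupp_measurable[OF Cc_inf_csupp[OF \<phi>(1)]] csupp_measurable[OF csupp_Pop[OF \<phi>(1)]] by auto
  have "Lp_norm p (\<lambda>z. \<phi> z - f z) = Lp_norm p (\<lambda>z. \<phi> z - f' z)" "Lp_norm p (\<lambda>z. Pop \<phi> z - g z) = Lp_norm p (\<lambda>z. Pop \<phi> z - g' z)"
    using ae by (intro Lp_norm_cong_AE; auto)+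
  then show "\<exists>(u, w)\<in>test_graph. Lp_norm p (\<lambda>z. u z - f' z) < e \<and> Lp_norm p (\<lambda>z. w z - g' z) < e"
    using \<phi> by (auto simp: test_graph_def)
qed

theorem closure_eq_weak:
  assumes p: "1 < p"
  shows "graph_closure p test_graph = weak_graph p"
proof
  show "graph_closure p test_graph \<subseteq> weak_graph p" by (rule closure_subset_weak[OF p])
  show "weak_graph p \<subseteq> graph_closure p test_graph"
  proof clarify
    fix f g assume fg: "(f, g) \<in> weak_graph p"
    then have Lp: "f \<in> Lp p" "g \<in> Lp p" and w: "\<And>\<phi>. \<phi> \<in> Cc_inf \<Longrightarrow> (\<integral>z. f z * Pop_adj \<phi> z \<partial>lborel) = (\<integral>z. g z * \<phi> z \<partial>lborel)"
      by (auto simp: weak_graph_def)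
    \<comment> \<open>Any value above \<open>d\<close> would do. \<open>f1\<close> solves in the
      closure the equation that \<open>f\<close> solves weakly, so \<open>f - f1\<close> is a weak
      solution of the homogeneous equation; once \<open>f1 = f\<close> almost everywhere,
      \<open>g\<close> is recovered from \<open>h\<close>.\<close>
    define \<mu> where "\<mu> = d + 1"
    have \<mu>: "\<mu> > d" by (simp add: \<mu>_def)
    define h where "h z = \<mu> *\<^sub>R f z + g z" for z
    have h: "h \<in> Lp p" unfolding h_def[abs_def] using Lp p by (intro Lp_add Lp_scaleR) auto
    obtain f1 where f1: "(f1, \<lambda>z. h z - \<mu> *\<^sub>R f1 z) \<in> graph_closure p test_graph" using closure_surj[OF p \<mu> h] .
    define g1 where "g1 z = h z - \<mu> *\<^sub>R f1 z" for z
    have fg1: "(f1, g1) \<in> graph_closure p test_graph" using f1 by (simp add: g1_def[abs_def])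
    then have "(f1, g1) \<in> weak_graph p" using closure_subset_weak[OF p] by blast
    then have Lp1: "f1 \<in> Lp p" "g1 \<in> Lp p" and w1: "\<And>\<phi>. \<phi> \<in> Cc_inf \<Longrightarrow> (\<integral>z. f1 z * Pop_adj \<phi> z \<partial>lborel) = (\<integral>z. g1 z * \<phi> z \<partial>lborel)"
      by (auto simp: weak_graph_def)
    have dLp: "(\<lambda>z. f z - f1 z) \<in> Lp p" using Lp Lp1 p by (intro Lp_diff) auto
    have "AE z in lborel. f z - f1 z = 0"
    proof (rule weak_solution_unique[OF p dLp \<mu>])
      fix \<phi> :: "'a \<Rightarrow> complex" assume \<phi>: "\<phi> \<in> Cc_inf"
      note i = Lp_integrable_csupp[OF p]
      note c = Cc_inf_csupp[OF \<phi>] csupp_Pop_adj[OF \<phi>]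
      have "(\<integral>z. (f z - f1 z) * (\<mu> *\<^sub>R \<phi> z + Pop_adj \<phi> z) \<partial>lborel)
         = (\<integral>z. (f z - f1 z) * (\<mu> *\<^sub>R \<phi> z) \<partial>lborel) + (\<integral>z. (f z - f1 z) * Pop_adj \<phi> z \<partial>lborel)"
        by (rule Lp_pairing_add[OF p dLp csupp_scaleR[OF continuous_on_const c(1)] c(2)])
      also have "(\<integral>z. (f z - f1 z) * Pop_adj \<phi> z \<partial>lborel) = (\<integral>z. f z * Pop_adj \<phi> z \<partial>lborel) - (\<integral>z. f1 z * Pop_adj \<phi> z \<partial>lborel)"
        unfolding left_diff_distrib by (rule Bochner_Integration.integral_diff[OF i[OF Lp(1) c(2)] i[OF Lp1(1) c(2)]])
      also have "\<dots> = (\<integral>z. g z * \<phi> z \<partial>lborel) - (\<integral>z. g1 z * \<phi> z \<partial>lborel)" by (simp only: w[OF \<phi>] w1[OF \<phi>])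
      also have "\<dots> = (\<integral>z. g z * \<phi> z - g1 z * \<phi> z \<partial>lborel)"
        by (rule Bochner_Integration.integral_diff[OF i[OF Lp(2) c(1)] i[OF Lp1(2) c(1)], symmetric])
      also have "(\<lambda>z. g z * \<phi> z - g1 z * \<phi> z) = (\<lambda>z. - ((f z - f1 z) * (\<mu> *\<^sub>R \<phi> z)))"
        by (rule ext) (simp add: g1_def h_def algebra_simps)
      finally show "(\<integral>z. (f z - f1 z) * (\<mu> *\<^sub>R \<phi> z + Pop_adj \<phi> z) \<partial>lborel) = 0" by simp
    qed
    then have ae: "AE z in lborel. f1 z = f z" by eventually_elim simp
    then have "AE z in lborel. g1 z = g z" by eventually_elim (simp add: g1_def h_def)
    with ae show "(f, g) \<in> graph_closure p test_graph" by (intro graph_closure_cong_AE[OF p fg1 Lp])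
  qed
qed

text \<open>Through the weak equation, \<open>f\<close> determines all pairings of \<open>g\<close>
  with test functions, hence \<open>g\<close> almost everywhere.\<close>

theorem closable_test_graph:
  assumes p: "1 < p"
  shows "closable p test_graph"
  unfolding closable_def
proof (intro conjI allI impI)
  show "test_graph \<subseteq> Lp p \<times> Lp p" using p by (auto simp: test_graph_def intro: Cc_inf_Lp Pop_Lp)
  fix f f' g g' assume *: "(f, g) \<in> graph_closure p test_graph \<and> (f', g') \<in> graph_closure p test_graph \<and> ae_eq f f'"
  then have w: "(f, g) \<in> weak_graph p" "(f', g') \<in> weak_graph p" using closure_subset_weak[OF p] by auto
  then have Lp: "f \<in> Lp p" "g \<in> Lp p" "f' \<in> Lp p" "g' \<in> Lp p" by (auto simp: weak_graph_def)
  have "AE z in lborel. g z - g' z = 0"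
  proof (rule Lp_fundamental_lemma[OF p])
    show "(\<lambda>z. g z - g' z) \<in> Lp p" using Lp p by (intro Lp_diff) auto
    fix \<phi> :: "'a \<Rightarrow> complex" assume \<phi>: "\<phi> \<in> Cc_inf"
    note i = Lp_integrable_csupp[OF p]
    have "(\<integral>z. f z * Pop_adj \<phi> z \<partial>lborel) = (\<integral>z. f' z * Pop_adj \<phi> z \<partial>lborel)"
    proof (rule integral_cong_AE)
      show "AE z in lborel. f z * Pop_adj \<phi> z = f' z * Pop_adj \<phi> z"
        using * by (auto simp: ae_eq_def elim!: eventually_mono)
    qed (use i[OF Lp(1) csupp_Pop_adj[OF \<phi>]] i[OF Lp(3) csupp_Pop_adj[OF \<phi>]] in auto)
    then have "(\<integral>z. g z * \<phi> z \<partial>lborel) = (\<integral>z. g' z * \<phi> z \<partial>lborel)" using w \<phi> by (auto simp: weak_graph_def)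
    then show "(\<integral>z. (g z - g' z) * \<phi> z \<partial>lborel) = 0"
      using i[OF Lp(2) Cc_inf_csupp[OF \<phi>]] i[OF Lp(4) Cc_inf_csupp[OF \<phi>]] by (simp add: left_diff_distrib)
  qed
  then show "ae_eq g g'" by (simp add: ae_eq_def)
qed

lemma weak_graph_add:
  assumes p: "1 < p" and "(f, g) \<in> weak_graph p" "(f', g') \<in> weak_graph p"
  shows "(\<lambda>z. f z + f' z, \<lambda>z. g z + g' z) \<in> weak_graph p"
proof -
  have Lp: "f \<in> Lp p" "g \<in> Lp p" "f' \<in> Lp p" "g' \<in> Lp p" using assms by (auto simp: weak_graph_def)
  note i = Lp_integrable_csupp[OF p]
  show ?thesis
    using assms Lp by (auto simp: weak_graph_def distrib_right intro!: Lp_add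
      simp: Bochner_Integration.integral_add[OF i[OF Lp(1) csupp_Pop_adj] i[OF Lp(3) csupp_Pop_adj]]
        Bochner_Integration.integral_add[OF i[OF Lp(2) Cc_inf_csupp] i[OF Lp(4) Cc_inf_csupp]])
qed

lemma weak_graph_cmult:
  assumes "(f, g) \<in> weak_graph p"
  shows "(\<lambda>z. c * f z, \<lambda>z. c * g z) \<in> weak_graph p"
  using assms by (auto simp: weak_graph_def mult.assoc intro: Lp_cmult)

lemma weak_graph_scaleR:
  assumes "(f, g) \<in> weak_graph p"
  shows "(\<lambda>z. c *\<^sub>R f z, \<lambda>z. c *\<^sub>R g z) \<in> weak_graph p"
  using weak_graph_cmult[OF assms, of "of_real c"] by (simp add: scaleR_conv_of_real)

text \<open>\<open>closure_eq_weak\<close> supplies test functions that approximate the pair in the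
  graph seminorm, and both sides of the inequality are continuous in it.\<close>

lemma weak_graph_accretive:
  assumes p: "1 < p" and fg: "(f, g) \<in> weak_graph p"
  shows "(\<mu> - d) * Lp_norm p f \<le> Lp_norm p (\<lambda>z. \<mu> *\<^sub>R f z + g z)"
proof -
  have Lp: "f \<in> Lp p" "g \<in> Lp p" using fg by (auto simp: weak_graph_def)
  have cl: "(f, g) \<in> graph_closure p test_graph" using fg closure_eq_weak[OF p] by simp
  have "(\<mu> - d) * Lp_norm p f \<le> Lp_norm p (\<lambda>z. \<mu> *\<^sub>R f z + g z) + e * (\<bar>\<mu> - d\<bar> + \<bar>\<mu>\<bar> + 1)" if e: "e > 0" for e
  proof -
    obtain \<phi> where \<phi>: "\<phi> \<in> Cc_inf" "Lp_norm p (\<lambda>z. \<phi> z - f z) < e" "Lp_norm p (\<lambda>z. Pop \<phi> z - g z) < e"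
      using closure_approx[OF cl e] .
    have \<phi>p: "\<phi> \<in> Lp p" "Pop \<phi> \<in> Lp p" using Cc_inf_Lp[OF \<phi>(1)] Pop_Lp[OF \<phi>(1)] p by auto
    have a: "(\<lambda>z. \<mu> *\<^sub>R \<phi> z + Pop \<phi> z) \<in> Lp p" "(\<lambda>z. \<mu> *\<^sub>R f z + g z) \<in> Lp p"
      using \<phi>p Lp p by (auto intro!: Lp_add Lp_scaleR)
    have "Lp_norm p (\<lambda>z. (\<mu> *\<^sub>R \<phi> z + Pop \<phi> z) - (\<mu> *\<^sub>R f z + g z))
      = Lp_norm p (\<lambda>z. \<mu> *\<^sub>R (\<phi> z - f z) + (Pop \<phi> z - g z))" by (simp add: algebra_simps)
    also have "\<dots> \<le> Lp_norm p (\<lambda>z. \<mu> *\<^sub>R (\<phi> z - f z)) + Lp_norm p (\<lambda>z. Pop \<phi> z - g z)"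
      using \<phi>p Lp p by (intro Lp_norm_add Lp_scaleR Lp_diff) auto
    also have "Lp_norm p (\<lambda>z. \<mu> *\<^sub>R (\<phi> z - f z)) = \<bar>\<mu>\<bar> * Lp_norm p (\<lambda>z. \<phi> z - f z)"
      using Lp_norm_scaleR[of p \<mu> "\<lambda>z. \<phi> z - f z"] p by simp
    also have "\<bar>\<mu>\<bar> * Lp_norm p (\<lambda>z. \<phi> z - f z) \<le> \<bar>\<mu>\<bar> * e" using \<phi>(2) by (intro mult_left_mono) auto
    finally have 1: "Lp_norm p (\<lambda>z. \<mu> *\<^sub>R \<phi> z + Pop \<phi> z) \<le> Lp_norm p (\<lambda>z. \<mu> *\<^sub>R f z + g z) + (\<bar>\<mu>\<bar> * e + e)"
      using Lp_norm_abs_diff[OF p a] \<phi>(3) by linarith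
    have "\<bar>Lp_norm p \<phi> - Lp_norm p f\<bar> \<le> e" using Lp_norm_abs_diff[OF p \<phi>p(1) Lp(1)] \<phi>(2) by linarith
    then have "\<bar>(\<mu> - d) * (Lp_norm p f - Lp_norm p \<phi>)\<bar> \<le> \<bar>\<mu> - d\<bar> * e"
      unfolding abs_mult by (intro mult_left_mono) auto
    then have "(\<mu> - d) * Lp_norm p f \<le> (\<mu> - d) * Lp_norm p \<phi> + \<bar>\<mu> - d\<bar> * e"
      by (simp add: right_diff_distrib abs_le_iff)
    then show ?thesis using accretive_Cc_inf[OF p \<phi>(1), of \<mu>] 1 by (simp add: algebra_simps)
  qed
  note * = this
  define C where "C = \<bar>\<mu> - d\<bar> + \<bar>\<mu>\<bar> + 1"
  have C: "C > 0" by (simp add: C_def)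
  show ?thesis
  proof (rule field_le_epsilon)
    fix e :: real assume "e > 0"
    then show "(\<mu> - d) * Lp_norm p f \<le> Lp_norm p (\<lambda>z. \<mu> *\<^sub>R f z + g z) + e"
      using *[of "e / C"] C by (simp add: C_def[symmetric])
  qed
qed

text \<open>\<open>A\<close> stands for \<open>(P + d) / m\<close>: the shift turns the estimate of
  \<open>weak_graph_accretive\<close> into accretivity, and the factor \<open>1 / m\<close> matches
  the time scale of the claim. The shift is undone by the factor \<open>exp (d t / m)\<close> in
  \<open>T'\<close>.\<close>

theorem generates_weak_graph:
  assumes p: "1 < p" and m: "m > 0"
  shows "\<exists>T. generates p (op_scale (1 / m) (weak_graph p)) T"
proof -
  define A where "A = {(f, g). f \<in> Lp p \<and> g \<in> Lp p \<and> (f, \<lambda>z. m *\<^sub>R g z - d *\<^sub>R f z) \<in> weak_graph p}"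
  have A_iff: "(f, g) \<in> A \<longleftrightarrow> f \<in> Lp p \<and> g \<in> Lp p \<and> (f, \<lambda>z. m *\<^sub>R g z - d *\<^sub>R f z) \<in> weak_graph p" for f g
    by (simp add: A_def)
  interpret complete_seminorm "Lp p" "Lp_norm p" by (rule Lp_complete_seminorm[OF p])
  interpret m_accretive "Lp p" "Lp_norm p" A
  proof
    show "(x, y) \<in> A \<Longrightarrow> x \<in> Lp p \<and> y \<in> Lp p" for x y by (simp add: A_iff)
    have addA: "x + y \<in> A" if "x \<in> A" "y \<in> A" for x y
    proof -
      obtain x1 x2 y1 y2 where xy: "x = (x1, x2)" "y = (y1, y2)" by (cases x, cases y)
      have "(\<lambda>z. x1 z + y1 z, \<lambda>z. (m *\<^sub>R x2 z - d *\<^sub>R x1 z) + (m *\<^sub>R y2 z - d *\<^sub>R y1 z)) \<in> weak_graph p"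
        using that xy by (intro weak_graph_add[OF p]) (auto simp: A_iff)
      moreover have "(\<lambda>z. (m *\<^sub>R x2 z - d *\<^sub>R x1 z) + (m *\<^sub>R y2 z - d *\<^sub>R y1 z)) = (\<lambda>z. m *\<^sub>R (x2 + y2) z - d *\<^sub>R (x1 + y1) z)"
        by (rule ext) (simp add: algebra_simps)
      ultimately show ?thesis using that by (simp add: xy A_iff) (simp add: plus_fun_def)
    qed
    have scaleA: "c *\<^sub>R x \<in> A" if "x \<in> A" for c x
    proof -
      obtain x1 x2 where xy: "x = (x1, x2)" by (cases x)
      have "(\<lambda>z. c *\<^sub>R x1 z, \<lambda>z. c *\<^sub>R (m *\<^sub>R x2 z - d *\<^sub>R x1 z)) \<in> weak_graph p"
        using that xy by (intro weak_graph_scaleR) (auto simp: A_iff)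
      moreover have "(\<lambda>z. c *\<^sub>R (m *\<^sub>R x2 z - d *\<^sub>R x1 z)) = (\<lambda>z. m *\<^sub>R (c *\<^sub>R x2) z - d *\<^sub>R (c *\<^sub>R x1) z)"
        by (rule ext) (simp add: scaleR_fun_def scaleR_diff_right mult.commute)
      ultimately show ?thesis using that by (simp add: xy A_iff) (simp add: scaleR_fun_def)
    qed
    have null: "(x, y) \<in> A" if "x \<in> Lp p" "y \<in> Lp p" "Lp_norm p x = 0" "Lp_norm p y = 0" for x y
    proof -
      have x0: "AE z in lborel. x z = 0" and y0: "AE z in lborel. y z = 0"
        using that Lp_norm_eq_0_iff[of p x] Lp_norm_eq_0_iff[of p y] p by auto
      have g: "(\<lambda>z. m *\<^sub>R y z - d *\<^sub>R x z) \<in> Lp p" using that p by (intro Lp_diff Lp_scaleR) auto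
      have "(\<integral>z. x z * Pop_adj \<phi> z \<partial>lborel) = (\<integral>z. (m *\<^sub>R y z - d *\<^sub>R x z) * \<phi> z \<partial>lborel)" if \<phi>: "\<phi> \<in> Cc_inf" for \<phi>
      proof (rule integral_cong_AE)
        show "AE z in lborel. x z * Pop_adj \<phi> z = (m *\<^sub>R y z - d *\<^sub>R x z) * \<phi> z"
          using x0 y0 by eventually_elim simp
      qed (use Lp_integrable_csupp[OF p \<open>x \<in> Lp p\<close> csupp_Pop_adj[OF \<phi>]] Lp_integrable_csupp[OF p g Cc_inf_csupp[OF \<phi>]] in auto)
      then show ?thesis using that g by (simp add: A_iff weak_graph_def)
    qed
    then show "x \<in> Lp p \<Longrightarrow> y \<in> Lp p \<Longrightarrow> Lp_norm p x = 0 \<Longrightarrow> Lp_norm p y = 0 \<Longrightarrow> (x, y) \<in> A" for x y .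
    have "(0, 0) \<in> A" by (rule null) auto
    then show "subspace A" using addA scaleA by (auto simp: subspace_def zero_prod_def)
    show "Lp_norm p x \<le> Lp_norm p (x + h *\<^sub>R y)" if xy: "(x, y) \<in> A" and h: "h > 0" for x y h
    proof -
      \<comment> \<open>The parameter for which
        \<open>\<mu> x + P x = (m / h) (x + h A x)\<close>.\<close>
      define \<mu> where "\<mu> = m / h + d"
      have eq: "\<mu> *\<^sub>R x z + (m *\<^sub>R y z - d *\<^sub>R x z) = (m / h) *\<^sub>R (x + h *\<^sub>R y) z" for z
        using h by (simp add: \<mu>_def scaleR_fun_def scaleR_add_left scaleR_add_right)
      have "(m / h) * Lp_norm p x = (\<mu> - d) * Lp_norm p x" by (simp add: \<mu>_def)
      also have "\<dots> \<le> Lp_norm p (\<lambda>z. \<mu> *\<^sub>R x z + (m *\<^sub>R y z - d *\<^sub>R x z))"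
        using xy by (intro weak_graph_accretive[OF p]) (simp add: A_iff)
      also have "\<dots> = (m / h) * Lp_norm p (x + h *\<^sub>R y)"
        unfolding eq using Lp_norm_scaleR[of p "m / h" "x + h *\<^sub>R y"] p m h by simp
      finally show ?thesis using m h by (simp add: field_simps)
    qed
    show "\<exists>x y. (x, y) \<in> A \<and> x + h *\<^sub>R y = z" if h: "h > 0" and z: "z \<in> Lp p" for h z
    proof -
      define \<mu> where "\<mu> = m / h + d"
      have \<mu>: "\<mu> > d" using m h by (simp add: \<mu>_def)
      obtain f where f: "(f, \<lambda>x. (m / h) *\<^sub>R z x - \<mu> *\<^sub>R f x) \<in> graph_closure p test_graph"
        using closure_surj[OF p \<mu> Lp_scaleR[OF z, of "m / h"]] .
      define y where "y = (1 / h) *\<^sub>R (z - f)"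
      have fL: "f \<in> Lp p" using f by (auto simp: graph_closure_def)
      have eq: "(\<lambda>x. (m / h) *\<^sub>R z x - \<mu> *\<^sub>R f x) = (\<lambda>x. m *\<^sub>R y x - d *\<^sub>R f x)"
        by (rule ext) (simp add: y_def \<mu>_def scaleR_fun_def algebra_simps)
      have "(f, y) \<in> A"
        using f fL z unfolding eq closure_eq_weak[OF p] by (simp add: A_iff) (simp add: y_def)
      moreover have "f + h *\<^sub>R y = z" using h by (simp add: y_def)
      ultimately show ?thesis by blast
    qed
    show "\<exists>u w. (u, w) \<in> A \<and> Lp_norm p (u - x) < e" if x: "x \<in> Lp p" and e: "e > 0" for x e
    proof -
      obtain \<phi> where \<phi>: "\<phi> \<in> Cc_inf" "Lp_norm p (\<lambda>z. \<phi> z - x z) < e" using Lp_dense_Cc_inf[OF p x e] .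
      have \<phi>p: "\<phi> \<in> Lp p" "Pop \<phi> \<in> Lp p" using Cc_inf_Lp[OF \<phi>(1)] Pop_Lp[OF \<phi>(1)] p by auto
      have w: "(\<phi>, Pop \<phi>) \<in> weak_graph p"
        using \<phi>p integral_by_parts[OF \<phi>(1)] by (simp add: weak_graph_def)
      define y where "y z = (1 / m) *\<^sub>R (Pop \<phi> z + d *\<^sub>R \<phi> z)" for z
      have "y \<in> Lp p" unfolding y_def[abs_def] using \<phi>p p by (intro Lp_add Lp_scaleR) auto
      moreover have "(\<lambda>z. m *\<^sub>R y z - d *\<^sub>R \<phi> z) = Pop \<phi>" using m by (auto simp: y_def)
      ultimately have "(\<phi>, y) \<in> A" using w \<phi>p by (simp add: A_iff)
      then show ?thesis using \<phi>(2) by (auto simp: fun_diff_def)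
    qed
  qed
  define a where "a = d / m"
  define T' where "T' t f = exp (a * t) *\<^sub>R T t f" for t f
  have T'X: "T' t f \<in> Lp p" if "f \<in> Lp p" "t \<ge> 0" for t f using T_X[OF that] by (simp add: T'_def)
  have N: "ae_eq f g" if "f \<in> Lp p" "g \<in> Lp p" "Lp_norm p (f - g) = 0" for f g
    using that by (simp add: ae_eq_iff_Lp_norm[OF p] fun_diff_def)
  \<comment> \<open>The abstract theory knows real scalars only; homogeneity for complex
    \<open>c\<close> holds because multiplication by \<open>c\<close> preserves
    \<open>A\<close>.\<close>
  have scaleT: "Lp_norm p (T t (\<lambda>z. c * f z) - (\<lambda>z. c * T t f z)) = 0" if f: "f \<in> Lp p" "t \<ge> 0" for t f c
  proof (rule T_commute_op[where S = "\<lambda>f z. c * f z" and C = "norm c", OF _ _ _ _ f])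
    show "x \<in> Lp p \<Longrightarrow> (\<lambda>z. c * x z) \<in> Lp p" for x by (rule Lp_cmult)
    show "(\<lambda>z. c * x z, \<lambda>z. c * y z) \<in> A" if "(x, y) \<in> A" for x y
    proof -
      have "(\<lambda>z. c * x z, \<lambda>z. c * (m *\<^sub>R y z - d *\<^sub>R x z)) \<in> weak_graph p"
        using that by (intro weak_graph_cmult) (simp add: A_iff)
      moreover have "c * (m *\<^sub>R y z - d *\<^sub>R x z) = m *\<^sub>R (c * y z) - d *\<^sub>R (c * x z)" for z
        by (simp add: right_diff_distrib)
      ultimately show ?thesis using that Lp_cmult by (auto simp: A_iff)
    qed
    show "(\<lambda>z. c * (x + b *\<^sub>R y) z) = (\<lambda>z. c * x z) + b *\<^sub>R (\<lambda>z. c * y z)" for x y b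
      by (rule ext) (simp add: scaleR_fun_def distrib_left)
    show "Lp_norm p (\<lambda>z. c * x z) \<le> norm c * Lp_norm p x" for x using Lp_norm_cmult[of p c x] p by simp
  qed
  have "C0_semigroup p T'"
    unfolding C0_semigroup_def
  proof (intro conjI allI impI ballI)
    fix t :: real assume t: "t \<ge> 0"
    show "bounded_operator p (T' t)"
      unfolding bounded_operator_def
    proof (intro conjI ballI allI)
      show "T' t f \<in> Lp p" if "f \<in> Lp p" for f by (rule T'X[OF that t])
      show "ae_eq (T' t (\<lambda>z. f z + g z)) (\<lambda>z. T' t f z + T' t g z)" if fg: "f \<in> Lp p" "g \<in> Lp p" for f g
      proof -
        have "Lp_norm p (exp (a * t) *\<^sub>R (T t (f + g) - (T t f + T t g))) = 0"
          using T_add[OF fg t] T_X[OF _ t] fg by (simp add: N_scale)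
        also have "exp (a * t) *\<^sub>R (T t (f + g) - (T t f + T t g)) = T' t (f + g) - (T' t f + T' t g)"
          by (simp add: T'_def algebra_simps)
        finally have "ae_eq (T' t (f + g)) (T' t f + T' t g)"
          by (rule N[OF T'X[OF X_add[OF fg] t] X_add[OF T'X[OF fg(1) t] T'X[OF fg(2) t]]])
        then show ?thesis by (simp add: plus_fun_def)
      qed
      show "ae_eq (T' t (\<lambda>z. c * f z)) (\<lambda>z. c * T' t f z)" if f: "f \<in> Lp p" for f c
      proof -
        have X: "T t (\<lambda>z. c * f z) \<in> Lp p" "(\<lambda>z. c * T t f z) \<in> Lp p" by (intro T_X Lp_cmult f t)+
        have "Lp_norm p (exp (a * t) *\<^sub>R (T t (\<lambda>z. c * f z) - (\<lambda>z. c * T t f z))) = 0"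
          using scaleT[OF f t] X by (simp add: N_scale)
        also have "exp (a * t) *\<^sub>R (T t (\<lambda>z. c * f z) - (\<lambda>z. c * T t f z)) = T' t (\<lambda>z. c * f z) - (\<lambda>z. c * T' t f z)"
          by (rule ext) (simp add: T'_def scaleR_fun_def scaleR_diff_right)
        finally show ?thesis by (rule N[OF T'X[OF Lp_cmult[OF f] t] Lp_cmult[OF T'X[OF f t]]])
      qed
      show "\<exists>C. \<forall>f\<in>Lp p. Lp_norm p (T' t f) \<le> C * Lp_norm p f"
      proof (intro exI[of _ "exp (a * t)"] ballI)
        show "Lp_norm p (T' t f) \<le> exp (a * t) * Lp_norm p f" if "f \<in> Lp p" for f
          using T_le[OF that t] T_X[OF that t] by (simp add: T'_def N_scale)
      qed
    qed
  next
    fix f :: "'a \<Rightarrow> complex" assume f: "f \<in> Lp p"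
    show "ae_eq (T' 0 f) f" using T_0[OF f] T_X[OF f] f by (intro N) (auto simp: T'_def)
  next
    fix s t :: real and f :: "'a \<Rightarrow> complex" assume st: "s \<ge> 0" "t \<ge> 0" and f: "f \<in> Lp p"
    have X: "T (s + t) f \<in> Lp p" "T t f \<in> Lp p" "T s (T t f) \<in> Lp p" using T_X f st by auto
    have X2: "T s (exp (a * t) *\<^sub>R T t f) \<in> Lp p" using X T_X st by auto
    have 1: "Lp_norm p (T s (exp (a * t) *\<^sub>R T t f) - exp (a * t) *\<^sub>R T s (T t f)) = 0"
      using scaleT[OF X(2) st(1), of "of_real (exp (a * t))"]
      by (simp add: scaleR_fun_def scaleR_conv_of_real fun_diff_def)
    have 2: "Lp_norm p (T (s + t) f - T s (T t f)) = 0" by (rule T_semigroup[OF f st])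
    have "T' (s + t) f - T' s (T' t f) = exp (a * (s + t)) *\<^sub>R (T (s + t) f - T s (T t f))
        - exp (a * s) *\<^sub>R (T s (exp (a * t) *\<^sub>R T t f) - exp (a * t) *\<^sub>R T s (T t f))"
      by (simp add: T'_def scaleR_diff_right distrib_left exp_add)
    then have "Lp_norm p (T' (s + t) f - T' s (T' t f)) \<le> 0"
      using N_diff_le[of "exp (a * (s + t)) *\<^sub>R (T (s + t) f - T s (T t f))"
        "exp (a * s) *\<^sub>R (T s (exp (a * t) *\<^sub>R T t f) - exp (a * t) *\<^sub>R T s (T t f))"] 1 2 X X2 by (simp add: N_scale)
    then show "ae_eq (T' (s + t) f) (T' s (T' t f))"
      using f st T'X by (intro N) (auto simp: antisym)
  next
    fix f :: "'a \<Rightarrow> complex" assume f: "f \<in> Lp p"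
    show "((\<lambda>t. Lp_norm p (\<lambda>z. T' t f z - f z)) \<longlongrightarrow> 0) (at_right 0)"
    proof (rule tendsto_sandwich[OF _ _ tendsto_const])
      have e: "((\<lambda>t. exp (a * t)) \<longlongrightarrow> exp (a * 0)) (at_right 0)" by (intro tendsto_intros)
      have "((\<lambda>t. exp (a * t) * Lp_norm p (T t f - f) + \<bar>exp (a * t) - 1\<bar> * Lp_norm p f)
         \<longlongrightarrow> exp (a * 0) * 0 + \<bar>exp (a * 0) - 1\<bar> * Lp_norm p f) (at_right 0)"
        by (intro tendsto_intros e T_continuous f)
      then show "((\<lambda>t. exp (a * t) * Lp_norm p (T t f - f) + \<bar>exp (a * t) - 1\<bar> * Lp_norm p f) \<longlongrightarrow> 0) (at_right 0)" by simp
      have "Lp_norm p (\<lambda>z. T' t f z - f z) \<le> exp (a * t) * Lp_norm p (T t f - f) + \<bar>exp (a * t) - 1\<bar> * Lp_norm p f" if t: "t > 0" for t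
      proof -
        have X: "T t f \<in> Lp p" using T_X f t by auto
        have "(\<lambda>z. T' t f z - f z) = exp (a * t) *\<^sub>R (T t f - f) + (exp (a * t) - 1) *\<^sub>R f"
          by (rule ext) (simp add: T'_def scaleR_fun_def algebra_simps)
        then show ?thesis
          using N_triangle[of "exp (a * t) *\<^sub>R (T t f - f)" "(exp (a * t) - 1) *\<^sub>R f"] X f by (simp add: N_scale)
      qed
      then show "\<forall>\<^sub>F t in at_right 0. Lp_norm p (\<lambda>z. T' t f z - f z) \<le> exp (a * t) * Lp_norm p (T t f - f) + \<bar>exp (a * t) - 1\<bar> * Lp_norm p f"
        by (auto simp: eventually_at_right_field intro: exI[of _ 1])
    qed (auto intro: always_eventually)
  qed
  moreover have "infinitesimal_generator p T' = op_scale (-1) (op_scale (1 / m) (weak_graph p))"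
  proof -
    \<comment> \<open>Removing the factor \<open>exp (a * t)\<close> shifts the derivative from
      \<open>g\<close> to \<open>g - a f\<close>, to which \<open>T_generator\<close> applies; the
      shift by \<open>d\<close> hidden in \<open>A\<close> then cancels, since
      \<open>a = d / m\<close>.\<close>
    have gen: "((\<lambda>t. Lp_norm p (\<lambda>z. (1 / t) *\<^sub>R (T' t f z - f z) - g z)) \<longlongrightarrow> 0) (at_right 0)
       \<longleftrightarrow> (f, \<lambda>z. (- m) *\<^sub>R g z) \<in> weak_graph p" (is "?L \<longleftrightarrow> ?R") if Lp: "f \<in> Lp p" "g \<in> Lp p" for f g
    proof -
      define g0 where "g0 z = g z + (- a) *\<^sub>R f z" for z
      have g0: "g0 \<in> Lp p" unfolding g0_def[abs_def] using Lp p by (intro Lp_add Lp_scaleR) auto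
      have "?L \<longleftrightarrow> ((\<lambda>t. Lp_norm p (\<lambda>z. (1 / t) *\<^sub>R (T t f z - f z) - g0 z)) \<longlongrightarrow> 0) (at_right 0)"
      proof
        assume ?L
        from rescaled_difference_quotient[OF p Lp T'X[OF Lp(1)] this, of "- a"]
        show "((\<lambda>t. Lp_norm p (\<lambda>z. (1 / t) *\<^sub>R (T t f z - f z) - g0 z)) \<longlongrightarrow> 0) (at_right 0)"
          by (simp add: T'_def scaleR_fun_def g0_def flip: exp_add)
      next
        assume "((\<lambda>t. Lp_norm p (\<lambda>z. (1 / t) *\<^sub>R (T t f z - f z) - g0 z)) \<longlongrightarrow> 0) (at_right 0)"
        from rescaled_difference_quotient[OF p Lp(1) g0 T_X[OF Lp(1)] this, of a]
        show ?L by (simp add: T'_def scaleR_fun_def g0_def)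
      qed
      also have "\<dots> \<longleftrightarrow> (f, - g0) \<in> A"
        using T_generator[OF Lp(1) g0] by (simp add: scaleR_fun_def fun_diff_def)
      also have "\<dots> \<longleftrightarrow> ?R"
      proof -
        have "(\<lambda>z. m *\<^sub>R (- g0) z - d *\<^sub>R f z) = (\<lambda>z. (- m) *\<^sub>R g z)"
          using m by (intro ext) (simp add: g0_def a_def scaleR_diff_right)
        then show ?thesis using Lp g0 by (simp add: A_iff)
      qed
      finally show ?thesis .
    qed
    have "(f, g) \<in> op_scale (-1) (op_scale (1 / m) (weak_graph p)) \<longleftrightarrow> f \<in> Lp p \<and> g \<in> Lp p \<and> (f, \<lambda>z. (- m) *\<^sub>R g z) \<in> weak_graph p" for f g
    proof
      assume "(f, g) \<in> op_scale (-1) (op_scale (1 / m) (weak_graph p))"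
      then obtain h where h: "(f, h) \<in> weak_graph p" "g = (\<lambda>z. (-1) *\<^sub>R (1 / m) *\<^sub>R h z)" by (auto simp: op_scale_def)
      then have Lp: "f \<in> Lp p" "h \<in> Lp p" by (auto simp: weak_graph_def)
      have "g \<in> Lp p" unfolding h(2) using Lp by (intro Lp_scaleR)
      moreover have "(\<lambda>z. (- m) *\<^sub>R g z) = h" using m by (auto simp: h(2))
      ultimately show "f \<in> Lp p \<and> g \<in> Lp p \<and> (f, \<lambda>z. (- m) *\<^sub>R g z) \<in> weak_graph p" using h Lp by simp
    next
      assume *: "f \<in> Lp p \<and> g \<in> Lp p \<and> (f, \<lambda>z. (- m) *\<^sub>R g z) \<in> weak_graph p"
      have "g = (\<lambda>z. (-1) *\<^sub>R (1 / m) *\<^sub>R (- m) *\<^sub>R g z)" using m by auto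
      then show "(f, g) \<in> op_scale (-1) (op_scale (1 / m) (weak_graph p))"
        using * unfolding op_scale_def by (force simp: image_iff)
    qed
    then show ?thesis using gen by (auto simp: infinitesimal_generator_def)
  qed
  ultimately show ?thesis by (auto simp: generates_def)
qed

end

section \<open>The Fokker--Planck operator\<close>

text \<open>The set where a continuous function exceeds its essential bound is open and null, hence
  empty. This upgrades the hypothesis on the second derivatives to a genuine bound, which makes
  \<open>\<nabla>V\<close> globally Lipschitz.\<close>

lemma Linfty_continuous_bounded:
  fixes f :: "'a::euclidean_space \<Rightarrow> real"
  assumes "f \<in> Linfty" "continuous_on UNIV f"
  shows "\<exists>C. \<forall>z. \<bar>f z\<bar> \<le> C"
proof -
  obtain C where C: "AE z in lborel. \<bar>f z\<bar> \<le> C" using assms(1) by (auto simp: Linfty_def)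
  let ?U = "{z. C < \<bar>f z\<bar>}"
  have "open ?U" by (intro open_Collect_less continuous_intros assms(2))
  have "AE z in lborel. z \<notin> ?U" using C by eventually_elim auto
  then have "emeasure lborel ?U = 0"
    using \<open>open ?U\<close> by (subst (asm) AE_iff_measurable[of ?U]) auto
  then have "negligible ?U" using \<open>open ?U\<close> by (auto simp: negligible_iff_null_sets null_sets_def)
  then have "?U = {}" using open_not_negligible \<open>open ?U\<close> by blast
  then show ?thesis by (auto simp: not_less)
qed

lemma Basis_vec_axis: "(Basis :: (real^'n::finite) set) = range (\<lambda>i. axis i 1)"
  by (auto simp: Basis_vec_def)

lemma sum_Basis_axis: "(\<Sum>e\<in>(Basis :: (real^'n::finite) set). h e) = (\<Sum>i\<in>UNIV. h (axis i 1))"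
  unfolding Basis_vec_axis by (subst sum.reindex) (auto simp: inj_on_def axis_eq_axis)

lemma sum_Basis_phase:
  "(\<Sum>e\<in>(Basis :: 'n::finite phase set). h e) = (\<Sum>i\<in>UNIV. h (dir_x i)) + (\<Sum>i\<in>UNIV. h (dir_v i))"
proof -
  have "(\<Sum>e\<in>(Basis :: 'n phase set). h e) = (\<Sum>b\<in>Basis. h (b, 0)) + (\<Sum>b\<in>Basis. h (0, b))"
    unfolding Basis_prod_def
    by (subst sum.union_disjoint) (auto simp: sum.reindex inj_on_def)
  then show ?thesis by (simp add: sum_Basis_axis dir_x_def dir_v_def)
qed

lemma dir_Basis: "dir_x i \<in> Basis" "dir_v i \<in> Basis"
  by (auto simp: dir_x_def dir_v_def Basis_prod_def Basis_vec_axis)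

definition gradient :: "(real^'n::finite \<Rightarrow> real) \<Rightarrow> real^'n \<Rightarrow> real^'n" where
  "gradient V x = (\<chi> i. dir_deriv (axis i 1) V x)"

lemma gradient_lipschitz:
  fixes V :: "real^'n::finite \<Rightarrow> real"
  assumes V: "Ck 2 V" "\<forall>i j. dir_deriv (axis i 1) (dir_deriv (axis j 1) V) \<in> Linfty"
  obtains L where "L \<ge> 0" "\<And>x y. norm (gradient V x - gradient V y) \<le> L * norm (x - y)"
proof -
  have "\<exists>L\<ge>0. \<forall>x y. norm (dir_deriv (axis j 1) V x - dir_deriv (axis j 1) V y) \<le> L * norm (x - y)" for j
  proof -
    have j: "axis j 1 \<in> (Basis :: (real^'n) set)" by (simp add: Basis_vec_axis)
    have C1: "Ck (Suc 0) (dir_deriv (axis j 1) V)" using V(1) j by (simp add: numeral_2_eq_2)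
    show ?thesis
    proof (rule bounded_derivatives_lipschitz)
      show "dir_deriv (axis j 1) V differentiable (at z)" for z by (rule Ck_differentiable[OF C1])
      fix e :: "real^'n" assume e: "e \<in> Basis"
      then obtain i where "e = axis i 1" by (auto simp: Basis_vec_axis)
      then have "dir_deriv e (dir_deriv (axis j 1) V) \<in> Linfty" using V(2) by simp
      moreover have "continuous_on UNIV (dir_deriv e (dir_deriv (axis j 1) V))" using C1 e by simp
      ultimately show "\<exists>M. \<forall>z. norm (dir_deriv e (dir_deriv (axis j 1) V) z) \<le> M"
        using Linfty_continuous_bounded by simp
    qed blast
  qed
  then obtain L where L: "\<And>j. L j \<ge> 0"
    "\<And>j x y. norm (dir_deriv (axis j 1) V x - dir_deriv (axis j 1) V y) \<le> L j * norm (x - y)" by metis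
  have "norm (gradient V x - gradient V y) \<le> (\<Sum>j\<in>UNIV. L j) * norm (x - y)" for x y
  proof -
    have "norm (gradient V x - gradient V y) \<le> (\<Sum>j\<in>UNIV. \<bar>(gradient V x - gradient V y) $ j\<bar>)" by (rule norm_le_l1_cart)
    also have "\<dots> \<le> (\<Sum>j\<in>UNIV. L j * norm (x - y))"
      using L(2) by (intro sum_mono) (simp add: gradient_def)
    finally show ?thesis by (simp add: sum_distrib_right)
  qed
  then show ?thesis using L(1) by (intro that[of "\<Sum>j\<in>UNIV. L j"]) (auto intro: sum_nonneg)
qed

definition fp_drift :: "(real^'n::finite \<Rightarrow> real) \<Rightarrow> real \<Rightarrow> 'n phase \<Rightarrow> 'n phase" where
  "fp_drift V m z = (m *\<^sub>R snd z, - gradient V (fst z))"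

definition fp_potential :: "real \<Rightarrow> real \<Rightarrow> real \<Rightarrow> 'n::finite phase \<Rightarrow> real" where
  "fp_potential m \<beta> \<gamma> z = (\<gamma> / \<beta>) * (m\<^sup>2 * \<beta>\<^sup>2 / 4 * (norm (snd z))\<^sup>2 - m * \<beta> * real CARD('n) / 2)"

lemma fp_drift_inner:
  "fp_drift V m z \<bullet> dir_x i = m * snd z $ i"
  "fp_drift V m z \<bullet> dir_v i = - dir_deriv (axis i 1) V (fst z)"
  by (auto simp: fp_drift_def dir_x_def dir_v_def gradient_def inner_axis)

text \<open>The potential is smallest at \<open>v = 0\<close>, where it equals \<open>- (\<gamma> /
  \<beta>) (m \<beta> n / 2) = - \<gamma> m n / 2\<close>; this is the origin of \<open>d\<close>.
  Its Lipschitz bound comes from \<open>|a^2 - b^2| = (a + b) |a - b|\<close>.\<close>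

lemma transport_diffusion_fp:
  fixes V :: "real^'n::finite \<Rightarrow> real"
  assumes pos: "m > 0" "\<beta> > 0" "\<gamma> > 0"
    and V: "Ck 2 V" "\<forall>i j. dir_deriv (axis i 1) (dir_deriv (axis j 1) V) \<in> Linfty"
  obtains L Lw where "transport_diffusion (fp_drift V m) (range dir_v) (\<gamma> / \<beta>) (\<gamma> * m * real CARD('n) / 2) L Lw (fp_potential m \<beta> \<gamma>)"
proof -
  obtain L where L: "L \<ge> 0" "\<And>x y. norm (gradient V x - gradient V y) \<le> L * norm (x - y)"
    using gradient_lipschitz[OF V] by blast
  define c where "c = (\<gamma> / \<beta>) * (m\<^sup>2 * \<beta>\<^sup>2 / 4)"
  have c: "c \<ge> 0" using pos by (simp add: c_def)
  have "transport_diffusion (fp_drift V m) (range dir_v) (\<gamma> / \<beta>) (\<gamma> * m * real CARD('n) / 2) (m + L) c (fp_potential m \<beta> \<gamma>)"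
  proof
    fix x y :: "'n phase"
    have proj: "norm (fst z) \<le> norm z" "norm (snd z) \<le> norm z" for z :: "'n phase"
      using norm_fst_le[of "fst z" "snd z"] norm_snd_le[of "snd z" "fst z"] by simp_all
    have "norm (fp_drift V m x - fp_drift V m y) \<le> norm (m *\<^sub>R snd x - m *\<^sub>R snd y) + norm (gradient V (fst x) - gradient V (fst y))"
      unfolding fp_drift_def by (simp add: norm_minus_commute) (metis norm_Pair_le norm_minus_commute)
    also have "\<dots> \<le> m * norm (snd x - snd y) + L * norm (fst x - fst y)"
      using L(2) pos by (intro add_mono) (auto simp: scaleR_diff_right[symmetric])
    also have "\<dots> \<le> m * norm (x - y) + L * norm (x - y)"
      using pos L(1) proj[of "x - y"] by (intro add_mono mult_left_mono) simp_all
    finally show "norm (fp_drift V m x - fp_drift V m y) \<le> (m + L) * norm (x - y)" by (simp add: distrib_right)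
    let ?a = "norm (snd x)" and ?b = "norm (snd y)"
    have "fp_potential m \<beta> \<gamma> x - fp_potential m \<beta> \<gamma> y = c * (?a\<^sup>2 - ?b\<^sup>2)"
      by (simp add: fp_potential_def c_def diff_divide_distrib algebra_simps)
    also have "?a\<^sup>2 - ?b\<^sup>2 = (?a + ?b) * (?a - ?b)" by (simp add: power2_eq_square algebra_simps)
    finally have "\<bar>fp_potential m \<beta> \<gamma> x - fp_potential m \<beta> \<gamma> y\<bar> = c * ((?a + ?b) * \<bar>?a - ?b\<bar>)"
      using c by (simp add: abs_mult)
    also have "\<dots> \<le> c * ((1 + norm x + norm y) * norm (x - y))"
    proof (intro mult_left_mono[OF _ c] mult_mono)
      show "?a + ?b \<le> 1 + norm x + norm y" using proj[of x] proj[of y] by simp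
      show "\<bar>?a - ?b\<bar> \<le> norm (x - y)"
        using norm_triangle_ineq3[of "snd x" "snd y"] proj[of "x - y"] by simp
    qed auto
    finally show "\<bar>fp_potential m \<beta> \<gamma> x - fp_potential m \<beta> \<gamma> y\<bar> \<le> c * (1 + norm x + norm y) * norm (x - y)"
      by (simp add: mult.assoc)
  next
    fix e z :: "'n phase" and t assume "e \<in> Basis"
    then consider b where "e = (b, 0)" | b where "e = (0, b)" by (auto simp: Basis_prod_def)
    then show "fp_drift V m (z + t *\<^sub>R e) \<bullet> e = fp_drift V m z \<bullet> e"
      by cases (auto simp: fp_drift_def)
  next
    show "range dir_v \<subseteq> (Basis :: 'n phase set)" using dir_Basis by auto
    show "0 \<le> \<gamma> / \<beta>" "0 \<le> m + L" "0 \<le> c" using pos L c by auto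
    fix z :: "'n phase"
    have "(\<gamma> / \<beta>) * (m\<^sup>2 * \<beta>\<^sup>2 / 4 * (norm (snd z))\<^sup>2) \<ge> 0" using pos by simp
    moreover have "(\<gamma> / \<beta>) * (m * \<beta> * real CARD('n) / 2) = \<gamma> * m * real CARD('n) / 2" using pos by simp
    ultimately show "- (\<gamma> * m * real CARD('n) / 2) \<le> fp_potential m \<beta> \<gamma> z"
      by (simp only: fp_potential_def right_diff_distrib)
  qed
  then show ?thesis using that by blast
qed

section \<open>Identification with the given definitions\<close>

lemma graph_closure_Domain:
  "Domain (graph_closure p G) = {f \<in> Lp p. \<exists>F. (\<forall>k::nat. F k \<in> G) \<and> (\<exists>g\<in>Lp p.
     (\<lambda>k. Lp_norm p (\<lambda>z. fst (F k) z - f z)) \<longlonglongrightarrow> 0 \<and> (\<lambda>k. Lp_norm p (\<lambda>z. snd (F k) z - g z)) \<longlonglongrightarrow> 0)}"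
proof (intro set_eqI iffI)
  fix f assume "f \<in> Domain (graph_closure p G)"
  then obtain g where Lp: "f \<in> Lp p" "g \<in> Lp p"
    and cl: "\<And>\<epsilon>. \<epsilon> > 0 \<Longrightarrow> \<exists>(u, w)\<in>G. Lp_norm p (\<lambda>z. u z - f z) < \<epsilon> \<and> Lp_norm p (\<lambda>z. w z - g z) < \<epsilon>"
    by (auto simp: graph_closure_def)
  have "\<exists>x\<in>G. Lp_norm p (\<lambda>z. fst x z - f z) < 1 / real (Suc k) \<and> Lp_norm p (\<lambda>z. snd x z - g z) < 1 / real (Suc k)" for k
    using cl[of "1 / real (Suc k)"] by (simp add: case_prod_unfold del: of_nat_Suc)
  then obtain F where F: "\<And>k. F k \<in> G" "\<And>k. Lp_norm p (\<lambda>z. fst (F k) z - f z) < 1 / real (Suc k)"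
    "\<And>k. Lp_norm p (\<lambda>z. snd (F k) z - g z) < 1 / real (Suc k)" by metis
  have zero: "(\<lambda>k. 1 / real (Suc k)) \<longlonglongrightarrow> 0" using LIMSEQ_inverse_real_of_nat by (simp add: inverse_eq_divide)
  have "(\<lambda>k. Lp_norm p (\<lambda>z. fst (F k) z - f z)) \<longlonglongrightarrow> 0" "(\<lambda>k. Lp_norm p (\<lambda>z. snd (F k) z - g z)) \<longlonglongrightarrow> 0"
    by (rule tendsto_sandwich[OF _ _ tendsto_const zero];
      use F(2,3) in \<open>auto intro!: always_eventually less_imp_le simp del: of_nat_Suc\<close>)+
  then show "f \<in> {f \<in> Lp p. \<exists>F. (\<forall>k::nat. F k \<in> G) \<and> (\<exists>g\<in>Lp p.
     (\<lambda>k. Lp_norm p (\<lambda>z. fst (F k) z - f z)) \<longlonglongrightarrow> 0 \<and> (\<lambda>k. Lp_norm p (\<lambda>z. snd (F k) z - g z)) \<longlonglongrightarrow> 0)}"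
    using F(1) Lp by blast
next
  fix f assume "f \<in> {f \<in> Lp p. \<exists>F. (\<forall>k::nat. F k \<in> G) \<and> (\<exists>g\<in>Lp p.
     (\<lambda>k. Lp_norm p (\<lambda>z. fst (F k) z - f z)) \<longlonglongrightarrow> 0 \<and> (\<lambda>k. Lp_norm p (\<lambda>z. snd (F k) z - g z)) \<longlonglongrightarrow> 0)}"
  then obtain F g where Lp: "f \<in> Lp p" "g \<in> Lp p" and F: "\<And>k::nat. F k \<in> G"
    and lim: "(\<lambda>k. Lp_norm p (\<lambda>z. fst (F k) z - f z)) \<longlonglongrightarrow> 0" "(\<lambda>k. Lp_norm p (\<lambda>z. snd (F k) z - g z)) \<longlonglongrightarrow> 0" by blast
  have "\<exists>(u, w)\<in>G. Lp_norm p (\<lambda>z. u z - f z) < \<epsilon> \<and> Lp_norm p (\<lambda>z. w z - g z) < \<epsilon>" if e: "\<epsilon> > 0" for \<epsilon>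
  proof -
    have "\<forall>\<^sub>F k in sequentially. Lp_norm p (\<lambda>z. fst (F k) z - f z) < \<epsilon> \<and> Lp_norm p (\<lambda>z. snd (F k) z - g z) < \<epsilon>"
      using order_tendstoD(2)[OF lim(1) e] order_tendstoD(2)[OF lim(2) e] by (rule eventually_conj)
    then obtain k where "Lp_norm p (\<lambda>z. fst (F k) z - f z) < \<epsilon> \<and> Lp_norm p (\<lambda>z. snd (F k) z - g z) < \<epsilon>"
      by (auto simp: eventually_sequentially)
    then show ?thesis using F[of k] by (auto simp: case_prod_unfold)
  qed
  then show "f \<in> Domain (graph_closure p G)" using Lp by (auto simp: graph_closure_def)
qed

lemma D_min_eq: "D_min p V m \<beta> \<gamma> = Domain (graph_closure p (P_graph V m \<beta> \<gamma>))"
proof -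
  have "(\<exists>F. (\<forall>k::nat. F k \<in> Cc_inf) \<and> (\<exists>g\<in>Lp p.
      (\<lambda>k. Lp_norm p (\<lambda>z. F k z - f z)) \<longlonglongrightarrow> 0 \<and> (\<lambda>k. Lp_norm p (\<lambda>z. P_op V m \<beta> \<gamma> (F k) z - g z)) \<longlonglongrightarrow> 0))
    \<longleftrightarrow> (\<exists>F. (\<forall>k::nat. F k \<in> P_graph V m \<beta> \<gamma>) \<and> (\<exists>g\<in>Lp p.
      (\<lambda>k. Lp_norm p (\<lambda>z. fst (F k) z - f z)) \<longlonglongrightarrow> 0 \<and> (\<lambda>k. Lp_norm p (\<lambda>z. snd (F k) z - g z)) \<longlonglongrightarrow> 0))" (is "?L \<longleftrightarrow> ?R") for f
  proof
    assume ?L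
    then obtain F g where F: "\<And>k::nat. F k \<in> Cc_inf" "g \<in> Lp p"
      "(\<lambda>k. Lp_norm p (\<lambda>z. F k z - f z)) \<longlonglongrightarrow> 0" "(\<lambda>k. Lp_norm p (\<lambda>z. P_op V m \<beta> \<gamma> (F k) z - g z)) \<longlonglongrightarrow> 0" by blast
    have "\<forall>k. (F k, P_op V m \<beta> \<gamma> (F k)) \<in> P_graph V m \<beta> \<gamma>" using F(1) by (auto simp: P_graph_def)
    then show ?R using F(2-) by (intro exI[of _ "\<lambda>k. (F k, P_op V m \<beta> \<gamma> (F k))"]) auto
  next
    assume ?R
    then obtain F g where F: "\<And>k::nat. F k \<in> P_graph V m \<beta> \<gamma>" "g \<in> Lp p"
      "(\<lambda>k. Lp_norm p (\<lambda>z. fst (F k) z - f z)) \<longlonglongrightarrow> 0" "(\<lambda>k. Lp_norm p (\<lambda>z. snd (F k) z - g z)) \<longlonglongrightarrow> 0" by blast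
    have 1: "fst (F k) \<in> Cc_inf" "snd (F k) = P_op V m \<beta> \<gamma> (fst (F k))" for k
      using F(1)[of k] by (auto simp: P_graph_def)
    show ?L using F(2-) 1(1) unfolding 1(2) by (intro exI[of _ "\<lambda>k. fst (F k)"]) auto
  qed
  then show ?thesis unfolding D_min_def graph_closure_Domain by blast
qed

text \<open>The coordinate \<open>v_i\<close> is constant along \<open>x_i\<close>. Hence it makes
  no difference that \<open>T_distr\<close> multiplies the test function by \<open>v_i\<close>
  before the derivative reaches it.\<close>

lemma dir_deriv_snd_mult:
  assumes "\<phi> \<in> Cc_inf"
  shows "dir_deriv (dir_x i) (\<lambda>z. (snd z $ i) *\<^sub>R \<phi> z) z = (snd z $ i) *\<^sub>R dir_deriv (dir_x i) \<phi> z"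
proof -
  have "bounded_linear (\<lambda>z :: (real^'a) \<times> (real^'a). snd z $ i)"
    by (rule bounded_linear_compose[OF bounded_linear_vec_nth bounded_linear_snd])
  then have D: "((\<lambda>z :: (real^'a) \<times> (real^'a). snd z $ i) has_derivative (\<lambda>h. snd h $ i)) (at z)" for z
    by (rule bounded_linear_imp_has_derivative)
  have "dir_deriv (dir_x i) (\<lambda>z :: (real^'a) \<times> (real^'a). snd z $ i) z = 0"
    by (subst dir_deriv_eqI[OF D]) (simp add: dir_x_def)
  then show ?thesis
    using dir_deriv_mult[OF differentiableI[OF D] Cc_inf_differentiable[OF assms], of "dir_x i"] by simp
qed

theorem theorem1p1:
  fixes V :: "real^'n::finite \<Rightarrow> real" and m \<beta> \<gamma> p :: real
  assumes "m > 0" and "\<beta> > 0" and "\<gamma> > 0" and "1 < p"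
    and "Ck 2 V"
    and "\<forall>i j. dir_deriv (axis i 1) (dir_deriv (axis j 1) V) \<in> Linfty"
  shows "closable p (P_graph V m \<beta> \<gamma>)
    \<and> Domain (graph_closure p (P_graph V m \<beta> \<gamma>)) = D_min p V m \<beta> \<gamma>
    \<and> D_min p V m \<beta> \<gamma> = D_max p V m \<beta> \<gamma>
    \<and> graph_closure p (P_graph V m \<beta> \<gamma>) = P_distr_graph p V m \<beta> \<gamma> (D_max p V m \<beta> \<gamma>)
    \<and> (\<exists>T. generates p (op_scale (1 / m) (P_distr_graph p V m \<beta> \<gamma> (D_max p V m \<beta> \<gamma>))) T)"
proof -
  note p = \<open>1 < p\<close>
  obtain L Lw where "transport_diffusion (fp_drift V m) (range dir_v) (\<gamma> / \<beta>) (\<gamma> * m * real CARD('n) / 2) L Lw (fp_potential m \<beta> \<gamma>)"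
    using transport_diffusion_fp[OF assms(1-3,5,6)] .
  then interpret transport_diffusion "fp_drift V m" "range dir_v" "\<gamma> / \<beta>" "\<gamma> * m * real CARD('n) / 2" L Lw "fp_potential m \<beta> \<gamma>" .
  have sum_E: "(\<Sum>e\<in>range dir_v. h e) = (\<Sum>i\<in>UNIV. h (dir_v i))" for h :: "'n phase \<Rightarrow> complex"
    by (subst sum.reindex) (auto simp: inj_on_def dir_v_def axis_eq_axis)
  have transport: "(\<Sum>e\<in>Basis. (fp_drift V m z \<bullet> e) *\<^sub>R dir_deriv e u z) =
     m *\<^sub>R (\<Sum>i\<in>UNIV. (snd z $ i) *\<^sub>R dir_deriv (dir_x i) u z) - (\<Sum>i\<in>UNIV. dir_deriv (axis i 1) V (fst z) *\<^sub>R dir_deriv (dir_v i) u z)"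
    for u :: "'n phase \<Rightarrow> complex" and z
    by (simp add: sum_Basis_phase fp_drift_inner scaleR_sum_right sum_negf)
  have "P_op V m \<beta> \<gamma> \<phi> z = Pop \<phi> z" for \<phi> z
    by (cases z) (simp add: P_op_def T_op_def H_op_def Pop_def transport sum_E fp_potential_def algebra_simps)
  then have "P_op V m \<beta> \<gamma> \<phi> = Pop \<phi>" for \<phi> by (rule ext)
  then have test: "P_graph V m \<beta> \<gamma> = test_graph" by (simp add: P_graph_def test_graph_def)
  \<comment> \<open>The bridge to distributions: moving one derivative to the test function flips
    the sign of the transport term, moving two leaves the diffusion unchanged, and this is the shape
    of \<open>Pop_adj\<close>.\<close>
  have distr: "P_distr V m \<beta> \<gamma> f \<phi> = (\<integral>z. f z * Pop_adj \<phi> z \<partial>lborel)" if f: "f \<in> Lp p" and \<phi>: "\<phi> \<in> Cc_inf" for f \<phi>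
  proof -
    define a where "a i z = (snd z $ i) *\<^sub>R dir_deriv (dir_x i) \<phi> z" for i z
    define b where "b z = (\<Sum>i\<in>UNIV. dir_deriv (axis i 1) V (fst z) *\<^sub>R dir_deriv (dir_v i) \<phi> z)" for z
    define c where "c i z = dir_deriv (dir_v i) (dir_deriv (dir_v i) \<phi>) z" for i z
    define w where "w z = (m\<^sup>2 * \<beta>\<^sup>2 / 4 * (norm (snd z))\<^sup>2 - m * \<beta> * real CARD('n) / 2) *\<^sub>R \<phi> z" for z :: "'n phase"
    have cV: "continuous_on UNIV (\<lambda>z :: 'n phase. dir_deriv (axis i 1) V (fst z))" for i
    proof -
      have "Ck (Suc 0) (dir_deriv (axis i 1) V)" using assms(5) by (simp add: numeral_2_eq_2 Basis_vec_axis)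
      from Ck_continuous[OF this] show ?thesis
        by (rule continuous_on_compose2) (auto intro: continuous_intros)
    qed
    have cs: "csupp (a i)" "csupp (c i)" "csupp b" "csupp w" for i
      unfolding a_def b_def c_def w_def
      by (intro csupp_scaleR csupp_sum cV Cc_inf_csupp Cc_inf_dir_deriv \<phi> dir_Basis continuous_intros)+
    have adj: "Pop_adj \<phi> z = m *\<^sub>R ((-1) *\<^sub>R (\<Sum>i\<in>UNIV. a i z)) + (b z + (\<gamma> / \<beta>) *\<^sub>R ((-1) *\<^sub>R (\<Sum>i\<in>UNIV. c i z) + w z))" for z
      by (simp add: Pop_adj_def transport sum_E fp_potential_def a_def b_def c_def w_def scaleR_add_right algebra_simps)
    have cont1: "continuous_on UNIV (\<lambda>z :: 'n phase. r)" for r :: real by simp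
    have "(\<integral>z. f z * Pop_adj \<phi> z \<partial>lborel) =
       m *\<^sub>R ((-1) *\<^sub>R (\<Sum>i\<in>UNIV. \<integral>z. f z * a i z \<partial>lborel))
       + ((\<integral>z. f z * b z \<partial>lborel) + (\<gamma> / \<beta>) *\<^sub>R ((-1) *\<^sub>R (\<Sum>i\<in>UNIV. \<integral>z. f z * c i z \<partial>lborel) + (\<integral>z. f z * w z \<partial>lborel)))"
    proof -
      have s: "csupp (\<lambda>z. \<Sum>i\<in>UNIV. a i z)" "csupp (\<lambda>z. \<Sum>i\<in>UNIV. c i z)" by (intro csupp_sum cs)+
      have s2: "csupp (\<lambda>z. (-1) *\<^sub>R (\<Sum>i\<in>UNIV. c i z))" by (rule csupp_scaleR[OF cont1 s(2)])
      have s3: "csupp (\<lambda>z. (-1) *\<^sub>R (\<Sum>i\<in>UNIV. c i z) + w z)" by (rule csupp_add[OF s2 cs(4)])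
      have s4: "csupp (\<lambda>z. (\<gamma> / \<beta>) *\<^sub>R ((-1) *\<^sub>R (\<Sum>i\<in>UNIV. c i z) + w z))" by (rule csupp_scaleR[OF cont1 s3])
      have s5: "csupp (\<lambda>z. m *\<^sub>R ((-1) *\<^sub>R (\<Sum>i\<in>UNIV. a i z)))" by (intro csupp_scaleR[OF cont1] s)
      show ?thesis
        unfolding adj Lp_pairing_add[OF p f s5 csupp_add[OF cs(3) s4]] Lp_pairing_add[OF p f cs(3) s4]
          Lp_pairing_scaleR[OF p f] Lp_pairing_add[OF p f s2 cs(4)]
        by (simp only: Lp_pairing_sum[OF p f cs(1)] Lp_pairing_sum[OF p f cs(2)])
    qed
    also have "\<dots> = P_distr V m \<beta> \<gamma> f \<phi>"
      by (simp add: P_distr_def T_distr_def H_distr_def distr_mult_def distr_deriv_def distr_of_fun_def gradV_dv_def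
          dir_deriv_snd_mult[OF \<phi>] a_def b_def c_def w_def sum_negf)
    finally show ?thesis by simp
  qed
  \<comment> \<open>With this and \<open>test\<close>, all claims become statements about
    \<open>test_graph\<close> and \<open>weak_graph\<close>.\<close>
  have weak: "P_distr_graph p V m \<beta> \<gamma> (D_max p V m \<beta> \<gamma>) = weak_graph p"
    by (auto simp: P_distr_graph_def D_max_def weak_graph_def distr_eq_def distr distr_of_fun_def)
  have "D_max p V m \<beta> \<gamma> = Domain (weak_graph p)"
    by (auto simp: D_max_def weak_graph_def distr_eq_def distr distr_of_fun_def)
  then show ?thesis
    unfolding D_min_eq weak test closure_eq_weak[OF p]
    using closable_test_graph[OF p] generates_weak_graph[OF p assms(1)] by simp
qed

end
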